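(* Let $\tau$ and $\kappa$ be two skew pairings between two Hopf algebroids $\Pi$ and $\mathcal{L}$ over $B$. Then $\overline B\subseteq\Pi\,{}^{\tau}\!\bowtie_{\kappa}\mathcal{L}$, with the product $$(\alpha\otimes X)\cdot_{\tau\kappa}(\beta\otimes Y)=\alpha\,\tau[X_{(1)}|\beta_{(1)}]\,\beta_{(2)+}\otimes\overline{\kappa[X_{(3)}|\beta_{(2)-}]}\,X_{(2)}Y$$ on $\Pi\otimes_{B^e}\mathcal{L}$, is a left $\Pi\,{}^{\tau}\!\bowtie_{\tau}\mathcal{L}$-Galois extension.
   Context: $k$ is a field, $B$ a unital $k$-algebra, $\overline B$ its opposite algebra with canonical anti-isomorphism $B\to\overline B$, $b\mapsto\bar b$, and $B^e=B\otimes\overline B$. $M\diamond_B N:=M\otimes N/\langle \bar bm\otimes n-m\otimes bn\rangle$; $M\times_BN:=\{\sum m_i\otimes n_i\in M\diamond_BN:\ \sum m_i\bar a\otimes n_i=\sum m_i\otimes n_ia\ \forall a\in B\}$; $M\otimes^BN:=M\otimes N/\langle bm\otimes n-m\otimes nb\rangle$. A left bialgebroid over $B$ is an algebra $\mathcal{L}$ with algebra maps $s:B\to\mathcal{L}$, $t:\overline B\to\mathcal{L}$ with commuting images (one writes $b,\bar b$ for $s(b),t(\bar b)$), with left $B^e$-module maps $\Delta:\mathcal{L}\to\mathcal{L}\times_B\mathcal{L}$, $\Delta(X)=X_{(1)}\otimes X_{(2)}$ (so $\Delta(b\bar cX)=bX_{(1)}\otimes\bar cX_{(2)}$) and $\varepsilon:\mathcal{L}\to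 B$ (so $\varepsilon(b\bar cX)=b\varepsilon(X)c$), coassociative and counital ($\varepsilon(X_{(1)})X_{(2)}=\overline{\varepsilon(X_{(2)})}X_{(1)}=X$), such that $\Delta$ is an algebra map (componentwise product on $\mathcal{L}\times_B\mathcal{L}$), $\varepsilon(1)=1$ and $\varepsilon(X\varepsilon(Y))=\varepsilon(XY)=\varepsilon(X\overline{\varepsilon(Y)})$. Standing assumption: all $B$-module and $\overline B$-module structures are faithfully flat. $\mathcal{L}$ is a Hopf algebroid if both $\lambda:\mathcal{L}\otimes_{\overline B}\mathcal{L}\to\mathcal{L}\diamond_B\mathcal{L}$, $\lambda(X\otimes Y)=X_{(1)}\otimes X_{(2)}Y$, and $\mu:\mathcal{L}\otimes^B\mathcal{L}\to\mathcal{L}\diamond_B\mathcal{L}$, $\mu(X\otimes Y)=Y_{(1)}X\otimes Y_{(2)}$, are bijective; $X_+\otimes_{\overline B}X_-:=\lambda^{-1}(X\diamond1)$. A skew pairing is a linear map $\tau[\cdot|\cdot]:\mathcal{L}\otimes\Pi\to B$ with, for $a,b,c,d,f\in B$, $X,Y\in\mathcal{L}$, $\alpha,\beta\in\Pi$: $\tau[a\bar bXc\bar d|\alpha]f=a\tau[X|c\bar f\alpha d\bar b]$; $\tau[X|\alpha\beta]=\tau[X_{(1)}|\alpha\overline{\tau[X_{(2)}|\beta]}]=\tau[\overline{\tau[X_{(2)}|\beta]}X_{(1)}|\alpha]$; $\tau[XY|\alpha]=\tau[X\tau[Y|\alpha_{(1)}]|\alpha_{(2)}]=\tau[X|\tau[Y|\alpha_{(1)}]\alpha_{(2)}]$;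 $\tau[X|1]=\varepsilon(X)$; $\tau[1|\alpha]=\varepsilon(\alpha)$. $\Pi\,{}^{\tau}\!\bowtie_{\kappa}\mathcal{L}$ is $\Pi\otimes_{B^e}\mathcal{L}$ with the product $\cdot_{\tau\kappa}$; it is a $B^e$-ring via $b\otimes\bar c\mapsto b\bar c\otimes1$, and $\overline B$ denotes the image of $\bar c\mapsto\bar c\otimes1$. $\Pi\,{}^{\tau}\!\bowtie_{\tau}\mathcal{L}$ (the case $\kappa=\tau$) is a left bialgebroid over $B$ with coproduct $\alpha\otimes X\mapsto(\alpha_{(1)}\otimes X_{(1)})\otimes(\alpha_{(2)}\otimes X_{(2)})$ and counit $\varepsilon(\alpha\otimes X)=\varepsilon(\alpha\varepsilon(X))$. $\Pi\,{}^{\tau}\!\bowtie_{\kappa}\mathcal{L}$ is a left $\Pi\,{}^{\tau}\!\bowtie_{\tau}\mathcal{L}$-comodule algebra with coaction given by the same formula as the coproduct. For a left bialgebroid $\mathcal{H}$ over $B$, a left $\mathcal{H}$-comodule algebra is an algebra $P$ with algebra map $B\to P$ and a coassociative counital coaction $P\to\mathcal{H}\times_BP$, $p\mapsto p_{(-1)}\otimes p_{(0)}$, which is an algebra map with $bpb'\mapsto bp_{(-1)}b'\otimes p_{(0)}$. A left $\mathcal{H}$-Galois extension $N\subseteq P$ means: $N=\{p:p_{(-1)}\otimes p_{(0)}=1\otimes p\}$ and $P\otimes_NP\to\mathcal{H}\diamond_BP$, $p\otimes q\mapsto p_{(-1)}\otimes p_{(0)}q$, is bijective. *)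

theory Defs
  imports "HOL-Algebra.Algebra"
begin

section \<open>Algebras over a field\<close>

text \<open>The locale \<^locale>\<open>algebra\<close> of the library is restricted to commutative algebras.\<close>

locale k_algebra = scalars: field K + module K A + total: ring A for K (structure) and A (structure) +
  assumes smult_mult_left:
      "\<lbrakk>k \<in> carrier K; x \<in> carrier A; y \<in> carrier A\<rbrakk>
        \<Longrightarrow> (k \<odot>\<^bsub>A\<^esub> x) \<otimes>\<^bsub>A\<^esub> y = k \<odot>\<^bsub>A\<^esub> (x \<otimes>\<^bsub>A\<^esub> y)"
    and smult_mult_right:
      "\<lbrakk>k \<in> carrier K; x \<in> carrier A; y \<in> carrier A\<rbrakk>
        \<Longrightarrow> x \<otimes>\<^bsub>A\<^esub> (k \<odot>\<^bsub>A\<^esub> y) = k \<odot>\<^bsub>A\<^esub> (x \<otimes>\<^bsub>A\<^esub> y)"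

definition alg_hom ::
  "('k, 'i) ring_scheme \<Rightarrow> ('k, 'a, 'm) module_scheme \<Rightarrow> ('k, 'c, 'n) module_scheme \<Rightarrow> ('a \<Rightarrow> 'c) set"
  where "alg_hom K A C = {f \<in> ring_hom A C.
    \<forall>k \<in> carrier K. \<forall>x \<in> carrier A. f (k \<odot>\<^bsub>A\<^esub> x) = k \<odot>\<^bsub>C\<^esub> f x}"

definition opposite :: "('k, 'a, 'm) module_scheme \<Rightarrow> ('k, 'a, 'm) module_scheme"
  where "opposite A = A\<lparr>monoid.mult := (\<lambda>x y. y \<otimes>\<^bsub>A\<^esub> x)\<rparr>"


section \<open>Tensor products\<close>

text \<open>
  A (balanced) tensor product is the quotient of the free abelian group on the set of pure tensors
  by the subgroup generated by relators.  It is packaged as a \<^typ>\<open>('k, 'a) module\<close>, whose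
  multiplicative fields are left unspecified.  Its elements are cosets of formal sums of pure
  tensors.  Since the zero element is the subgroup of relations itself, the class of a formal
  sum can be read off from the tensor product alone.
\<close>

definition repr :: "('x \<Rightarrow>\<^sub>0 int) set \<Rightarrow> ('x \<Rightarrow>\<^sub>0 int)"
  where "repr C = (SOME c. c \<in> C)"

definition cls :: "(('x \<Rightarrow>\<^sub>0 int) set, 'm) ring_scheme \<Rightarrow> ('x \<Rightarrow>\<^sub>0 int) \<Rightarrow> ('x \<Rightarrow>\<^sub>0 int) set"
  where "cls T c = \<zero>\<^bsub>T\<^esub> #>\<^bsub>free_Abelian_group UNIV\<^esub> c"

definition presented ::
  "'x set \<Rightarrow> ('x \<Rightarrow>\<^sub>0 int) set \<Rightarrow> ('k \<Rightarrow> 'x \<Rightarrow> 'x) \<Rightarrow> ('k, ('x \<Rightarrow>\<^sub>0 int) set) module"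
  where "presented S R act =
    (let F = free_Abelian_group S; H = generate F R; Q = F Mod H in
      \<lparr>carrier = carrier Q, monoid.mult = undefined, monoid.one = undefined,
       ring.zero = \<one>\<^bsub>Q\<^esub>, ring.add = monoid.mult Q,
       module.smult = (\<lambda>k C. H #>\<^bsub>F\<^esub> frag_extend (\<lambda>x. frag_of (act k x)) (repr C))\<rparr>)"

text \<open>
  \<open>expand f C\<close> extends \<open>f\<close> linearly from pure tensors to a representative of \<open>C\<close>: if
  \<open>comult L x\<close> stands for \<open>x\<^sub>1 \<otimes> x\<^sub>2\<close>, then \<open>expand (\<lambda>(x1, x2). f x1 x2) (comult L x)\<close> is Sweedler's
  \<open>f x\<^sub>1 x\<^sub>2\<close>, with values in formal sums.  Its versions \<open>induced T f C\<close> with values in the tensor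
  product \<open>T\<close> and \<open>evaluate G f C\<close> with values in the abelian group \<open>G\<close> do not depend on the
  representative whenever \<open>f\<close> is compatible with the relations.
\<close>

definition expand :: "('x \<Rightarrow> ('y \<Rightarrow>\<^sub>0 int)) \<Rightarrow> ('x \<Rightarrow>\<^sub>0 int) set \<Rightarrow> ('y \<Rightarrow>\<^sub>0 int)"
  where "expand f C = frag_extend f (repr C)"

definition induced ::
  "(('y \<Rightarrow>\<^sub>0 int) set, 'm) ring_scheme \<Rightarrow> ('x \<Rightarrow> ('y \<Rightarrow>\<^sub>0 int)) \<Rightarrow> ('x \<Rightarrow>\<^sub>0 int) set
    \<Rightarrow> ('y \<Rightarrow>\<^sub>0 int) set"
  where "induced T f C = cls T (expand f C)"

definition evaluate :: "('a, 'm) ring_scheme \<Rightarrow> ('x \<Rightarrow> 'a) \<Rightarrow> ('x \<Rightarrow>\<^sub>0 int) set \<Rightarrow> 'a"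
  where "evaluate G f C =
    (\<Oplus>\<^bsub>G\<^esub>x \<in> Poly_Mapping.keys (repr C). [Poly_Mapping.lookup (repr C) x] \<cdot>\<^bsub>G\<^esub> f x)"

definition bilinear_relators ::
  "('k, 'i) ring_scheme \<Rightarrow> ('k, 'm, 'u) module_scheme \<Rightarrow> ('k, 'n, 'v) module_scheme
    \<Rightarrow> (('m \<times> 'n) \<Rightarrow>\<^sub>0 int) set"
  where "bilinear_relators K M N =
    {frag_of (x \<oplus>\<^bsub>M\<^esub> x', y) - frag_of (x, y) - frag_of (x', y) | x x' y.
        x \<in> carrier M \<and> x' \<in> carrier M \<and> y \<in> carrier N}
    \<union> {frag_of (x, y \<oplus>\<^bsub>N\<^esub> y') - frag_of (x, y) - frag_of (x, y') | x y y'.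
        x \<in> carrier M \<and> y \<in> carrier N \<and> y' \<in> carrier N}
    \<union> {frag_of (k \<odot>\<^bsub>M\<^esub> x, y) - frag_of (x, k \<odot>\<^bsub>N\<^esub> y) | k x y.
        k \<in> carrier K \<and> x \<in> carrier M \<and> y \<in> carrier N}"

text \<open>
  \<open>tensor K M N I f g\<close> is \<open>M \<otimes>\<^sub>K N\<close> modulo the elements \<open>f i m \<otimes> n - m \<otimes> g i n\<close> for \<open>i \<in> I\<close>.
\<close>

definition tensor ::
  "('k, 'i) ring_scheme \<Rightarrow> ('k, 'm, 'u) module_scheme \<Rightarrow> ('k, 'n, 'v) module_scheme
    \<Rightarrow> 'j set \<Rightarrow> ('j \<Rightarrow> 'm \<Rightarrow> 'm) \<Rightarrow> ('j \<Rightarrow> 'n \<Rightarrow> 'n) \<Rightarrow> ('k, (('m \<times> 'n) \<Rightarrow>\<^sub>0 int) set) module"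
  where "tensor K M N I f g =
    presented (carrier M \<times> carrier N)
      (bilinear_relators K M N
        \<union> {frag_of (f i x, y) - frag_of (x, g i y) | i x y.
            i \<in> I \<and> x \<in> carrier M \<and> y \<in> carrier N})
      (\<lambda>k (x, y). (k \<odot>\<^bsub>M\<^esub> x, y))"

text \<open>
  \<open>M \<diamond>\<^sub>B N\<close> and \<open>M \<times>\<^sub>B N\<close>.  All modules occurring here are algebras, and the \<open>B\<close>- and
  \<open>opposite B\<close>-actions are multiplications with the images of \<open>t : opposite B \<rightarrow> M\<close> and
  \<open>s : B \<rightarrow> N\<close>.
\<close>

definition diamond ::
  "('k, 'i) ring_scheme \<Rightarrow> ('k, 'b, 'w) module_scheme
    \<Rightarrow> ('k, 'm, 'u) module_scheme \<Rightarrow> ('b \<Rightarrow> 'm) \<Rightarrow> ('k, 'n, 'v) module_scheme \<Rightarrow> ('b \<Rightarrow> 'n)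
    \<Rightarrow> ('k, (('m \<times> 'n) \<Rightarrow>\<^sub>0 int) set) module"
  where "diamond K B M t N s =
    tensor K M N (carrier B) (\<lambda>b x. t b \<otimes>\<^bsub>M\<^esub> x) (\<lambda>b y. s b \<otimes>\<^bsub>N\<^esub> y)"

definition takeuchi ::
  "('k, 'i) ring_scheme \<Rightarrow> ('k, 'b, 'w) module_scheme
    \<Rightarrow> ('k, 'm, 'u) module_scheme \<Rightarrow> ('b \<Rightarrow> 'm) \<Rightarrow> ('k, 'n, 'v) module_scheme \<Rightarrow> ('b \<Rightarrow> 'n)
    \<Rightarrow> (('m \<times> 'n) \<Rightarrow>\<^sub>0 int) set set"
  where "takeuchi K B M t N s =
    {C \<in> carrier (diamond K B M t N s). \<forall>a \<in> carrier B.
      induced (diamond K B M t N s) (\<lambda>(x, y). frag_of (x \<otimes>\<^bsub>M\<^esub> t a, y)) C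
      = induced (diamond K B M t N s) (\<lambda>(x, y). frag_of (x, y \<otimes>\<^bsub>N\<^esub> s a)) C}"

text \<open>The threefold product \<open>M \<diamond>\<^sub>B N \<diamond>\<^sub>B Q\<close>, in which coassociativity is expressed.\<close>

definition diamond3 ::
  "('k, 'i) ring_scheme \<Rightarrow> ('k, 'b, 'w) module_scheme
    \<Rightarrow> ('k, 'm, 'u) module_scheme \<Rightarrow> ('b \<Rightarrow> 'm)
    \<Rightarrow> ('k, 'n, 'v) module_scheme \<Rightarrow> ('b \<Rightarrow> 'n) \<Rightarrow> ('b \<Rightarrow> 'n)
    \<Rightarrow> ('k, 'q, 'z) module_scheme \<Rightarrow> ('b \<Rightarrow> 'q)
    \<Rightarrow> ('k, (('m \<times> 'n \<times> 'q) \<Rightarrow>\<^sub>0 int) set) module"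
  where "diamond3 K B M tM N sN tN Q sQ =
    presented (carrier M \<times> carrier N \<times> carrier Q)
      ({frag_of (x \<oplus>\<^bsub>M\<^esub> x', y, z) - frag_of (x, y, z) - frag_of (x', y, z) | x x' y z.
          x \<in> carrier M \<and> x' \<in> carrier M \<and> y \<in> carrier N \<and> z \<in> carrier Q}
      \<union> {frag_of (x, y \<oplus>\<^bsub>N\<^esub> y', z) - frag_of (x, y, z) - frag_of (x, y', z) | x y y' z.
          x \<in> carrier M \<and> y \<in> carrier N \<and> y' \<in> carrier N \<and> z \<in> carrier Q}
      \<union> {frag_of (x, y, z \<oplus>\<^bsub>Q\<^esub> z') - frag_of (x, y, z) - frag_of (x, y, z') | x y z z'.
          x \<in> carrier M \<and> y \<in> carrier N \<and> z \<in> carrier Q \<and> z' \<in> carrier Q}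
      \<union> {frag_of (k \<odot>\<^bsub>M\<^esub> x, y, z) - frag_of (x, k \<odot>\<^bsub>N\<^esub> y, z) | k x y z.
          k \<in> carrier K \<and> x \<in> carrier M \<and> y \<in> carrier N \<and> z \<in> carrier Q}
      \<union> {frag_of (x, k \<odot>\<^bsub>N\<^esub> y, z) - frag_of (x, y, k \<odot>\<^bsub>Q\<^esub> z) | k x y z.
          k \<in> carrier K \<and> x \<in> carrier M \<and> y \<in> carrier N \<and> z \<in> carrier Q}
      \<union> {frag_of (tM b \<otimes>\<^bsub>M\<^esub> x, y, z) - frag_of (x, sN b \<otimes>\<^bsub>N\<^esub> y, z) | b x y z.
          b \<in> carrier B \<and> x \<in> carrier M \<and> y \<in> carrier N \<and> z \<in> carrier Q}
      \<union> {frag_of (x, tN b \<otimes>\<^bsub>N\<^esub> y, z) - frag_of (x, y, sQ b \<otimes>\<^bsub>Q\<^esub> z) | b x y z.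
          b \<in> carrier B \<and> x \<in> carrier M \<and> y \<in> carrier N \<and> z \<in> carrier Q})
      (\<lambda>k (x, y, z). (k \<odot>\<^bsub>M\<^esub> x, y, z))"


section \<open>Left bialgebroids\<close>

record ('k, 'b, 'a) bialgebroid = "('k, 'a) module" +
  src :: "'b \<Rightarrow> 'a"
  tgt :: "'b \<Rightarrow> 'a"
  comult :: "'a \<Rightarrow> (('a \<times> 'a) \<Rightarrow>\<^sub>0 int) set"
  counit :: "'a \<Rightarrow> 'b"

abbreviation diamond_self ::
  "('k, 'i) ring_scheme \<Rightarrow> ('k, 'b, 'w) module_scheme \<Rightarrow> ('k, 'b, 'a, 'm) bialgebroid_scheme
    \<Rightarrow> ('k, (('a \<times> 'a) \<Rightarrow>\<^sub>0 int) set) module"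
  where "diamond_self K B L \<equiv> diamond K B L (tgt L) L (src L)"

text \<open>The componentwise product, meaningful on elements of \<open>M \<times>\<^sub>B N\<close>.\<close>

definition component_mult ::
  "('k, 'm, 'u) module_scheme \<Rightarrow> ('k, 'n, 'v) module_scheme
    \<Rightarrow> ('k, (('m \<times> 'n) \<Rightarrow>\<^sub>0 int) set, 'w) module_scheme
    \<Rightarrow> (('m \<times> 'n) \<Rightarrow>\<^sub>0 int) set \<Rightarrow> (('m \<times> 'n) \<Rightarrow>\<^sub>0 int) set \<Rightarrow> (('m \<times> 'n) \<Rightarrow>\<^sub>0 int) set"
  where "component_mult M N T C D =
    induced T (\<lambda>(x, y). expand (\<lambda>(x', y'). frag_of (x \<otimes>\<^bsub>M\<^esub> x', y \<otimes>\<^bsub>N\<^esub> y')) D) C"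

locale left_bialgebroid =
  fixes K :: "('k, 'i) ring_scheme"
    and B :: "('k, 'b, 'w) module_scheme"
    and L :: "('k, 'b, 'a, 'm) bialgebroid_scheme"
  assumes base_algebra: "k_algebra K B"
    and total_algebra: "k_algebra K L"
    and src_hom: "src L \<in> alg_hom K B L"
    and tgt_hom: "tgt L \<in> alg_hom K (opposite B) L"
    and src_tgt_commute:
      "\<lbrakk>b \<in> carrier B; c \<in> carrier B\<rbrakk> \<Longrightarrow> src L b \<otimes>\<^bsub>L\<^esub> tgt L c = tgt L c \<otimes>\<^bsub>L\<^esub> src L b"
    and comult_closed:
      "x \<in> carrier L \<Longrightarrow> comult L x \<in> takeuchi K B L (tgt L) L (src L)"
    and comult_add:
      "\<lbrakk>x \<in> carrier L; y \<in> carrier L\<rbrakk>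
        \<Longrightarrow> comult L (x \<oplus>\<^bsub>L\<^esub> y) = comult L x \<oplus>\<^bsub>diamond_self K B L\<^esub> comult L y"
    and comult_Be_linear:
      "\<lbrakk>b \<in> carrier B; c \<in> carrier B; x \<in> carrier L\<rbrakk>
        \<Longrightarrow> comult L (src L b \<otimes>\<^bsub>L\<^esub> tgt L c \<otimes>\<^bsub>L\<^esub> x)
          = induced (diamond_self K B L)
              (\<lambda>(x1, x2). frag_of (src L b \<otimes>\<^bsub>L\<^esub> x1, tgt L c \<otimes>\<^bsub>L\<^esub> x2)) (comult L x)"
    and counit_closed: "x \<in> carrier L \<Longrightarrow> counit L x \<in> carrier B"
    and counit_add:
      "\<lbrakk>x \<in> carrier L; y \<in> carrier L\<rbrakk> \<Longrightarrow> counit L (x \<oplus>\<^bsub>L\<^esub> y) = counit L x \<oplus>\<^bsub>B\<^esub> counit L y"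
    and counit_Be_linear:
      "\<lbrakk>b \<in> carrier B; c \<in> carrier B; x \<in> carrier L\<rbrakk>
        \<Longrightarrow> counit L (src L b \<otimes>\<^bsub>L\<^esub> tgt L c \<otimes>\<^bsub>L\<^esub> x) = b \<otimes>\<^bsub>B\<^esub> counit L x \<otimes>\<^bsub>B\<^esub> c"
    and coassociative:
      "x \<in> carrier L \<Longrightarrow>
        induced (diamond3 K B L (tgt L) L (src L) (tgt L) L (src L))
          (\<lambda>(x', x3). expand (\<lambda>(x1, x2). frag_of (x1, x2, x3)) (comult L x')) (comult L x)
        = induced (diamond3 K B L (tgt L) L (src L) (tgt L) L (src L))
          (\<lambda>(x1, x'). expand (\<lambda>(x2, x3). frag_of (x1, x2, x3)) (comult L x')) (comult L x)"
    and counital_left: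
      "x \<in> carrier L \<Longrightarrow> evaluate L (\<lambda>(x1, x2). src L (counit L x1) \<otimes>\<^bsub>L\<^esub> x2) (comult L x) = x"
    and counital_right:
      "x \<in> carrier L \<Longrightarrow> evaluate L (\<lambda>(x1, x2). tgt L (counit L x2) \<otimes>\<^bsub>L\<^esub> x1) (comult L x) = x"
    and comult_mult:
      "\<lbrakk>x \<in> carrier L; y \<in> carrier L\<rbrakk>
        \<Longrightarrow> comult L (x \<otimes>\<^bsub>L\<^esub> y)
          = component_mult L L (diamond_self K B L) (comult L x) (comult L y)"
    and comult_one: "comult L \<one>\<^bsub>L\<^esub> = cls (diamond_self K B L) (frag_of (\<one>\<^bsub>L\<^esub>, \<one>\<^bsub>L\<^esub>))"
    and counit_one: "counit L \<one>\<^bsub>L\<^esub> = \<one>\<^bsub>B\<^esub>"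
    and counit_mult_src:
      "\<lbrakk>x \<in> carrier L; y \<in> carrier L\<rbrakk>
        \<Longrightarrow> counit L (x \<otimes>\<^bsub>L\<^esub> src L (counit L y)) = counit L (x \<otimes>\<^bsub>L\<^esub> y)"
    and counit_mult_tgt:
      "\<lbrakk>x \<in> carrier L; y \<in> carrier L\<rbrakk>
        \<Longrightarrow> counit L (x \<otimes>\<^bsub>L\<^esub> tgt L (counit L y)) = counit L (x \<otimes>\<^bsub>L\<^esub> y)"


section \<open>Hopf algebroids\<close>

definition tensor_over_opposite ::
  "('k, 'i) ring_scheme \<Rightarrow> ('k, 'b, 'w) module_scheme \<Rightarrow> ('k, 'b, 'a, 'm) bialgebroid_scheme
    \<Rightarrow> ('k, (('a \<times> 'a) \<Rightarrow>\<^sub>0 int) set) module"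
  where "tensor_over_opposite K B L =
    tensor K L L (carrier B) (\<lambda>b x. x \<otimes>\<^bsub>L\<^esub> tgt L b) (\<lambda>b y. tgt L b \<otimes>\<^bsub>L\<^esub> y)"

definition tensor_upper ::
  "('k, 'i) ring_scheme \<Rightarrow> ('k, 'b, 'w) module_scheme \<Rightarrow> ('k, 'b, 'a, 'm) bialgebroid_scheme
    \<Rightarrow> ('k, (('a \<times> 'a) \<Rightarrow>\<^sub>0 int) set) module"
  where "tensor_upper K B L =
    tensor K L L (carrier B) (\<lambda>b x. src L b \<otimes>\<^bsub>L\<^esub> x) (\<lambda>b y. y \<otimes>\<^bsub>L\<^esub> src L b)"

definition lambda_map ::
  "('k, 'i) ring_scheme \<Rightarrow> ('k, 'b, 'w) module_scheme \<Rightarrow> ('k, 'b, 'a, 'm) bialgebroid_scheme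
    \<Rightarrow> (('a \<times> 'a) \<Rightarrow>\<^sub>0 int) set \<Rightarrow> (('a \<times> 'a) \<Rightarrow>\<^sub>0 int) set"
  where "lambda_map K B L = induced (diamond_self K B L)
    (\<lambda>(x, y). expand (\<lambda>(x1, x2). frag_of (x1, x2 \<otimes>\<^bsub>L\<^esub> y)) (comult L x))"

definition mu_map ::
  "('k, 'i) ring_scheme \<Rightarrow> ('k, 'b, 'w) module_scheme \<Rightarrow> ('k, 'b, 'a, 'm) bialgebroid_scheme
    \<Rightarrow> (('a \<times> 'a) \<Rightarrow>\<^sub>0 int) set \<Rightarrow> (('a \<times> 'a) \<Rightarrow>\<^sub>0 int) set"
  where "mu_map K B L = induced (diamond_self K B L)
    (\<lambda>(x, y). expand (\<lambda>(y1, y2). frag_of (y1 \<otimes>\<^bsub>L\<^esub> x, y2)) (comult L y))"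

locale hopf_algebroid = left_bialgebroid +
  assumes lambda_bij: "bij_betw (lambda_map K B L)
      (carrier (tensor_over_opposite K B L)) (carrier (diamond_self K B L))"
    and mu_bij: "bij_betw (mu_map K B L)
      (carrier (tensor_upper K B L)) (carrier (diamond_self K B L))"

text \<open>The element \<open>x\<^sub>+ \<otimes> x\<^sub>-\<close>.\<close>

definition plus_minus ::
  "('k, 'i) ring_scheme \<Rightarrow> ('k, 'b, 'w) module_scheme \<Rightarrow> ('k, 'b, 'a, 'm) bialgebroid_scheme
    \<Rightarrow> 'a \<Rightarrow> (('a \<times> 'a) \<Rightarrow>\<^sub>0 int) set"
  where "plus_minus K B L x =
    inv_into (carrier (tensor_over_opposite K B L)) (lambda_map K B L)
      (cls (diamond_self K B L) (frag_of (x, \<one>\<^bsub>L\<^esub>)))"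


section \<open>Faithful flatness\<close>

locale right_module = module K N for K (structure) and N (structure) and A (structure) +
  fixes ract
  assumes ract_closed: "\<lbrakk>n \<in> carrier N; a \<in> carrier A\<rbrakk> \<Longrightarrow> ract n a \<in> carrier N"
    and ract_add_left:
      "\<lbrakk>n \<in> carrier N; n' \<in> carrier N; a \<in> carrier A\<rbrakk>
        \<Longrightarrow> ract (n \<oplus>\<^bsub>N\<^esub> n') a = ract n a \<oplus>\<^bsub>N\<^esub> ract n' a"
    and ract_add_right:
      "\<lbrakk>n \<in> carrier N; a \<in> carrier A; a' \<in> carrier A\<rbrakk>
        \<Longrightarrow> ract n (a \<oplus>\<^bsub>A\<^esub> a') = ract n a \<oplus>\<^bsub>N\<^esub> ract n a'"
    and ract_smult:
      "\<lbrakk>k \<in> carrier K; n \<in> carrier N; a \<in> carrier A\<rbrakk>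
        \<Longrightarrow> ract n (k \<odot>\<^bsub>A\<^esub> a) = k \<odot>\<^bsub>N\<^esub> ract n a"
    and ract_mult:
      "\<lbrakk>n \<in> carrier N; a \<in> carrier A; a' \<in> carrier A\<rbrakk>
        \<Longrightarrow> ract n (a \<otimes>\<^bsub>A\<^esub> a') = ract (ract n a) a'"
    and ract_one: "n \<in> carrier N \<Longrightarrow> ract n \<one>\<^bsub>A\<^esub> = n"

text \<open>
  \<open>faithfully_flat K A M act\<close>: the left \<open>A\<close>-module \<open>M\<close> (with action \<open>act\<close>) is flat, and
  \<open>N \<otimes>\<^sub>A M = 0\<close> implies \<open>N = 0\<close>.  HOL cannot quantify over modules of all types, so the test modules
  are the right \<open>A\<close>-modules with carrier in \<^typ>\<open>(nat \<Rightarrow> 'b) set\<close>.  Up to isomorphism these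
  include all countably generated right \<open>A\<close>-modules (the subquotients of a countable free module),
  and both conditions are detected on finitely generated ones: flatness on the inclusions of right
  ideals into \<open>A\<close>, faithfulness on cyclic modules.
\<close>

definition faithfully_flat ::
  "('k, 'i) ring_scheme \<Rightarrow> ('k, 'b, 'w) module_scheme \<Rightarrow> ('k, 'a, 'm) module_scheme
    \<Rightarrow> ('b \<Rightarrow> 'a \<Rightarrow> 'a) \<Rightarrow> bool"
  where "faithfully_flat K A M act \<longleftrightarrow>
    (\<forall>(N :: ('k, (nat \<Rightarrow> 'b) set) module) r (N' :: ('k, (nat \<Rightarrow> 'b) set) module) r' h.
      right_module K N A r \<and> right_module K N' A r'
      \<and> h \<in> carrier N \<rightarrow> carrier N'
      \<and> (\<forall>n \<in> carrier N. \<forall>n' \<in> carrier N. h (n \<oplus>\<^bsub>N\<^esub> n') = h n \<oplus>\<^bsub>N'\<^esub> h n')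
      \<and> (\<forall>n \<in> carrier N. \<forall>a \<in> carrier A. h (r n a) = r' (h n) a)
      \<and> inj_on h (carrier N)
      \<longrightarrow> inj_on
            (induced (tensor K N' M (carrier A) (\<lambda>a n. r' n a) act) (\<lambda>(n, m). frag_of (h n, m)))
            (carrier (tensor K N M (carrier A) (\<lambda>a n. r n a) act)))
    \<and> (\<forall>(N :: ('k, (nat \<Rightarrow> 'b) set) module) r.
      right_module K N A r
      \<and> carrier (tensor K N M (carrier A) (\<lambda>a n. r n a) act)
          = {\<zero>\<^bsub>tensor K N M (carrier A) (\<lambda>a n. r n a) act\<^esub>}
      \<longrightarrow> carrier N = {\<zero>\<^bsub>N\<^esub>})"

text \<open>
  The four module structures of a bialgebroid, namely left \<open>B\<close>, right \<open>B\<close>, left \<open>opposite B\<close>, right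
  \<open>opposite B\<close>, where right modules are left modules over the opposite algebra.
\<close>

definition all_faithfully_flat ::
  "('k, 'i) ring_scheme \<Rightarrow> ('k, 'b, 'w) module_scheme \<Rightarrow> ('k, 'b, 'a, 'm) bialgebroid_scheme
    \<Rightarrow> bool"
  where "all_faithfully_flat K B L \<longleftrightarrow>
    faithfully_flat K B L (\<lambda>b x. src L b \<otimes>\<^bsub>L\<^esub> x)
    \<and> faithfully_flat K (opposite B) L (\<lambda>b x. x \<otimes>\<^bsub>L\<^esub> src L b)
    \<and> faithfully_flat K (opposite B) L (\<lambda>b x. tgt L b \<otimes>\<^bsub>L\<^esub> x)
    \<and> faithfully_flat K B L (\<lambda>b x. x \<otimes>\<^bsub>L\<^esub> tgt L b)"


section \<open>Comodule algebras and Galois extensions\<close>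

record ('k, 'b, 'h, 'p) comodule_algebra = "('k, 'p) module" +
  base_map :: "'b \<Rightarrow> 'p"
  coact :: "'p \<Rightarrow> (('h \<times> 'p) \<Rightarrow>\<^sub>0 int) set"

abbreviation diamond_coact ::
  "('k, 'i) ring_scheme \<Rightarrow> ('k, 'b, 'w) module_scheme \<Rightarrow> ('k, 'b, 'h, 'm) bialgebroid_scheme
    \<Rightarrow> ('k, 'b, 'h, 'p, 'n) comodule_algebra_scheme \<Rightarrow> ('k, (('h \<times> 'p) \<Rightarrow>\<^sub>0 int) set) module"
  where "diamond_coact K B H P \<equiv> diamond K B H (tgt H) P (base_map P)"

locale left_comodule_algebra =
  fixes K :: "('k, 'i) ring_scheme"
    and B :: "('k, 'b, 'w) module_scheme"
    and H :: "('k, 'b, 'h, 'm) bialgebroid_scheme"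
    and P :: "('k, 'b, 'h, 'p, 'n) comodule_algebra_scheme"
  assumes comodule_k_algebra: "k_algebra K P"
    and base_map_hom: "base_map P \<in> alg_hom K B P"
    and coact_closed: "p \<in> carrier P \<Longrightarrow> coact P p \<in> takeuchi K B H (tgt H) P (base_map P)"
    and coact_add:
      "\<lbrakk>p \<in> carrier P; q \<in> carrier P\<rbrakk>
        \<Longrightarrow> coact P (p \<oplus>\<^bsub>P\<^esub> q) = coact P p \<oplus>\<^bsub>diamond_coact K B H P\<^esub> coact P q"
    and coact_smult:
      "\<lbrakk>k \<in> carrier K; p \<in> carrier P\<rbrakk>
        \<Longrightarrow> coact P (k \<odot>\<^bsub>P\<^esub> p) = k \<odot>\<^bsub>diamond_coact K B H P\<^esub> coact P p"
    and coact_mult: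
      "\<lbrakk>p \<in> carrier P; q \<in> carrier P\<rbrakk>
        \<Longrightarrow> coact P (p \<otimes>\<^bsub>P\<^esub> q)
          = component_mult H P (diamond_coact K B H P) (coact P p) (coact P q)"
    and coact_one: "coact P \<one>\<^bsub>P\<^esub> = cls (diamond_coact K B H P) (frag_of (\<one>\<^bsub>H\<^esub>, \<one>\<^bsub>P\<^esub>))"
    and coact_B_bilinear:
      "\<lbrakk>b \<in> carrier B; b' \<in> carrier B; p \<in> carrier P\<rbrakk>
        \<Longrightarrow> coact P (base_map P b \<otimes>\<^bsub>P\<^esub> p \<otimes>\<^bsub>P\<^esub> base_map P b')
          = induced (diamond_coact K B H P)
              (\<lambda>(h, q). frag_of (src H b \<otimes>\<^bsub>H\<^esub> h \<otimes>\<^bsub>H\<^esub> src H b', q)) (coact P p)"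
    and coact_coassociative:
      "p \<in> carrier P \<Longrightarrow>
        induced (diamond3 K B H (tgt H) H (src H) (tgt H) P (base_map P))
          (\<lambda>(h, q). expand (\<lambda>(h1, h2). frag_of (h1, h2, q)) (comult H h)) (coact P p)
        = induced (diamond3 K B H (tgt H) H (src H) (tgt H) P (base_map P))
          (\<lambda>(h, q). expand (\<lambda>(h', q'). frag_of (h, h', q')) (coact P q)) (coact P p)"
    and coact_counital:
      "p \<in> carrier P
        \<Longrightarrow> evaluate P (\<lambda>(h, q). base_map P (counit H h) \<otimes>\<^bsub>P\<^esub> q) (coact P p) = p"

definition coinvariants ::
  "('k, 'i) ring_scheme \<Rightarrow> ('k, 'b, 'w) module_scheme \<Rightarrow> ('k, 'b, 'h, 'm) bialgebroid_scheme
    \<Rightarrow> ('k, 'b, 'h, 'p, 'n) comodule_algebra_scheme \<Rightarrow> 'p set"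
  where "coinvariants K B H P =
    {p \<in> carrier P. coact P p = cls (diamond_coact K B H P) (frag_of (\<one>\<^bsub>H\<^esub>, p))}"

definition galois_map ::
  "('k, 'i) ring_scheme \<Rightarrow> ('k, 'b, 'w) module_scheme \<Rightarrow> ('k, 'b, 'h, 'm) bialgebroid_scheme
    \<Rightarrow> ('k, 'b, 'h, 'p, 'n) comodule_algebra_scheme
    \<Rightarrow> (('p \<times> 'p) \<Rightarrow>\<^sub>0 int) set \<Rightarrow> (('h \<times> 'p) \<Rightarrow>\<^sub>0 int) set"
  where "galois_map K B H P = induced (diamond_coact K B H P)
    (\<lambda>(p, q). expand (\<lambda>(h, p'). frag_of (h, p' \<otimes>\<^bsub>P\<^esub> q)) (coact P p))"

definition left_galois_extension ::
  "('k, 'i) ring_scheme \<Rightarrow> ('k, 'b, 'w) module_scheme \<Rightarrow> ('k, 'b, 'h, 'm) bialgebroid_scheme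
    \<Rightarrow> ('k, 'b, 'h, 'p, 'n) comodule_algebra_scheme \<Rightarrow> 'p set \<Rightarrow> bool"
  where "left_galois_extension K B H P N \<longleftrightarrow>
    left_bialgebroid K B H \<and> left_comodule_algebra K B H P
    \<and> N = coinvariants K B H P
    \<and> bij_betw (galois_map K B H P)
        (carrier (tensor K P P N (\<lambda>n p. p \<otimes>\<^bsub>P\<^esub> n) (\<lambda>n q. n \<otimes>\<^bsub>P\<^esub> q)))
        (carrier (diamond_coact K B H P))"


section \<open>Skew pairings\<close>

text \<open>The second bialgebroid \<open>\<Pi>\<close> is called \<open>U\<close>, since \<open>Pi\<close> is taken by the library.\<close>

locale skew_pairing =
  fixes K :: "('k, 'i) ring_scheme"
    and B :: "('k, 'b, 'w) module_scheme"
    and L :: "('k, 'b, 'l, 'm) bialgebroid_scheme"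
    and U :: "('k, 'b, 'p, 'n) bialgebroid_scheme"
    and \<tau> :: "'l \<Rightarrow> 'p \<Rightarrow> 'b"
  assumes pairing_closed:
      "\<lbrakk>x \<in> carrier L; \<alpha> \<in> carrier U\<rbrakk> \<Longrightarrow> \<tau> x \<alpha> \<in> carrier B"
    and pairing_add_left:
      "\<lbrakk>x \<in> carrier L; y \<in> carrier L; \<alpha> \<in> carrier U\<rbrakk>
        \<Longrightarrow> \<tau> (x \<oplus>\<^bsub>L\<^esub> y) \<alpha> = \<tau> x \<alpha> \<oplus>\<^bsub>B\<^esub> \<tau> y \<alpha>"
    and pairing_add_right:
      "\<lbrakk>x \<in> carrier L; \<alpha> \<in> carrier U; \<beta> \<in> carrier U\<rbrakk>
        \<Longrightarrow> \<tau> x (\<alpha> \<oplus>\<^bsub>U\<^esub> \<beta>) = \<tau> x \<alpha> \<oplus>\<^bsub>B\<^esub> \<tau> x \<beta>"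
    and pairing_smult_left:
      "\<lbrakk>k \<in> carrier K; x \<in> carrier L; \<alpha> \<in> carrier U\<rbrakk>
        \<Longrightarrow> \<tau> (k \<odot>\<^bsub>L\<^esub> x) \<alpha> = k \<odot>\<^bsub>B\<^esub> \<tau> x \<alpha>"
    and pairing_smult_right:
      "\<lbrakk>k \<in> carrier K; x \<in> carrier L; \<alpha> \<in> carrier U\<rbrakk>
        \<Longrightarrow> \<tau> x (k \<odot>\<^bsub>U\<^esub> \<alpha>) = k \<odot>\<^bsub>B\<^esub> \<tau> x \<alpha>"
    and pairing_B_linear:
      "\<lbrakk>a \<in> carrier B; b \<in> carrier B; c \<in> carrier B; d \<in> carrier B; f \<in> carrier B;
        x \<in> carrier L; \<alpha> \<in> carrier U\<rbrakk>
        \<Longrightarrow> \<tau> (src L a \<otimes>\<^bsub>L\<^esub> tgt L b \<otimes>\<^bsub>L\<^esub> x \<otimes>\<^bsub>L\<^esub> src L c \<otimes>\<^bsub>L\<^esub> tgt L d) \<alpha> \<otimes>\<^bsub>B\<^esub> f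
          = a \<otimes>\<^bsub>B\<^esub>
            \<tau> x (src U c \<otimes>\<^bsub>U\<^esub> tgt U f \<otimes>\<^bsub>U\<^esub> \<alpha> \<otimes>\<^bsub>U\<^esub> src U d \<otimes>\<^bsub>U\<^esub> tgt U b)"
    and pairing_mult_right:
      "\<lbrakk>x \<in> carrier L; \<alpha> \<in> carrier U; \<beta> \<in> carrier U\<rbrakk>
        \<Longrightarrow> \<tau> x (\<alpha> \<otimes>\<^bsub>U\<^esub> \<beta>)
          = evaluate B (\<lambda>(x1, x2). \<tau> x1 (\<alpha> \<otimes>\<^bsub>U\<^esub> tgt U (\<tau> x2 \<beta>))) (comult L x)"
    and pairing_mult_right':
      "\<lbrakk>x \<in> carrier L; \<alpha> \<in> carrier U; \<beta> \<in> carrier U\<rbrakk>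
        \<Longrightarrow> \<tau> x (\<alpha> \<otimes>\<^bsub>U\<^esub> \<beta>)
          = evaluate B (\<lambda>(x1, x2). \<tau> (tgt L (\<tau> x2 \<beta>) \<otimes>\<^bsub>L\<^esub> x1) \<alpha>) (comult L x)"
    and pairing_mult_left:
      "\<lbrakk>x \<in> carrier L; y \<in> carrier L; \<alpha> \<in> carrier U\<rbrakk>
        \<Longrightarrow> \<tau> (x \<otimes>\<^bsub>L\<^esub> y) \<alpha>
          = evaluate B (\<lambda>(\<alpha>1, \<alpha>2). \<tau> (x \<otimes>\<^bsub>L\<^esub> src L (\<tau> y \<alpha>1)) \<alpha>2) (comult U \<alpha>)"
    and pairing_mult_left':
      "\<lbrakk>x \<in> carrier L; y \<in> carrier L; \<alpha> \<in> carrier U\<rbrakk>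
        \<Longrightarrow> \<tau> (x \<otimes>\<^bsub>L\<^esub> y) \<alpha>
          = evaluate B (\<lambda>(\<alpha>1, \<alpha>2). \<tau> x (src U (\<tau> y \<alpha>1) \<otimes>\<^bsub>U\<^esub> \<alpha>2)) (comult U \<alpha>)"
    and pairing_one_right: "x \<in> carrier L \<Longrightarrow> \<tau> x \<one>\<^bsub>U\<^esub> = counit L x"
    and pairing_one_left: "\<alpha> \<in> carrier U \<Longrightarrow> \<tau> \<one>\<^bsub>L\<^esub> \<alpha> = counit U \<alpha>"


section \<open>The twisted double\<close>

text \<open>
  \<open>U \<otimes> L\<close> over \<open>B \<otimes> opposite B\<close>, balanced with respect to the additive generators
  \<open>b \<otimes> c\<close> of the latter.
\<close>

definition tensor_Be ::
  "('k, 'i) ring_scheme \<Rightarrow> ('k, 'b, 'w) module_scheme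
    \<Rightarrow> ('k, 'b, 'p, 'n) bialgebroid_scheme \<Rightarrow> ('k, 'b, 'l, 'm) bialgebroid_scheme
    \<Rightarrow> ('k, (('p \<times> 'l) \<Rightarrow>\<^sub>0 int) set) module"
  where "tensor_Be K B U L =
    tensor K U L (carrier B \<times> carrier B)
      (\<lambda>(b, c) \<alpha>. \<alpha> \<otimes>\<^bsub>U\<^esub> (src U b \<otimes>\<^bsub>U\<^esub> tgt U c))
      (\<lambda>(b, c) x. (src L b \<otimes>\<^bsub>L\<^esub> tgt L c) \<otimes>\<^bsub>L\<^esub> x)"

text \<open>The formal sums \<open>x\<^sub>1 \<otimes> x\<^sub>2 \<otimes> x\<^sub>3\<close> and \<open>\<beta>\<^sub>1 \<otimes> \<beta>\<^sub>2\<^sub>+ \<otimes> \<beta>\<^sub>2\<^sub>-\<close>.\<close>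

definition comult3 :: "('k, 'b, 'a, 'm) bialgebroid_scheme \<Rightarrow> 'a \<Rightarrow> (('a \<times> 'a \<times> 'a) \<Rightarrow>\<^sub>0 int)"
  where "comult3 L x =
    expand (\<lambda>(x1, x'). expand (\<lambda>(x2, x3). frag_of (x1, x2, x3)) (comult L x')) (comult L x)"

definition comult_plus_minus ::
  "('k, 'i) ring_scheme \<Rightarrow> ('k, 'b, 'w) module_scheme \<Rightarrow> ('k, 'b, 'a, 'm) bialgebroid_scheme
    \<Rightarrow> 'a \<Rightarrow> (('a \<times> 'a \<times> 'a) \<Rightarrow>\<^sub>0 int)"
  where "comult_plus_minus K B L x =
    expand (\<lambda>(x1, x2). expand (\<lambda>(p, m). frag_of (x1, p, m)) (plus_minus K B L x2)) (comult L x)"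

definition double_mult ::
  "('k, 'i) ring_scheme \<Rightarrow> ('k, 'b, 'w) module_scheme
    \<Rightarrow> ('k, 'b, 'p, 'n) bialgebroid_scheme \<Rightarrow> ('k, 'b, 'l, 'm) bialgebroid_scheme
    \<Rightarrow> ('l \<Rightarrow> 'p \<Rightarrow> 'b) \<Rightarrow> ('l \<Rightarrow> 'p \<Rightarrow> 'b)
    \<Rightarrow> (('p \<times> 'l) \<Rightarrow>\<^sub>0 int) set \<Rightarrow> (('p \<times> 'l) \<Rightarrow>\<^sub>0 int) set \<Rightarrow> (('p \<times> 'l) \<Rightarrow>\<^sub>0 int) set"
  where "double_mult K B U L \<tau> \<kappa> C D =
    induced (tensor_Be K B U L)
      (\<lambda>(\<alpha>, x). expand
        (\<lambda>(\<beta>, y). frag_extend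
          (\<lambda>(x1, x2, x3). frag_extend
            (\<lambda>(\<beta>1, \<beta>2p, \<beta>2m).
              frag_of (\<alpha> \<otimes>\<^bsub>U\<^esub> src U (\<tau> x1 \<beta>1) \<otimes>\<^bsub>U\<^esub> \<beta>2p, tgt L (\<kappa> x3 \<beta>2m) \<otimes>\<^bsub>L\<^esub> x2 \<otimes>\<^bsub>L\<^esub> y))
            (comult_plus_minus K B U \<beta>))
          (comult3 L x))
        D)
      C"

definition double_algebra ::
  "('k, 'i) ring_scheme \<Rightarrow> ('k, 'b, 'w) module_scheme
    \<Rightarrow> ('k, 'b, 'p, 'n) bialgebroid_scheme \<Rightarrow> ('k, 'b, 'l, 'm) bialgebroid_scheme
    \<Rightarrow> ('l \<Rightarrow> 'p \<Rightarrow> 'b) \<Rightarrow> ('l \<Rightarrow> 'p \<Rightarrow> 'b) \<Rightarrow> ('k, (('p \<times> 'l) \<Rightarrow>\<^sub>0 int) set) module"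
  where "double_algebra K B U L \<tau> \<kappa> =
    (tensor_Be K B U L)
      \<lparr>monoid.mult := double_mult K B U L \<tau> \<kappa>,
       monoid.one := cls (tensor_Be K B U L) (frag_of (\<one>\<^bsub>U\<^esub>, \<one>\<^bsub>L\<^esub>))\<rparr>"

definition double_src ::
  "('k, 'i) ring_scheme \<Rightarrow> ('k, 'b, 'w) module_scheme
    \<Rightarrow> ('k, 'b, 'p, 'n) bialgebroid_scheme \<Rightarrow> ('k, 'b, 'l, 'm) bialgebroid_scheme
    \<Rightarrow> 'b \<Rightarrow> (('p \<times> 'l) \<Rightarrow>\<^sub>0 int) set"
  where "double_src K B U L b = cls (tensor_Be K B U L) (frag_of (src U b, \<one>\<^bsub>L\<^esub>))"

definition double_tgt ::
  "('k, 'i) ring_scheme \<Rightarrow> ('k, 'b, 'w) module_scheme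
    \<Rightarrow> ('k, 'b, 'p, 'n) bialgebroid_scheme \<Rightarrow> ('k, 'b, 'l, 'm) bialgebroid_scheme
    \<Rightarrow> 'b \<Rightarrow> (('p \<times> 'l) \<Rightarrow>\<^sub>0 int) set"
  where "double_tgt K B U L c = cls (tensor_Be K B U L) (frag_of (tgt U c, \<one>\<^bsub>L\<^esub>))"

text \<open>
  The map \<open>\<alpha> \<otimes> x \<mapsto> (\<alpha>\<^sub>1 \<otimes> x\<^sub>1) \<otimes> (\<alpha>\<^sub>2 \<otimes> x\<^sub>2)\<close> into \<open>H \<diamond>\<^sub>B P\<close>, where \<open>H\<close> is the double of \<open>\<tau>, \<tau>\<close> and
  \<open>P\<close> that of \<open>\<tau>, \<kappa>\<close>; for \<open>\<kappa> = \<tau>\<close> it is the coproduct of \<open>H\<close>.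
\<close>

definition double_coact ::
  "('k, 'i) ring_scheme \<Rightarrow> ('k, 'b, 'w) module_scheme
    \<Rightarrow> ('k, 'b, 'p, 'n) bialgebroid_scheme \<Rightarrow> ('k, 'b, 'l, 'm) bialgebroid_scheme
    \<Rightarrow> ('l \<Rightarrow> 'p \<Rightarrow> 'b) \<Rightarrow> ('l \<Rightarrow> 'p \<Rightarrow> 'b) \<Rightarrow> (('p \<times> 'l) \<Rightarrow>\<^sub>0 int) set
    \<Rightarrow> (((('p \<times> 'l) \<Rightarrow>\<^sub>0 int) set \<times> (('p \<times> 'l) \<Rightarrow>\<^sub>0 int) set) \<Rightarrow>\<^sub>0 int) set"
  where "double_coact K B U L \<tau> \<kappa> =
    induced
      (diamond K B
        (double_algebra K B U L \<tau> \<tau>) (double_tgt K B U L)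
        (double_algebra K B U L \<tau> \<kappa>) (double_src K B U L))
      (\<lambda>(\<alpha>, x). expand
        (\<lambda>(\<alpha>1, \<alpha>2). expand
          (\<lambda>(x1, x2). frag_of (cls (tensor_Be K B U L) (frag_of (\<alpha>1, x1)),
                               cls (tensor_Be K B U L) (frag_of (\<alpha>2, x2))))
          (comult L x))
        (comult U \<alpha>))"

definition double_bialgebroid ::
  "('k, 'i) ring_scheme \<Rightarrow> ('k, 'b, 'w) module_scheme
    \<Rightarrow> ('k, 'b, 'p, 'n) bialgebroid_scheme \<Rightarrow> ('k, 'b, 'l, 'm) bialgebroid_scheme
    \<Rightarrow> ('l \<Rightarrow> 'p \<Rightarrow> 'b) \<Rightarrow> ('k, 'b, (('p \<times> 'l) \<Rightarrow>\<^sub>0 int) set) bialgebroid"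
  where "double_bialgebroid K B U L \<tau> =
    module.extend (double_algebra K B U L \<tau> \<tau>)
      (bialgebroid.fields (double_src K B U L) (double_tgt K B U L)
        (double_coact K B U L \<tau> \<tau>)
        (evaluate B (\<lambda>(\<alpha>, x). counit U (\<alpha> \<otimes>\<^bsub>U\<^esub> src U (counit L x)))))"

definition double_comodule_algebra ::
  "('k, 'i) ring_scheme \<Rightarrow> ('k, 'b, 'w) module_scheme
    \<Rightarrow> ('k, 'b, 'p, 'n) bialgebroid_scheme \<Rightarrow> ('k, 'b, 'l, 'm) bialgebroid_scheme
    \<Rightarrow> ('l \<Rightarrow> 'p \<Rightarrow> 'b) \<Rightarrow> ('l \<Rightarrow> 'p \<Rightarrow> 'b)
    \<Rightarrow> ('k, 'b, (('p \<times> 'l) \<Rightarrow>\<^sub>0 int) set, (('p \<times> 'l) \<Rightarrow>\<^sub>0 int) set) comodule_algebra"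
  where "double_comodule_algebra K B U L \<tau> \<kappa> =
    module.extend (double_algebra K B U L \<tau> \<kappa>)
      (comodule_algebra.fields (double_src K B U L) (double_coact K B U L \<tau> \<kappa>))"

end

theory Submission imports Defs
begin

text \<open>
  Tensor products are presented groups here, and an equation between cosets of formal sums gives no handle for
  calculations.  It is therefore tested on characters.  Since \<open>\<rat> / \<int>\<close> is an injective
  cogenerator of abelian groups, two elements of a tensor product are equal if all balanced functions with values in
  \<open>\<rat> / \<int>\<close> agree on them (\<open>separating_character\<close>, \<open>tensor_eqI\<close>).  Evaluated in a balanced function, a coproduct
  \<open>x\<^sub>1 \<otimes> x\<^sub>2\<close> or a translation \<open>x\<^sub>+ \<otimes> x\<^sub>-\<close> becomes a finite sum in \<open>\<rat> / \<int>\<close>.  Sums over different elements commute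
  freely, each axiom becomes a rewrite rule for such sums, and well-definedness becomes
  the balancedness of the summand.

  The product of the double moves \<open>x\<close> past \<open>\<beta>\<close> by
  \<open>x \<beta> = \<tau>[x\<^sub>1|\<beta>\<^sub>1] \<beta>\<^sub>2\<^sub>+ \<otimes> tgt (\<kappa>[x\<^sub>3|\<beta>\<^sub>2\<^sub>-]) x\<^sub>2\<close>.  This is the composite of a left half \<open>W\<close>, which uses
  \<open>\<tau>\<close>, and a right half \<open>V\<close>, which uses \<open>\<kappa>\<close>.  Each half moves products factor by factor; for \<open>V\<close> this
  rests on \<open>\<beta>\<^sub>+\<^sub>+ \<otimes> \<beta>\<^sub>- \<otimes> \<beta>\<^sub>+\<^sub>- = \<beta>\<^sub>+ \<otimes> \<beta>\<^sub>-\<^sub>1 \<otimes> \<beta>\<^sub>-\<^sub>2\<close>.  Moreover the halves can be exchanged when they share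
  only one of their arguments (\<open>V_W_swap\<close>, \<open>W_V_swap\<close>).  So the composite \<open>R\<close> moves products factor by factor in
  either argument (\<open>R_mult\<close>, \<open>R_mult_arg\<close>), and that is the associativity of the double.

  The coproduct of a cross relation has \<open>W\<close> for \<open>\<tau>\<close> in its first component and \<open>V\<close> for \<open>\<kappa>\<close> in its second.  The missing
  inner halves \<open>V\<close> and \<open>W\<close>, both for \<open>\<tau>\<close>, can be inserted because together they cancel (\<open>W_V_cancel\<close>).
  Therefore the first component multiplies with the pairings \<open>\<tau>, \<tau>\<close> and the second with \<open>\<tau>, \<kappa>\<close>
  (\<open>cosum_cross\<close>): the coaction is an algebra map.  A similar cancellation, \<open>W_V_counit\<close>, makes the counit
  compatible with the product.

  If the coaction of \<open>p\<close> is \<open>1 \<otimes> p\<close>, then the counit in the second component shows that \<open>p\<close> is the image of \<open>\<epsilon>(p)\<close> under the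
  target map.  The inverse of the Galois map is \<open>(\<alpha> \<otimes> x) \<otimes> q \<mapsto> (\<alpha>\<^sub>+ \<otimes> x\<^sub>+) \<otimes> x\<^sub>- \<alpha>\<^sub>- q\<close>.  The two composites are the
  identity by \<open>x\<^sub>1\<^sub>+ \<otimes> x\<^sub>1\<^sub>- x\<^sub>2 = x \<otimes> 1\<close> and \<open>x\<^sub>+\<^sub>1 \<otimes> x\<^sub>+\<^sub>2 x\<^sub>- = x \<otimes> 1\<close> in both Hopf algebroids (\<open>back_coa\<close>, \<open>back_pull\<close>).
\<close>

section \<open>Characters with values in the rationals modulo the integers\<close>

text \<open>
  The rational points of the circle.  The group is divisible, so that characters extend, and it has
  torsion of every order, so that characters separate points.
\<close>

quotient_type circle = rat / "\<lambda>x y. x - y \<in> \<int>"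
proof (rule equivpI)
  show "reflp (\<lambda>x y :: rat. x - y \<in> \<int>)" by (simp add: reflp_def)
  show "symp (\<lambda>x y :: rat. x - y \<in> \<int>)"
    by (auto simp: symp_def) (metis Ints_minus minus_diff_eq)
  show "transp (\<lambda>x y :: rat. x - y \<in> \<int>)"
    by (auto simp: transp_def) (metis Ints_add diff_add_cancel add_diff_eq)
qed

instantiation circle :: ab_group_add
begin

lift_definition zero_circle :: circle is 0 .

lift_definition plus_circle :: "circle \<Rightarrow> circle \<Rightarrow> circle" is "(+)"
  by (metis Ints_add add_diff_add)

lift_definition minus_circle :: "circle \<Rightarrow> circle \<Rightarrow> circle" is "(-)"
proof -
  fix a b c d :: rat
  assume "a - b \<in> \<int>" "c - d \<in> \<int>"
  then have "(a - b) - (c - d) \<in> \<int>" by (rule Ints_diff)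
  then show "(a - c) - (b - d) \<in> \<int>" by (simp add: algebra_simps)
qed

lift_definition uminus_circle :: "circle \<Rightarrow> circle" is uminus
  by (metis Ints_minus minus_diff_minus)

instance
  by standard (transfer; simp)+

end

lift_definition zmul :: "int \<Rightarrow> circle \<Rightarrow> circle" is "\<lambda>n x. of_int n * x"
  by (metis Ints_mult Ints_of_int right_diff_distrib)

lemma zmul_add: "zmul (m + n) x = zmul m x + zmul n x"
  by transfer (simp add: algebra_simps)

lemma zmul_add_right: "zmul n (x + y) = zmul n x + zmul n y"
  by transfer (simp add: algebra_simps)

lemma zmul_diff: "zmul (m - n) x = zmul m x - zmul n x"
  by transfer (simp add: algebra_simps)

lemma zmul_mult: "zmul (m * n) x = zmul m (zmul n x)"
  by transfer (simp add: algebra_simps)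

lemma zmul_0 [simp]: "zmul 0 x = 0" and zmul_1 [simp]: "zmul 1 x = x" and zmul_zero [simp]: "zmul n 0 = 0"
  by (transfer; simp)+

lemma circle_divisible:
  assumes "n \<noteq> 0"
  shows "\<exists>y. zmul n y = x"
  using assms by transfer (rule_tac x = "x / of_int n" in exI, simp)

text \<open>
  These are the possible values at a generator of a nontrivial character of a cyclic group of order
  \<open>d\<close>, where \<open>d = 0\<close> stands for the infinite cyclic group.
\<close>

lemma circle_torsion:
  assumes "d \<noteq> 1" "d \<ge> 0"
  shows "\<exists>y. y \<noteq> 0 \<and> zmul d y = 0"
proof (cases "d = 0")
  case True
  have "1 / 2 \<notin> (\<int> :: rat set)"
  proof
    assume "1 / 2 \<in> (\<int> :: rat set)"
    then obtain k :: int where "1 / 2 = (of_int k :: rat)" by (rule Ints_cases)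
    then have "of_int (2 * k) = (of_int 1 :: rat)" by simp
    then have "2 * k = 1" by (simp only: of_int_eq_iff)
    then show False by presburger
  qed
  then have "\<exists>y :: circle. y \<noteq> 0" by transfer (rule_tac x = "1 / 2" in exI, simp)
  then show ?thesis using True by simp
next
  case False
  then have d: "d > 1" using assms by simp
  have "1 / of_int d \<notin> (\<int> :: rat set)"
  proof
    assume "1 / of_int d \<in> (\<int> :: rat set)"
    then obtain k :: int where "1 / of_int d = (of_int k :: rat)" by (rule Ints_cases)
    then have "of_int (k * d) = (of_int 1 :: rat)" using d by (simp add: field_simps)
    then have "k * d = 1" by (simp only: of_int_eq_iff)
    then show False using d by (simp add: zmult_eq_1_iff)
  qed
  then show ?thesis using d by transfer (rule_tac x = "1 / of_int d" in exI, simp)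
qed

lemma int_subgroup_principal:
  fixes D :: "int set"
  assumes "0 \<in> D" and diff: "\<And>m n. m \<in> D \<Longrightarrow> n \<in> D \<Longrightarrow> m - n \<in> D"
  obtains d where "d \<ge> 0" "d \<in> D" "\<And>n. n \<in> D \<Longrightarrow> d dvd n"
proof (cases "D = {0}")
  case True
  then show ?thesis using that[of 0] by auto
next
  case False
  have neg: "- n \<in> D" if "n \<in> D" for n using diff[OF \<open>0 \<in> D\<close> that] by simp
  have add: "m + n \<in> D" if "m \<in> D" "n \<in> D" for m n using diff[OF that(1) neg[OF that(2)]] by simp
  have nmul: "int k * n \<in> D" if "n \<in> D" for k n
    by (induction k) (auto simp: \<open>0 \<in> D\<close> algebra_simps add that)
  have mul: "k * n \<in> D" if "n \<in> D" for k n
  proof (cases "k \<ge> 0")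
    case True then show ?thesis using nmul[OF that, of "nat k"] by simp
  next
    case False then show ?thesis using neg[OF nmul[OF that, of "nat (- k)"]] by simp
  qed
  define d where "d = (LEAST k. k > 0 \<and> int k \<in> D)"
  obtain m where "m \<in> D" "m \<noteq> 0" using False \<open>0 \<in> D\<close> by auto
  then have "\<exists>k. k > 0 \<and> int k \<in> D"
    using neg by (intro exI[of _ "nat \<bar>m\<bar>"]) (auto simp: abs_if)
  then have d: "d > 0" "int d \<in> D" unfolding d_def by (auto dest!: LeastI_ex)
  have "int d dvd n" if "n \<in> D" for n
  proof -
    have "n - (n div int d) * int d \<in> D" by (intro diff that mul d)
    then have md: "n mod int d \<in> D" by (simp add: minus_div_mult_eq_mod)
    have "n mod int d < int d" "n mod int d \<ge> 0" using d by auto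
    then have "nat (n mod int d) < d" by linarith
    from not_less_Least[OF this[unfolded d_def]] md \<open>n mod int d \<ge> 0\<close>
    have "n mod int d = 0" by (auto simp: d_def)
    then show ?thesis by auto
  qed
  then show ?thesis using that[of "int d"] d by auto
qed

text \<open>
  The graph of a character of some subgroup of a free abelian group.  As graphs, characters of
  different subgroups are ordered by inclusion, which is the order for Zorn's lemma.
\<close>

definition partial_character :: "(('x \<Rightarrow>\<^sub>0 int) \<times> circle) set \<Rightarrow> bool"
  where "partial_character \<Gamma> \<longleftrightarrow> (0, 0) \<in> \<Gamma>
    \<and> (\<forall>x p y q. (x, p) \<in> \<Gamma> \<longrightarrow> (y, q) \<in> \<Gamma> \<longrightarrow> (x - y, p - q) \<in> \<Gamma>)
    \<and> (\<forall>p. (0, p) \<in> \<Gamma> \<longrightarrow> p = 0)"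

lemma partial_character_add:
  assumes "partial_character \<Gamma>" "(x, p) \<in> \<Gamma>" "(y, q) \<in> \<Gamma>"
  shows "(x + y, p + q) \<in> \<Gamma>"
proof -
  have "(0 - y, 0 - q) \<in> \<Gamma>" using assms unfolding partial_character_def by blast
  then have "(x - (0 - y), p - (0 - q)) \<in> \<Gamma>" using assms unfolding partial_character_def by blast
  then show ?thesis by simp
qed

lemma partial_character_cmul:
  assumes "partial_character \<Gamma>" "(x, p) \<in> \<Gamma>"
  shows "(frag_cmul n x, zmul n p) \<in> \<Gamma>"
proof (induction n rule: int_induct[where k = 0])
  case base
  then show ?case using assms by (simp add: partial_character_def)
next
  case (step1 i)
  then show ?case
    using partial_character_add[OF assms(1) step1(2) assms(2)]
    by (simp add: frag_cmul_distrib zmul_add)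
next
  case (step2 i)
  then show ?case
    using assms unfolding partial_character_def by (simp add: frag_cmul_diff_distrib zmul_diff)
qed

lemma partial_character_unique:
  assumes "partial_character \<Gamma>" "(x, p) \<in> \<Gamma>" "(x, q) \<in> \<Gamma>"
  shows "p = q"
proof -
  have "(x - x, p - q) \<in> \<Gamma>" using assms unfolding partial_character_def by blast
  then show ?thesis using assms(1) unfolding partial_character_def by auto
qed

definition extend_by where
  "extend_by \<Gamma> x y = {(u + frag_cmul n x, p + zmul n y) | u p n. (u, p) \<in> \<Gamma>}"

text \<open>
  The hypothesis on \<open>y\<close> is what makes \<open>u + n x \<mapsto> p + n y\<close> independent of the way in
  which an element is written.
\<close>

lemma partial_character_extend:
  assumes \<Gamma>: "partial_character \<Gamma>" and y: "\<And>n p. (frag_cmul n x, p) \<in> \<Gamma> \<Longrightarrow> zmul n y = p"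
  shows "partial_character (extend_by \<Gamma> x y)" "\<Gamma> \<subseteq> extend_by \<Gamma> x y" "(x, y) \<in> extend_by \<Gamma> x y"
proof -
  have zero: "(0, 0) \<in> \<Gamma>" using \<Gamma> by (simp add: partial_character_def)
  show sub: "\<Gamma> \<subseteq> extend_by \<Gamma> x y"
  proof
    fix z assume "z \<in> \<Gamma>"
    then show "z \<in> extend_by \<Gamma> x y"
      unfolding extend_by_def
      by (intro CollectI exI[of _ "fst z"] exI[of _ "snd z"] exI[of _ 0]) simp
  qed
  show "(x, y) \<in> extend_by \<Gamma> x y"
    unfolding extend_by_def using zero
    by (intro CollectI exI[of _ 0] exI[of _ 1]) simp
  show "partial_character (extend_by \<Gamma> x y)"
    unfolding partial_character_def
  proof (intro conjI allI impI)
    show "(0, 0) \<in> extend_by \<Gamma> x y" using zero sub by auto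
  next
    fix a p b q
    assume "(a, p) \<in> extend_by \<Gamma> x y" "(b, q) \<in> extend_by \<Gamma> x y"
    then obtain u p' m v q' n where *: "a = u + frag_cmul m x" "p = p' + zmul m y" "(u, p') \<in> \<Gamma>"
      "b = v + frag_cmul n x" "q = q' + zmul n y" "(v, q') \<in> \<Gamma>"
      unfolding extend_by_def by blast
    have "(u - v, p' - q') \<in> \<Gamma>" using * \<Gamma> unfolding partial_character_def by blast
    moreover have "a - b = (u - v) + frag_cmul (m - n) x" "p - q = (p' - q') + zmul (m - n) y"
      using * by (simp_all add: frag_cmul_diff_distrib zmul_diff)
    ultimately show "(a - b, p - q) \<in> extend_by \<Gamma> x y"
      unfolding extend_by_def by blast
  next
    fix p assume "(0, p) \<in> extend_by \<Gamma> x y"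
    then obtain u p' n where *: "0 = u + frag_cmul n x" "p = p' + zmul n y" "(u, p') \<in> \<Gamma>"
      unfolding extend_by_def by blast
    have "(0 - u, 0 - p') \<in> \<Gamma>" using * zero \<Gamma> unfolding partial_character_def by blast
    moreover have "0 - u = frag_cmul n x" using *(1) by (metis add_diff_cancel_left')
    ultimately have "zmul n y = - p'" using y by simp
    then show "p = 0" using * by simp
  qed
qed

text \<open>
  The integers \<open>n\<close> with \<open>n x\<close> in the domain form an ideal \<open>d \<int>\<close>.  Dividing the value at \<open>d x\<close> by
  \<open>d\<close> extends the character to \<open>x\<close>, so by maximality \<open>x\<close> was in the domain already.
\<close>

lemma maximal_partial_character_total:
  assumes \<Gamma>: "partial_character \<Gamma>"
    and max: "\<And>\<Delta>. partial_character \<Delta> \<Longrightarrow> \<Gamma> \<subseteq> \<Delta> \<Longrightarrow> \<Delta> = \<Gamma>"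
  shows "\<exists>y. (x, y) \<in> \<Gamma>"
proof -
  define D where "D = {n. \<exists>p. (frag_cmul n x, p) \<in> \<Gamma>}"
  have "0 \<in> D" using \<Gamma> by (auto simp: D_def partial_character_def)
  moreover have "m - n \<in> D" if "m \<in> D" "n \<in> D" for m n
    using that \<Gamma> unfolding D_def partial_character_def mem_Collect_eq frag_cmul_diff_distrib by blast
  ultimately obtain d where d: "d \<ge> 0" "d \<in> D" "\<And>n. n \<in> D \<Longrightarrow> d dvd n"
    using int_subgroup_principal[of D] by blast
  obtain p0 where p0: "(frag_cmul d x, p0) \<in> \<Gamma>" using d by (auto simp: D_def)
  have "\<exists>y. zmul d y = p0"
  proof (cases "d = 0")
    case True
    then have "p0 = 0" using p0 \<Gamma> by (auto simp: partial_character_def)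
    then show ?thesis using True by auto
  qed (rule circle_divisible)
  then obtain y where y: "zmul d y = p0" ..
  have "zmul n y = p" if "(frag_cmul n x, p) \<in> \<Gamma>" for n p
  proof -
    have "n \<in> D" using that by (auto simp: D_def)
    then obtain k where k: "n = k * d" using d by (metis dvd_def mult.commute)
    have "(frag_cmul k (frag_cmul d x), zmul k p0) \<in> \<Gamma>"
      by (rule partial_character_cmul[OF \<Gamma> p0])
    then have "zmul k p0 = p" using partial_character_unique[OF \<Gamma>] that k by simp
    then show ?thesis using k y by (simp add: zmul_mult)
  qed
  note ext = partial_character_extend[OF \<Gamma> this]
  then show ?thesis using max[of "extend_by \<Gamma> x y"] by blast
qed

text \<open>
  The character of a free abelian group with prescribed values on the generators.
\<close>

definition lin :: "('x \<Rightarrow> circle) \<Rightarrow> ('x \<Rightarrow>\<^sub>0 int) \<Rightarrow> circle"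
  where "lin f c = (\<Sum>x\<in>Poly_Mapping.keys c. zmul (Poly_Mapping.lookup c x) (f x))"

lemma lin_superset:
  "finite A \<Longrightarrow> Poly_Mapping.keys c \<subseteq> A \<Longrightarrow> lin f c = (\<Sum>x\<in>A. zmul (Poly_Mapping.lookup c x) (f x))"
  unfolding lin_def by (rule sum.mono_neutral_left) (auto simp: in_keys_iff)

lemma lin_0 [simp]: "lin f 0 = 0" and lin_of [simp]: "lin f (frag_of x) = f x"
  by (simp_all add: lin_def)

lemma lin_add: "lin f (c + d) = lin f c + lin f d"
proof -
  let ?A = "Poly_Mapping.keys c \<union> Poly_Mapping.keys d"
  have "Poly_Mapping.keys (c + d) \<subseteq> ?A" by (rule Poly_Mapping.keys_add)
  then show ?thesis
    by (simp add: lin_superset[of ?A] lookup_add zmul_add sum.distrib)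
qed

lemma lin_minus: "lin f (- c) = - lin f c"
  using lin_add[of f c "- c"] by (simp add: minus_unique)

lemma lin_diff: "lin f (c - d) = lin f c - lin f d"
  using lin_add[of f c "- d"] by (simp add: lin_minus)

lemma lin_cong: "(\<And>x. x \<in> Poly_Mapping.keys c \<Longrightarrow> f x = g x) \<Longrightarrow> lin f c = lin g c"
  by (simp add: lin_def)

lemma lin_plus: "lin (\<lambda>x. f x + g x) c = lin f c + lin g c"
  by (simp add: lin_def zmul_add_right sum.distrib)

lemma lin_zero [simp]: "lin (\<lambda>x. 0) c = 0"
  by (simp add: lin_def)

lemma additive_eq_lin:
  assumes "\<And>x y. \<phi> (x + y) = \<phi> x + \<phi> y"
  shows "\<phi> c = lin (\<lambda>x. \<phi> (frag_of x)) c"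
proof -
  have 0: "\<phi> 0 = 0" using assms[of 0 0] by simp
  then have "\<phi> (a - b) = \<phi> a - \<phi> b" for a b
    using assms[of "a - b" b] by simp
  then show ?thesis
    using 0 by (intro frag_induction[of c UNIV "\<lambda>c. \<phi> c = lin (\<lambda>x. \<phi> (frag_of x)) c"]) (auto simp: lin_diff)
qed

lemma lin_frag_extend: "lin f (frag_extend g c) = lin (\<lambda>x. lin f (g x)) c"
  using additive_eq_lin[of "\<lambda>c. lin f (frag_extend g c)" c] by (simp add: frag_extend_add lin_add)

lemma lin_commute: "lin (\<lambda>x. lin (\<lambda>y. f x y) d) c = lin (\<lambda>y. lin (\<lambda>x. f x y) c) d"
  using additive_eq_lin[of "\<lambda>c. lin (\<lambda>y. lin (\<lambda>x. f x y) c) d" c] by (simp add: lin_add lin_plus)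

text \<open>
  The cyclic subgroup generated by the class of \<open>c\<close> modulo \<open>H\<close> has a nontrivial character.  It is
  pulled back to \<open>H + \<int> c\<close> and extended to the whole group by Zorn's lemma (Baer's criterion for the
  injectivity of \<open>\<rat> / \<int>\<close>).
\<close>

lemma separating_character:
  assumes "0 \<in> H" and H: "\<And>x y. x \<in> H \<Longrightarrow> y \<in> H \<Longrightarrow> x - y \<in> H" and c: "c \<notin> H"
  obtains f where "\<And>h. h \<in> H \<Longrightarrow> lin f h = 0" "lin f c \<noteq> 0"
proof -
  define D where "D = {n. frag_cmul n c \<in> H}"
  have "0 \<in> D" using assms by (simp add: D_def)
  moreover have "m - n \<in> D" if "m \<in> D" "n \<in> D" for m n
    using that H by (simp add: D_def frag_cmul_diff_distrib)
  ultimately obtain d where d: "d \<ge> 0" "\<And>n. n \<in> D \<Longrightarrow> d dvd n" "d \<in> D"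
    by (metis int_subgroup_principal)
  have "d \<noteq> 1" using d(3) c by (auto simp: D_def)
  with d(1) obtain q where q: "q \<noteq> 0" "zmul d q = 0" using circle_torsion by blast
  have "partial_character (H \<times> {0})"
    using assms by (auto simp: partial_character_def)
  moreover have "zmul n q = p" if "(frag_cmul n c, p) \<in> H \<times> {0}" for n p
  proof -
    have "n \<in> D" "p = 0" using that by (auto simp: D_def)
    moreover from this obtain k where "n = k * d" using d by (metis dvd_def mult.commute)
    ultimately show ?thesis using q by (simp add: zmul_mult)
  qed
  ultimately have \<Gamma>0: "partial_character (extend_by (H \<times> {0}) c q)"
    "H \<times> {0} \<subseteq> extend_by (H \<times> {0}) c q" "(c, q) \<in> extend_by (H \<times> {0}) c q"
    using partial_character_extend[of "H \<times> {0}" c q] by blast+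
  define \<A> where "\<A> = {\<Gamma>. partial_character \<Gamma> \<and> extend_by (H \<times> {0}) c q \<subseteq> \<Gamma>}"
  have "\<exists>M\<in>\<A>. \<forall>P\<in>\<A>. M \<subseteq> P \<longrightarrow> P = M"
  proof (rule subset_Zorn_nonempty)
    show "\<A> \<noteq> {}" using \<Gamma>0 by (auto simp: \<A>_def)
    fix C assume C: "C \<noteq> {}" "subset.chain \<A> C"
    then have pc: "partial_character P" "extend_by (H \<times> {0}) c q \<subseteq> P" if "P \<in> C" for P
      using that by (auto simp: subset.chain_def \<A>_def)
    have "partial_character (\<Union>C)"
      unfolding partial_character_def
    proof (intro conjI allI impI)
      show "(0, 0) \<in> \<Union>C" using C(1) pc by (auto simp: partial_character_def)
    next
      fix x p y r assume "(x, p) \<in> \<Union>C" "(y, r) \<in> \<Union>C"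
      then obtain P Q where PQ: "P \<in> C" "Q \<in> C" "(x, p) \<in> P" "(y, r) \<in> Q" by blast
      then have "P \<subseteq> Q \<or> Q \<subseteq> P" using C(2) by (auto simp: subset_chain_def)
      then obtain Z where "Z \<in> C" "(x, p) \<in> Z" "(y, r) \<in> Z" using PQ by blast
      then show "(x - y, p - r) \<in> \<Union>C" using pc[of Z] unfolding partial_character_def by blast
    next
      fix p assume "(0, p) \<in> \<Union>C"
      then show "p = 0" using pc unfolding partial_character_def by blast
    qed
    then show "\<Union>C \<in> \<A>" using C(1) pc by (auto simp: \<A>_def)
  qed
  then obtain \<Gamma> where "\<Gamma> \<in> \<A>" and \<Gamma>max: "\<forall>P\<in>\<A>. \<Gamma> \<subseteq> P \<longrightarrow> P = \<Gamma>" ..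
  then have \<Gamma>: "partial_character \<Gamma>" "extend_by (H \<times> {0}) c q \<subseteq> \<Gamma>"
    by (simp_all add: \<A>_def)
  have max: "P = \<Gamma>" if "partial_character P" "\<Gamma> \<subseteq> P" for P
  proof -
    have "P \<in> \<A>" using that \<Gamma>(2) by (simp add: \<A>_def)
    with \<Gamma>max that(2) show ?thesis by simp
  qed
  define \<phi> where "\<phi> x = (THE y. (x, y) \<in> \<Gamma>)" for x
  have "\<exists>!y. (x, y) \<in> \<Gamma>" for x
    using maximal_partial_character_total[OF \<Gamma>(1) max] partial_character_unique[OF \<Gamma>(1)] by blast
  then have \<phi>: "(x, \<phi> x) \<in> \<Gamma>" for x unfolding \<phi>_def by (rule theI')
  have \<phi>_eq: "\<phi> x = y" if "(x, y) \<in> \<Gamma>" for x y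
    using partial_character_unique[OF \<Gamma>(1) \<phi> that] .
  have "\<phi> (x + y) = \<phi> x + \<phi> y" for x y
    by (rule \<phi>_eq) (rule partial_character_add[OF \<Gamma>(1) \<phi> \<phi>])
  then have lin: "\<phi> x = lin (\<lambda>x. \<phi> (frag_of x)) x" for x by (rule additive_eq_lin)
  show ?thesis
  proof (rule that[of "\<lambda>x. \<phi> (frag_of x)"])
    fix h assume "h \<in> H"
    then have "(h, 0) \<in> \<Gamma>" using \<Gamma>0(2) \<Gamma>(2) by blast
    then show "lin (\<lambda>x. \<phi> (frag_of x)) h = 0" using \<phi>_eq lin by metis
  next
    have "(c, q) \<in> \<Gamma>" using \<Gamma>0(3) \<Gamma>(2) by blast
    then show "lin (\<lambda>x. \<phi> (frag_of x)) c \<noteq> 0" using \<phi>_eq lin q(1) by metis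
  qed
qed

section \<open>Quotients of free abelian groups and their characters\<close>

definition additive_on :: "('a, 'm) ring_scheme \<Rightarrow> ('a \<Rightarrow> circle) \<Rightarrow> bool"
  where "additive_on A \<phi> \<longleftrightarrow>
    (\<forall>x\<in>carrier A. \<forall>y\<in>carrier A. \<phi> (x \<oplus>\<^bsub>A\<^esub> y) = \<phi> x + \<phi> y)"

lemma additive_onI:
  "(\<And>x y. x \<in> carrier A \<Longrightarrow> y \<in> carrier A \<Longrightarrow> \<phi> (x \<oplus>\<^bsub>A\<^esub> y) = \<phi> x + \<phi> y) \<Longrightarrow> additive_on A \<phi>"
  by (simp add: additive_on_def)

lemma additive_onD:
  "additive_on A \<phi> \<Longrightarrow> x \<in> carrier A \<Longrightarrow> y \<in> carrier A \<Longrightarrow> \<phi> (x \<oplus>\<^bsub>A\<^esub> y) = \<phi> x + \<phi> y"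
  by (simp add: additive_on_def)

lemma (in abelian_group) additive_on_zero:
  assumes "additive_on G \<phi>" shows "\<phi> \<zero> = 0"
  using additive_onD[OF assms, of \<zero> \<zero>] by simp

lemma (in abelian_group) additive_on_minus:
  assumes "additive_on G \<phi>" "x \<in> carrier G" shows "\<phi> (\<ominus> x) = - \<phi> x"
  using additive_onD[OF assms(1), of x "\<ominus> x"] additive_on_zero[OF assms(1)] assms(2)
  by (simp add: r_neg add_eq_0_iff)

lemma (in abelian_group) additive_on_nat_pow:
  assumes "additive_on G \<phi>" "x \<in> carrier G" shows "\<phi> ([(n :: nat)] \<cdot>\<^bsub>G\<^esub> x) = zmul (int n) (\<phi> x)"
proof (induction n)
  case 0
  then show ?case by (simp add: additive_on_zero[OF assms(1)])
next
  case (Suc n)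
  have "[Suc n] \<cdot>\<^bsub>G\<^esub> x = [n] \<cdot>\<^bsub>G\<^esub> x \<oplus> x" using assms by (simp add: add.nat_pow_Suc)
  then show ?case
    using Suc assms additive_onD[OF assms(1), of "[n] \<cdot>\<^bsub>G\<^esub> x" x] by (simp add: zmul_add add.commute)
qed

lemma (in abelian_group) additive_on_int_pow:
  assumes "additive_on G \<phi>" "x \<in> carrier G" shows "\<phi> ([(n :: int)] \<cdot>\<^bsub>G\<^esub> x) = zmul n (\<phi> x)"
proof (cases "n \<ge> 0")
  case True
  then have "[n] \<cdot>\<^bsub>G\<^esub> x = [nat n] \<cdot>\<^bsub>G\<^esub> x" by (metis add_pow_int_ge)
  then show ?thesis using additive_on_nat_pow[OF assms, of "nat n"] True by simp
next
  case False
  then have "[n] \<cdot>\<^bsub>G\<^esub> x = \<ominus> ([nat (- n)] \<cdot>\<^bsub>G\<^esub> x)" by (simp add: add_pow_int_lt)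
  then have "\<phi> ([n] \<cdot>\<^bsub>G\<^esub> x) = - zmul (- n) (\<phi> x)"
    using additive_on_nat_pow[OF assms, of "nat (- n)"] additive_on_minus[OF assms(1)] assms False
    by simp
  then show ?thesis using zmul_diff[of 0 n "\<phi> x"] by simp
qed

lemma (in abelian_group) additive_on_finsum:
  assumes "additive_on G \<phi>" "finite A" "f \<in> A \<rightarrow> carrier G"
  shows "\<phi> (\<Oplus>x\<in>A. f x) = (\<Sum>x\<in>A. \<phi> (f x))"
  using assms(2,3)
proof (induction A rule: finite_induct)
  case empty
  then show ?case by (simp add: additive_on_zero[OF assms(1)])
next
  case (insert x A)
  then show ?case using additive_onD[OF assms(1)] by (simp add: Pi_def)
qed

lemma (in abelian_group) evaluate_closed:
  assumes "\<And>x. x \<in> Poly_Mapping.keys (repr C) \<Longrightarrow> f x \<in> carrier G"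
  shows "evaluate G f C \<in> carrier G"
  unfolding evaluate_def using assms by (auto intro!: finsum_closed)

lemma (in abelian_group) additive_on_evaluate:
  assumes "additive_on G \<phi>" "\<And>x. x \<in> Poly_Mapping.keys (repr C) \<Longrightarrow> f x \<in> carrier G"
  shows "\<phi> (evaluate G f C) = lin (\<lambda>x. \<phi> (f x)) (repr C)"
  unfolding evaluate_def lin_def using assms
  by (subst additive_on_finsum) (auto simp: additive_on_int_pow)

text \<open>
  The group is a quotient of the free abelian group on its carrier.  A character of the latter that
  vanishes on the kernel but not on the difference of the two generators descends to it.
\<close>

lemma (in abelian_group) characters_separate:
  assumes "x \<in> carrier G" "y \<in> carrier G"
    and eq: "\<And>\<phi>. additive_on G \<phi> \<Longrightarrow> \<phi> x = \<phi> y"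
  shows "x = y"
proof (rule ccontr)
  assume "x \<noteq> y"
  obtain h where h: "h \<in> hom (free_Abelian_group (carrier G)) (add_monoid G)"
    and of: "\<And>z. z \<in> carrier G \<Longrightarrow> h (frag_of z) = z"
    using comm_group.free_Abelian_group_universal[OF a_comm_group, of "\<lambda>z. z" "carrier G"] by auto
  have hadd: "h (a + b) = h a \<oplus> h b"
    if "Poly_Mapping.keys a \<subseteq> carrier G" "Poly_Mapping.keys b \<subseteq> carrier G" for a b
    using h that by (auto simp: hom_def)
  have hcl: "h a \<in> carrier G" if "Poly_Mapping.keys a \<subseteq> carrier G" for a
    using h that by (auto simp: hom_def)
  have keys_diff: "Poly_Mapping.keys (a - b) \<subseteq> carrier G"
    if "Poly_Mapping.keys a \<subseteq> carrier G" "Poly_Mapping.keys b \<subseteq> carrier G" for a b :: "'a \<Rightarrow>\<^sub>0 int"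
    using that keys_diff[of a b] by blast
  have hdiff: "h (a - b) = h a \<ominus> h b"
    if "Poly_Mapping.keys a \<subseteq> carrier G" "Poly_Mapping.keys b \<subseteq> carrier G" for a b
  proof -
    have "h a = h (a - b) \<oplus> h b" using hadd[OF keys_diff[OF that] that(2)] by simp
    then show ?thesis using hcl[OF that(1)] hcl[OF that(2)] hcl[OF keys_diff[OF that]]
      by (simp add: a_minus_def a_assoc r_neg)
  qed
  define H where "H = {c. Poly_Mapping.keys c \<subseteq> carrier G \<and> h c = \<zero>}"
  have "h 0 = \<zero>" using hdiff[of 0 0] hcl[of 0] by (simp add: a_minus_def r_neg)
  then have "0 \<in> H" by (simp add: H_def)
  moreover have "a - b \<in> H" if "a \<in> H" "b \<in> H" for a b
    using that keys_diff hdiff by (auto simp: H_def a_minus_def)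
  moreover have "frag_of x - frag_of y \<notin> H"
  proof
    assume "frag_of x - frag_of y \<in> H"
    then have "x \<ominus> y = \<zero>" using hdiff[of "frag_of x" "frag_of y"] assms(1,2) of by (simp add: H_def)
    then show False using \<open>x \<noteq> y\<close> assms(1,2) by (metis a_minus_def minus_equality minus_minus r_neg a_inv_closed)
  qed
  ultimately obtain f where f: "\<And>h. h \<in> H \<Longrightarrow> lin f h = 0" "lin f (frag_of x - frag_of y) \<noteq> 0"
    by (metis separating_character)
  have "additive_on G f"
  proof (rule additive_onI)
    fix u v assume uv: "u \<in> carrier G" "v \<in> carrier G"
    have "frag_of (u \<oplus> v) - frag_of u - frag_of v \<in> H"
      using uv by (simp add: H_def hdiff keys_diff of a_minus_def minus_add)
        (metis a_assoc a_comm a_closed a_inv_closed minus_add r_neg)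
    from f(1)[OF this] show "f (u \<oplus> v) = f u + f v" by (simp add: lin_diff lin_add diff_diff_eq)
  qed
  then show False using eq f(2) by (simp add: lin_diff)
qed

definition vanishes_on :: "('x \<Rightarrow>\<^sub>0 int) set \<Rightarrow> ('x \<Rightarrow> circle) \<Rightarrow> bool"
  where "vanishes_on R f \<longleftrightarrow> (\<forall>r\<in>R. lin f r = 0)"

text \<open>
  The characters of a presented group are the functions on the generators whose linear extensions
  vanish on the relators.  This locale transfers the separation property to presented groups, so
  that equations between cosets are proved by evaluating arbitrary representatives.
\<close>

locale presentation =
  fixes S :: "'x set" and R :: "('x \<Rightarrow>\<^sub>0 int) set" and act :: "'k \<Rightarrow> 'x \<Rightarrow> 'x"
  assumes relators: "r \<in> R \<Longrightarrow> Poly_Mapping.keys r \<subseteq> S"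
begin

abbreviation "F \<equiv> free_Abelian_group S"
abbreviation "H \<equiv> generate F R"
abbreviation "T \<equiv> presented S R act"

lemma H_subgroup: "subgroup H F"
  using relators by (intro group.generate_is_subgroup) auto

lemma H_keys: "h \<in> H \<Longrightarrow> Poly_Mapping.keys h \<subseteq> S"
  using subgroup.subset[OF H_subgroup] by (metis carrier_free_Abelian_group_iff subsetD)

lemma H_zero: "0 \<in> H"
  using subgroup.one_closed[OF H_subgroup] by simp

lemma H_minus: "h \<in> H \<Longrightarrow> - h \<in> H"
  using subgroup.m_inv_closed[OF H_subgroup, of h] by (simp add: H_keys)

lemma H_add: "h \<in> H \<Longrightarrow> h' \<in> H \<Longrightarrow> h + h' \<in> H"
  using subgroup.m_closed[OF H_subgroup, of h h'] by simp

lemma H_diff: "h \<in> H \<Longrightarrow> h' \<in> H \<Longrightarrow> h - h' \<in> H"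
  using H_add[of h "- h'"] H_minus by simp

lemma zero_T: "\<zero>\<^bsub>T\<^esub> = H"
  by (simp add: presented_def Let_def)

lemma cls_T: "cls T c = (\<lambda>h. h + c) ` H"
  by (auto simp: cls_def zero_T r_coset_def)

lemma cls_eq_iff: "cls T c = cls T d \<longleftrightarrow> c - d \<in> H"
proof
  assume "cls T c = cls T d"
  then have "0 + c \<in> cls T d" using H_zero by (auto simp: cls_T)
  then obtain h where "h \<in> H" "c = h + d" by (auto simp: cls_T)
  then show "c - d \<in> H" by simp
next
  assume cd: "c - d \<in> H"
  have "h + c \<in> (\<lambda>h. h + d) ` H" "h + d \<in> (\<lambda>h. h + c) ` H" if h: "h \<in> H" for h
  proof -
    have "h + c = (h + (c - d)) + d" "h + d = (h - (c - d)) + c" by simp_all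
    then show "h + c \<in> (\<lambda>h. h + d) ` H" "h + d \<in> (\<lambda>h. h + c) ` H"
      using H_add[OF h cd] H_diff[OF h cd] by blast+
  qed
  then show "cls T c = cls T d" unfolding cls_T by blast
qed

lemma carrier_T: "carrier T = cls T ` {c. Poly_Mapping.keys c \<subseteq> S}"
proof -
  have "H #>\<^bsub>F\<^esub> c = cls T c" for c unfolding cls_T by (auto simp: r_coset_def)
  moreover have "carrier T = (\<lambda>c. H #>\<^bsub>F\<^esub> c) ` carrier F"
    by (simp add: presented_def Let_def carrier_FactGroup)
  moreover have "carrier F = {c. Poly_Mapping.keys c \<subseteq> S}" by auto
  ultimately show ?thesis by simp
qed

lemma cls_closed: "Poly_Mapping.keys c \<subseteq> S \<Longrightarrow> cls T c \<in> carrier T"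
  by (auto simp: carrier_T)

lemma repr_cls: "\<exists>h\<in>H. repr (cls T c) = h + c"
proof -
  have "c \<in> cls T c" using H_zero by (force simp: cls_T)
  then have "repr (cls T c) \<in> cls T c" unfolding repr_def by (rule someI)
  then show ?thesis by (auto simp: cls_T)
qed

lemma repr_carrier:
  assumes "C \<in> carrier T"
  shows "Poly_Mapping.keys (repr C) \<subseteq> S" "cls T (repr C) = C"
proof -
  obtain c where c: "Poly_Mapping.keys c \<subseteq> S" "C = cls T c" using assms by (auto simp: carrier_T)
  obtain h where h: "h \<in> H" "repr C = h + c" using repr_cls c by blast
  show "Poly_Mapping.keys (repr C) \<subseteq> S"
    using Poly_Mapping.keys_add[of h c] H_keys[OF h(1)] c(1) h(2) by auto
  show "cls T (repr C) = C" unfolding c(2) cls_eq_iff using h c by simp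
qed

lemma cls_add:
  assumes "Poly_Mapping.keys c \<subseteq> S" "Poly_Mapping.keys d \<subseteq> S"
  shows "cls T c \<oplus>\<^bsub>T\<^esub> cls T d = cls T (c + d)"
proof -
  have "add T = set_mult F" by (simp add: presented_def Let_def)
  have sum: "cls T c \<oplus>\<^bsub>T\<^esub> cls T d = (\<Union>h\<in>H. \<Union>h'\<in>H. {(h + c) + (h' + d)})"
    using \<open>add T = set_mult F\<close> by (auto simp: set_mult_def cls_T)
  show ?thesis
    unfolding sum unfolding cls_T
  proof (intro subset_antisym subsetI)
    fix z assume "z \<in> (\<Union>h\<in>H. \<Union>h'\<in>H. {(h + c) + (h' + d)})"
    then obtain h h' where "h \<in> H" "h' \<in> H" "z = (h + h') + (c + d)" by (auto simp: ac_simps)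
    then show "z \<in> (\<lambda>h. h + (c + d)) ` H" using H_add by blast
  next
    fix z assume "z \<in> (\<lambda>h. h + (c + d)) ` H"
    then obtain h where "h \<in> H" "z = (h + c) + (0 + d)" by (auto simp: ac_simps)
    then show "z \<in> (\<Union>h\<in>H. \<Union>h'\<in>H. {(h + c) + (h' + d)})" using H_zero by blast
  qed
qed

lemma zero_cls: "\<zero>\<^bsub>T\<^esub> = cls T 0"
  by (simp add: cls_T zero_T)

lemma vanishes_on_H:
  assumes "vanishes_on R f" "h \<in> H" shows "lin f h = 0"
  using assms(2)
proof (induction h rule: generate.induct)
  case (incl h) then show ?case using assms(1) by (simp add: vanishes_on_def)
next
  case (inv h) then show ?case using relators assms(1) by (simp add: vanishes_on_def lin_minus)
qed (simp_all add: lin_add)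

lemma lin_repr_cls: "vanishes_on R f \<Longrightarrow> lin f (repr (cls T c)) = lin f c"
  using repr_cls[of c] vanishes_on_H by (auto simp: lin_add)

lemma lin_repr_add:
  assumes "vanishes_on R f" "C \<in> carrier T" "D \<in> carrier T"
  shows "lin f (repr (C \<oplus>\<^bsub>T\<^esub> D)) = lin f (repr C) + lin f (repr D)"
proof -
  have "C \<oplus>\<^bsub>T\<^esub> D = cls T (repr C + repr D)"
    using cls_add[OF repr_carrier(1)[OF assms(2)] repr_carrier(1)[OF assms(3)]] assms
    by (simp add: repr_carrier)
  then show ?thesis using assms by (simp add: lin_repr_cls lin_add)
qed

text \<open>
  If the difference of two representatives is not a relation, then some character separates it
  from the subgroup of relations.
\<close>

lemma presented_eqI:
  assumes "C \<in> carrier T" "D \<in> carrier T"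
    and eq: "\<And>f. vanishes_on R f \<Longrightarrow> lin f (repr C) = lin f (repr D)"
  shows "C = D"
proof (rule ccontr)
  assume "C \<noteq> D"
  then have "repr C - repr D \<notin> H"
    using cls_eq_iff[of "repr C" "repr D"] assms by (simp add: repr_carrier)
  then obtain f where f: "\<And>h. h \<in> H \<Longrightarrow> lin f h = 0" "lin f (repr C - repr D) \<noteq> 0"
    using H_zero H_diff by (metis separating_character)
  then have "vanishes_on R f" by (auto simp: vanishes_on_def generate.incl)
  then show False using eq f(2) by (simp add: lin_diff)
qed

lemma lin_repr_induced:
  "vanishes_on R f \<Longrightarrow> lin f (repr (induced T g C)) = lin (\<lambda>x. lin f (g x)) (repr C)"
  by (simp add: induced_def expand_def lin_repr_cls lin_frag_extend)

lemma induced_closed: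
  assumes "\<And>x. x \<in> Poly_Mapping.keys (repr C) \<Longrightarrow> Poly_Mapping.keys (g x) \<subseteq> S"
  shows "induced T g C \<in> carrier T"
  unfolding induced_def expand_def
  using assms keys_frag_extend[of g "repr C"] by (intro cls_closed) blast

lemma add_closed_T: "C \<in> carrier T \<Longrightarrow> D \<in> carrier T \<Longrightarrow> C \<oplus>\<^bsub>T\<^esub> D \<in> carrier T"
proof -
  assume C: "C \<in> carrier T" "D \<in> carrier T"
  then obtain c d where cd: "Poly_Mapping.keys c \<subseteq> S" "Poly_Mapping.keys d \<subseteq> S" "C = cls T c" "D = cls T d"
    by (auto simp: carrier_T)
  have "Poly_Mapping.keys (c + d) \<subseteq> S" using cd Poly_Mapping.keys_add[of c d] by blast
  then show "C \<oplus>\<^bsub>T\<^esub> D \<in> carrier T" using cd by (simp add: cls_add cls_closed)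
qed

lemma abelian_group_T: "abelian_group T"
proof (rule abelian_groupI)
  show "\<zero>\<^bsub>T\<^esub> \<in> carrier T" by (simp add: zero_cls cls_closed)
  then have zero: "vanishes_on R f \<Longrightarrow> lin f (repr \<zero>\<^bsub>T\<^esub>) = 0" for f
    unfolding zero_cls by (simp add: lin_repr_cls)
  fix C D E assume C: "C \<in> carrier T" "D \<in> carrier T" "E \<in> carrier T"
  show "C \<oplus>\<^bsub>T\<^esub> D \<in> carrier T" using C by (simp add: add_closed_T)
  show "C \<oplus>\<^bsub>T\<^esub> D \<oplus>\<^bsub>T\<^esub> E = C \<oplus>\<^bsub>T\<^esub> (D \<oplus>\<^bsub>T\<^esub> E)"
    using C by (intro presented_eqI) (auto simp: add_closed_T lin_repr_add ac_simps)
  show "C \<oplus>\<^bsub>T\<^esub> D = D \<oplus>\<^bsub>T\<^esub> C"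
    using C by (intro presented_eqI) (auto simp: add_closed_T lin_repr_add ac_simps)
  show "\<zero>\<^bsub>T\<^esub> \<oplus>\<^bsub>T\<^esub> C = C"
    using C \<open>\<zero>\<^bsub>T\<^esub> \<in> carrier T\<close>
    by (intro presented_eqI) (auto simp: add_closed_T lin_repr_add zero)
  have k: "Poly_Mapping.keys (- repr C) \<subseteq> S" using repr_carrier(1)[OF C(1)] by simp
  have "cls T (- repr C) \<oplus>\<^bsub>T\<^esub> C = \<zero>\<^bsub>T\<^esub>"
    using C k \<open>\<zero>\<^bsub>T\<^esub> \<in> carrier T\<close>
    by (intro presented_eqI) (auto simp: add_closed_T cls_closed lin_repr_add lin_repr_cls lin_minus zero)
  then show "\<exists>D\<in>carrier T. D \<oplus>\<^bsub>T\<^esub> C = \<zero>\<^bsub>T\<^esub>" using k cls_closed by blast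
qed

lemma smult_T: "k \<odot>\<^bsub>T\<^esub> C = cls T (frag_extend (\<lambda>x. frag_of (act k x)) (repr C))"
proof -
  have *: "k \<odot>\<^bsub>T\<^esub> C = H #>\<^bsub>F\<^esub> frag_extend (\<lambda>x. frag_of (act k x)) (repr C)"
    by (simp add: presented_def Let_def)
  show ?thesis unfolding * cls_T by (auto simp: r_coset_def)
qed

end

section \<open>Balanced functions on tensor products\<close>

definition biadditive ::
  "('m, 'u) ring_scheme \<Rightarrow> ('n, 'v) ring_scheme \<Rightarrow> ('m \<Rightarrow> 'n \<Rightarrow> circle) \<Rightarrow> bool"
  where "biadditive M N \<phi> \<longleftrightarrow>
    (\<forall>x\<in>carrier M. \<forall>x'\<in>carrier M. \<forall>y\<in>carrier N. \<phi> (x \<oplus>\<^bsub>M\<^esub> x') y = \<phi> x y + \<phi> x' y)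
    \<and> (\<forall>x\<in>carrier M. \<forall>y\<in>carrier N. \<forall>y'\<in>carrier N. \<phi> x (y \<oplus>\<^bsub>N\<^esub> y') = \<phi> x y + \<phi> x y')"

definition balanced ::
  "('m, 'u) ring_scheme \<Rightarrow> ('n, 'v) ring_scheme \<Rightarrow> 'j set \<Rightarrow> ('j \<Rightarrow> 'm \<Rightarrow> 'm) \<Rightarrow> ('j \<Rightarrow> 'n \<Rightarrow> 'n)
    \<Rightarrow> ('m \<Rightarrow> 'n \<Rightarrow> circle) \<Rightarrow> bool"
  where "balanced M N I f g \<phi> \<longleftrightarrow> biadditive M N \<phi>
    \<and> (\<forall>i\<in>I. \<forall>x\<in>carrier M. \<forall>y\<in>carrier N. \<phi> (f i x) y = \<phi> x (g i y))"

lemma balancedI: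
  assumes "\<And>x x' y. x \<in> carrier M \<Longrightarrow> x' \<in> carrier M \<Longrightarrow> y \<in> carrier N \<Longrightarrow> \<phi> (x \<oplus>\<^bsub>M\<^esub> x') y = \<phi> x y + \<phi> x' y"
    and "\<And>x y y'. x \<in> carrier M \<Longrightarrow> y \<in> carrier N \<Longrightarrow> y' \<in> carrier N \<Longrightarrow> \<phi> x (y \<oplus>\<^bsub>N\<^esub> y') = \<phi> x y + \<phi> x y'"
    and "\<And>i x y. i \<in> I \<Longrightarrow> x \<in> carrier M \<Longrightarrow> y \<in> carrier N \<Longrightarrow> \<phi> (f i x) y = \<phi> x (g i y)"
  shows "balanced M N I f g \<phi>"
  using assms by (simp add: balanced_def biadditive_def)

lemma balancedD:
  assumes "balanced M N I f g \<phi>"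
  shows "x \<in> carrier M \<Longrightarrow> x' \<in> carrier M \<Longrightarrow> y \<in> carrier N \<Longrightarrow> \<phi> (x \<oplus>\<^bsub>M\<^esub> x') y = \<phi> x y + \<phi> x' y"
    and "x \<in> carrier M \<Longrightarrow> y \<in> carrier N \<Longrightarrow> y' \<in> carrier N \<Longrightarrow> \<phi> x (y \<oplus>\<^bsub>N\<^esub> y') = \<phi> x y + \<phi> x y'"
    and "i \<in> I \<Longrightarrow> x \<in> carrier M \<Longrightarrow> y \<in> carrier N \<Longrightarrow> \<phi> (f i x) y = \<phi> x (g i y)"
  using assms by (simp_all add: balanced_def biadditive_def)

text \<open>
  The value at \<open>C\<close> of the character of the tensor product that is given by the balanced function
  \<open>\<phi>\<close>.  If \<open>C\<close> is written \<open>c1 \<otimes> c2\<close> in Sweedler's notation, this is \<open>\<phi> c1 c2\<close>.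
\<close>

definition tsum :: "(('x \<times> 'y) \<Rightarrow>\<^sub>0 int) set \<Rightarrow> ('x \<Rightarrow> 'y \<Rightarrow> circle) \<Rightarrow> circle"
  where "tsum C \<phi> = lin (\<lambda>(x, y). \<phi> x y) (repr C)"

lemma tsum_plus: "tsum C (\<lambda>x y. \<phi> x y + \<psi> x y) = tsum C \<phi> + tsum C \<psi>"
  unfolding tsum_def case_prod_beta by (rule lin_plus)

lemma tsum_commute:
  "tsum C (\<lambda>x y. tsum D (\<lambda>u v. \<phi> x y u v)) = tsum D (\<lambda>u v. tsum C (\<lambda>x y. \<phi> x y u v))"
  unfolding tsum_def case_prod_beta by (rule lin_commute)

text \<open>
  In all tensor products below the scalars act through the base algebra.  Then
  \<open>K_balanced\<close> holds, and a function need only be balanced over the index set.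
\<close>

locale tensor_product =
  fixes K :: "('k, 'i) ring_scheme" and M :: "('k, 'm, 'u) module_scheme"
    and N :: "('k, 'n, 'v) module_scheme"
    and I :: "'j set" and f :: "'j \<Rightarrow> 'm \<Rightarrow> 'm" and g :: "'j \<Rightarrow> 'n \<Rightarrow> 'n"
  assumes M_add: "\<And>x y. x \<in> carrier M \<Longrightarrow> y \<in> carrier M \<Longrightarrow> x \<oplus>\<^bsub>M\<^esub> y \<in> carrier M"
    and N_add: "\<And>x y. x \<in> carrier N \<Longrightarrow> y \<in> carrier N \<Longrightarrow> x \<oplus>\<^bsub>N\<^esub> y \<in> carrier N"
    and M_smult: "\<And>k x. k \<in> carrier K \<Longrightarrow> x \<in> carrier M \<Longrightarrow> k \<odot>\<^bsub>M\<^esub> x \<in> carrier M"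
    and N_smult: "\<And>k x. k \<in> carrier K \<Longrightarrow> x \<in> carrier N \<Longrightarrow> k \<odot>\<^bsub>N\<^esub> x \<in> carrier N"
    and f_closed: "\<And>i x. i \<in> I \<Longrightarrow> x \<in> carrier M \<Longrightarrow> f i x \<in> carrier M"
    and g_closed: "\<And>i x. i \<in> I \<Longrightarrow> x \<in> carrier N \<Longrightarrow> g i x \<in> carrier N"
    and K_balanced: "\<And>\<phi> k x y. balanced M N I f g \<phi> \<Longrightarrow> k \<in> carrier K \<Longrightarrow> x \<in> carrier M \<Longrightarrow> y \<in> carrier N
      \<Longrightarrow> \<phi> (k \<odot>\<^bsub>M\<^esub> x) y = \<phi> x (k \<odot>\<^bsub>N\<^esub> y)"
begin

abbreviation "TP \<equiv> tensor K M N I f g"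
abbreviation "bal \<equiv> balanced M N I f g"

abbreviation "tensor_relators \<equiv> bilinear_relators K M N
        \<union> {frag_of (f i x, y) - frag_of (x, g i y) | i x y.
            i \<in> I \<and> x \<in> carrier M \<and> y \<in> carrier N}"

sublocale pres: presentation "carrier M \<times> carrier N" tensor_relators "\<lambda>k (x, y). (k \<odot>\<^bsub>M\<^esub> x, y)"
proof
  have sub: "Poly_Mapping.keys (a - b) \<subseteq> A" if "Poly_Mapping.keys a \<subseteq> A" "Poly_Mapping.keys b \<subseteq> A"
    for a b :: "('m \<times> 'n) \<Rightarrow>\<^sub>0 int" and A
    using that keys_diff[of a b] by blast
  fix r assume "r \<in> tensor_relators"
  then show "Poly_Mapping.keys r \<subseteq> carrier M \<times> carrier N"
    unfolding bilinear_relators_def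
    by (elim UnE CollectE exE conjE; hypsubst; intro sub)
       (simp_all add: M_add N_add M_smult N_smult f_closed g_closed)
qed

lemma TP_presented: "TP = presented (carrier M \<times> carrier N) tensor_relators (\<lambda>k (x, y). (k \<odot>\<^bsub>M\<^esub> x, y))"
  by (simp add: tensor_def)

text \<open>
  This is the universal property of the tensor product, for the coefficient group \<open>\<rat> / \<int>\<close>.
\<close>

lemma vanishes_iff: "vanishes_on tensor_relators (\<lambda>(x, y). \<phi> x y) \<longleftrightarrow> bal \<phi>"
proof
  assume r: "vanishes_on tensor_relators (\<lambda>(x, y). \<phi> x y)"
  then have r: "lin (\<lambda>(x, y). \<phi> x y) c = 0" if "c \<in> tensor_relators" for c
    using that by (simp add: vanishes_on_def)
  show "bal \<phi>"
  proof (rule balancedI)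
    fix x x' y assume *: "x \<in> carrier M" "x' \<in> carrier M" "y \<in> carrier N"
    then have "frag_of (x \<oplus>\<^bsub>M\<^esub> x', y) - frag_of (x, y) - frag_of (x', y) \<in> tensor_relators"
      unfolding bilinear_relators_def by blast
    from r[OF this] show "\<phi> (x \<oplus>\<^bsub>M\<^esub> x') y = \<phi> x y + \<phi> x' y" by (simp add: lin_diff lin_add diff_diff_eq)
  next
    fix x y y' assume *: "x \<in> carrier M" "y \<in> carrier N" "y' \<in> carrier N"
    then have "frag_of (x, y \<oplus>\<^bsub>N\<^esub> y') - frag_of (x, y) - frag_of (x, y') \<in> tensor_relators"
      unfolding bilinear_relators_def by blast
    from r[OF this] show "\<phi> x (y \<oplus>\<^bsub>N\<^esub> y') = \<phi> x y + \<phi> x y'" by (simp add: lin_diff lin_add diff_diff_eq)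
  next
    fix i x y assume *: "i \<in> I" "x \<in> carrier M" "y \<in> carrier N"
    then have "frag_of (f i x, y) - frag_of (x, g i y) \<in> tensor_relators" by blast
    from r[OF this] show "\<phi> (f i x) y = \<phi> x (g i y)" by (simp add: lin_diff)
  qed
next
  assume b: "bal \<phi>"
  show "vanishes_on tensor_relators (\<lambda>(x, y). \<phi> x y)"
    unfolding vanishes_on_def bilinear_relators_def
    using balancedD[OF b] K_balanced[OF b] by (auto simp: lin_diff)
qed

lemma vanishes_iff': "vanishes_on tensor_relators \<psi> \<longleftrightarrow> bal (\<lambda>x y. \<psi> (x, y))"
  using vanishes_iff[of "\<lambda>x y. \<psi> (x, y)"] by simp

lemma pure_closed: "x \<in> carrier M \<Longrightarrow> y \<in> carrier N \<Longrightarrow> cls TP (frag_of (x, y)) \<in> carrier TP"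
  unfolding TP_presented by (rule pres.cls_closed) simp

lemma tsum_pure: "bal \<phi> \<Longrightarrow> tsum (cls TP (frag_of (x, y))) \<phi> = \<phi> x y"
  unfolding TP_presented tsum_def by (simp add: pres.lin_repr_cls vanishes_iff)

lemma tsum_cls: "bal \<phi> \<Longrightarrow> tsum (cls TP c) \<phi> = lin (\<lambda>(x, y). \<phi> x y) c"
  unfolding TP_presented tsum_def by (simp add: pres.lin_repr_cls vanishes_iff)

lemma cls_closed: "Poly_Mapping.keys c \<subseteq> carrier M \<times> carrier N \<Longrightarrow> cls TP c \<in> carrier TP"
  unfolding TP_presented by (rule pres.cls_closed)

lemma tsum_add:
  "bal \<phi> \<Longrightarrow> C \<in> carrier TP \<Longrightarrow> D \<in> carrier TP \<Longrightarrow> tsum (C \<oplus>\<^bsub>TP\<^esub> D) \<phi> = tsum C \<phi> + tsum D \<phi>"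
  unfolding TP_presented tsum_def by (simp add: pres.lin_repr_add vanishes_iff)

lemma tensor_eqI:
  assumes "C \<in> carrier TP" "D \<in> carrier TP" "\<And>\<phi>. bal \<phi> \<Longrightarrow> tsum C \<phi> = tsum D \<phi>"
  shows "C = D"
  using assms unfolding TP_presented tsum_def
proof (intro pres.presented_eqI)
  fix \<psi> :: "'m \<times> 'n \<Rightarrow> circle" assume "vanishes_on tensor_relators \<psi>"
  then have "bal (\<lambda>x y. \<psi> (x, y))" by (simp add: vanishes_iff')
  from assms(3)[OF this] show "lin \<psi> (repr C) = lin \<psi> (repr D)" by (simp add: tsum_def)
qed

lemma tsum_induced:
  "bal \<phi> \<Longrightarrow> tsum (induced TP h C) \<phi> = lin (\<lambda>z. lin (\<lambda>(x, y). \<phi> x y) (h z)) (repr C)"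
  unfolding TP_presented tsum_def by (simp add: pres.lin_repr_induced vanishes_iff)

lemma induced_closed:
  assumes "\<And>z. z \<in> Poly_Mapping.keys (repr C) \<Longrightarrow> Poly_Mapping.keys (h z) \<subseteq> carrier M \<times> carrier N"
  shows "induced TP h C \<in> carrier TP"
  using assms unfolding TP_presented by (rule pres.induced_closed)

lemma keys_repr: "C \<in> carrier TP \<Longrightarrow> Poly_Mapping.keys (repr C) \<subseteq> carrier M \<times> carrier N"
  unfolding TP_presented by (rule pres.repr_carrier)

lemma tsum_cong:
  assumes "C \<in> carrier TP" "\<And>x y. x \<in> carrier M \<Longrightarrow> y \<in> carrier N \<Longrightarrow> \<phi> x y = \<psi> x y"
  shows "tsum C \<phi> = tsum C \<psi>"
  unfolding tsum_def using keys_repr[OF assms(1)] assms(2) by (intro lin_cong) auto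

lemma abelian_group_TP: "abelian_group TP"
  unfolding TP_presented by (rule pres.abelian_group_T)

lemma tsum_smult:
  "bal \<phi> \<Longrightarrow> tsum (k \<odot>\<^bsub>TP\<^esub> C) \<phi> = tsum C (\<lambda>x y. \<phi> (k \<odot>\<^bsub>M\<^esub> x) y)"
  unfolding TP_presented tsum_def
  by (simp add: pres.smult_T pres.lin_repr_cls vanishes_iff lin_frag_extend)
     (simp add: case_prod_beta')

lemma smult_closed:
  assumes "k \<in> carrier K" "C \<in> carrier TP" shows "k \<odot>\<^bsub>TP\<^esub> C \<in> carrier TP"
  unfolding TP_presented pres.smult_T
proof (rule pres.cls_closed)
  show "Poly_Mapping.keys (frag_extend (\<lambda>x. frag_of ((\<lambda>(x, y). (k \<odot>\<^bsub>M\<^esub> x, y)) x)) (repr C))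
    \<subseteq> carrier M \<times> carrier N"
    using keys_frag_extend[of "\<lambda>x. frag_of ((\<lambda>(x, y). (k \<odot>\<^bsub>M\<^esub> x, y)) x)" "repr C"] keys_repr[OF assms(2)]
      M_smult[OF assms(1)] by fastforce
qed

lemma pure_add_left:
  assumes "x \<in> carrier M" "x' \<in> carrier M" "y \<in> carrier N"
  shows "cls TP (frag_of (x \<oplus>\<^bsub>M\<^esub> x', y)) = cls TP (frag_of (x, y)) \<oplus>\<^bsub>TP\<^esub> cls TP (frag_of (x', y))"
  using assms abelian_monoid.a_closed[OF abelian_group.axioms(1)[OF abelian_group_TP]]
  by (intro tensor_eqI) (auto simp: pure_closed M_add tsum_pure tsum_add balancedD)

lemma pure_add_right:
  assumes "x \<in> carrier M" "y' \<in> carrier N" "y \<in> carrier N"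
  shows "cls TP (frag_of (x, y \<oplus>\<^bsub>N\<^esub> y')) = cls TP (frag_of (x, y)) \<oplus>\<^bsub>TP\<^esub> cls TP (frag_of (x, y'))"
  using assms abelian_monoid.a_closed[OF abelian_group.axioms(1)[OF abelian_group_TP]]
  by (intro tensor_eqI) (auto simp: pure_closed N_add tsum_pure tsum_add balancedD)

lemma pure_balanced:
  assumes "i \<in> I" "x \<in> carrier M" "y \<in> carrier N"
  shows "cls TP (frag_of (f i x, y)) = cls TP (frag_of (x, g i y))"
  using assms by (intro tensor_eqI) (auto simp: pure_closed f_closed g_closed tsum_pure balancedD(3))

lemma balanced_pure:
  assumes "additive_on TP \<Phi>"
  shows "bal (\<lambda>x y. \<Phi> (cls TP (frag_of (x, y))))"
  by (rule balancedI)
     (auto simp: pure_add_left pure_add_right pure_balanced additive_onD[OF assms] pure_closed)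

lemma additive_on_tsum:
  assumes "additive_on TP \<Phi>" "C \<in> carrier TP"
  shows "\<Phi> C = tsum C (\<lambda>x y. \<Phi> (cls TP (frag_of (x, y))))"
proof -
  interpret abelian_group TP by (rule abelian_group_TP)
  let ?P = "\<lambda>c. \<Phi> (cls TP c) = lin (\<lambda>(x, y). \<Phi> (cls TP (frag_of (x, y)))) c
    \<and> Poly_Mapping.keys c \<subseteq> carrier M \<times> carrier N"
  have P: "?P c" if "Poly_Mapping.keys c \<subseteq> carrier M \<times> carrier N" for c
  proof (rule frag_induction[OF that, of ?P])
    show "?P 0" using additive_on_zero[OF assms(1)] pres.zero_cls by (simp add: TP_presented)
  next
    fix x assume "x \<in> carrier M \<times> carrier N"
    then show "?P (frag_of x)" by (auto simp: case_prod_beta)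
  next
    fix a b assume ab: "?P a" "?P b"
    then have k: "Poly_Mapping.keys (a - b) \<subseteq> carrier M \<times> carrier N" using keys_diff[of a b] by blast
    have "cls TP (a - b) \<oplus>\<^bsub>TP\<^esub> cls TP b = cls TP a"
      using pres.cls_add[of "a - b" b] k ab by (simp add: TP_presented)
    then have "\<Phi> (cls TP (a - b)) + \<Phi> (cls TP b) = \<Phi> (cls TP a)"
      using additive_onD[OF assms(1) cls_closed[OF k] cls_closed[of b]] ab by simp
    then show "?P (a - b)" using k ab by (simp add: lin_diff algebra_simps)
  qed
  have "cls TP (repr C) = C" using pres.repr_carrier(2) assms(2) by (simp add: TP_presented)
  then show ?thesis using P[OF keys_repr[OF assms(2)]] by (simp add: tsum_def)
qed

lemma additive_tsum: "bal \<phi> \<Longrightarrow> additive_on TP (\<lambda>C. tsum C \<phi>)"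
  by (rule additive_onI) (rule tsum_add)

text \<open>
  Pure tensors generate, so an identity between additive expressions in one variable may be
  checked on them.
\<close>

lemma pure_ext:
  assumes "additive_on TP \<Phi>" "additive_on TP \<Psi>" "C \<in> carrier TP"
    and "\<And>x y. x \<in> carrier M \<Longrightarrow> y \<in> carrier N \<Longrightarrow> \<Phi> (cls TP (frag_of (x, y))) = \<Psi> (cls TP (frag_of (x, y)))"
  shows "\<Phi> C = \<Psi> C"
  unfolding additive_on_tsum[OF assms(1,3)] additive_on_tsum[OF assms(2,3)]
  by (rule tsum_cong[OF assms(3)]) (rule assms(4))

end

section \<open>Sweedler calculus in a left bialgebroid\<close>

lemma lin_expand: "lin \<psi> (expand (\<lambda>(x, y). h x y) D) = tsum D (\<lambda>x y. lin \<psi> (h x y))"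
  unfolding expand_def lin_frag_extend tsum_def by (simp add: case_prod_beta')

lemma (in tensor_product) tsum_induced_pair:
  "bal \<phi> \<Longrightarrow> tsum (induced TP (\<lambda>(x, y). h x y) C) \<phi> = tsum C (\<lambda>x y. lin (\<lambda>(u, v). \<phi> u v) (h x y))"
  unfolding tsum_induced tsum_def[of C] by (simp add: case_prod_beta')

text \<open>
  Sweedler's \<open>\<phi> x1 x2\<close>.  The conditional keeps the arguments inside the carrier whatever the
  representative of the coproduct.  It gives the congruence rule its membership premises, so that
  the simplifier can rewrite below nested sums.
\<close>

definition csum :: "('k, 'b, 'a, 'm) bialgebroid_scheme \<Rightarrow> 'a \<Rightarrow> ('a \<Rightarrow> 'a \<Rightarrow> circle) \<Rightarrow> circle"
  where "csum L x \<phi> = tsum (comult L x)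
    (\<lambda>x1 x2. if x \<in> carrier L \<and> x1 \<in> carrier L \<and> x2 \<in> carrier L then \<phi> x1 x2 else 0)"

lemma csum_cong [cong]:
  assumes "x = y" "\<And>x1 x2. x1 \<in> carrier L \<Longrightarrow> x2 \<in> carrier L \<Longrightarrow> \<phi> x1 x2 = \<psi> x1 x2"
  shows "csum L x \<phi> = csum L y \<psi>"
  unfolding csum_def using assms by (simp cong: if_cong conj_cong)

lemma tsum_zero [simp]: "tsum C (\<lambda>x y. 0) = 0"
  by (simp add: tsum_def case_prod_beta')

lemma csum_plus: "csum L x (\<lambda>x1 x2. \<phi> x1 x2 + \<psi> x1 x2) = csum L x \<phi> + csum L x \<psi>"
  unfolding csum_def tsum_plus[symmetric] by (rule arg_cong[where f = "tsum _"]) (auto simp: fun_eq_iff)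

lemma tsum_if: "(if P then tsum C \<phi> else 0) = tsum C (\<lambda>x y. if P then \<phi> x y else 0)"
  by simp

text \<open>
  Nested Sweedler sums over different elements are finite sums in an abelian group.
\<close>

lemma csum_commute:
  "csum L x (\<lambda>x1 x2. csum L' y (\<lambda>y1 y2. \<phi> x1 x2 y1 y2))
    = csum L' y (\<lambda>y1 y2. csum L x (\<lambda>x1 x2. \<phi> x1 x2 y1 y2))"
  unfolding csum_def tsum_if
  by (subst tsum_commute) (intro arg_cong[where f = "tsum _"] ext, simp)

text \<open>
  The characters of the threefold tensor product over the base algebra.  As for two factors, the
  relations over the scalar field follow from those over the base algebra.
\<close>

definition balanced3 where
  "balanced3 B M tM N sN tN Q sQ \<phi> \<longleftrightarrow>
    (\<forall>x\<in>carrier M. \<forall>x'\<in>carrier M. \<forall>y\<in>carrier N. \<forall>z\<in>carrier Q. \<phi> (x \<oplus>\<^bsub>M\<^esub> x') y z = \<phi> x y z + (\<phi> x' y z :: circle))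
    \<and> (\<forall>x\<in>carrier M. \<forall>y\<in>carrier N. \<forall>y'\<in>carrier N. \<forall>z\<in>carrier Q. \<phi> x (y \<oplus>\<^bsub>N\<^esub> y') z = \<phi> x y z + \<phi> x y' z)
    \<and> (\<forall>x\<in>carrier M. \<forall>y\<in>carrier N. \<forall>z\<in>carrier Q. \<forall>z'\<in>carrier Q. \<phi> x y (z \<oplus>\<^bsub>Q\<^esub> z') = \<phi> x y z + \<phi> x y z')
    \<and> (\<forall>b\<in>carrier B. \<forall>x\<in>carrier M. \<forall>y\<in>carrier N. \<forall>z\<in>carrier Q. \<phi> (tM b \<otimes>\<^bsub>M\<^esub> x) y z = \<phi> x (sN b \<otimes>\<^bsub>N\<^esub> y) z)
    \<and> (\<forall>b\<in>carrier B. \<forall>x\<in>carrier M. \<forall>y\<in>carrier N. \<forall>z\<in>carrier Q. \<phi> x (tN b \<otimes>\<^bsub>N\<^esub> y) z = \<phi> x y (sQ b \<otimes>\<^bsub>Q\<^esub> z))"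

lemma balanced3I:
  assumes "\<And>x x' y z. x \<in> carrier M \<Longrightarrow> x' \<in> carrier M \<Longrightarrow> y \<in> carrier N \<Longrightarrow> z \<in> carrier Q
      \<Longrightarrow> \<phi> (x \<oplus>\<^bsub>M\<^esub> x') y z = \<phi> x y z + \<phi> x' y z"
    and "\<And>x y y' z. x \<in> carrier M \<Longrightarrow> y \<in> carrier N \<Longrightarrow> y' \<in> carrier N \<Longrightarrow> z \<in> carrier Q
      \<Longrightarrow> \<phi> x (y \<oplus>\<^bsub>N\<^esub> y') z = \<phi> x y z + \<phi> x y' z"
    and "\<And>x y z z'. x \<in> carrier M \<Longrightarrow> y \<in> carrier N \<Longrightarrow> z \<in> carrier Q \<Longrightarrow> z' \<in> carrier Q
      \<Longrightarrow> \<phi> x y (z \<oplus>\<^bsub>Q\<^esub> z') = \<phi> x y z + \<phi> x y z'"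
    and "\<And>b x y z. b \<in> carrier B \<Longrightarrow> x \<in> carrier M \<Longrightarrow> y \<in> carrier N \<Longrightarrow> z \<in> carrier Q
      \<Longrightarrow> \<phi> (tM b \<otimes>\<^bsub>M\<^esub> x) y z = \<phi> x (sN b \<otimes>\<^bsub>N\<^esub> y) z"
    and "\<And>b x y z. b \<in> carrier B \<Longrightarrow> x \<in> carrier M \<Longrightarrow> y \<in> carrier N \<Longrightarrow> z \<in> carrier Q
      \<Longrightarrow> \<phi> x (tN b \<otimes>\<^bsub>N\<^esub> y) z = \<phi> x y (sQ b \<otimes>\<^bsub>Q\<^esub> z)"
  shows "balanced3 B M tM N sN tN Q sQ \<phi>"
  using assms by (simp add: balanced3_def)

locale triple_product =
  fixes K :: "('k, 'i) ring_scheme" and B :: "('k, 'b, 'w) module_scheme"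
    and M :: "('k, 'm, 'u) module_scheme" and tM :: "'b \<Rightarrow> 'm"
    and N :: "('k, 'n, 'v) module_scheme" and sN tN :: "'b \<Rightarrow> 'n"
    and Q :: "('k, 'q, 'z) module_scheme" and sQ :: "'b \<Rightarrow> 'q"
  assumes M_add: "\<And>x y. x \<in> carrier M \<Longrightarrow> y \<in> carrier M \<Longrightarrow> x \<oplus>\<^bsub>M\<^esub> y \<in> carrier M"
    and N_add: "\<And>x y. x \<in> carrier N \<Longrightarrow> y \<in> carrier N \<Longrightarrow> x \<oplus>\<^bsub>N\<^esub> y \<in> carrier N"
    and Q_add: "\<And>x y. x \<in> carrier Q \<Longrightarrow> y \<in> carrier Q \<Longrightarrow> x \<oplus>\<^bsub>Q\<^esub> y \<in> carrier Q"
    and M_smult: "\<And>k x. k \<in> carrier K \<Longrightarrow> x \<in> carrier M \<Longrightarrow> k \<odot>\<^bsub>M\<^esub> x \<in> carrier M"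
    and N_smult: "\<And>k x. k \<in> carrier K \<Longrightarrow> x \<in> carrier N \<Longrightarrow> k \<odot>\<^bsub>N\<^esub> x \<in> carrier N"
    and Q_smult: "\<And>k x. k \<in> carrier K \<Longrightarrow> x \<in> carrier Q \<Longrightarrow> k \<odot>\<^bsub>Q\<^esub> x \<in> carrier Q"
    and tM_mult: "\<And>b x. b \<in> carrier B \<Longrightarrow> x \<in> carrier M \<Longrightarrow> tM b \<otimes>\<^bsub>M\<^esub> x \<in> carrier M"
    and sN_mult: "\<And>b x. b \<in> carrier B \<Longrightarrow> x \<in> carrier N \<Longrightarrow> sN b \<otimes>\<^bsub>N\<^esub> x \<in> carrier N"
    and tN_mult: "\<And>b x. b \<in> carrier B \<Longrightarrow> x \<in> carrier N \<Longrightarrow> tN b \<otimes>\<^bsub>N\<^esub> x \<in> carrier N"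
    and sQ_mult: "\<And>b x. b \<in> carrier B \<Longrightarrow> x \<in> carrier Q \<Longrightarrow> sQ b \<otimes>\<^bsub>Q\<^esub> x \<in> carrier Q"
    and smult_M: "\<And>k x. k \<in> carrier K \<Longrightarrow> x \<in> carrier M \<Longrightarrow> k \<odot>\<^bsub>M\<^esub> x = tM (k \<odot>\<^bsub>B\<^esub> \<one>\<^bsub>B\<^esub>) \<otimes>\<^bsub>M\<^esub> x"
    and smult_N: "\<And>k x. k \<in> carrier K \<Longrightarrow> x \<in> carrier N \<Longrightarrow> k \<odot>\<^bsub>N\<^esub> x = sN (k \<odot>\<^bsub>B\<^esub> \<one>\<^bsub>B\<^esub>) \<otimes>\<^bsub>N\<^esub> x"
    and smult_N': "\<And>k x. k \<in> carrier K \<Longrightarrow> x \<in> carrier N \<Longrightarrow> k \<odot>\<^bsub>N\<^esub> x = tN (k \<odot>\<^bsub>B\<^esub> \<one>\<^bsub>B\<^esub>) \<otimes>\<^bsub>N\<^esub> x"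
    and smult_Q: "\<And>k x. k \<in> carrier K \<Longrightarrow> x \<in> carrier Q \<Longrightarrow> k \<odot>\<^bsub>Q\<^esub> x = sQ (k \<odot>\<^bsub>B\<^esub> \<one>\<^bsub>B\<^esub>) \<otimes>\<^bsub>Q\<^esub> x"
    and smult_one: "\<And>k. k \<in> carrier K \<Longrightarrow> k \<odot>\<^bsub>B\<^esub> \<one>\<^bsub>B\<^esub> \<in> carrier B"
begin

abbreviation "T3 \<equiv> diamond3 K B M tM N sN tN Q sQ"
abbreviation "bal3 \<equiv> balanced3 B M tM N sN tN Q sQ"

abbreviation "triple_relators \<equiv>
      ({frag_of (x \<oplus>\<^bsub>M\<^esub> x', y, z) - frag_of (x, y, z) - frag_of (x', y, z) | x x' y z.
          x \<in> carrier M \<and> x' \<in> carrier M \<and> y \<in> carrier N \<and> z \<in> carrier Q}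
      \<union> {frag_of (x, y \<oplus>\<^bsub>N\<^esub> y', z) - frag_of (x, y, z) - frag_of (x, y', z) | x y y' z.
          x \<in> carrier M \<and> y \<in> carrier N \<and> y' \<in> carrier N \<and> z \<in> carrier Q}
      \<union> {frag_of (x, y, z \<oplus>\<^bsub>Q\<^esub> z') - frag_of (x, y, z) - frag_of (x, y, z') | x y z z'.
          x \<in> carrier M \<and> y \<in> carrier N \<and> z \<in> carrier Q \<and> z' \<in> carrier Q}
      \<union> {frag_of (k \<odot>\<^bsub>M\<^esub> x, y, z) - frag_of (x, k \<odot>\<^bsub>N\<^esub> y, z) | k x y z.
          k \<in> carrier K \<and> x \<in> carrier M \<and> y \<in> carrier N \<and> z \<in> carrier Q}
      \<union> {frag_of (x, k \<odot>\<^bsub>N\<^esub> y, z) - frag_of (x, y, k \<odot>\<^bsub>Q\<^esub> z) | k x y z.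
          k \<in> carrier K \<and> x \<in> carrier M \<and> y \<in> carrier N \<and> z \<in> carrier Q}
      \<union> {frag_of (tM b \<otimes>\<^bsub>M\<^esub> x, y, z) - frag_of (x, sN b \<otimes>\<^bsub>N\<^esub> y, z) | b x y z.
          b \<in> carrier B \<and> x \<in> carrier M \<and> y \<in> carrier N \<and> z \<in> carrier Q}
      \<union> {frag_of (x, tN b \<otimes>\<^bsub>N\<^esub> y, z) - frag_of (x, y, sQ b \<otimes>\<^bsub>Q\<^esub> z) | b x y z.
          b \<in> carrier B \<and> x \<in> carrier M \<and> y \<in> carrier N \<and> z \<in> carrier Q})"

sublocale pres3: presentation "carrier M \<times> carrier N \<times> carrier Q" triple_relators
  "\<lambda>k (x, y, z). (k \<odot>\<^bsub>M\<^esub> x, y, z)"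
proof
  have sub: "Poly_Mapping.keys (a - b) \<subseteq> A" if "Poly_Mapping.keys a \<subseteq> A" "Poly_Mapping.keys b \<subseteq> A"
    for a b :: "('m \<times> 'n \<times> 'q) \<Rightarrow>\<^sub>0 int" and A
    using that keys_diff[of a b] by blast
  fix r assume "r \<in> triple_relators"
  then show "Poly_Mapping.keys r \<subseteq> carrier M \<times> carrier N \<times> carrier Q"
    by (elim UnE CollectE exE conjE; hypsubst; intro sub)
       (simp_all add: M_add N_add Q_add M_smult N_smult Q_smult tM_mult sN_mult tN_mult sQ_mult)
qed

lemma T3_presented: "T3 = presented (carrier M \<times> carrier N \<times> carrier Q) triple_relators
  (\<lambda>k (x, y, z). (k \<odot>\<^bsub>M\<^esub> x, y, z))"
  by (simp add: diamond3_def)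

lemma vanishes3_iff: "vanishes_on triple_relators (\<lambda>(x, y, z). \<phi> x y z) \<longleftrightarrow> bal3 \<phi>"
proof
  assume r: "vanishes_on triple_relators (\<lambda>(x, y, z). \<phi> x y z)"
  have r: "lin (\<lambda>(x, y, z). \<phi> x y z) c = 0" if "c \<in> triple_relators" for c
    by (rule bspec[OF r[unfolded vanishes_on_def] that])
  show "bal3 \<phi>"
  proof (rule balanced3I)
    fix x x' y z assume "x \<in> carrier M" "x' \<in> carrier M" "y \<in> carrier N" "z \<in> carrier Q"
    then have "frag_of (x \<oplus>\<^bsub>M\<^esub> x', y, z) - frag_of (x, y, z) - frag_of (x', y, z) \<in> triple_relators"
      unfolding Un_iff mem_Collect_eq by blast
    from r[OF this] show "\<phi> (x \<oplus>\<^bsub>M\<^esub> x') y z = \<phi> x y z + \<phi> x' y z" by (simp add: lin_diff lin_add diff_diff_eq)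
  next
    fix x y y' z assume "x \<in> carrier M" "y \<in> carrier N" "y' \<in> carrier N" "z \<in> carrier Q"
    then have "frag_of (x, y \<oplus>\<^bsub>N\<^esub> y', z) - frag_of (x, y, z) - frag_of (x, y', z) \<in> triple_relators"
      unfolding Un_iff mem_Collect_eq by blast
    from r[OF this] show "\<phi> x (y \<oplus>\<^bsub>N\<^esub> y') z = \<phi> x y z + \<phi> x y' z" by (simp add: lin_diff lin_add diff_diff_eq)
  next
    fix x y z z' assume "x \<in> carrier M" "y \<in> carrier N" "z \<in> carrier Q" "z' \<in> carrier Q"
    then have "frag_of (x, y, z \<oplus>\<^bsub>Q\<^esub> z') - frag_of (x, y, z) - frag_of (x, y, z') \<in> triple_relators"
      unfolding Un_iff mem_Collect_eq by blast
    from r[OF this] show "\<phi> x y (z \<oplus>\<^bsub>Q\<^esub> z') = \<phi> x y z + \<phi> x y z'" by (simp add: lin_diff lin_add diff_diff_eq)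
  next
    fix b x y z assume "b \<in> carrier B" "x \<in> carrier M" "y \<in> carrier N" "z \<in> carrier Q"
    then have "frag_of (tM b \<otimes>\<^bsub>M\<^esub> x, y, z) - frag_of (x, sN b \<otimes>\<^bsub>N\<^esub> y, z) \<in> triple_relators" by blast
    from r[OF this] show "\<phi> (tM b \<otimes>\<^bsub>M\<^esub> x) y z = \<phi> x (sN b \<otimes>\<^bsub>N\<^esub> y) z" by (simp add: lin_diff)
  next
    fix b x y z assume "b \<in> carrier B" "x \<in> carrier M" "y \<in> carrier N" "z \<in> carrier Q"
    then have "frag_of (x, tN b \<otimes>\<^bsub>N\<^esub> y, z) - frag_of (x, y, sQ b \<otimes>\<^bsub>Q\<^esub> z) \<in> triple_relators" by blast
    from r[OF this] show "\<phi> x (tN b \<otimes>\<^bsub>N\<^esub> y) z = \<phi> x y (sQ b \<otimes>\<^bsub>Q\<^esub> z)" by (simp add: lin_diff)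
  qed
next
  assume b: "bal3 \<phi>"
  show "vanishes_on triple_relators (\<lambda>(x, y, z). \<phi> x y z)"
    unfolding vanishes_on_def
    using b[unfolded balanced3_def] smult_one
    by (auto simp: lin_diff smult_M smult_N smult_Q) (simp add: smult_N[symmetric] smult_N')
qed

lemma lin_repr_induced3:
  "bal3 \<phi> \<Longrightarrow> lin (\<lambda>(x, y, z). \<phi> x y z) (repr (induced T3 h C)) = lin (\<lambda>w. lin (\<lambda>(x, y, z). \<phi> x y z) (h w)) (repr C)"
  unfolding T3_presented by (rule pres3.lin_repr_induced) (simp only: vanishes3_iff)

lemma diamond3_eqI:
  assumes "C \<in> carrier T3" "D \<in> carrier T3"
    and "\<And>\<phi>. bal3 \<phi> \<Longrightarrow> lin (\<lambda>(x, y, z). \<phi> x y z) (repr C) = lin (\<lambda>(x, y, z). \<phi> x y z) (repr D)"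
  shows "C = D"
  using assms unfolding T3_presented
proof (intro pres3.presented_eqI)
  fix \<psi> :: "'m \<times> 'n \<times> 'q \<Rightarrow> circle" assume "vanishes_on triple_relators \<psi>"
  then have "bal3 (\<lambda>x y z. \<psi> (x, y, z))" using vanishes3_iff[of "\<lambda>x y z. \<psi> (x, y, z)"] by simp
  from assms(3)[OF this] show "lin \<psi> (repr C) = lin \<psi> (repr D)" by simp
qed

lemma induced3_closed:
  assumes "\<And>w. w \<in> Poly_Mapping.keys (repr C) \<Longrightarrow> Poly_Mapping.keys (h w) \<subseteq> carrier M \<times> carrier N \<times> carrier Q"
  shows "induced T3 h C \<in> carrier T3"
  using assms unfolding T3_presented by (rule pres3.induced_closed)

end

context left_bialgebroid
begin

sublocale B: k_algebra K B by (rule base_algebra)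
sublocale L: k_algebra K L by (rule total_algebra)

lemma src_closed [simp]: "b \<in> carrier B \<Longrightarrow> src L b \<in> carrier L"
  using src_hom by (auto simp: alg_hom_def ring_hom_def)

lemma tgt_closed [simp]: "b \<in> carrier B \<Longrightarrow> tgt L b \<in> carrier L"
  using tgt_hom by (auto simp: alg_hom_def ring_hom_def opposite_def)

lemma src_add: "a \<in> carrier B \<Longrightarrow> b \<in> carrier B \<Longrightarrow> src L (a \<oplus>\<^bsub>B\<^esub> b) = src L a \<oplus>\<^bsub>L\<^esub> src L b"
  using src_hom by (auto simp: alg_hom_def ring_hom_def)

lemma src_mult: "a \<in> carrier B \<Longrightarrow> b \<in> carrier B \<Longrightarrow> src L (a \<otimes>\<^bsub>B\<^esub> b) = src L a \<otimes>\<^bsub>L\<^esub> src L b"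
  using src_hom by (auto simp: alg_hom_def ring_hom_def)

lemma src_one [simp]: "src L \<one>\<^bsub>B\<^esub> = \<one>\<^bsub>L\<^esub>"
  using src_hom by (auto simp: alg_hom_def ring_hom_def)

lemma src_smult: "k \<in> carrier K \<Longrightarrow> a \<in> carrier B \<Longrightarrow> src L (k \<odot>\<^bsub>B\<^esub> a) = k \<odot>\<^bsub>L\<^esub> src L a"
  using src_hom by (auto simp: alg_hom_def)

lemma tgt_add: "a \<in> carrier B \<Longrightarrow> b \<in> carrier B \<Longrightarrow> tgt L (a \<oplus>\<^bsub>B\<^esub> b) = tgt L a \<oplus>\<^bsub>L\<^esub> tgt L b"
  using tgt_hom by (auto simp: alg_hom_def ring_hom_def opposite_def)

lemma tgt_mult: "a \<in> carrier B \<Longrightarrow> b \<in> carrier B \<Longrightarrow> tgt L (a \<otimes>\<^bsub>B\<^esub> b) = tgt L b \<otimes>\<^bsub>L\<^esub> tgt L a"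
  using tgt_hom by (auto simp: alg_hom_def ring_hom_def opposite_def)

lemma tgt_one [simp]: "tgt L \<one>\<^bsub>B\<^esub> = \<one>\<^bsub>L\<^esub>"
  using tgt_hom by (auto simp: alg_hom_def ring_hom_def opposite_def)

lemma tgt_smult: "k \<in> carrier K \<Longrightarrow> a \<in> carrier B \<Longrightarrow> tgt L (k \<odot>\<^bsub>B\<^esub> a) = k \<odot>\<^bsub>L\<^esub> tgt L a"
  using tgt_hom by (auto simp: alg_hom_def opposite_def)

lemmas closed [simp] = ring.ring_simprules(1,5,6)[OF L.total.ring_axioms]
  ring.ring_simprules(1,5,6)[OF B.total.ring_axioms] counit_closed L.smult_closed B.smult_closed

lemmas one_simps [simp] = L.total.l_one L.total.r_one B.total.l_one B.total.r_one

lemmas additive = src_add tgt_add counit_add L.total.l_distr L.total.r_distr B.total.l_distr B.total.r_distr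

lemmas assoc = L.total.m_assoc B.total.m_assoc

lemma src_tgt_left:
  "b \<in> carrier B \<Longrightarrow> c \<in> carrier B \<Longrightarrow> x \<in> carrier L
    \<Longrightarrow> src L b \<otimes>\<^bsub>L\<^esub> (tgt L c \<otimes>\<^bsub>L\<^esub> x) = tgt L c \<otimes>\<^bsub>L\<^esub> (src L b \<otimes>\<^bsub>L\<^esub> x)"
  using src_tgt_commute[of b c] by (simp add: L.total.m_assoc[symmetric])

lemma src_smult_one: "k \<in> carrier K \<Longrightarrow> src L (k \<odot>\<^bsub>B\<^esub> \<one>\<^bsub>B\<^esub>) = k \<odot>\<^bsub>L\<^esub> \<one>\<^bsub>L\<^esub>"
  by (simp add: src_smult)

lemma tgt_smult_one: "k \<in> carrier K \<Longrightarrow> tgt L (k \<odot>\<^bsub>B\<^esub> \<one>\<^bsub>B\<^esub>) = k \<odot>\<^bsub>L\<^esub> \<one>\<^bsub>L\<^esub>"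
  by (simp add: tgt_smult)

lemma smult_src: "k \<in> carrier K \<Longrightarrow> x \<in> carrier L \<Longrightarrow> k \<odot>\<^bsub>L\<^esub> x = src L (k \<odot>\<^bsub>B\<^esub> \<one>\<^bsub>B\<^esub>) \<otimes>\<^bsub>L\<^esub> x"
  by (simp add: src_smult_one L.smult_mult_left)

lemma smult_tgt: "k \<in> carrier K \<Longrightarrow> x \<in> carrier L \<Longrightarrow> k \<odot>\<^bsub>L\<^esub> x = tgt L (k \<odot>\<^bsub>B\<^esub> \<one>\<^bsub>B\<^esub>) \<otimes>\<^bsub>L\<^esub> x"
  by (simp add: tgt_smult_one L.smult_mult_left)

lemma smult_src_right: "k \<in> carrier K \<Longrightarrow> x \<in> carrier L \<Longrightarrow> k \<odot>\<^bsub>L\<^esub> x = x \<otimes>\<^bsub>L\<^esub> src L (k \<odot>\<^bsub>B\<^esub> \<one>\<^bsub>B\<^esub>)"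
  by (simp add: src_smult_one L.smult_mult_right)

lemma smult_tgt_right: "k \<in> carrier K \<Longrightarrow> x \<in> carrier L \<Longrightarrow> k \<odot>\<^bsub>L\<^esub> x = x \<otimes>\<^bsub>L\<^esub> tgt L (k \<odot>\<^bsub>B\<^esub> \<one>\<^bsub>B\<^esub>)"
  by (simp add: tgt_smult_one L.smult_mult_right)

sublocale dia: tensor_product K L L "carrier B" "\<lambda>b x. tgt L b \<otimes>\<^bsub>L\<^esub> x" "\<lambda>b y. src L b \<otimes>\<^bsub>L\<^esub> y"
proof
  fix \<phi> k x y
  assume b: "balanced L L (carrier B) (\<lambda>b x. tgt L b \<otimes>\<^bsub>L\<^esub> x) (\<lambda>b y. src L b \<otimes>\<^bsub>L\<^esub> y) \<phi>"
    and k: "k \<in> carrier K" "x \<in> carrier L" "y \<in> carrier L"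
  show "\<phi> (k \<odot>\<^bsub>L\<^esub> x) y = \<phi> x (k \<odot>\<^bsub>L\<^esub> y)"
    unfolding smult_tgt[OF k(1,2)] smult_src[OF k(1,3)]
    by (rule balancedD(3)[OF b]) (use k in auto)
qed auto

lemma dia_eq: "dia.TP = diamond_self K B L"
  by (simp add: diamond_def)

abbreviation "bal \<equiv> dia.bal"
abbreviation "bal3 \<equiv> balanced3 B L (tgt L) L (src L) (tgt L) L (src L)"

sublocale tri: triple_product K B L "tgt L" L "src L" "tgt L" L "src L"
  by standard (auto simp: smult_src[symmetric] smult_tgt[symmetric])

lemma comult_carrier: "x \<in> carrier L \<Longrightarrow> comult L x \<in> carrier dia.TP"
  using comult_closed[of x] by (simp add: takeuchi_def dia_eq)

lemma csum_if: "csum L x \<phi> = (if x \<in> carrier L then tsum (comult L x) \<phi> else 0)"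
  unfolding csum_def by simp (rule impI, rule dia.tsum_cong[OF comult_carrier], auto)

lemma csum_add:
  "bal \<phi> \<Longrightarrow> x \<in> carrier L \<Longrightarrow> y \<in> carrier L \<Longrightarrow> csum L (x \<oplus>\<^bsub>L\<^esub> y) \<phi> = csum L x \<phi> + csum L y \<phi>"
  by (simp add: csum_if comult_add dia_eq[symmetric] dia.tsum_add comult_carrier)

lemma csum_Be:
  assumes "bal \<phi>" "b \<in> carrier B" "c \<in> carrier B" "x \<in> carrier L"
  shows "csum L (src L b \<otimes>\<^bsub>L\<^esub> (tgt L c \<otimes>\<^bsub>L\<^esub> x)) \<phi> = csum L x (\<lambda>x1 x2. \<phi> (src L b \<otimes>\<^bsub>L\<^esub> x1) (tgt L c \<otimes>\<^bsub>L\<^esub> x2))"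
  using assms comult_Be_linear[of b c x]
  by (simp add: csum_if L.total.m_assoc dia_eq[symmetric] dia.tsum_induced_pair)

lemma csum_src:
  assumes "bal \<phi>" "b \<in> carrier B" "x \<in> carrier L"
  shows "csum L (src L b \<otimes>\<^bsub>L\<^esub> x) \<phi> = csum L x (\<lambda>x1 x2. \<phi> (src L b \<otimes>\<^bsub>L\<^esub> x1) x2)"
  using csum_Be[OF assms(1,2) B.total.one_closed assms(3)] assms by simp

lemma csum_tgt:
  assumes "bal \<phi>" "b \<in> carrier B" "x \<in> carrier L"
  shows "csum L (tgt L b \<otimes>\<^bsub>L\<^esub> x) \<phi> = csum L x (\<lambda>x1 x2. \<phi> x1 (tgt L b \<otimes>\<^bsub>L\<^esub> x2))"
  using csum_Be[OF assms(1) B.total.one_closed assms(2,3)] assms by simp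

text \<open>
  The values of the coproduct lie in the Takeuchi product.
\<close>

lemma csum_takeuchi:
  assumes "bal \<phi>" "b \<in> carrier B" "x \<in> carrier L"
  shows "csum L x (\<lambda>x1 x2. \<phi> (x1 \<otimes>\<^bsub>L\<^esub> tgt L b) x2) = csum L x (\<lambda>x1 x2. \<phi> x1 (x2 \<otimes>\<^bsub>L\<^esub> src L b))"
proof -
  have "induced dia.TP (\<lambda>(x, y). frag_of (x \<otimes>\<^bsub>L\<^esub> tgt L b, y)) (comult L x)
      = induced dia.TP (\<lambda>(x, y). frag_of (x, y \<otimes>\<^bsub>L\<^esub> src L b)) (comult L x)"
    using comult_closed[OF assms(3)] assms(2) by (simp add: takeuchi_def dia_eq)
  then have "tsum (induced dia.TP (\<lambda>(x, y). frag_of (x \<otimes>\<^bsub>L\<^esub> tgt L b, y)) (comult L x)) \<phi>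
      = tsum (induced dia.TP (\<lambda>(x, y). frag_of (x, y \<otimes>\<^bsub>L\<^esub> src L b)) (comult L x)) \<phi>" by simp
  then show ?thesis using assms by (simp add: dia.tsum_induced_pair csum_if)
qed

lemma csum_mult:
  assumes "bal \<phi>" "x \<in> carrier L" "y \<in> carrier L"
  shows "csum L (x \<otimes>\<^bsub>L\<^esub> y) \<phi> = csum L x (\<lambda>x1 x2. csum L y (\<lambda>y1 y2. \<phi> (x1 \<otimes>\<^bsub>L\<^esub> y1) (x2 \<otimes>\<^bsub>L\<^esub> y2)))"
  using assms comult_mult[OF assms(2,3)]
  by (simp add: csum_if component_mult_def dia_eq[symmetric] dia.tsum_induced_pair lin_expand)

lemma csum_one: "bal \<phi> \<Longrightarrow> csum L \<one>\<^bsub>L\<^esub> \<phi> = \<phi> \<one>\<^bsub>L\<^esub> \<one>\<^bsub>L\<^esub>"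
  by (simp add: csum_if comult_one dia_eq[symmetric] dia.tsum_pure)

lemma csum_coassoc:
  assumes "bal3 \<phi>"
  shows "csum L x (\<lambda>x' x3. csum L x' (\<lambda>x1 x2. \<phi> x1 x2 x3)) = csum L x (\<lambda>x1 x'. csum L x' (\<lambda>x2 x3. \<phi> x1 x2 x3))"
proof (cases "x \<in> carrier L")
  case True
  let ?C = "\<lambda>h. lin (\<lambda>(x, y, z). \<phi> x y z) (repr (induced tri.T3 h (comult L x)))"
  have "tsum (comult L x) (\<lambda>x' x3. tsum (comult L x') (\<lambda>x1 x2. \<phi> x1 x2 x3))
    = ?C (\<lambda>(x', x3). expand (\<lambda>(x1, x2). frag_of (x1, x2, x3)) (comult L x'))"
    unfolding tri.lin_repr_induced3[OF assms] tsum_def[of "comult L x"]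
    by (rule lin_cong) (auto simp: lin_expand)
  also have "\<dots> = ?C (\<lambda>(x1, x'). expand (\<lambda>(x2, x3). frag_of (x1, x2, x3)) (comult L x'))"
    using coassociative[OF True] by simp
  also have "\<dots> = tsum (comult L x) (\<lambda>x1 x'. tsum (comult L x') (\<lambda>x2 x3. \<phi> x1 x2 x3))"
    unfolding tri.lin_repr_induced3[OF assms] tsum_def[of "comult L x"]
    by (rule lin_cong) (auto simp: lin_expand)
  finally have "tsum (comult L x) (\<lambda>x' x3. tsum (comult L x') (\<lambda>x1 x2. \<phi> x1 x2 x3))
    = tsum (comult L x) (\<lambda>x1 x'. tsum (comult L x') (\<lambda>x2 x3. \<phi> x1 x2 x3))" .
  moreover have "csum L x (\<lambda>x' x3. csum L x' (\<lambda>x1 x2. \<phi> x1 x2 x3))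
      = tsum (comult L x) (\<lambda>x' x3. tsum (comult L x') (\<lambda>x1 x2. \<phi> x1 x2 x3))"
    unfolding csum_if by (simp add: True) (rule dia.tsum_cong[OF comult_carrier[OF True]], simp)
  moreover have "csum L x (\<lambda>x1 x'. csum L x' (\<lambda>x2 x3. \<phi> x1 x2 x3))
      = tsum (comult L x) (\<lambda>x1 x'. tsum (comult L x') (\<lambda>x2 x3. \<phi> x1 x2 x3))"
    unfolding csum_if by (simp add: True) (rule dia.tsum_cong[OF comult_carrier[OF True]], simp)
  ultimately show ?thesis by simp
qed (simp add: csum_if)

lemma csum_counit_left:
  assumes "additive_on L \<phi>" "x \<in> carrier L"
  shows "csum L x (\<lambda>x1 x2. \<phi> (src L (counit L x1) \<otimes>\<^bsub>L\<^esub> x2)) = \<phi> x"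
proof -
  have "\<phi> (evaluate L (\<lambda>(x1, x2). src L (counit L x1) \<otimes>\<^bsub>L\<^esub> x2) (comult L x))
      = lin (\<lambda>z. \<phi> ((\<lambda>(x1, x2). src L (counit L x1) \<otimes>\<^bsub>L\<^esub> x2) z)) (repr (comult L x))"
    using dia.keys_repr[OF comult_carrier[OF assms(2)]]
    by (intro abelian_group.additive_on_evaluate[OF L.total.is_abelian_group] assms) auto
  then show ?thesis using assms counital_left[of x] by (simp add: csum_if tsum_def case_prod_beta')
qed

lemma csum_counit_right:
  assumes "additive_on L \<phi>" "x \<in> carrier L"
  shows "csum L x (\<lambda>x1 x2. \<phi> (tgt L (counit L x2) \<otimes>\<^bsub>L\<^esub> x1)) = \<phi> x"
proof -
  have "\<phi> (evaluate L (\<lambda>(x1, x2). tgt L (counit L x2) \<otimes>\<^bsub>L\<^esub> x1) (comult L x))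
      = lin (\<lambda>z. \<phi> ((\<lambda>(x1, x2). tgt L (counit L x2) \<otimes>\<^bsub>L\<^esub> x1) z)) (repr (comult L x))"
    using dia.keys_repr[OF comult_carrier[OF assms(2)]]
    by (intro abelian_group.additive_on_evaluate[OF L.total.is_abelian_group] assms) auto
  then show ?thesis using assms counital_right[of x] by (simp add: csum_if tsum_def case_prod_beta')
qed

text \<open>
  Left multiplication by a coproduct is well defined on the tensor product over the base: this is what
  the Takeuchi condition is for.
\<close>

lemma balanced_mult_sum:
  assumes "bal \<phi>"
  shows "bal (\<lambda>y1 y2. csum L x (\<lambda>x1 x2. \<phi> (x1 \<otimes>\<^bsub>L\<^esub> y1) (x2 \<otimes>\<^bsub>L\<^esub> y2)))"
proof (cases "x \<in> carrier L")
  case True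
  show ?thesis
  proof (rule balancedI)
    fix b y1 y2 assume *: "b \<in> carrier B" "y1 \<in> carrier L" "y2 \<in> carrier L"
    have "bal (\<lambda>x1 x2. \<phi> (x1 \<otimes>\<^bsub>L\<^esub> y1) (x2 \<otimes>\<^bsub>L\<^esub> y2))"
      by (rule balancedI) (use * in \<open>simp_all add: additive assoc balancedD[OF assms]\<close>)
    from csum_takeuchi[OF this *(1) True]
    show "csum L x (\<lambda>x1 x2. \<phi> (x1 \<otimes>\<^bsub>L\<^esub> (tgt L b \<otimes>\<^bsub>L\<^esub> y1)) (x2 \<otimes>\<^bsub>L\<^esub> y2))
      = csum L x (\<lambda>x1 x2. \<phi> (x1 \<otimes>\<^bsub>L\<^esub> y1) (x2 \<otimes>\<^bsub>L\<^esub> (src L b \<otimes>\<^bsub>L\<^esub> y2)))"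
      using * by (simp add: assoc)
  qed (simp_all add: L.total.r_distr csum_plus balancedD[OF assms])
qed (simp add: csum_if balanced_def biadditive_def)

text \<open>
  The axioms only give linearity of the coproduct on the left.  On the right it follows from
  multiplicativity and the value of the coproduct at \<open>src L b\<close>.
\<close>

lemma csum_src_right:
  assumes \<phi>: "bal \<phi>" and b: "b \<in> carrier B" and x: "x \<in> carrier L"
  shows "csum L (x \<otimes>\<^bsub>L\<^esub> src L b) \<phi> = csum L x (\<lambda>x1 x2. \<phi> (x1 \<otimes>\<^bsub>L\<^esub> src L b) x2)"
proof -
  note bal = balanced_mult_sum[OF \<phi>, of x]
  have "csum L (x \<otimes>\<^bsub>L\<^esub> src L b) \<phi>
      = csum L (src L b \<otimes>\<^bsub>L\<^esub> \<one>\<^bsub>L\<^esub>) (\<lambda>y1 y2. csum L x (\<lambda>x1 x2. \<phi> (x1 \<otimes>\<^bsub>L\<^esub> y1) (x2 \<otimes>\<^bsub>L\<^esub> y2)))"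
    unfolding csum_mult[OF \<phi> x src_closed[OF b]] using b by (simp, intro csum_commute)
  also have "\<dots> = csum L x (\<lambda>x1 x2. \<phi> (x1 \<otimes>\<^bsub>L\<^esub> src L b) x2)"
  proof -
    have "bal (\<lambda>x1 x2. csum L x (\<lambda>xa1 xa2. \<phi> (xa1 \<otimes>\<^bsub>L\<^esub> (src L b \<otimes>\<^bsub>L\<^esub> x1)) (xa2 \<otimes>\<^bsub>L\<^esub> x2)))"
      by (rule balancedI) (use b balancedD[OF bal] in \<open>simp_all add: additive src_tgt_left\<close>)
    then show ?thesis
      using b by (subst csum_src[OF bal]) (simp_all add: csum_one)
  qed
  finally show ?thesis .
qed

lemma csum_tgt_right:
  assumes \<phi>: "bal \<phi>" and b: "b \<in> carrier B" and x: "x \<in> carrier L"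
  shows "csum L (x \<otimes>\<^bsub>L\<^esub> tgt L b) \<phi> = csum L x (\<lambda>x1 x2. \<phi> x1 (x2 \<otimes>\<^bsub>L\<^esub> tgt L b))"
proof -
  note bal = balanced_mult_sum[OF \<phi>, of x]
  have "csum L (x \<otimes>\<^bsub>L\<^esub> tgt L b) \<phi>
      = csum L (tgt L b \<otimes>\<^bsub>L\<^esub> \<one>\<^bsub>L\<^esub>) (\<lambda>y1 y2. csum L x (\<lambda>x1 x2. \<phi> (x1 \<otimes>\<^bsub>L\<^esub> y1) (x2 \<otimes>\<^bsub>L\<^esub> y2)))"
    unfolding csum_mult[OF \<phi> x tgt_closed[OF b]] using b by (simp, intro csum_commute)
  also have "\<dots> = csum L x (\<lambda>x1 x2. \<phi> x1 (x2 \<otimes>\<^bsub>L\<^esub> tgt L b))"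
  proof -
    have "bal (\<lambda>x1 x2. csum L x (\<lambda>xa1 xa2. \<phi> (xa1 \<otimes>\<^bsub>L\<^esub> x1) (xa2 \<otimes>\<^bsub>L\<^esub> (tgt L b \<otimes>\<^bsub>L\<^esub> x2))))"
      by (rule balancedI) (use b balancedD[OF bal] in \<open>simp_all add: additive src_tgt_left[symmetric]\<close>)
    then show ?thesis
      using b by (subst csum_tgt[OF bal]) (simp_all add: csum_one)
  qed
  finally show ?thesis .
qed

lemma counit_src: "b \<in> carrier B \<Longrightarrow> x \<in> carrier L \<Longrightarrow> counit L (src L b \<otimes>\<^bsub>L\<^esub> x) = b \<otimes>\<^bsub>B\<^esub> counit L x"
  using counit_Be_linear[of b "\<one>\<^bsub>B\<^esub>" x] by simp

lemma counit_tgt: "b \<in> carrier B \<Longrightarrow> x \<in> carrier L \<Longrightarrow> counit L (tgt L b \<otimes>\<^bsub>L\<^esub> x) = counit L x \<otimes>\<^bsub>B\<^esub> b"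
  using counit_Be_linear[of "\<one>\<^bsub>B\<^esub>" b x] by simp

lemma counit_of_src [simp]: "b \<in> carrier B \<Longrightarrow> counit L (src L b) = b"
  using counit_src[of b "\<one>\<^bsub>L\<^esub>"] by (simp add: counit_one)

lemma counit_mult_tgt_src:
  "b \<in> carrier B \<Longrightarrow> x \<in> carrier L \<Longrightarrow> counit L (x \<otimes>\<^bsub>L\<^esub> tgt L b) = counit L (x \<otimes>\<^bsub>L\<^esub> src L b)"
  using counit_mult_tgt[of x "src L b"] by simp

end

section \<open>The translation map of a Hopf algebroid\<close>

text \<open>
  Sweedler's \<open>\<phi> x\<^sub>+ x\<^sub>-\<close> for the translation map; the conditional serves the same purpose as in
  \<open>csum\<close>.  Bound variables \<open>p\<close> and \<open>m\<close> stand for \<open>x\<^sub>+\<close> and \<open>x\<^sub>-\<close>.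
\<close>

definition pmsum ::
  "('k, 'i) ring_scheme \<Rightarrow> ('k, 'b, 'w) module_scheme \<Rightarrow> ('k, 'b, 'a, 'm) bialgebroid_scheme
    \<Rightarrow> 'a \<Rightarrow> ('a \<Rightarrow> 'a \<Rightarrow> circle) \<Rightarrow> circle"
  where "pmsum K B L x \<phi> = tsum (plus_minus K B L x)
    (\<lambda>p m. if x \<in> carrier L \<and> p \<in> carrier L \<and> m \<in> carrier L then \<phi> p m else 0)"

lemma pmsum_cong [cong]:
  assumes "x = y" "\<And>p m. p \<in> carrier L \<Longrightarrow> m \<in> carrier L \<Longrightarrow> \<phi> p m = \<psi> p m"
  shows "pmsum K B L x \<phi> = pmsum K B L y \<psi>"
  unfolding pmsum_def using assms by (simp cong: if_cong conj_cong)

lemma pmsum_plus: "pmsum K B L x (\<lambda>p m. \<phi> p m + \<psi> p m) = pmsum K B L x \<phi> + pmsum K B L x \<psi>"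
  unfolding pmsum_def tsum_plus[symmetric] by (rule arg_cong[where f = "tsum _"]) (auto simp: fun_eq_iff)

lemma pmsum_commute:
  "pmsum K B L x (\<lambda>p m. pmsum K B L' y (\<lambda>p' m'. \<phi> p m p' m'))
    = pmsum K B L' y (\<lambda>p' m'. pmsum K B L x (\<lambda>p m. \<phi> p m p' m'))"
  unfolding pmsum_def tsum_if
  by (subst tsum_commute) (intro arg_cong[where f = "tsum _"] ext, simp)

lemma csum_pmsum_commute:
  "csum L x (\<lambda>x1 x2. pmsum K B L' y (\<lambda>p m. \<phi> x1 x2 p m))
    = pmsum K B L' y (\<lambda>p m. csum L x (\<lambda>x1 x2. \<phi> x1 x2 p m))"
  unfolding pmsum_def csum_def tsum_if
  by (subst tsum_commute) (intro arg_cong[where f = "tsum _"] ext, simp)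

context hopf_algebroid
begin

sublocale low: tensor_product K L L "carrier B" "\<lambda>b x. x \<otimes>\<^bsub>L\<^esub> tgt L b" "\<lambda>b y. tgt L b \<otimes>\<^bsub>L\<^esub> y"
proof
  fix \<phi> k x y
  assume b: "balanced L L (carrier B) (\<lambda>b x. x \<otimes>\<^bsub>L\<^esub> tgt L b) (\<lambda>b y. tgt L b \<otimes>\<^bsub>L\<^esub> y) \<phi>"
    and k: "k \<in> carrier K" "x \<in> carrier L" "y \<in> carrier L"
  show "\<phi> (k \<odot>\<^bsub>L\<^esub> x) y = \<phi> x (k \<odot>\<^bsub>L\<^esub> y)"
    unfolding smult_tgt_right[OF k(1,2)] smult_tgt[OF k(1,3)]
    by (rule balancedD(3)[OF b]) (use k in auto)
qed auto

lemma low_eq: "low.TP = tensor_over_opposite K B L"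
  by (simp add: tensor_over_opposite_def)

abbreviation "lbal \<equiv> low.bal"
abbreviation "pm \<equiv> pmsum K B L"

lemma lambda_pullback_balanced:
  assumes "bal \<phi>" shows "lbal (\<lambda>x y. csum L x (\<lambda>x1 x2. \<phi> x1 (x2 \<otimes>\<^bsub>L\<^esub> y)))"
proof (rule balancedI)
  fix x x' y assume *: "x \<in> carrier L" "x' \<in> carrier L" "y \<in> carrier L"
  have "bal (\<lambda>x1 x2. \<phi> x1 (x2 \<otimes>\<^bsub>L\<^esub> y))"
    by (rule balancedI) (use * in \<open>simp_all add: additive assoc balancedD[OF assms]\<close>)
  then show "csum L (x \<oplus>\<^bsub>L\<^esub> x') (\<lambda>x1 x2. \<phi> x1 (x2 \<otimes>\<^bsub>L\<^esub> y))
      = csum L x (\<lambda>x1 x2. \<phi> x1 (x2 \<otimes>\<^bsub>L\<^esub> y)) + csum L x' (\<lambda>x1 x2. \<phi> x1 (x2 \<otimes>\<^bsub>L\<^esub> y))"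
    using * by (simp add: csum_add)
next
  fix x y y' assume *: "x \<in> carrier L" "y \<in> carrier L" "y' \<in> carrier L"
  then show "csum L x (\<lambda>x1 x2. \<phi> x1 (x2 \<otimes>\<^bsub>L\<^esub> (y \<oplus>\<^bsub>L\<^esub> y')))
      = csum L x (\<lambda>x1 x2. \<phi> x1 (x2 \<otimes>\<^bsub>L\<^esub> y)) + csum L x (\<lambda>x1 x2. \<phi> x1 (x2 \<otimes>\<^bsub>L\<^esub> y'))"
    by (simp add: L.total.r_distr balancedD[OF assms] csum_plus)
next
  fix b x y assume *: "b \<in> carrier B" "x \<in> carrier L" "y \<in> carrier L"
  have "bal (\<lambda>x1 x2. \<phi> x1 (x2 \<otimes>\<^bsub>L\<^esub> y))"
    by (rule balancedI) (use * in \<open>simp_all add: additive assoc balancedD[OF assms]\<close>)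
  then show "csum L (x \<otimes>\<^bsub>L\<^esub> tgt L b) (\<lambda>x1 x2. \<phi> x1 (x2 \<otimes>\<^bsub>L\<^esub> y))
      = csum L x (\<lambda>x1 x2. \<phi> x1 (x2 \<otimes>\<^bsub>L\<^esub> (tgt L b \<otimes>\<^bsub>L\<^esub> y)))"
    using * by (simp add: csum_tgt_right assoc)
qed

lemma lambda_closed: "C \<in> carrier low.TP \<Longrightarrow> lambda_map K B L C \<in> carrier dia.TP"
  using lambda_bij by (auto simp: bij_betw_def dia_eq low_eq)

lemma tsum_lambda:
  assumes "bal \<phi>" "C \<in> carrier low.TP"
  shows "tsum (lambda_map K B L C) \<phi> = tsum C (\<lambda>x y. csum L x (\<lambda>x1 x2. \<phi> x1 (x2 \<otimes>\<^bsub>L\<^esub> y)))"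
  unfolding lambda_map_def dia_eq[symmetric] dia.tsum_induced_pair[OF assms(1)] lin_expand
  by (rule low.tsum_cong[OF assms(2)]) (simp add: csum_if)

text \<open>
  Formal sums that become equal under \<open>\<lambda>\<close> are not distinguished by functions on the source of \<open>\<lambda>\<close>.
\<close>

lemma lambda_injective:
  assumes c: "Poly_Mapping.keys c \<subseteq> carrier L \<times> carrier L" and d: "Poly_Mapping.keys d \<subseteq> carrier L \<times> carrier L"
    and eq: "\<And>\<phi>. bal \<phi> \<Longrightarrow> lin (\<lambda>(x, y). csum L x (\<lambda>x1 x2. \<phi> x1 (x2 \<otimes>\<^bsub>L\<^esub> y))) c
      = lin (\<lambda>(x, y). csum L x (\<lambda>x1 x2. \<phi> x1 (x2 \<otimes>\<^bsub>L\<^esub> y))) d"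
    and g: "lbal g"
  shows "lin (\<lambda>(x, y). g x y) c = lin (\<lambda>(x, y). g x y) d"
proof -
  note cl = low.cls_closed[OF c] low.cls_closed[OF d]
  have "lambda_map K B L (cls low.TP c) = lambda_map K B L (cls low.TP d)"
    by (rule dia.tensor_eqI)
       (simp_all add: lambda_closed cl tsum_lambda low.tsum_cls[OF lambda_pullback_balanced] eq)
  then have "cls low.TP c = cls low.TP d"
    using lambda_bij cl by (auto simp: bij_betw_def low_eq inj_on_def)
  then show ?thesis using low.tsum_cls[OF g] by metis
qed

lemma plus_minus_closed: "x \<in> carrier L \<Longrightarrow> plus_minus K B L x \<in> carrier low.TP"
  and lambda_plus_minus:
    "x \<in> carrier L \<Longrightarrow> lambda_map K B L (plus_minus K B L x) = cls dia.TP (frag_of (x, \<one>\<^bsub>L\<^esub>))"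
proof -
  assume x: "x \<in> carrier L"
  then have "cls dia.TP (frag_of (x, \<one>\<^bsub>L\<^esub>)) \<in> lambda_map K B L ` carrier low.TP"
    using lambda_bij dia.pure_closed[OF x L.total.one_closed] by (simp add: bij_betw_def dia_eq low_eq)
  then show "plus_minus K B L x \<in> carrier low.TP"
    "lambda_map K B L (plus_minus K B L x) = cls dia.TP (frag_of (x, \<one>\<^bsub>L\<^esub>))"
    unfolding plus_minus_def dia_eq[symmetric] low_eq[symmetric]
    by (rule inv_into_into, rule f_inv_into_f)
qed

lemma pm_if: "pm x \<phi> = (if x \<in> carrier L then tsum (plus_minus K B L x) \<phi> else 0)"
  unfolding pmsum_def by simp (rule impI, rule low.tsum_cong[OF plus_minus_closed], auto)

text \<open>
  The defining identity \<open>x\<^sub>+\<^sub>1 \<otimes> x\<^sub>+\<^sub>2 x\<^sub>- = x \<otimes> 1\<close>.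
\<close>

lemma pm_csum_mult:
  assumes "bal \<phi>" "x \<in> carrier L"
  shows "pm x (\<lambda>p m. csum L p (\<lambda>p1 p2. \<phi> p1 (p2 \<otimes>\<^bsub>L\<^esub> m))) = \<phi> x \<one>\<^bsub>L\<^esub>"
proof -
  have "pm x (\<lambda>p m. csum L p (\<lambda>p1 p2. \<phi> p1 (p2 \<otimes>\<^bsub>L\<^esub> m))) = tsum (lambda_map K B L (plus_minus K B L x)) \<phi>"
    using assms by (simp add: pm_if tsum_lambda plus_minus_closed)
  then show ?thesis by (simp add: lambda_plus_minus dia.tsum_pure assms)
qed

lemma keys_plus_minus: "x \<in> carrier L \<Longrightarrow> Poly_Mapping.keys (repr (plus_minus K B L x)) \<subseteq> carrier L \<times> carrier L"
  by (rule low.keys_repr[OF plus_minus_closed])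

lemma pm_lin: "x \<in> carrier L \<Longrightarrow> pm x g = lin (\<lambda>(p, m). g p m) (repr (plus_minus K B L x))"
  by (simp add: pm_if tsum_def)

lemma pm_add:
  assumes "lbal g" "x \<in> carrier L" "y \<in> carrier L"
  shows "pm (x \<oplus>\<^bsub>L\<^esub> y) g = pm x g + pm y g"
proof -
  let ?c = "repr (plus_minus K B L (x \<oplus>\<^bsub>L\<^esub> y))" and ?d = "repr (plus_minus K B L x) + repr (plus_minus K B L y)"
  have "lin (\<lambda>(p, m). g p m) ?c = lin (\<lambda>(p, m). g p m) ?d"
  proof (rule lambda_injective[OF _ _ _ assms(1)])
    show "Poly_Mapping.keys ?c \<subseteq> carrier L \<times> carrier L" by (simp add: keys_plus_minus assms)
    show "Poly_Mapping.keys ?d \<subseteq> carrier L \<times> carrier L"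
      using Poly_Mapping.keys_add[of "repr (plus_minus K B L x)" "repr (plus_minus K B L y)"]
        keys_plus_minus[OF assms(2)] keys_plus_minus[OF assms(3)] by (meson Un_least order_trans)
    fix \<phi> assume "bal \<phi>"
    then show "lin (\<lambda>(x, y). csum L x (\<lambda>x1 x2. \<phi> x1 (x2 \<otimes>\<^bsub>L\<^esub> y))) ?c
        = lin (\<lambda>(x, y). csum L x (\<lambda>x1 x2. \<phi> x1 (x2 \<otimes>\<^bsub>L\<^esub> y))) ?d"
      using assms(2,3) by (simp add: lin_add pm_lin[symmetric] pm_csum_mult balancedD(1))
  qed
  then show ?thesis using assms(2,3) by (simp add: lin_add pm_lin)
qed

lemma pm_tgt:
  assumes "lbal g" "b \<in> carrier B" "x \<in> carrier L"
  shows "pm (tgt L b \<otimes>\<^bsub>L\<^esub> x) g = pm x (\<lambda>p m. g p (m \<otimes>\<^bsub>L\<^esub> src L b))"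
proof -
  let ?c = "repr (plus_minus K B L (tgt L b \<otimes>\<^bsub>L\<^esub> x))"
  let ?d = "frag_extend (\<lambda>(p, m). frag_of (p, m \<otimes>\<^bsub>L\<^esub> src L b)) (repr (plus_minus K B L x))"
  have d: "lin (\<lambda>(p, m). h p m) ?d = pm x (\<lambda>p m. h p (m \<otimes>\<^bsub>L\<^esub> src L b))" for h
    using assms(3) by (simp add: lin_frag_extend pm_lin case_prod_beta')
  have "lin (\<lambda>(p, m). g p m) ?c = lin (\<lambda>(p, m). g p m) ?d"
  proof (rule lambda_injective[OF _ _ _ assms(1)])
    show "Poly_Mapping.keys ?c \<subseteq> carrier L \<times> carrier L" by (simp add: keys_plus_minus assms)
    show "Poly_Mapping.keys ?d \<subseteq> carrier L \<times> carrier L"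
      by (rule order_trans[OF keys_frag_extend]) (use keys_plus_minus[OF assms(3)] assms(2) in auto)
    fix \<phi> assume \<phi>: "bal \<phi>"
    have "bal (\<lambda>x y. \<phi> x (y \<otimes>\<^bsub>L\<^esub> src L b))"
      by (rule balancedI) (use assms(2) in \<open>simp_all add: additive assoc balancedD[OF \<phi>]\<close>)
    from pm_csum_mult[OF this assms(3)]
    show "lin (\<lambda>(x, y). csum L x (\<lambda>x1 x2. \<phi> x1 (x2 \<otimes>\<^bsub>L\<^esub> y))) ?c
        = lin (\<lambda>(x, y). csum L x (\<lambda>x1 x2. \<phi> x1 (x2 \<otimes>\<^bsub>L\<^esub> y))) ?d"
      unfolding d using assms(2,3) \<phi>
      by (simp add: pm_lin[symmetric] pm_csum_mult balancedD(3)[OF \<phi>] assoc)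
  qed
  then show ?thesis unfolding d using assms(2,3) by (simp add: pm_lin)
qed

text \<open>
  The companion \<open>x\<^sub>1\<^sub>+ \<otimes> x\<^sub>1\<^sub>- x\<^sub>2 = x \<otimes> 1\<close> of the defining identity: the map \<open>\<lambda>\<close> takes
  both sides to the coproduct of \<open>x\<close>.
\<close>

lemma csum_pm_mult:
  assumes "lbal g" "x \<in> carrier L"
  shows "csum L x (\<lambda>x1 x2. pm x1 (\<lambda>p m. g p (m \<otimes>\<^bsub>L\<^esub> x2))) = g x \<one>\<^bsub>L\<^esub>"
proof -
  let ?c = "expand (\<lambda>(x1, x2). frag_extend (\<lambda>(p, m). frag_of (p, m \<otimes>\<^bsub>L\<^esub> x2)) (repr (plus_minus K B L x1))) (comult L x)"
  let ?d = "frag_of (x, \<one>\<^bsub>L\<^esub>)"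
  have c: "lin (\<lambda>(p, m). h p m) ?c = csum L x (\<lambda>x1 x2. pm x1 (\<lambda>p m. h p (m \<otimes>\<^bsub>L\<^esub> x2)))" for h
    unfolding lin_expand csum_if using assms(2)
    by simp (rule dia.tsum_cong[OF comult_carrier], simp_all add: lin_frag_extend pm_lin case_prod_beta')
  have "lin (\<lambda>(p, m). g p m) ?c = lin (\<lambda>(p, m). g p m) ?d"
  proof (rule lambda_injective[OF _ _ _ assms(1)])
    have k: "Poly_Mapping.keys (frag_extend (\<lambda>(p, m). frag_of (p, m \<otimes>\<^bsub>L\<^esub> x2)) (repr (plus_minus K B L x1)))
        \<subseteq> carrier L \<times> carrier L" if "x1 \<in> carrier L" "x2 \<in> carrier L" for x1 x2
      by (rule order_trans[OF keys_frag_extend]) (use that keys_plus_minus[OF that(1)] in auto)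
    show "Poly_Mapping.keys ?c \<subseteq> carrier L \<times> carrier L"
      unfolding expand_def
    proof (rule order_trans[OF keys_frag_extend], rule UN_least)
      fix z assume "z \<in> Poly_Mapping.keys (repr (comult L x))"
      then have "fst z \<in> carrier L" "snd z \<in> carrier L"
        using dia.keys_repr[OF comult_carrier[OF assms(2)]] by auto
      from k[OF this] show "Poly_Mapping.keys (case z of (x1, x2) \<Rightarrow> frag_extend (\<lambda>(p, m). frag_of (p, m \<otimes>\<^bsub>L\<^esub> x2))
          (repr (plus_minus K B L x1))) \<subseteq> carrier L \<times> carrier L"
        by (simp add: case_prod_beta)
    qed
    show "Poly_Mapping.keys ?d \<subseteq> carrier L \<times> carrier L" using assms by simp
    fix \<phi> assume \<phi>: "bal \<phi>"
    have "pm x1 (\<lambda>p m. csum L p (\<lambda>p1 p2. \<phi> p1 (p2 \<otimes>\<^bsub>L\<^esub> (m \<otimes>\<^bsub>L\<^esub> x2)))) = \<phi> x1 x2"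
      if "x1 \<in> carrier L" "x2 \<in> carrier L" for x1 x2
    proof -
      have "bal (\<lambda>x y. \<phi> x (y \<otimes>\<^bsub>L\<^esub> x2))"
        by (rule balancedI) (use that in \<open>simp_all add: additive assoc balancedD[OF \<phi>]\<close>)
      from pm_csum_mult[OF this that(1)] show ?thesis using that by (simp add: assoc)
    qed
    then show "lin (\<lambda>(x, y). csum L x (\<lambda>x1 x2. \<phi> x1 (x2 \<otimes>\<^bsub>L\<^esub> y))) ?c
        = lin (\<lambda>(x, y). csum L x (\<lambda>x1 x2. \<phi> x1 (x2 \<otimes>\<^bsub>L\<^esub> y))) ?d"
      unfolding c by simp
  qed
  then show ?thesis unfolding c by simp
qed

text \<open>
  Every function \<open>g\<close> on the source of \<open>\<lambda>\<close> is the pullback along \<open>\<lambda>\<close> of the function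
  \<open>G x y = g x\<^sub>+ (x\<^sub>- y)\<close> on its target.  After this substitution the rules for \<open>x\<^sub>+ \<otimes> x\<^sub>-\<close> below
  follow from \<open>pm_csum_mult\<close> and the rules for the coproduct.
\<close>

definition lower_ext where
  "lower_ext g x y = pm x (\<lambda>p m. g p (m \<otimes>\<^bsub>L\<^esub> y))"

lemma lower_ext:
  assumes g: "lbal g"
  shows "bal (lower_ext g)"
    and "x \<in> carrier L \<Longrightarrow> y \<in> carrier L \<Longrightarrow> g x y = csum L x (\<lambda>x1 x2. lower_ext g x1 (x2 \<otimes>\<^bsub>L\<^esub> y))"
    and "x \<in> carrier L \<Longrightarrow> pm x g = lower_ext g x \<one>\<^bsub>L\<^esub>"
    and "y \<in> carrier L \<Longrightarrow> bal (\<lambda>x1 x2. lower_ext g x1 (x2 \<otimes>\<^bsub>L\<^esub> y))"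
proof -
  have g': "lbal (\<lambda>p m. g p (m \<otimes>\<^bsub>L\<^esub> y))" if "y \<in> carrier L" for y
    by (rule balancedI) (use that in \<open>simp_all add: additive assoc balancedD[OF g]\<close>)
  show G: "bal (lower_ext g)"
    unfolding lower_ext_def
    by (rule balancedI) (simp_all add: pm_add g' L.total.r_distr balancedD[OF g] pmsum_plus pm_tgt assoc)
  show "g x y = csum L x (\<lambda>x1 x2. lower_ext g x1 (x2 \<otimes>\<^bsub>L\<^esub> y))" if "x \<in> carrier L" "y \<in> carrier L"
    unfolding lower_ext_def using csum_pm_mult[OF g', of y x] that by (simp add: assoc)
  show "pm x g = lower_ext g x \<one>\<^bsub>L\<^esub>" by (simp add: lower_ext_def)
  show "bal (\<lambda>x1 x2. lower_ext g x1 (x2 \<otimes>\<^bsub>L\<^esub> y))" if "y \<in> carrier L"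
    by (rule balancedI) (use that in \<open>simp_all add: additive assoc balancedD[OF G]\<close>)
qed

lemma pm_src:
  assumes g: "lbal g" and b: "b \<in> carrier B" and x: "x \<in> carrier L"
  shows "pm (src L b \<otimes>\<^bsub>L\<^esub> x) g = pm x (\<lambda>p m. g (src L b \<otimes>\<^bsub>L\<^esub> p) m)"
proof -
  let ?G = "lower_ext g"
  note G = lower_ext[OF g]
  have 1: "bal (\<lambda>u v. ?G (src L b \<otimes>\<^bsub>L\<^esub> u) v)"
    by (rule balancedI) (use b in \<open>simp_all add: additive src_tgt_left balancedD[OF G(1)]\<close>)
  have "pm x (\<lambda>p m. g (src L b \<otimes>\<^bsub>L\<^esub> p) m) = pm x (\<lambda>p m. csum L p (\<lambda>x1 x2. ?G (src L b \<otimes>\<^bsub>L\<^esub> x1) (x2 \<otimes>\<^bsub>L\<^esub> m)))"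
    using b by (simp add: G(2) csum_src[OF G(4)])
  also have "\<dots> = ?G (src L b \<otimes>\<^bsub>L\<^esub> x) \<one>\<^bsub>L\<^esub>" using pm_csum_mult[OF 1 x] .
  finally show ?thesis using b x by (simp add: G(3))
qed

lemma pm_src_right:
  assumes g: "lbal g" and b: "b \<in> carrier B" and x: "x \<in> carrier L"
  shows "pm (x \<otimes>\<^bsub>L\<^esub> src L b) g = pm x (\<lambda>p m. g (p \<otimes>\<^bsub>L\<^esub> src L b) m)"
proof -
  let ?G = "lower_ext g"
  note G = lower_ext[OF g]
  have 1: "bal (\<lambda>u v. ?G (u \<otimes>\<^bsub>L\<^esub> src L b) v)"
    by (rule balancedI) (use b in \<open>simp_all add: additive assoc balancedD[OF G(1)]\<close>)
  have "pm x (\<lambda>p m. g (p \<otimes>\<^bsub>L\<^esub> src L b) m) = pm x (\<lambda>p m. csum L p (\<lambda>x1 x2. ?G (x1 \<otimes>\<^bsub>L\<^esub> src L b) (x2 \<otimes>\<^bsub>L\<^esub> m)))"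
    using b by (simp add: G(2) csum_src_right[OF G(4)])
  also have "\<dots> = ?G (x \<otimes>\<^bsub>L\<^esub> src L b) \<one>\<^bsub>L\<^esub>" using pm_csum_mult[OF 1 x] .
  finally show ?thesis using b x by (simp add: G(3))
qed

lemma pm_tgt_right:
  assumes g: "lbal g" and b: "b \<in> carrier B" and x: "x \<in> carrier L"
  shows "pm (x \<otimes>\<^bsub>L\<^esub> tgt L b) g = pm x (\<lambda>p m. g p (src L b \<otimes>\<^bsub>L\<^esub> m))"
proof -
  let ?G = "lower_ext g"
  note G = lower_ext[OF g]
  have 1: "bal (\<lambda>u v. ?G (u \<otimes>\<^bsub>L\<^esub> tgt L b) v)"
    by (rule balancedI) (use b in \<open>simp_all add: additive assoc balancedD[OF G(1)]\<close>)
  have "pm x (\<lambda>p m. g p (src L b \<otimes>\<^bsub>L\<^esub> m)) = pm x (\<lambda>p m. csum L p (\<lambda>x1 x2. ?G (x1 \<otimes>\<^bsub>L\<^esub> tgt L b) (x2 \<otimes>\<^bsub>L\<^esub> m)))"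
    using b by (simp add: G(2) csum_takeuchi[OF G(4)] assoc)
  also have "\<dots> = ?G (x \<otimes>\<^bsub>L\<^esub> tgt L b) \<one>\<^bsub>L\<^esub>" using pm_csum_mult[OF 1 x] .
  finally show ?thesis using b x by (simp add: G(3))
qed

text \<open>
  Both sides are pullbacks along \<open>\<lambda>\<close> of functions with the same value at \<open>x \<otimes> 1\<close>.
\<close>

lemma pm_takeuchi:
  assumes g: "lbal g" and b: "b \<in> carrier B" and x: "x \<in> carrier L"
  shows "pm x (\<lambda>p m. g (tgt L b \<otimes>\<^bsub>L\<^esub> p) m) = pm x (\<lambda>p m. g p (m \<otimes>\<^bsub>L\<^esub> tgt L b))"
proof -
  let ?G = "lower_ext g"
  note G = lower_ext[OF g]
  have 1: "bal (\<lambda>u v. ?G u (tgt L b \<otimes>\<^bsub>L\<^esub> v))" "bal (\<lambda>u v. ?G u (v \<otimes>\<^bsub>L\<^esub> tgt L b))"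
    by (rule balancedI; use b in \<open>simp add: additive assoc src_tgt_left[symmetric] balancedD[OF G(1)]\<close>)+
  have "pm x (\<lambda>p m. g (tgt L b \<otimes>\<^bsub>L\<^esub> p) m) = pm x (\<lambda>p m. csum L p (\<lambda>x1 x2. ?G x1 (tgt L b \<otimes>\<^bsub>L\<^esub> (x2 \<otimes>\<^bsub>L\<^esub> m))))"
    using b by (simp add: G(2) csum_tgt[OF G(4)] assoc)
  also have "\<dots> = ?G x (tgt L b)" using pm_csum_mult[OF 1(1) x] b by simp
  also have "\<dots> = pm x (\<lambda>p m. csum L p (\<lambda>x1 x2. ?G x1 ((x2 \<otimes>\<^bsub>L\<^esub> m) \<otimes>\<^bsub>L\<^esub> tgt L b)))"
    using pm_csum_mult[OF 1(2) x] b by simp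
  also have "\<dots> = pm x (\<lambda>p m. g p (m \<otimes>\<^bsub>L\<^esub> tgt L b))" using b by (simp add: G(2) assoc)
  finally show ?thesis .
qed

text \<open>
  The inner sum over \<open>y\<close> collapses by \<open>pm_csum_mult\<close>, and then so does the outer one, because left
  multiplication by a coproduct preserves balancedness.
\<close>

lemma pm_mult:
  assumes g: "lbal g" and x: "x \<in> carrier L" and y: "y \<in> carrier L"
  shows "pm (x \<otimes>\<^bsub>L\<^esub> y) g = pm x (\<lambda>p m. pm y (\<lambda>p' m'. g (p \<otimes>\<^bsub>L\<^esub> p') (m' \<otimes>\<^bsub>L\<^esub> m)))"
proof -
  let ?G = "lower_ext g"
  note G = lower_ext[OF g]
  have 1: "bal (\<lambda>u v. ?G (u \<otimes>\<^bsub>L\<^esub> y) v)"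
    by (rule balancedI) (use y in \<open>simp_all add: additive assoc balancedD[OF G(1)]\<close>)
  have 3: "pm y (\<lambda>p' m'. g (p \<otimes>\<^bsub>L\<^esub> p') (m' \<otimes>\<^bsub>L\<^esub> m)) = csum L p (\<lambda>p1 p2. ?G (p1 \<otimes>\<^bsub>L\<^esub> y) (p2 \<otimes>\<^bsub>L\<^esub> m))"
    if "p \<in> carrier L" "m \<in> carrier L" for p m
  proof -
    have "pm y (\<lambda>p' m'. g (p \<otimes>\<^bsub>L\<^esub> p') (m' \<otimes>\<^bsub>L\<^esub> m))
      = pm y (\<lambda>p' m'. csum L p (\<lambda>p1 p2. csum L p' (\<lambda>p1' p2'. ?G (p1 \<otimes>\<^bsub>L\<^esub> p1') (p2 \<otimes>\<^bsub>L\<^esub> ((p2' \<otimes>\<^bsub>L\<^esub> m') \<otimes>\<^bsub>L\<^esub> m)))))"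
      using that by (simp add: G(2) csum_mult[OF G(4)] assoc)
    also have "\<dots> = pm y (\<lambda>p' m'. csum L p' (\<lambda>p1' p2'. csum L p (\<lambda>p1 p2. ?G (p1 \<otimes>\<^bsub>L\<^esub> p1') ((p2 \<otimes>\<^bsub>L\<^esub> (p2' \<otimes>\<^bsub>L\<^esub> m')) \<otimes>\<^bsub>L\<^esub> m))))"
      using that by (simp add: assoc) (intro pmsum_cong refl csum_commute)
    also have "\<dots> = csum L p (\<lambda>p1 p2. ?G (p1 \<otimes>\<^bsub>L\<^esub> y) ((p2 \<otimes>\<^bsub>L\<^esub> \<one>\<^bsub>L\<^esub>) \<otimes>\<^bsub>L\<^esub> m))"
      by (rule pm_csum_mult[OF balanced_mult_sum[OF G(4)[OF that(2)], of p] y])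
    also have "\<dots> = csum L p (\<lambda>p1 p2. ?G (p1 \<otimes>\<^bsub>L\<^esub> y) (p2 \<otimes>\<^bsub>L\<^esub> m))" using that by simp
    finally show ?thesis .
  qed
  have "pm x (\<lambda>p m. pm y (\<lambda>p' m'. g (p \<otimes>\<^bsub>L\<^esub> p') (m' \<otimes>\<^bsub>L\<^esub> m))) = ?G (x \<otimes>\<^bsub>L\<^esub> y) \<one>\<^bsub>L\<^esub>"
    using pm_csum_mult[OF 1 x] by (simp add: 3)
  then show ?thesis using x y by (simp add: G(3))
qed

lemma pm_one:
  assumes g: "lbal g" shows "pm \<one>\<^bsub>L\<^esub> g = g \<one>\<^bsub>L\<^esub> \<one>\<^bsub>L\<^esub>"
proof -
  let ?G = "lower_ext g"
  note G = lower_ext[OF g]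
  show ?thesis using G(3) by (simp add: G(2)) (simp add: csum_one[OF G(1)])
qed

lemma pm_counit_right:
  assumes h: "additive_on L h" and x: "x \<in> carrier L"
  shows "pm x (\<lambda>p m. h (p \<otimes>\<^bsub>L\<^esub> tgt L (counit L m))) = h x"
proof -
  have f: "bal (\<lambda>u v. h (tgt L (counit L v) \<otimes>\<^bsub>L\<^esub> u))"
    by (rule balancedI) (simp_all add: additive additive_onD[OF h] counit_src tgt_mult assoc)
  have "pm x (\<lambda>p m. h (p \<otimes>\<^bsub>L\<^esub> tgt L (counit L m)))
      = pm x (\<lambda>p m. csum L p (\<lambda>p1 p2. h (tgt L (counit L (p2 \<otimes>\<^bsub>L\<^esub> m)) \<otimes>\<^bsub>L\<^esub> p1)))"
  proof (rule pmsum_cong[OF refl])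
    fix p m assume pm: "p \<in> carrier L" "m \<in> carrier L"
    have "h (p \<otimes>\<^bsub>L\<^esub> tgt L (counit L m)) = csum L (p \<otimes>\<^bsub>L\<^esub> tgt L (counit L m)) (\<lambda>p1 p2. h (tgt L (counit L p2) \<otimes>\<^bsub>L\<^esub> p1))"
      using pm by (simp add: csum_counit_right[OF h])
    also have "\<dots> = csum L p (\<lambda>p1 p2. h (tgt L (counit L (p2 \<otimes>\<^bsub>L\<^esub> m)) \<otimes>\<^bsub>L\<^esub> p1))"
      using pm by (simp add: csum_tgt_right[OF f] counit_mult_tgt)
    finally show "h (p \<otimes>\<^bsub>L\<^esub> tgt L (counit L m)) = csum L p (\<lambda>p1 p2. h (tgt L (counit L (p2 \<otimes>\<^bsub>L\<^esub> m)) \<otimes>\<^bsub>L\<^esub> p1))" .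
  qed
  also have "\<dots> = h x" using pm_csum_mult[OF f x] x by (simp add: counit_one)
  finally show ?thesis .
qed

lemma pm_mult_counit:
  assumes h: "additive_on L h" and x: "x \<in> carrier L"
  shows "pm x (\<lambda>p m. h (p \<otimes>\<^bsub>L\<^esub> m)) = h (src L (counit L x))"
proof -
  have f: "bal (\<lambda>u v. h (src L (counit L u) \<otimes>\<^bsub>L\<^esub> v))"
    by (rule balancedI) (simp_all add: additive additive_onD[OF h] counit_tgt src_mult assoc)
  have "csum L p (\<lambda>p1 p2. h (src L (counit L p1) \<otimes>\<^bsub>L\<^esub> (p2 \<otimes>\<^bsub>L\<^esub> m))) = h (p \<otimes>\<^bsub>L\<^esub> m)"
    if "p \<in> carrier L" "m \<in> carrier L" for p m
  proof -
    have "additive_on L (\<lambda>z. h (z \<otimes>\<^bsub>L\<^esub> m))"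
      by (rule additive_onI) (use that in \<open>simp add: additive additive_onD[OF h]\<close>)
    from csum_counit_left[OF this that(1)] show ?thesis using that by (simp add: assoc)
  qed
  then show ?thesis using pm_csum_mult[OF f x] x by simp
qed

text \<open>
  The identity \<open>x\<^sub>1 \<otimes> x\<^sub>2\<^sub>+ \<otimes> x\<^sub>2\<^sub>- = x\<^sub>+\<^sub>1 \<otimes> x\<^sub>+\<^sub>2 \<otimes> x\<^sub>-\<close>: factor the function through \<open>\<lambda>\<close> in its last two
  arguments and use coassociativity.
\<close>

lemma csum_pm:
  assumes add: "\<And>x x' p m. x \<in> carrier L \<Longrightarrow> x' \<in> carrier L \<Longrightarrow> p \<in> carrier L \<Longrightarrow> m \<in> carrier L
      \<Longrightarrow> f (x \<oplus>\<^bsub>L\<^esub> x') p m = f x p m + f x' p m"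
    and low: "\<And>x. x \<in> carrier L \<Longrightarrow> lbal (f x)"
    and bal: "\<And>b x p m. b \<in> carrier B \<Longrightarrow> x \<in> carrier L \<Longrightarrow> p \<in> carrier L \<Longrightarrow> m \<in> carrier L
      \<Longrightarrow> f (tgt L b \<otimes>\<^bsub>L\<^esub> x) p m = f x (src L b \<otimes>\<^bsub>L\<^esub> p) m"
    and x: "x \<in> carrier L"
  shows "csum L x (\<lambda>x1 x2. pm x2 (\<lambda>p m. f x1 p m)) = pm x (\<lambda>p m. csum L p (\<lambda>p1 p2. f p1 p2 m))"
proof -
  define G where "G u = lower_ext (f u)" for u
  have G: "bal (G u)" "\<And>y z. y \<in> carrier L \<Longrightarrow> z \<in> carrier L \<Longrightarrow> f u y z = csum L y (\<lambda>y1 y2. G u y1 (y2 \<otimes>\<^bsub>L\<^esub> z))"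
    "\<And>y. y \<in> carrier L \<Longrightarrow> pm y (f u) = G u y \<one>\<^bsub>L\<^esub>" if "u \<in> carrier L" for u
    unfolding G_def using lower_ext[OF low[OF that]] by auto
  have G_add: "G (u \<oplus>\<^bsub>L\<^esub> u') y z = G u y z + G u' y z"
    if "u \<in> carrier L" "u' \<in> carrier L" "z \<in> carrier L" for u u' y z
    unfolding G_def lower_ext_def using that by (simp add: add pmsum_plus)
  have low': "lbal (\<lambda>p m. f u p (m \<otimes>\<^bsub>L\<^esub> z))" if "u \<in> carrier L" "z \<in> carrier L" for u z
    by (rule balancedI) (use that in \<open>simp_all add: additive assoc balancedD[OF low]\<close>)
  have G_tgt: "G (tgt L b \<otimes>\<^bsub>L\<^esub> u) y z = G u (src L b \<otimes>\<^bsub>L\<^esub> y) z"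
    if "b \<in> carrier B" "u \<in> carrier L" "y \<in> carrier L" "z \<in> carrier L" for b u y z
    unfolding G_def lower_ext_def using that by (simp add: bal pm_src[OF low'])
  have b3: "bal3 (\<lambda>u v w. G u v (w \<otimes>\<^bsub>L\<^esub> m))" if "m \<in> carrier L" for m
    by (rule balanced3I) (use that in \<open>simp_all add: additive G_add assoc balancedD[OF G(1)] G_tgt\<close>)
  have b2: "bal (\<lambda>u v. G u v z)" if "z \<in> carrier L" for z
    by (rule balancedI) (use that in \<open>simp_all add: additive G_add assoc balancedD[OF G(1)] G_tgt\<close>)
  have b: "bal (\<lambda>p z. csum L p (\<lambda>u v. G u v z))"
    by (rule balancedI) (simp_all add: csum_add[OF b2] balancedD[OF G(1)] csum_plus csum_tgt[OF b2])
  have "pm x (\<lambda>p m. csum L p (\<lambda>p1 p2. f p1 p2 m))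
      = pm x (\<lambda>p m. csum L p (\<lambda>p1 p'. csum L p' (\<lambda>p2 p3. G p1 p2 (p3 \<otimes>\<^bsub>L\<^esub> m))))"
    by (simp add: G(2))
  also have "\<dots> = pm x (\<lambda>p m. csum L p (\<lambda>p' p3. csum L p' (\<lambda>p1 p2. G p1 p2 (p3 \<otimes>\<^bsub>L\<^esub> m))))"
    by (simp add: csum_coassoc[OF b3])
  also have "\<dots> = csum L x (\<lambda>p1 p2. G p1 p2 \<one>\<^bsub>L\<^esub>)" by (rule pm_csum_mult[OF b x])
  also have "\<dots> = csum L x (\<lambda>x1 x2. pm x2 (\<lambda>p m. f x1 p m))" by (simp add: G(3))
  finally show ?thesis by simp
qed

text \<open>
  The identity \<open>x\<^sub>+\<^sub>+ \<otimes> x\<^sub>- \<otimes> x\<^sub>+\<^sub>- = x\<^sub>+ \<otimes> x\<^sub>-\<^sub>1 \<otimes> x\<^sub>-\<^sub>2\<close>.  The function is factored through \<open>\<lambda>\<close> twice, first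
  in its first and third arguments (\<open>G\<close>), then in the remaining second one (\<open>J\<close>).  Both sides then become the
  value of \<open>J\<close> at \<open>x \<otimes> 1 \<otimes> 1\<close>.
\<close>

lemma pm_pm:
  assumes add: "\<And>p p' y z. p \<in> carrier L \<Longrightarrow> p' \<in> carrier L \<Longrightarrow> y \<in> carrier L \<Longrightarrow> z \<in> carrier L
      \<Longrightarrow> f (p \<oplus>\<^bsub>L\<^esub> p') y z = f p y z + f p' y z"
    and bal: "\<And>p. p \<in> carrier L \<Longrightarrow> bal (f p)"
    and low: "\<And>b p y z. b \<in> carrier B \<Longrightarrow> p \<in> carrier L \<Longrightarrow> y \<in> carrier L \<Longrightarrow> z \<in> carrier L
      \<Longrightarrow> f (p \<otimes>\<^bsub>L\<^esub> tgt L b) y z = f p y (tgt L b \<otimes>\<^bsub>L\<^esub> z)"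
    and x: "x \<in> carrier L"
  shows "pm x (\<lambda>p m. pm p (\<lambda>p' m'. f p' m m')) = pm x (\<lambda>p m. csum L m (\<lambda>m1 m2. f p m1 m2))"
proof -
  have l1: "lbal (\<lambda>p z. f p y z)" if "y \<in> carrier L" for y
    by (rule balancedI) (use that in \<open>simp_all add: add low balancedD[OF bal]\<close>)
  define G where "G y = lower_ext (\<lambda>p z. f p y z)" for y
  have G: "bal (G y)" "\<And>p z. p \<in> carrier L \<Longrightarrow> z \<in> carrier L \<Longrightarrow> f p y z = csum L p (\<lambda>p1 p2. G y p1 (p2 \<otimes>\<^bsub>L\<^esub> z))"
    "\<And>p. p \<in> carrier L \<Longrightarrow> pm p (\<lambda>p' m'. f p' y m') = G y p \<one>\<^bsub>L\<^esub>" if "y \<in> carrier L" for y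
    unfolding G_def using lower_ext[OF l1[OF that]] by auto
  have l1': "lbal (\<lambda>p m. f p y (m \<otimes>\<^bsub>L\<^esub> z))" if "y \<in> carrier L" "z \<in> carrier L" for y z
    by (rule balancedI) (use that in \<open>simp_all add: additive assoc balancedD[OF l1]\<close>)
  have G_add: "G (y \<oplus>\<^bsub>L\<^esub> y') u v = G y u v + G y' u v"
    if "y \<in> carrier L" "y' \<in> carrier L" "v \<in> carrier L" for y y' u v
    unfolding G_def lower_ext_def using that by (simp add: balancedD[OF bal] pmsum_plus)
  have G_tgt: "G y (u \<otimes>\<^bsub>L\<^esub> tgt L b) v = G (tgt L b \<otimes>\<^bsub>L\<^esub> y) u v"
    if "b \<in> carrier B" "y \<in> carrier L" "u \<in> carrier L" "v \<in> carrier L" for b y u v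
    unfolding G_def lower_ext_def using that by (simp add: pm_tgt_right[OF l1'] balancedD[OF bal] assoc)
  have l2: "lbal (\<lambda>u y. G y u v)" if "v \<in> carrier L" for v
    by (rule balancedI) (use that in \<open>simp_all add: G_add G_tgt balancedD[OF G(1)]\<close>)
  define J where "J u w v = lower_ext (\<lambda>u y. G y u v) u w" for u w v
  have J: "bal (\<lambda>u w. J u w v)" "\<And>u y. u \<in> carrier L \<Longrightarrow> y \<in> carrier L \<Longrightarrow> G y u v = csum L u (\<lambda>u1 u2. J u1 (u2 \<otimes>\<^bsub>L\<^esub> y) v)"
    if "v \<in> carrier L" for v
    unfolding J_def using lower_ext[OF l2[OF that]] by auto
  have l2': "lbal (\<lambda>u y. G (y \<otimes>\<^bsub>L\<^esub> w) u v)" if "v \<in> carrier L" "w \<in> carrier L" for v w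
    by (rule balancedI) (use that in \<open>simp_all add: additive assoc balancedD[OF l2]\<close>)
  have Jwv: "bal (J u)" if "u \<in> carrier L" for u
  proof (rule balancedI)
    fix b w v assume *: "b \<in> carrier B" "w \<in> carrier L" "v \<in> carrier L"
    have "J u (tgt L b \<otimes>\<^bsub>L\<^esub> w) v = pm u (\<lambda>q n. G ((n \<otimes>\<^bsub>L\<^esub> tgt L b) \<otimes>\<^bsub>L\<^esub> w) q v)"
      unfolding J_def lower_ext_def using * by (simp add: assoc)
    also have "\<dots> = pm u (\<lambda>q n. G (n \<otimes>\<^bsub>L\<^esub> w) (tgt L b \<otimes>\<^bsub>L\<^esub> q) v)"
      using pm_takeuchi[OF l2'[OF *(3,2)] *(1) that] by simp
    also have "\<dots> = J u w (src L b \<otimes>\<^bsub>L\<^esub> v)"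
      unfolding J_def lower_ext_def using * by (simp add: balancedD(3)[OF G(1)])
    finally show "J u (tgt L b \<otimes>\<^bsub>L\<^esub> w) v = J u w (src L b \<otimes>\<^bsub>L\<^esub> v)" .
  next
    fix w v v' assume *: "w \<in> carrier L" "v \<in> carrier L" "v' \<in> carrier L"
    show "J u w (v \<oplus>\<^bsub>L\<^esub> v') = J u w v + J u w v'"
      unfolding J_def lower_ext_def using * by (simp add: balancedD[OF G(1)] pmsum_plus)
  qed (use that balancedD[OF J(1)] in simp)
  have Jvw: "bal (\<lambda>u v. csum L v (J u))"
    by (rule balancedI)
       (simp_all add: csum_add[OF Jwv] csum_src[OF Jwv] balancedD[OF J(1)] csum_plus)
  have "pm x (\<lambda>p m. pm p (\<lambda>p' m'. f p' m m')) = pm x (\<lambda>p m. csum L p (\<lambda>p1 p2. J p1 (p2 \<otimes>\<^bsub>L\<^esub> m) \<one>\<^bsub>L\<^esub>))"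
    by (simp add: G(3) J(2))
  also have "\<dots> = J x \<one>\<^bsub>L\<^esub> \<one>\<^bsub>L\<^esub>" by (rule pm_csum_mult[OF J(1) x]) simp
  also have "\<dots> = pm x (\<lambda>p m. csum L p (\<lambda>q1 p'. csum L (p' \<otimes>\<^bsub>L\<^esub> m) (J q1)))"
    unfolding pm_csum_mult[OF Jvw x] using x by (simp add: csum_one[OF Jwv])
  also have "\<dots> = pm x (\<lambda>p m. csum L m (\<lambda>m1 m2. f p m1 m2))"
  proof (rule pmsum_cong[OF refl])
    fix p m assume pm: "p \<in> carrier L" "m \<in> carrier L"
    have b3: "bal3 (\<lambda>q1 q2 q3. J q1 (q2 \<otimes>\<^bsub>L\<^esub> m1) (q3 \<otimes>\<^bsub>L\<^esub> m2))" if "m1 \<in> carrier L" "m2 \<in> carrier L" for m1 m2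
      by (rule balanced3I) (use that in \<open>simp_all add: additive assoc balancedD[OF J(1)] balancedD[OF Jwv]\<close>)
    have "csum L p (\<lambda>q1 p'. csum L (p' \<otimes>\<^bsub>L\<^esub> m) (J q1))
        = csum L p (\<lambda>q1 p'. csum L p' (\<lambda>q2 q3. csum L m (\<lambda>m1 m2. J q1 (q2 \<otimes>\<^bsub>L\<^esub> m1) (q3 \<otimes>\<^bsub>L\<^esub> m2))))"
      using pm by (simp add: csum_mult[OF Jwv])
    also have "\<dots> = csum L p (\<lambda>q1 p'. csum L m (\<lambda>m1 m2. csum L p' (\<lambda>q2 q3. J q1 (q2 \<otimes>\<^bsub>L\<^esub> m1) (q3 \<otimes>\<^bsub>L\<^esub> m2))))"
      by (intro csum_cong refl csum_commute)
    also have "\<dots> = csum L m (\<lambda>m1 m2. csum L p (\<lambda>q1 p'. csum L p' (\<lambda>q2 q3. J q1 (q2 \<otimes>\<^bsub>L\<^esub> m1) (q3 \<otimes>\<^bsub>L\<^esub> m2))))"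
      by (rule csum_commute)
    also have "\<dots> = csum L m (\<lambda>m1 m2. csum L p (\<lambda>p' q3. csum L p' (\<lambda>q1 q2. J q1 (q2 \<otimes>\<^bsub>L\<^esub> m1) (q3 \<otimes>\<^bsub>L\<^esub> m2))))"
      by (simp add: csum_coassoc[OF b3])
    also have "\<dots> = csum L m (\<lambda>m1 m2. f p m1 m2)"
      using pm by (simp add: G(2) J(2))
    finally show "csum L p (\<lambda>q1 p'. csum L (p' \<otimes>\<^bsub>L\<^esub> m) (J q1)) = csum L m (\<lambda>m1 m2. f p m1 m2)" .
  qed
  finally show ?thesis .
qed

end

section \<open>The cross relations of a skew pairing\<close>

text \<open>
  The product of the double moves \<open>x\<close> past \<open>\<beta>\<close> in two halves.  This half uses the first pairing and
  replaces \<open>x \<otimes> \<beta>\<close> by \<open>\<tau>[x\<^sub>1|\<beta>\<^sub>1] \<beta>\<^sub>2 \<otimes> x\<^sub>2\<close>.  As for \<open>csum\<close>, the conditional gives the congruence rule its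
  membership premises.
\<close>

definition cross_left ::
  "('k, 'b, 'p, 'n) bialgebroid_scheme \<Rightarrow> ('k, 'b, 'l, 'm) bialgebroid_scheme
    \<Rightarrow> ('l \<Rightarrow> 'p \<Rightarrow> 'b) \<Rightarrow> 'l \<Rightarrow> 'p \<Rightarrow> ('p \<Rightarrow> 'l \<Rightarrow> circle) \<Rightarrow> circle"
  where "cross_left U L \<tau> x \<beta> G = csum L x (\<lambda>x1 x2. csum U \<beta> (\<lambda>\<beta>1 \<beta>2.
    if src U (\<tau> x1 \<beta>1) \<otimes>\<^bsub>U\<^esub> \<beta>2 \<in> carrier U then G (src U (\<tau> x1 \<beta>1) \<otimes>\<^bsub>U\<^esub> \<beta>2) x2 else 0))"

text \<open>
  This half uses the second pairing and replaces \<open>\<beta> \<otimes> x\<close> by \<open>\<beta>\<^sub>+ \<otimes> tgt (\<tau>[x\<^sub>2|\<beta>\<^sub>-]) x\<^sub>1\<close>.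
\<close>

definition cross_right ::
  "('k, 'i) ring_scheme \<Rightarrow> ('k, 'b, 'w) module_scheme \<Rightarrow> ('k, 'b, 'p, 'n) bialgebroid_scheme
    \<Rightarrow> ('k, 'b, 'l, 'm) bialgebroid_scheme \<Rightarrow> ('l \<Rightarrow> 'p \<Rightarrow> 'b) \<Rightarrow> 'p \<Rightarrow> 'l \<Rightarrow> ('p \<Rightarrow> 'l \<Rightarrow> circle) \<Rightarrow> circle"
  where "cross_right K B U L \<tau> \<beta> x F = pmsum K B U \<beta> (\<lambda>p m. csum L x (\<lambda>x1 x2.
    if tgt L (\<tau> x2 m) \<otimes>\<^bsub>L\<^esub> x1 \<in> carrier L then F p (tgt L (\<tau> x2 m) \<otimes>\<^bsub>L\<^esub> x1) else 0))"

lemma cross_left_cong [cong]: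
  assumes "x = y" "\<beta> = \<gamma>" "\<And>\<alpha> z. \<alpha> \<in> carrier U \<Longrightarrow> z \<in> carrier L \<Longrightarrow> F \<alpha> z = G \<alpha> z"
  shows "cross_left U L \<tau> x \<beta> F = cross_left U L \<tau> y \<gamma> G"
  unfolding cross_left_def using assms by (simp cong: if_cong)

lemma cross_right_cong [cong]:
  assumes "\<beta> = \<gamma>" "x = y" "\<And>\<alpha> z. \<alpha> \<in> carrier U \<Longrightarrow> z \<in> carrier L \<Longrightarrow> F \<alpha> z = G \<alpha> z"
  shows "cross_right K B U L \<tau> \<beta> x F = cross_right K B U L \<tau> \<gamma> y G"
  unfolding cross_right_def using assms by (simp cong: if_cong)

locale hopf_pair = U: hopf_algebroid K B U + L: hopf_algebroid K B L
  for K :: "('k, 'i) ring_scheme" and B :: "('k, 'b, 'w) module_scheme"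
    and U :: "('k, 'b, 'p, 'n) bialgebroid_scheme" and L :: "('k, 'b, 'l, 'm) bialgebroid_scheme"
begin

text \<open>
  Balancedness over the two tensor factors of the enveloping algebra separately.  The left half needs
  only the first kind of balancedness, the right half only the second.
\<close>

abbreviation "sbal \<equiv> balanced U L (carrier B) (\<lambda>b \<alpha>. \<alpha> \<otimes>\<^bsub>U\<^esub> src U b) (\<lambda>b x. src L b \<otimes>\<^bsub>L\<^esub> x)"
abbreviation "tbal \<equiv> balanced U L (carrier B) (\<lambda>b \<alpha>. \<alpha> \<otimes>\<^bsub>U\<^esub> tgt U b) (\<lambda>b x. tgt L b \<otimes>\<^bsub>L\<^esub> x)"

lemmas additives = U.additive L.additive
lemmas assocs = U.assoc L.assoc
lemmas mults = U.src_mult U.tgt_mult L.src_mult L.tgt_mult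
lemmas commutes = U.src_tgt_left L.src_tgt_left

lemma sbal_assoc:
  assumes "sbal G" "a \<in> carrier U" "\<beta> \<in> carrier U" "b \<in> carrier B" "x \<in> carrier L"
  shows "G (a \<otimes>\<^bsub>U\<^esub> (\<beta> \<otimes>\<^bsub>U\<^esub> src U b)) x = G (a \<otimes>\<^bsub>U\<^esub> \<beta>) (src L b \<otimes>\<^bsub>L\<^esub> x)"
  using balancedD(3)[OF assms(1), of b "a \<otimes>\<^bsub>U\<^esub> \<beta>" x] assms by (simp add: U.assoc)

lemma tbal_assoc:
  assumes "tbal G" "a \<in> carrier U" "\<beta> \<in> carrier U" "b \<in> carrier B" "x \<in> carrier L"
  shows "G (a \<otimes>\<^bsub>U\<^esub> (\<beta> \<otimes>\<^bsub>U\<^esub> tgt U b)) x = G (a \<otimes>\<^bsub>U\<^esub> \<beta>) (tgt L b \<otimes>\<^bsub>L\<^esub> x)"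
  using balancedD(3)[OF assms(1), of b "a \<otimes>\<^bsub>U\<^esub> \<beta>" x] assms by (simp add: U.assoc)

end

locale hopf_pairing = hopf_pair K B U L + skew_pairing K B L U \<tau>
  for K :: "('k, 'i) ring_scheme" and B :: "('k, 'b, 'w) module_scheme"
    and U :: "('k, 'b, 'p, 'n) bialgebroid_scheme" and L :: "('k, 'b, 'l, 'm) bialgebroid_scheme"
    and \<tau> :: "'l \<Rightarrow> 'p \<Rightarrow> 'b"
begin

abbreviation "W \<equiv> cross_left U L \<tau>"
abbreviation "V \<equiv> cross_right K B U L \<tau>"

lemmas pairing_closed [simp]
lemmas pairing_one_left [simp] pairing_one_right [simp]
lemmas pairing_adds = pairing_add_left pairing_add_right

lemma pairing_src: "a \<in> carrier B \<Longrightarrow> x \<in> carrier L \<Longrightarrow> \<alpha> \<in> carrier U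
    \<Longrightarrow> \<tau> (src L a \<otimes>\<^bsub>L\<^esub> x) \<alpha> = a \<otimes>\<^bsub>B\<^esub> \<tau> x \<alpha>"
  using pairing_B_linear[of a "\<one>\<^bsub>B\<^esub>" "\<one>\<^bsub>B\<^esub>" "\<one>\<^bsub>B\<^esub>" "\<one>\<^bsub>B\<^esub>" x \<alpha>] by simp

lemma pairing_tgt: "b \<in> carrier B \<Longrightarrow> x \<in> carrier L \<Longrightarrow> \<alpha> \<in> carrier U
    \<Longrightarrow> \<tau> (tgt L b \<otimes>\<^bsub>L\<^esub> x) \<alpha> = \<tau> x (\<alpha> \<otimes>\<^bsub>U\<^esub> tgt U b)"
  using pairing_B_linear[of "\<one>\<^bsub>B\<^esub>" b "\<one>\<^bsub>B\<^esub>" "\<one>\<^bsub>B\<^esub>" "\<one>\<^bsub>B\<^esub>" x \<alpha>] by simp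

lemma pairing_src_right: "c \<in> carrier B \<Longrightarrow> x \<in> carrier L \<Longrightarrow> \<alpha> \<in> carrier U
    \<Longrightarrow> \<tau> (x \<otimes>\<^bsub>L\<^esub> src L c) \<alpha> = \<tau> x (src U c \<otimes>\<^bsub>U\<^esub> \<alpha>)"
  using pairing_B_linear[of "\<one>\<^bsub>B\<^esub>" "\<one>\<^bsub>B\<^esub>" c "\<one>\<^bsub>B\<^esub>" "\<one>\<^bsub>B\<^esub>" x \<alpha>] by simp

lemma pairing_tgt_right: "d \<in> carrier B \<Longrightarrow> x \<in> carrier L \<Longrightarrow> \<alpha> \<in> carrier U
    \<Longrightarrow> \<tau> (x \<otimes>\<^bsub>L\<^esub> tgt L d) \<alpha> = \<tau> x (\<alpha> \<otimes>\<^bsub>U\<^esub> src U d)"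
  using pairing_B_linear[of "\<one>\<^bsub>B\<^esub>" "\<one>\<^bsub>B\<^esub>" "\<one>\<^bsub>B\<^esub>" d "\<one>\<^bsub>B\<^esub>" x \<alpha>] by simp

lemma pairing_arg_tgt: "f \<in> carrier B \<Longrightarrow> x \<in> carrier L \<Longrightarrow> \<alpha> \<in> carrier U
    \<Longrightarrow> \<tau> x (tgt U f \<otimes>\<^bsub>U\<^esub> \<alpha>) = \<tau> x \<alpha> \<otimes>\<^bsub>B\<^esub> f"
  using pairing_B_linear[of "\<one>\<^bsub>B\<^esub>" "\<one>\<^bsub>B\<^esub>" "\<one>\<^bsub>B\<^esub>" "\<one>\<^bsub>B\<^esub>" f x \<alpha>] by simp

lemmas pairing_B = pairing_src pairing_tgt pairing_src_right pairing_tgt_right pairing_arg_tgt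

lemma pairing_mult_arg:
  assumes "additive_on B h" "x \<in> carrier L" "\<alpha> \<in> carrier U" "\<beta> \<in> carrier U"
  shows "h (\<tau> x (\<alpha> \<otimes>\<^bsub>U\<^esub> \<beta>)) = csum L x (\<lambda>x1 x2. h (\<tau> x1 (\<alpha> \<otimes>\<^bsub>U\<^esub> tgt U (\<tau> x2 \<beta>))))"
proof -
  have "h (evaluate B (\<lambda>(x1, x2). \<tau> x1 (\<alpha> \<otimes>\<^bsub>U\<^esub> tgt U (\<tau> x2 \<beta>))) (comult L x))
      = lin (\<lambda>z. h ((\<lambda>(x1, x2). \<tau> x1 (\<alpha> \<otimes>\<^bsub>U\<^esub> tgt U (\<tau> x2 \<beta>))) z)) (repr (comult L x))"
    using L.dia.keys_repr[OF L.comult_carrier[OF assms(2)]] assms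
    by (intro abelian_group.additive_on_evaluate[OF U.B.total.is_abelian_group] assms) auto
  then show ?thesis using assms pairing_mult_right[of x \<alpha> \<beta>] by (simp add: L.csum_if tsum_def case_prod_beta')
qed

lemma pairing_mult:
  assumes "additive_on B h" "x \<in> carrier L" "y \<in> carrier L" "\<alpha> \<in> carrier U"
  shows "h (\<tau> (x \<otimes>\<^bsub>L\<^esub> y) \<alpha>) = csum U \<alpha> (\<lambda>\<alpha>1 \<alpha>2. h (\<tau> x (src U (\<tau> y \<alpha>1) \<otimes>\<^bsub>U\<^esub> \<alpha>2)))"
proof -
  have "h (evaluate B (\<lambda>(\<alpha>1, \<alpha>2). \<tau> x (src U (\<tau> y \<alpha>1) \<otimes>\<^bsub>U\<^esub> \<alpha>2)) (comult U \<alpha>))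
      = lin (\<lambda>z. h ((\<lambda>(\<alpha>1, \<alpha>2). \<tau> x (src U (\<tau> y \<alpha>1) \<otimes>\<^bsub>U\<^esub> \<alpha>2)) z)) (repr (comult U \<alpha>))"
    using U.dia.keys_repr[OF U.comult_carrier[OF assms(4)]] assms
    by (intro abelian_group.additive_on_evaluate[OF U.B.total.is_abelian_group] assms) auto
  then show ?thesis using assms pairing_mult_left'[of x y \<alpha>] by (simp add: U.csum_if tsum_def case_prod_beta')
qed

lemma W_eq: "W x \<beta> G = csum L x (\<lambda>x1 x2. csum U \<beta> (\<lambda>\<beta>1 \<beta>2. G (src U (\<tau> x1 \<beta>1) \<otimes>\<^bsub>U\<^esub> \<beta>2) x2))"
  by (simp add: cross_left_def)

lemma V_eq: "V \<beta> x F = pmsum K B U \<beta> (\<lambda>p m. csum L x (\<lambda>x1 x2. F p (tgt L (\<tau> x2 m) \<otimes>\<^bsub>L\<^esub> x1)))"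
  by (simp add: cross_right_def)

lemma W_plus: "W x \<beta> (\<lambda>\<alpha> y. G \<alpha> y + G' \<alpha> y) = W x \<beta> G + W x \<beta> G'"
  by (simp add: W_eq csum_plus)

lemma V_plus: "V \<beta> x (\<lambda>\<alpha> y. F \<alpha> y + F' \<alpha> y) = V \<beta> x F + V \<beta> x F'"
  by (simp add: V_eq csum_plus pmsum_plus)

lemma W_csum: "W x \<beta> (\<lambda>\<alpha> y. csum M z (\<lambda>u v. H \<alpha> y u v)) = csum M z (\<lambda>u v. W x \<beta> (\<lambda>\<alpha> y. H \<alpha> y u v))"
proof -
  have "W x \<beta> (\<lambda>\<alpha> y. csum M z (\<lambda>u v. H \<alpha> y u v))
      = csum L x (\<lambda>x1 x2. csum M z (\<lambda>u v. csum U \<beta> (\<lambda>\<beta>1 \<beta>2. H (src U (\<tau> x1 \<beta>1) \<otimes>\<^bsub>U\<^esub> \<beta>2) x2 u v)))"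
    unfolding W_eq by (intro csum_cong refl csum_commute)
  also have "\<dots> = csum M z (\<lambda>u v. csum L x (\<lambda>x1 x2. csum U \<beta> (\<lambda>\<beta>1 \<beta>2. H (src U (\<tau> x1 \<beta>1) \<otimes>\<^bsub>U\<^esub> \<beta>2) x2 u v)))"
    by (rule csum_commute)
  finally show ?thesis by (simp add: W_eq)
qed

lemma V_csum: "V \<beta> x (\<lambda>\<alpha> y. csum M z (\<lambda>u v. H \<alpha> y u v)) = csum M z (\<lambda>u v. V \<beta> x (\<lambda>\<alpha> y. H \<alpha> y u v))"
proof -
  have "V \<beta> x (\<lambda>\<alpha> y. csum M z (\<lambda>u v. H \<alpha> y u v))
      = pmsum K B U \<beta> (\<lambda>p m. csum M z (\<lambda>u v. csum L x (\<lambda>x1 x2. H p (tgt L (\<tau> x2 m) \<otimes>\<^bsub>L\<^esub> x1) u v)))"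
    unfolding V_eq by (intro pmsum_cong refl csum_commute)
  also have "\<dots> = csum M z (\<lambda>u v. pmsum K B U \<beta> (\<lambda>p m. csum L x (\<lambda>x1 x2. H p (tgt L (\<tau> x2 m) \<otimes>\<^bsub>L\<^esub> x1) u v)))"
    by (rule csum_pmsum_commute[symmetric])
  finally show ?thesis by (simp add: V_eq)
qed

lemma W_pmsum: "W x \<beta> (\<lambda>\<alpha> y. pmsum K B M z (\<lambda>u v. H \<alpha> y u v)) = pmsum K B M z (\<lambda>u v. W x \<beta> (\<lambda>\<alpha> y. H \<alpha> y u v))"
  unfolding W_eq by (simp only: csum_pmsum_commute)

lemma V_pmsum: "V \<beta> x (\<lambda>\<alpha> y. pmsum K B M z (\<lambda>u v. H \<alpha> y u v)) = pmsum K B M z (\<lambda>u v. V \<beta> x (\<lambda>\<alpha> y. H \<alpha> y u v))"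
  unfolding V_eq by (subst csum_pmsum_commute) (rule pmsum_commute)

text \<open>
  With the first argument of the pairing held fixed, its value acts on \<open>\<beta>\<^sub>2\<close> compatibly with the
  tensor product in which \<open>\<beta>\<^sub>1 \<otimes> \<beta>\<^sub>2\<close> lives.  Here the linearity of the pairing in the base is used.
\<close>

lemma left_kernel:
  assumes g: "additive_on U g" and x: "x \<in> carrier L"
  shows "U.bal (\<lambda>\<beta>1 \<beta>2. g (src U (\<tau> x \<beta>1) \<otimes>\<^bsub>U\<^esub> \<beta>2))"
  by (rule balancedI)
     (use x in \<open>simp_all add: pairing_adds additives additive_onD[OF g] pairing_B mults assocs\<close>)

lemma right_kernel:
  assumes g: "additive_on L g" and m: "m \<in> carrier U"
  shows "L.bal (\<lambda>x1 x2. g (tgt L (\<tau> x2 m) \<otimes>\<^bsub>L\<^esub> x1))"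
  by (rule balancedI)
     (use m in \<open>simp_all add: pairing_adds additives additive_onD[OF g] pairing_B mults assocs\<close>)

lemma sbal_additive: "sbal G \<Longrightarrow> y \<in> carrier L \<Longrightarrow> additive_on U (\<lambda>\<alpha>. G \<alpha> y)"
  "sbal G \<Longrightarrow> \<alpha> \<in> carrier U \<Longrightarrow> additive_on L (G \<alpha>)"
  by (auto intro!: additive_onI simp: balancedD)

lemma tbal_additive: "tbal G \<Longrightarrow> y \<in> carrier L \<Longrightarrow> additive_on U (\<lambda>\<alpha>. G \<alpha> y)"
  "tbal G \<Longrightarrow> \<alpha> \<in> carrier U \<Longrightarrow> additive_on L (G \<alpha>)"
  by (auto intro!: additive_onI simp: balancedD)

lemma W_kernel:
  assumes G: "sbal G" and \<beta>: "\<beta> \<in> carrier U"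
  shows "L.bal (\<lambda>x1 x2. csum U \<beta> (\<lambda>\<beta>1 \<beta>2. G (src U (\<tau> x1 \<beta>1) \<otimes>\<^bsub>U\<^esub> \<beta>2) x2))"
proof (rule balancedI)
  fix b x y assume *: "b \<in> carrier B" "x \<in> carrier L" "y \<in> carrier L"
  show "csum U \<beta> (\<lambda>\<beta>1 \<beta>2. G (src U (\<tau> (tgt L b \<otimes>\<^bsub>L\<^esub> x) \<beta>1) \<otimes>\<^bsub>U\<^esub> \<beta>2) y)
      = csum U \<beta> (\<lambda>\<beta>1 \<beta>2. G (src U (\<tau> x \<beta>1) \<otimes>\<^bsub>U\<^esub> \<beta>2) (src L b \<otimes>\<^bsub>L\<^esub> y))"
    using U.csum_takeuchi[OF left_kernel[OF sbal_additive(1)[OF G *(3)] *(2)] *(1) \<beta>] *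
    by (simp add: pairing_B sbal_assoc[OF G])
qed (simp_all add: pairing_adds additives balancedD[OF G] csum_plus)

lemma V_kernel:
  assumes F: "tbal F" and x: "x \<in> carrier L"
  shows "U.lbal (\<lambda>p m. csum L x (\<lambda>x1 x2. F p (tgt L (\<tau> x2 m) \<otimes>\<^bsub>L\<^esub> x1)))"
  by (rule balancedI)
     (simp_all add: pairing_adds additives balancedD[OF F] csum_plus pairing_B mults assocs)

lemma W_add_left:
  assumes "sbal G" "x \<in> carrier L" "y \<in> carrier L" "\<beta> \<in> carrier U"
  shows "W (x \<oplus>\<^bsub>L\<^esub> y) \<beta> G = W x \<beta> G + W y \<beta> G"
  unfolding W_eq by (rule L.csum_add[OF W_kernel]) (use assms in auto)

lemma W_add_right:
  assumes G: "sbal G" and "x \<in> carrier L" "\<beta> \<in> carrier U" "\<gamma> \<in> carrier U"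
  shows "W x (\<beta> \<oplus>\<^bsub>U\<^esub> \<gamma>) G = W x \<beta> G + W x \<gamma> G"
  unfolding W_eq using assms
  by (simp add: U.csum_add left_kernel[OF sbal_additive(1)[OF G]] csum_plus)

lemma W_src:
  assumes "sbal G" "a \<in> carrier B" "x \<in> carrier L" "\<beta> \<in> carrier U"
  shows "W (src L a \<otimes>\<^bsub>L\<^esub> x) \<beta> G = W x \<beta> (\<lambda>\<alpha> y. G (src U a \<otimes>\<^bsub>U\<^esub> \<alpha>) y)"
  unfolding W_eq using assms by (simp add: L.csum_src[OF W_kernel] pairing_B mults assocs)

lemma W_tgt:
  assumes "sbal G" "a \<in> carrier B" "x \<in> carrier L" "\<beta> \<in> carrier U"
  shows "W (tgt L a \<otimes>\<^bsub>L\<^esub> x) \<beta> G = W x \<beta> (\<lambda>\<alpha> y. G \<alpha> (tgt L a \<otimes>\<^bsub>L\<^esub> y))"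
  unfolding W_eq using assms by (simp add: L.csum_tgt[OF W_kernel])

lemma W_tgt_right:
  assumes "sbal G" "a \<in> carrier B" "x \<in> carrier L" "\<beta> \<in> carrier U"
  shows "W (x \<otimes>\<^bsub>L\<^esub> tgt L a) \<beta> G = W x \<beta> (\<lambda>\<alpha> y. G \<alpha> (y \<otimes>\<^bsub>L\<^esub> tgt L a))"
  unfolding W_eq using assms by (simp add: L.csum_tgt_right[OF W_kernel])

lemma W_arg_src_right:
  assumes G: "sbal G" and a: "a \<in> carrier B" and x: "x \<in> carrier L" and \<beta>: "\<beta> \<in> carrier U"
  shows "W x (\<beta> \<otimes>\<^bsub>U\<^esub> src U a) G = W x \<beta> (\<lambda>\<alpha> y. G \<alpha> (y \<otimes>\<^bsub>L\<^esub> src L a))"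
  unfolding W_eq
  using L.csum_takeuchi[OF W_kernel[OF G \<beta>] a x] a x \<beta>
  by (simp add: U.csum_src_right[OF left_kernel[OF sbal_additive(1)[OF G]]] pairing_B)

lemma W_arg_tgt_right:
  assumes G: "sbal G" and "a \<in> carrier B" "x \<in> carrier L" "\<beta> \<in> carrier U"
  shows "W x (\<beta> \<otimes>\<^bsub>U\<^esub> tgt U a) G = W x \<beta> (\<lambda>\<alpha> y. G (\<alpha> \<otimes>\<^bsub>U\<^esub> tgt U a) y)"
  unfolding W_eq using assms
  by (simp add: U.csum_tgt_right[OF left_kernel[OF sbal_additive(1)[OF G]]] assocs)

lemma W_arg_tgt:
  assumes G: "sbal G" and "a \<in> carrier B" "x \<in> carrier L" "\<beta> \<in> carrier U"
  shows "W x (tgt U a \<otimes>\<^bsub>U\<^esub> \<beta>) G = W x \<beta> (\<lambda>\<alpha> y. G (tgt U a \<otimes>\<^bsub>U\<^esub> \<alpha>) y)"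
  unfolding W_eq using assms
  by (simp add: U.csum_tgt[OF left_kernel[OF sbal_additive(1)[OF G]]] commutes)

lemma V_add_left:
  assumes "tbal F" "x \<in> carrier L" "\<beta> \<in> carrier U" "\<gamma> \<in> carrier U"
  shows "V (\<beta> \<oplus>\<^bsub>U\<^esub> \<gamma>) x F = V \<beta> x F + V \<gamma> x F"
  unfolding V_eq by (rule U.pm_add[OF V_kernel]) (use assms in auto)

lemma V_add_right:
  assumes F: "tbal F" and "x \<in> carrier L" "\<beta> \<in> carrier U" "y \<in> carrier L"
  shows "V \<beta> (x \<oplus>\<^bsub>L\<^esub> y) F = V \<beta> x F + V \<beta> y F"
  unfolding V_eq using assms
  by (simp add: L.csum_add right_kernel[OF tbal_additive(2)[OF F]] pmsum_plus)

lemma V_src: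
  assumes "tbal F" "a \<in> carrier B" "x \<in> carrier L" "\<beta> \<in> carrier U"
  shows "V (src U a \<otimes>\<^bsub>U\<^esub> \<beta>) x F = V \<beta> x (\<lambda>\<alpha> y. F (src U a \<otimes>\<^bsub>U\<^esub> \<alpha>) y)"
  unfolding V_eq using assms by (simp add: U.pm_src[OF V_kernel])

lemma V_src_right:
  assumes "tbal F" "a \<in> carrier B" "x \<in> carrier L" "\<beta> \<in> carrier U"
  shows "V (\<beta> \<otimes>\<^bsub>U\<^esub> src U a) x F = V \<beta> x (\<lambda>\<alpha> y. F (\<alpha> \<otimes>\<^bsub>U\<^esub> src U a) y)"
  unfolding V_eq using assms by (simp add: U.pm_src_right[OF V_kernel])

lemma V_tgt_right:
  assumes F: "tbal F" and a: "a \<in> carrier B" and x: "x \<in> carrier L" and \<beta>: "\<beta> \<in> carrier U"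
  shows "V (\<beta> \<otimes>\<^bsub>U\<^esub> tgt U a) x F = V \<beta> x (\<lambda>\<alpha> y. F \<alpha> (y \<otimes>\<^bsub>L\<^esub> tgt L a))"
proof -
  have "csum L x (\<lambda>x1 x2. F p (tgt L (\<tau> x2 m) \<otimes>\<^bsub>L\<^esub> (x1 \<otimes>\<^bsub>L\<^esub> tgt L a)))
      = csum L x (\<lambda>x1 x2. F p (tgt L (\<tau> x2 (src U a \<otimes>\<^bsub>U\<^esub> m)) \<otimes>\<^bsub>L\<^esub> x1))"
    if "p \<in> carrier U" "m \<in> carrier U" for p m
    using L.csum_takeuchi[OF right_kernel[OF tbal_additive(2)[OF F that(1)] that(2)] a x] a that
    by (simp add: pairing_B)
  then show ?thesis
    unfolding V_eq using assms by (simp add: U.pm_tgt_right[OF V_kernel] assocs)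
qed

lemma V_tgt:
  assumes F: "tbal F" and a: "a \<in> carrier B" and x: "x \<in> carrier L" and \<beta>: "\<beta> \<in> carrier U"
  shows "V (tgt U a \<otimes>\<^bsub>U\<^esub> \<beta>) x F = V \<beta> (x \<otimes>\<^bsub>L\<^esub> tgt L a) F"
  unfolding V_eq using assms
  by (simp add: U.pm_tgt[OF V_kernel] L.csum_tgt_right[OF right_kernel[OF tbal_additive(2)[OF F]]] pairing_B)

lemma V_arg_tgt:
  assumes F: "tbal F" and a: "a \<in> carrier B" and x: "x \<in> carrier L" and \<beta>: "\<beta> \<in> carrier U"
  shows "V \<beta> (tgt L a \<otimes>\<^bsub>L\<^esub> x) F = V \<beta> x (\<lambda>\<alpha> y. F (tgt U a \<otimes>\<^bsub>U\<^esub> \<alpha>) y)"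
  unfolding V_eq using U.pm_takeuchi[OF V_kernel[OF F x] a \<beta>] assms
  by (simp add: L.csum_tgt[OF right_kernel[OF tbal_additive(2)[OF F]]] pairing_B)

lemma V_arg_src:
  assumes F: "tbal F" and a: "a \<in> carrier B" and x: "x \<in> carrier L" and \<beta>: "\<beta> \<in> carrier U"
  shows "V \<beta> (src L a \<otimes>\<^bsub>L\<^esub> x) F = V \<beta> x (\<lambda>\<alpha> y. F \<alpha> (src L a \<otimes>\<^bsub>L\<^esub> y))"
  unfolding V_eq using assms
  by (simp add: L.csum_src[OF right_kernel[OF tbal_additive(2)[OF F]]] commutes)

lemma V_arg_src_right:
  assumes F: "tbal F" and a: "a \<in> carrier B" and x: "x \<in> carrier L" and \<beta>: "\<beta> \<in> carrier U"
  shows "V \<beta> (x \<otimes>\<^bsub>L\<^esub> src L a) F = V \<beta> x (\<lambda>\<alpha> y. F \<alpha> (y \<otimes>\<^bsub>L\<^esub> src L a))"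
  unfolding V_eq using assms
  by (simp add: L.csum_src_right[OF right_kernel[OF tbal_additive(2)[OF F]]] assocs)

lemma V_sbal:
  assumes "sbal F" "tbal F"
  shows "sbal (\<lambda>\<alpha> y. V \<alpha> y F)"
  by (rule balancedI)
     (simp_all add: V_add_left V_add_right V_src_right V_arg_src assms balancedD[OF assms(1)])

lemma V_tbal:
  assumes "tbal F" and z: "z \<in> carrier L"
  shows "tbal (\<lambda>\<alpha> y. V \<alpha> z (\<lambda>\<beta> w. F \<beta> (w \<otimes>\<^bsub>L\<^esub> y)))"
proof -
  have F: "tbal (\<lambda>\<beta> w. F \<beta> (w \<otimes>\<^bsub>L\<^esub> y))" if "y \<in> carrier L" for y
    by (rule balancedI) (use that in \<open>simp_all add: additives assocs balancedD[OF assms(1)]\<close>)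
  show ?thesis
    by (rule balancedI)
       (simp_all add: V_add_left z F additives balancedD[OF assms(1)] V_plus V_tgt_right assocs)
qed

text \<open>
  Moving a product \<open>x y\<close> past \<open>\<gamma>\<close> amounts to moving \<open>y\<close> and then \<open>x\<close>.  This is the axiom for
  \<open>\<tau>[x y|\<gamma>]\<close> together with coassociativity for \<open>\<gamma>\<close>.
\<close>

lemma W_mult:
  assumes G: "sbal G" and x: "x \<in> carrier L" and y: "y \<in> carrier L" and \<gamma>: "\<gamma> \<in> carrier U"
  shows "W (x \<otimes>\<^bsub>L\<^esub> y) \<gamma> G = W y \<gamma> (\<lambda>\<gamma>' y'. W x \<gamma>' (\<lambda>\<alpha> x'. G \<alpha> (x' \<otimes>\<^bsub>L\<^esub> y')))"
proof -
  have g: "additive_on B (\<lambda>b. G (src U b \<otimes>\<^bsub>U\<^esub> \<alpha>) z)" if "\<alpha> \<in> carrier U" "z \<in> carrier L" for \<alpha> z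
    by (rule additive_onI) (use that in \<open>simp add: additives balancedD[OF G]\<close>)
  have b3: "U.bal3 (\<lambda>\<gamma>1 \<gamma>2 \<gamma>3. G (src U (\<tau> x1 (src U (\<tau> y1 \<gamma>1) \<otimes>\<^bsub>U\<^esub> \<gamma>2)) \<otimes>\<^bsub>U\<^esub> \<gamma>3) z)"
    if "x1 \<in> carrier L" "y1 \<in> carrier L" "z \<in> carrier L" for x1 y1 z
    by (rule balanced3I)
       (use that in \<open>simp_all add: additives pairing_adds balancedD[OF G] pairing_B mults assocs commutes\<close>)
  have "W (x \<otimes>\<^bsub>L\<^esub> y) \<gamma> G
      = csum L x (\<lambda>x1 x2. csum L y (\<lambda>y1 y2. csum U \<gamma> (\<lambda>\<gamma>1 \<gamma>2. G (src U (\<tau> (x1 \<otimes>\<^bsub>L\<^esub> y1) \<gamma>1) \<otimes>\<^bsub>U\<^esub> \<gamma>2) (x2 \<otimes>\<^bsub>L\<^esub> y2))))"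
    unfolding W_eq by (simp add: L.csum_mult[OF W_kernel[OF G \<gamma>] x y])
  also have "\<dots> = csum L x (\<lambda>x1 x2. csum L y (\<lambda>y1 y2. csum U \<gamma> (\<lambda>\<gamma>' \<gamma>3. csum U \<gamma>' (\<lambda>\<gamma>1 \<gamma>2.
      G (src U (\<tau> x1 (src U (\<tau> y1 \<gamma>1) \<otimes>\<^bsub>U\<^esub> \<gamma>2)) \<otimes>\<^bsub>U\<^esub> \<gamma>3) (x2 \<otimes>\<^bsub>L\<^esub> y2)))))"
    by (simp add: pairing_mult[OF g])
  also have "\<dots> = csum L x (\<lambda>x1 x2. csum L y (\<lambda>y1 y2. csum U \<gamma> (\<lambda>\<gamma>1 \<gamma>'. csum U \<gamma>' (\<lambda>\<gamma>2 \<gamma>3.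
      G (src U (\<tau> x1 (src U (\<tau> y1 \<gamma>1) \<otimes>\<^bsub>U\<^esub> \<gamma>2)) \<otimes>\<^bsub>U\<^esub> \<gamma>3) (x2 \<otimes>\<^bsub>L\<^esub> y2)))))"
    by (simp add: U.csum_coassoc[OF b3])
  also have "\<dots> = csum L y (\<lambda>y1 y2. csum U \<gamma> (\<lambda>\<gamma>1 \<gamma>'. csum L x (\<lambda>x1 x2. csum U \<gamma>' (\<lambda>\<gamma>2 \<gamma>3.
      G (src U (\<tau> x1 (src U (\<tau> y1 \<gamma>1) \<otimes>\<^bsub>U\<^esub> \<gamma>2)) \<otimes>\<^bsub>U\<^esub> \<gamma>3) (x2 \<otimes>\<^bsub>L\<^esub> y2)))))"
    by (subst csum_commute, rule csum_cong[OF refl], rule csum_commute)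
  also have "\<dots> = W y \<gamma> (\<lambda>\<gamma>' y'. W x \<gamma>' (\<lambda>\<alpha> x'. G \<alpha> (x' \<otimes>\<^bsub>L\<^esub> y')))"
  proof -
    have "additive_on U (\<lambda>\<alpha>. G \<alpha> (x2 \<otimes>\<^bsub>L\<^esub> y2))" if "x2 \<in> carrier L" "y2 \<in> carrier L" for x2 y2
      by (rule sbal_additive[OF G]) (use that in simp)
    note k = left_kernel[OF this]
    show ?thesis
      by (simp add: W_eq U.csum_src[OF k])
  qed
  finally show ?thesis .
qed

text \<open>
  Moving \<open>x\<close> past a product amounts to moving it past the factors in turn.  The axiom for
  \<open>\<tau>[x|\<beta> \<gamma>]\<close> puts the inner value of the pairing on the right of \<open>\<beta>\<^sub>1\<close>; the Takeuchi condition
  carries it over to the left of \<open>\<gamma>\<^sub>2\<close>.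
\<close>

lemma W_mult_arg:
  assumes G: "sbal G" and x: "x \<in> carrier L" and \<beta>: "\<beta> \<in> carrier U" and \<gamma>: "\<gamma> \<in> carrier U"
  shows "W x (\<beta> \<otimes>\<^bsub>U\<^esub> \<gamma>) G = W x \<beta> (\<lambda>\<beta>' x'. W x' \<gamma> (\<lambda>\<gamma>' x''. G (\<beta>' \<otimes>\<^bsub>U\<^esub> \<gamma>') x''))"
proof -
  have g: "additive_on B (\<lambda>b. G (src U b \<otimes>\<^bsub>U\<^esub> \<alpha>) z)" if "\<alpha> \<in> carrier U" "z \<in> carrier L" for \<alpha> z
    by (rule additive_onI) (use that in \<open>simp add: additives balancedD[OF G]\<close>)
  have gr: "additive_on U (\<lambda>\<alpha>. G (\<alpha> \<otimes>\<^bsub>U\<^esub> \<delta>) z)" if "\<delta> \<in> carrier U" "z \<in> carrier L" for \<delta> z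
    by (rule additive_onI) (use that in \<open>simp add: additives balancedD[OF G]\<close>)
  have gl: "additive_on U (\<lambda>\<alpha>. G (\<delta> \<otimes>\<^bsub>U\<^esub> \<alpha>) z)" if "\<delta> \<in> carrier U" "z \<in> carrier L" for \<delta> z
    by (rule additive_onI) (use that in \<open>simp add: additives balancedD[OF G]\<close>)
  define f where "f x1 x2 x3 = csum U \<gamma> (\<lambda>\<gamma>1 \<gamma>2. csum U \<beta> (\<lambda>\<beta>1 \<beta>2.
      G (src U (\<tau> x1 \<beta>1) \<otimes>\<^bsub>U\<^esub> (\<beta>2 \<otimes>\<^bsub>U\<^esub> (src U (\<tau> x2 \<gamma>1) \<otimes>\<^bsub>U\<^esub> \<gamma>2))) x3))" for x1 x2 x3
  have tak_\<beta>: "csum U \<beta> (\<lambda>\<beta>1 \<beta>2. G (src U (\<tau> x1 (\<beta>1 \<otimes>\<^bsub>U\<^esub> tgt U b)) \<otimes>\<^bsub>U\<^esub> (\<beta>2 \<otimes>\<^bsub>U\<^esub> \<delta>)) z)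
      = csum U \<beta> (\<lambda>\<beta>1 \<beta>2. G (src U (\<tau> x1 \<beta>1) \<otimes>\<^bsub>U\<^esub> (\<beta>2 \<otimes>\<^bsub>U\<^esub> (src U b \<otimes>\<^bsub>U\<^esub> \<delta>))) z)"
    if "x1 \<in> carrier L" "b \<in> carrier B" "\<delta> \<in> carrier U" "z \<in> carrier L" for x1 b \<delta> z
    using U.csum_takeuchi[OF left_kernel[OF gr[OF that(3,4)] that(1)] that(2) \<beta>] that
    by (simp add: assocs)
  have b3: "L.bal3 f"
  proof (rule balanced3I)
    fix b x1 x2 x3 assume *: "b \<in> carrier B" "x1 \<in> carrier L" "x2 \<in> carrier L" "x3 \<in> carrier L"
    show "f (tgt L b \<otimes>\<^bsub>L\<^esub> x1) x2 x3 = f x1 (src L b \<otimes>\<^bsub>L\<^esub> x2) x3"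
      unfolding f_def using * by (simp add: pairing_B tak_\<beta> mults assocs)
    have "csum U \<gamma> (\<lambda>\<gamma>1 \<gamma>2. csum U \<beta> (\<lambda>\<beta>1 \<beta>2. G (src U (\<tau> x1 \<beta>1) \<otimes>\<^bsub>U\<^esub> (\<beta>2 \<otimes>\<^bsub>U\<^esub> (src U (\<tau> x2 (\<gamma>1 \<otimes>\<^bsub>U\<^esub> tgt U b)) \<otimes>\<^bsub>U\<^esub> \<gamma>2))) x3))
        = csum U \<gamma> (\<lambda>\<gamma>1 \<gamma>2. csum U \<beta> (\<lambda>\<beta>1 \<beta>2. G (src U (\<tau> x1 \<beta>1) \<otimes>\<^bsub>U\<^esub> (\<beta>2 \<otimes>\<^bsub>U\<^esub> (src U (\<tau> x2 \<gamma>1) \<otimes>\<^bsub>U\<^esub> (\<gamma>2 \<otimes>\<^bsub>U\<^esub> src U b)))) x3))"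
    proof -
      have "csum U \<gamma> (\<lambda>\<gamma>1 \<gamma>2. G (\<delta> \<otimes>\<^bsub>U\<^esub> (src U (\<tau> x2 (\<gamma>1 \<otimes>\<^bsub>U\<^esub> tgt U b)) \<otimes>\<^bsub>U\<^esub> \<gamma>2)) x3)
        = csum U \<gamma> (\<lambda>\<gamma>1 \<gamma>2. G (\<delta> \<otimes>\<^bsub>U\<^esub> (src U (\<tau> x2 \<gamma>1) \<otimes>\<^bsub>U\<^esub> (\<gamma>2 \<otimes>\<^bsub>U\<^esub> src U b))) x3)" if "\<delta> \<in> carrier U" for \<delta>
        using U.csum_takeuchi[OF left_kernel[OF gl[OF that *(4)] *(3)] *(1) \<gamma>] .
      then have "csum U \<beta> (\<lambda>\<beta>1 \<beta>2. csum U \<gamma> (\<lambda>\<gamma>1 \<gamma>2. G ((src U (\<tau> x1 \<beta>1) \<otimes>\<^bsub>U\<^esub> \<beta>2) \<otimes>\<^bsub>U\<^esub> (src U (\<tau> x2 (\<gamma>1 \<otimes>\<^bsub>U\<^esub> tgt U b)) \<otimes>\<^bsub>U\<^esub> \<gamma>2)) x3))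
        = csum U \<beta> (\<lambda>\<beta>1 \<beta>2. csum U \<gamma> (\<lambda>\<gamma>1 \<gamma>2. G ((src U (\<tau> x1 \<beta>1) \<otimes>\<^bsub>U\<^esub> \<beta>2) \<otimes>\<^bsub>U\<^esub> (src U (\<tau> x2 \<gamma>1) \<otimes>\<^bsub>U\<^esub> (\<gamma>2 \<otimes>\<^bsub>U\<^esub> src U b))) x3))"
        using * by simp
      then show ?thesis using * by (simp add: assocs csum_commute[of U \<gamma>])
    qed
    moreover have "G (src U (\<tau> x1 \<beta>1) \<otimes>\<^bsub>U\<^esub> (\<beta>2 \<otimes>\<^bsub>U\<^esub> (src U (\<tau> x2 \<gamma>1) \<otimes>\<^bsub>U\<^esub> (\<gamma>2 \<otimes>\<^bsub>U\<^esub> src U b)))) x3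
        = G (src U (\<tau> x1 \<beta>1) \<otimes>\<^bsub>U\<^esub> (\<beta>2 \<otimes>\<^bsub>U\<^esub> (src U (\<tau> x2 \<gamma>1) \<otimes>\<^bsub>U\<^esub> \<gamma>2))) (src L b \<otimes>\<^bsub>L\<^esub> x3)"
      if "\<beta>1 \<in> carrier U" "\<beta>2 \<in> carrier U" "\<gamma>1 \<in> carrier U" "\<gamma>2 \<in> carrier U" for \<beta>1 \<beta>2 \<gamma>1 \<gamma>2
      using balancedD(3)[OF G *(1), of "src U (\<tau> x1 \<beta>1) \<otimes>\<^bsub>U\<^esub> (\<beta>2 \<otimes>\<^bsub>U\<^esub> (src U (\<tau> x2 \<gamma>1) \<otimes>\<^bsub>U\<^esub> \<gamma>2))" x3] that *
      by (simp add: assocs)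
    ultimately show "f x1 (tgt L b \<otimes>\<^bsub>L\<^esub> x2) x3 = f x1 x2 (src L b \<otimes>\<^bsub>L\<^esub> x3)"
      unfolding f_def using * by (simp add: pairing_B)
  qed (unfold f_def, simp_all add: pairing_adds additives balancedD[OF G] csum_plus)
  have "W x (\<beta> \<otimes>\<^bsub>U\<^esub> \<gamma>) G = csum L x (\<lambda>x' x3. csum U \<beta> (\<lambda>\<beta>1 \<beta>2. csum U \<gamma> (\<lambda>\<gamma>1 \<gamma>2.
      G (src U (\<tau> x' (\<beta>1 \<otimes>\<^bsub>U\<^esub> \<gamma>1)) \<otimes>\<^bsub>U\<^esub> (\<beta>2 \<otimes>\<^bsub>U\<^esub> \<gamma>2)) x3)))"
    unfolding W_eq using \<beta> \<gamma> by (simp add: U.csum_mult[OF left_kernel[OF sbal_additive(1)[OF G]]])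
  also have "\<dots> = csum L x (\<lambda>x' x3. csum L x' (\<lambda>x1 x2. f x1 x2 x3))"
  proof (rule csum_cong[OF refl])
    fix x' x3 assume *: "x' \<in> carrier L" "x3 \<in> carrier L"
    have "csum U \<beta> (\<lambda>\<beta>1 \<beta>2. csum U \<gamma> (\<lambda>\<gamma>1 \<gamma>2. G (src U (\<tau> x' (\<beta>1 \<otimes>\<^bsub>U\<^esub> \<gamma>1)) \<otimes>\<^bsub>U\<^esub> (\<beta>2 \<otimes>\<^bsub>U\<^esub> \<gamma>2)) x3))
      = csum U \<beta> (\<lambda>\<beta>1 \<beta>2. csum U \<gamma> (\<lambda>\<gamma>1 \<gamma>2. csum L x' (\<lambda>x1 x2.
          G (src U (\<tau> x1 (\<beta>1 \<otimes>\<^bsub>U\<^esub> tgt U (\<tau> x2 \<gamma>1))) \<otimes>\<^bsub>U\<^esub> (\<beta>2 \<otimes>\<^bsub>U\<^esub> \<gamma>2)) x3)))"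
      using * by (simp add: pairing_mult_arg[OF g])
    also have "\<dots> = csum L x' (\<lambda>x1 x2. csum U \<gamma> (\<lambda>\<gamma>1 \<gamma>2. csum U \<beta> (\<lambda>\<beta>1 \<beta>2.
          G (src U (\<tau> x1 (\<beta>1 \<otimes>\<^bsub>U\<^esub> tgt U (\<tau> x2 \<gamma>1))) \<otimes>\<^bsub>U\<^esub> (\<beta>2 \<otimes>\<^bsub>U\<^esub> \<gamma>2)) x3)))"
      by (subst csum_commute[of U \<beta>], subst csum_commute[of U \<beta> L], rule csum_commute)
    also have "\<dots> = csum L x' (\<lambda>x1 x2. f x1 x2 x3)"
      unfolding f_def using * by (simp add: tak_\<beta>)
    finally show "csum U \<beta> (\<lambda>\<beta>1 \<beta>2. csum U \<gamma> (\<lambda>\<gamma>1 \<gamma>2. G (src U (\<tau> x' (\<beta>1 \<otimes>\<^bsub>U\<^esub> \<gamma>1)) \<otimes>\<^bsub>U\<^esub> (\<beta>2 \<otimes>\<^bsub>U\<^esub> \<gamma>2)) x3))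
      = csum L x' (\<lambda>x1 x2. f x1 x2 x3)" .
  qed
  also have "\<dots> = csum L x (\<lambda>x1 x'. csum L x' (\<lambda>x2 x3. f x1 x2 x3))"
    by (rule L.csum_coassoc[OF b3])
  also have "\<dots> = csum L x (\<lambda>x1 x'. csum U \<beta> (\<lambda>\<beta>1 \<beta>2. csum L x' (\<lambda>x2 x3. csum U \<gamma> (\<lambda>\<gamma>1 \<gamma>2.
      G ((src U (\<tau> x1 \<beta>1) \<otimes>\<^bsub>U\<^esub> \<beta>2) \<otimes>\<^bsub>U\<^esub> (src U (\<tau> x2 \<gamma>1) \<otimes>\<^bsub>U\<^esub> \<gamma>2)) x3))))"
  proof (rule csum_cong[OF refl])
    fix x1 x' assume *: "x1 \<in> carrier L" "x' \<in> carrier L"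
    have "csum L x' (\<lambda>x2 x3. f x1 x2 x3) = csum L x' (\<lambda>x2 x3. csum U \<beta> (\<lambda>\<beta>1 \<beta>2. csum U \<gamma> (\<lambda>\<gamma>1 \<gamma>2.
      G (src U (\<tau> x1 \<beta>1) \<otimes>\<^bsub>U\<^esub> (\<beta>2 \<otimes>\<^bsub>U\<^esub> (src U (\<tau> x2 \<gamma>1) \<otimes>\<^bsub>U\<^esub> \<gamma>2))) x3)))"
      unfolding f_def by (rule csum_cong[OF refl], rule csum_commute)
    also have "\<dots> = csum U \<beta> (\<lambda>\<beta>1 \<beta>2. csum L x' (\<lambda>x2 x3. csum U \<gamma> (\<lambda>\<gamma>1 \<gamma>2.
      G (src U (\<tau> x1 \<beta>1) \<otimes>\<^bsub>U\<^esub> (\<beta>2 \<otimes>\<^bsub>U\<^esub> (src U (\<tau> x2 \<gamma>1) \<otimes>\<^bsub>U\<^esub> \<gamma>2))) x3)))"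
      by (rule csum_commute)
    finally show "csum L x' (\<lambda>x2 x3. f x1 x2 x3) = csum U \<beta> (\<lambda>\<beta>1 \<beta>2. csum L x' (\<lambda>x2 x3. csum U \<gamma> (\<lambda>\<gamma>1 \<gamma>2.
      G ((src U (\<tau> x1 \<beta>1) \<otimes>\<^bsub>U\<^esub> \<beta>2) \<otimes>\<^bsub>U\<^esub> (src U (\<tau> x2 \<gamma>1) \<otimes>\<^bsub>U\<^esub> \<gamma>2)) x3)))"
      using * by (simp add: assocs)
  qed
  also have "\<dots> = W x \<beta> (\<lambda>\<beta>' x'. W x' \<gamma> (\<lambda>\<gamma>' x''. G (\<beta>' \<otimes>\<^bsub>U\<^esub> \<gamma>') x''))"
    by (simp add: W_eq)
  finally show ?thesis .
qed

text \<open>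
  The axiom for \<open>\<tau>[x y|\<gamma>\<^sub>-]\<close> splits \<open>\<gamma>\<^sub>-\<close> by its coproduct, and \<open>pm_pm\<close> rewrites
  \<open>\<gamma>\<^sub>+ \<otimes> \<gamma>\<^sub>-\<^sub>1 \<otimes> \<gamma>\<^sub>-\<^sub>2\<close> as the iterated translation \<open>\<gamma>\<^sub>+\<^sub>+ \<otimes> \<gamma>\<^sub>- \<otimes> \<gamma>\<^sub>+\<^sub>-\<close> of the right-hand side.
\<close>

lemma V_mult:
  assumes F: "tbal F" and x: "x \<in> carrier L" and y: "y \<in> carrier L" and \<gamma>: "\<gamma> \<in> carrier U"
  shows "V \<gamma> (x \<otimes>\<^bsub>L\<^esub> y) F = V \<gamma> y (\<lambda>\<gamma>' y'. V \<gamma>' x (\<lambda>\<alpha> x'. F \<alpha> (x' \<otimes>\<^bsub>L\<^esub> y')))"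
proof -
  have g: "additive_on B (\<lambda>b. F p (tgt L b \<otimes>\<^bsub>L\<^esub> z))" if "p \<in> carrier U" "z \<in> carrier L" for p z
    by (rule additive_onI) (use that in \<open>simp add: additives balancedD[OF F]\<close>)
  have gr: "additive_on L (\<lambda>z. F p (z \<otimes>\<^bsub>L\<^esub> w))" if "p \<in> carrier U" "w \<in> carrier L" for p w
    by (rule additive_onI) (use that in \<open>simp add: additives balancedD[OF F]\<close>)
  define f where "f p m1 m2 = csum L y (\<lambda>y1 y2. csum L x (\<lambda>x1 x2.
      F p (tgt L (\<tau> x2 (src U (\<tau> y2 m1) \<otimes>\<^bsub>U\<^esub> m2)) \<otimes>\<^bsub>L\<^esub> (x1 \<otimes>\<^bsub>L\<^esub> y1))))" for p m1 m2
  have f_tak: "f p m1 m2 = csum L y (\<lambda>y1 y2. csum L x (\<lambda>x1 x2.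
      F p ((tgt L (\<tau> x2 m2) \<otimes>\<^bsub>L\<^esub> x1) \<otimes>\<^bsub>L\<^esub> (tgt L (\<tau> y2 m1) \<otimes>\<^bsub>L\<^esub> y1))))"
    if *: "p \<in> carrier U" "m1 \<in> carrier U" "m2 \<in> carrier U" for p m1 m2
    unfolding f_def
  proof (rule csum_cong[OF refl])
    fix y1 y2 assume **: "y1 \<in> carrier L" "y2 \<in> carrier L"
    show "csum L x (\<lambda>x1 x2. F p (tgt L (\<tau> x2 (src U (\<tau> y2 m1) \<otimes>\<^bsub>U\<^esub> m2)) \<otimes>\<^bsub>L\<^esub> (x1 \<otimes>\<^bsub>L\<^esub> y1)))
        = csum L x (\<lambda>x1 x2. F p ((tgt L (\<tau> x2 m2) \<otimes>\<^bsub>L\<^esub> x1) \<otimes>\<^bsub>L\<^esub> (tgt L (\<tau> y2 m1) \<otimes>\<^bsub>L\<^esub> y1)))"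
      using L.csum_takeuchi[OF right_kernel[OF gr[OF *(1) **(1)] *(3)] pairing_closed[OF **(2) *(2)] x] * **
      by (simp add: pairing_B assocs)
  qed
  have "V \<gamma> (x \<otimes>\<^bsub>L\<^esub> y) F = pmsum K B U \<gamma> (\<lambda>p m. csum L x (\<lambda>x1 x2. csum L y (\<lambda>y1 y2.
      F p (tgt L (\<tau> (x2 \<otimes>\<^bsub>L\<^esub> y2) m) \<otimes>\<^bsub>L\<^esub> (x1 \<otimes>\<^bsub>L\<^esub> y1)))))"
    unfolding V_eq using x y by (simp add: L.csum_mult right_kernel[OF tbal_additive(2)[OF F]])
  also have "\<dots> = pmsum K B U \<gamma> (\<lambda>p m. csum U m (\<lambda>m1 m2. f p m1 m2))"
  proof (rule pmsum_cong[OF refl])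
    fix p m assume *: "p \<in> carrier U" "m \<in> carrier U"
    have "csum L x (\<lambda>x1 x2. csum L y (\<lambda>y1 y2. F p (tgt L (\<tau> (x2 \<otimes>\<^bsub>L\<^esub> y2) m) \<otimes>\<^bsub>L\<^esub> (x1 \<otimes>\<^bsub>L\<^esub> y1))))
      = csum L x (\<lambda>x1 x2. csum L y (\<lambda>y1 y2. csum U m (\<lambda>m1 m2. F p (tgt L (\<tau> x2 (src U (\<tau> y2 m1) \<otimes>\<^bsub>U\<^esub> m2)) \<otimes>\<^bsub>L\<^esub> (x1 \<otimes>\<^bsub>L\<^esub> y1)))))"
      using * by (simp add: pairing_mult[OF g])
    also have "\<dots> = csum U m (\<lambda>m1 m2. f p m1 m2)"
      unfolding f_def by (subst csum_commute[of L x L], subst csum_commute[of L x U], rule csum_commute)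
    finally show "csum L x (\<lambda>x1 x2. csum L y (\<lambda>y1 y2. F p (tgt L (\<tau> (x2 \<otimes>\<^bsub>L\<^esub> y2) m) \<otimes>\<^bsub>L\<^esub> (x1 \<otimes>\<^bsub>L\<^esub> y1))))
      = csum U m (\<lambda>m1 m2. f p m1 m2)" .
  qed
  also have "\<dots> = pmsum K B U \<gamma> (\<lambda>p m. pmsum K B U p (\<lambda>p' m'. f p' m m'))"
  proof (rule U.pm_pm[symmetric, OF _ _ _ \<gamma>])
    show "U.bal (f p)" if "p \<in> carrier U" for p
      unfolding f_def
      by (rule balancedI)
         (use that in \<open>simp_all add: pairing_adds additives balancedD[OF F] csum_plus pairing_B mults assocs commutes\<close>)
  qed (simp_all add: f_def pairing_adds additives balancedD[OF F] csum_plus pairing_B mults assocs commutes)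
  also have "\<dots> = pmsum K B U \<gamma> (\<lambda>p m. pmsum K B U p (\<lambda>p' m'. csum L y (\<lambda>y1 y2. csum L x (\<lambda>x1 x2.
      F p' ((tgt L (\<tau> x2 m') \<otimes>\<^bsub>L\<^esub> x1) \<otimes>\<^bsub>L\<^esub> (tgt L (\<tau> y2 m) \<otimes>\<^bsub>L\<^esub> y1))))))"
    by (simp add: f_tak)
  also have "\<dots> = V \<gamma> y (\<lambda>\<gamma>' y'. V \<gamma>' x (\<lambda>\<alpha> x'. F \<alpha> (x' \<otimes>\<^bsub>L\<^esub> y')))"
    by (simp add: V_eq csum_pmsum_commute)
  finally show ?thesis .
qed

text \<open>
  The translation map is antimultiplicative in its second component (\<open>pm_mult\<close>), which
  matches the order in which \<open>x\<close> passes the factors.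
\<close>

lemma V_mult_arg:
  assumes F: "tbal F" and x: "x \<in> carrier L" and \<beta>: "\<beta> \<in> carrier U" and \<gamma>: "\<gamma> \<in> carrier U"
  shows "V (\<beta> \<otimes>\<^bsub>U\<^esub> \<gamma>) x F = V \<beta> x (\<lambda>\<beta>' x'. V \<gamma> x' (\<lambda>\<gamma>' x''. F (\<beta>' \<otimes>\<^bsub>U\<^esub> \<gamma>') x''))"
proof -
  have g: "additive_on B (\<lambda>b. F p (tgt L b \<otimes>\<^bsub>L\<^esub> z))" if "p \<in> carrier U" "z \<in> carrier L" for p z
    by (rule additive_onI) (use that in \<open>simp add: additives balancedD[OF F]\<close>)
  have b3: "L.bal3 (\<lambda>x1 x2 x3. F p (tgt L (\<tau> (tgt L (\<tau> x3 m) \<otimes>\<^bsub>L\<^esub> x2) n) \<otimes>\<^bsub>L\<^esub> x1))"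
    if "p \<in> carrier U" "m \<in> carrier U" "n \<in> carrier U" for p m n
    by (rule balanced3I)
       (use that in \<open>simp_all add: additives pairing_adds balancedD[OF F] pairing_B mults assocs commutes\<close>)
  have "V (\<beta> \<otimes>\<^bsub>U\<^esub> \<gamma>) x F = pmsum K B U \<beta> (\<lambda>p m. pmsum K B U \<gamma> (\<lambda>q n. csum L x (\<lambda>x1 x2.
      F (p \<otimes>\<^bsub>U\<^esub> q) (tgt L (\<tau> x2 (n \<otimes>\<^bsub>U\<^esub> m)) \<otimes>\<^bsub>L\<^esub> x1))))"
    unfolding V_eq using \<beta> \<gamma> by (simp add: U.pm_mult[OF V_kernel[OF F x]])
  also have "\<dots> = pmsum K B U \<beta> (\<lambda>p m. pmsum K B U \<gamma> (\<lambda>q n. csum L x (\<lambda>x1 x'. csum L x' (\<lambda>x2 x3.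
      F (p \<otimes>\<^bsub>U\<^esub> q) (tgt L (\<tau> (tgt L (\<tau> x3 m) \<otimes>\<^bsub>L\<^esub> x2) n) \<otimes>\<^bsub>L\<^esub> x1)))))"
    by (simp add: pairing_mult_arg[OF g] pairing_B)
  also have "\<dots> = pmsum K B U \<beta> (\<lambda>p m. pmsum K B U \<gamma> (\<lambda>q n. csum L x (\<lambda>x' x3. csum L x' (\<lambda>x1 x2.
      F (p \<otimes>\<^bsub>U\<^esub> q) (tgt L (\<tau> (tgt L (\<tau> x3 m) \<otimes>\<^bsub>L\<^esub> x2) n) \<otimes>\<^bsub>L\<^esub> x1)))))"
    by (simp add: L.csum_coassoc[OF b3])
  also have "\<dots> = V \<beta> x (\<lambda>\<beta>' x'. V \<gamma> x' (\<lambda>\<gamma>' x''. F (\<beta>' \<otimes>\<^bsub>U\<^esub> \<gamma>') x''))"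
    unfolding V_eq
    by (simp add: L.csum_tgt[OF right_kernel[OF tbal_additive(2)[OF F]]] csum_pmsum_commute)
  finally show ?thesis .
qed

lemma W_one_left:
  assumes G: "sbal G" and \<beta>: "\<beta> \<in> carrier U"
  shows "W \<one>\<^bsub>L\<^esub> \<beta> G = G \<beta> \<one>\<^bsub>L\<^esub>"
  unfolding W_eq using \<beta>
  by (simp add: L.csum_one[OF W_kernel[OF G]] U.csum_counit_left[OF sbal_additive(1)[OF G]])

lemma W_one_right:
  assumes G: "sbal G" and x: "x \<in> carrier L"
  shows "W x \<one>\<^bsub>U\<^esub> G = G \<one>\<^bsub>U\<^esub> x"
proof -
  have "G (src U (counit L x1)) x2 = G \<one>\<^bsub>U\<^esub> (src L (counit L x1) \<otimes>\<^bsub>L\<^esub> x2)" if "x1 \<in> carrier L" "x2 \<in> carrier L" for x1 x2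
    using balancedD(3)[OF G, of "counit L x1" "\<one>\<^bsub>U\<^esub>" x2] that by simp
  then show ?thesis
    unfolding W_eq using x
    by (simp add: U.csum_one[OF left_kernel[OF sbal_additive(1)[OF G]]] L.csum_counit_left[OF sbal_additive(2)[OF G]])
qed

lemma V_one_left:
  assumes F: "tbal F" and x: "x \<in> carrier L"
  shows "V \<one>\<^bsub>U\<^esub> x F = F \<one>\<^bsub>U\<^esub> x"
  unfolding V_eq using x
  by (simp add: U.pm_one[OF V_kernel[OF F]] L.csum_counit_right[OF tbal_additive(2)[OF F]])

lemma V_one_right:
  assumes F: "tbal F" and \<beta>: "\<beta> \<in> carrier U"
  shows "V \<beta> \<one>\<^bsub>L\<^esub> F = F \<beta> \<one>\<^bsub>L\<^esub>"
proof -
  have "F p (tgt L (counit U m)) = F (p \<otimes>\<^bsub>U\<^esub> tgt U (counit U m)) \<one>\<^bsub>L\<^esub>" if "p \<in> carrier U" "m \<in> carrier U" for p m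
    using balancedD(3)[OF F, of "counit U m" p "\<one>\<^bsub>L\<^esub>"] that by simp
  then show ?thesis
    unfolding V_eq using \<beta>
    by (simp add: L.csum_one[OF right_kernel[OF tbal_additive(2)[OF F]]] U.pm_counit_right[OF tbal_additive(1)[OF F]])
qed

end

section \<open>Two skew pairings\<close>

definition cross ::
  "('k, 'i) ring_scheme \<Rightarrow> ('k, 'b, 'w) module_scheme \<Rightarrow> ('k, 'b, 'p, 'n) bialgebroid_scheme
    \<Rightarrow> ('k, 'b, 'l, 'm) bialgebroid_scheme \<Rightarrow> ('l \<Rightarrow> 'p \<Rightarrow> 'b) \<Rightarrow> ('l \<Rightarrow> 'p \<Rightarrow> 'b)
    \<Rightarrow> 'l \<Rightarrow> 'p \<Rightarrow> ('p \<Rightarrow> 'l \<Rightarrow> circle) \<Rightarrow> circle"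
  where "cross K B U L \<tau> \<kappa> x \<beta> F = cross_left U L \<tau> x \<beta> (\<lambda>\<alpha> y. cross_right K B U L \<kappa> \<alpha> y F)"

lemma cross_cong [cong]:
  assumes "x = y" "\<beta> = \<gamma>" "\<And>\<alpha> z. \<alpha> \<in> carrier U \<Longrightarrow> z \<in> carrier L \<Longrightarrow> F \<alpha> z = G \<alpha> z"
  shows "cross K B U L \<tau> \<kappa> x \<beta> F = cross K B U L \<tau> \<kappa> y \<gamma> G"
  unfolding cross_def using assms by simp

text \<open>
  A Sweedler sum for the coproduct of \<open>\<alpha> \<otimes> x\<close>, componentwise as in the double.
\<close>

definition cosum ::
  "('k, 'b, 'p, 'n) bialgebroid_scheme \<Rightarrow> ('k, 'b, 'l, 'm) bialgebroid_scheme
    \<Rightarrow> ('p \<Rightarrow> 'l \<Rightarrow> 'p \<Rightarrow> 'l \<Rightarrow> circle) \<Rightarrow> 'p \<Rightarrow> 'l \<Rightarrow> circle"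
  where "cosum U L J \<alpha> x = csum U \<alpha> (\<lambda>\<alpha>1 \<alpha>2. csum L x (\<lambda>x1 x2. J \<alpha>1 x1 \<alpha>2 x2))"

locale hopf_pairings = hopf_pair K B U L + t: hopf_pairing K B U L \<tau> + k: hopf_pairing K B U L \<kappa>
  for K :: "('k, 'i) ring_scheme" and B :: "('k, 'b, 'w) module_scheme"
    and U :: "('k, 'b, 'p, 'n) bialgebroid_scheme" and L :: "('k, 'b, 'l, 'm) bialgebroid_scheme"
    and \<tau> \<kappa> :: "'l \<Rightarrow> 'p \<Rightarrow> 'b"
begin

abbreviation "R \<equiv> cross K B U L \<tau> \<kappa>"

text \<open>
  The two halves act on the same \<open>\<gamma>\<close> but on different elements \<open>y\<close> and \<open>x\<close>.  They may be exchanged because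
  \<open>\<gamma>\<^sub>1 \<otimes> \<gamma>\<^sub>2\<^sub>+ \<otimes> \<gamma>\<^sub>2\<^sub>- = \<gamma>\<^sub>+\<^sub>1 \<otimes> \<gamma>\<^sub>+\<^sub>2 \<otimes> \<gamma>\<^sub>-\<close>.
\<close>

lemma V_W_swap:
  assumes t: "\<And>x. x \<in> carrier L \<Longrightarrow> tbal (\<lambda>\<alpha> y. J \<alpha> x y)"
    and x: "x \<in> carrier L" and y: "y \<in> carrier L" and \<gamma>: "\<gamma> \<in> carrier U"
  shows "k.V \<gamma> y (\<lambda>\<gamma>' y'. t.W x \<gamma>' (\<lambda>\<alpha> x'. J \<alpha> x' y')) = t.W x \<gamma> (\<lambda>\<gamma>' x'. k.V \<gamma>' y (\<lambda>\<alpha> y'. J \<alpha> x' y'))"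
proof -
  define f where "f x1 x2 \<gamma>1 p m = csum L y (\<lambda>y1 y2. J (src U (\<tau> x1 \<gamma>1) \<otimes>\<^bsub>U\<^esub> p) x2 (tgt L (\<kappa> y2 m) \<otimes>\<^bsub>L\<^esub> y1))"
    for x1 x2 \<gamma>1 p m
  have swap: "pmsum K B U \<gamma> (\<lambda>p m. csum U p (\<lambda>p1 p2. f x1 x2 p1 p2 m))
      = csum U \<gamma> (\<lambda>\<gamma>1 \<gamma>2. pmsum K B U \<gamma>2 (\<lambda>p m. f x1 x2 \<gamma>1 p m))"
    if *: "x1 \<in> carrier L" "x2 \<in> carrier L" for x1 x2
  proof (rule U.csum_pm[symmetric, OF _ _ _ \<gamma>])
    show "U.lbal (f x1 x2 \<gamma>1)" if "\<gamma>1 \<in> carrier U" for \<gamma>1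
      unfolding f_def
      by (rule balancedI)
         (use that * in \<open>simp_all add: additives k.pairing_adds balancedD[OF t] csum_plus
           k.pairing_B mults assocs tbal_assoc[OF t]\<close>)
  qed (use * in \<open>simp_all add: f_def additives t.pairing_adds balancedD[OF t] csum_plus t.pairing_B mults assocs\<close>)
  have "k.V \<gamma> y (\<lambda>\<gamma>' y'. t.W x \<gamma>' (\<lambda>\<alpha> x'. J \<alpha> x' y'))
      = pmsum K B U \<gamma> (\<lambda>p m. csum L y (\<lambda>y1 y2. csum L x (\<lambda>x1 x2. csum U p (\<lambda>p1 p2.
          J (src U (\<tau> x1 p1) \<otimes>\<^bsub>U\<^esub> p2) x2 (tgt L (\<kappa> y2 m) \<otimes>\<^bsub>L\<^esub> y1)))))"
    by (simp add: k.V_eq t.W_eq)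
  also have "\<dots> = pmsum K B U \<gamma> (\<lambda>p m. csum L x (\<lambda>x1 x2. csum U p (\<lambda>p1 p2. f x1 x2 p1 p2 m)))"
    unfolding f_def
    by (rule pmsum_cong[OF refl], subst csum_commute, rule csum_cong[OF refl], rule csum_commute)
  also have "\<dots> = csum L x (\<lambda>x1 x2. pmsum K B U \<gamma> (\<lambda>p m. csum U p (\<lambda>p1 p2. f x1 x2 p1 p2 m)))"
    by (rule csum_pmsum_commute[symmetric])
  also have "\<dots> = csum L x (\<lambda>x1 x2. csum U \<gamma> (\<lambda>\<gamma>1 \<gamma>2. pmsum K B U \<gamma>2 (\<lambda>p m. f x1 x2 \<gamma>1 p m)))"
    by (simp add: swap)
  also have "\<dots> = t.W x \<gamma> (\<lambda>\<gamma>' x'. k.V \<gamma>' y (\<lambda>\<alpha> y'. J \<alpha> x' y'))"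
    unfolding t.W_eq using y by (simp add: k.V_src[OF t]) (simp add: k.V_eq f_def)
  finally show ?thesis .
qed

text \<open>
  Dually, the two halves act on the same \<open>x\<close> but on different elements \<open>\<gamma>\<close> and \<open>\<beta>\<close>; here they may be exchanged by
  the coassociativity of the coproduct of \<open>x\<close>, the left half using \<open>x\<^sub>1\<close> and the right half \<open>x\<^sub>3\<close>.
\<close>

lemma W_V_swap:
  assumes s: "\<And>\<beta>. \<beta> \<in> carrier U \<Longrightarrow> sbal (\<lambda>\<gamma> x. J \<gamma> \<beta> x)"
    and x: "x \<in> carrier L" and \<beta>: "\<beta> \<in> carrier U" and \<gamma>: "\<gamma> \<in> carrier U"
  shows "t.W x \<gamma> (\<lambda>\<gamma>' x'. k.V \<beta> x' (\<lambda>\<beta>' x''. J \<gamma>' \<beta>' x''))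
    = k.V \<beta> x (\<lambda>\<beta>' x'. t.W x' \<gamma> (\<lambda>\<gamma>' x''. J \<gamma>' \<beta>' x''))"
proof -
  define f where "f p m x1 x2 x3 = csum U \<gamma> (\<lambda>\<gamma>1 \<gamma>2. J (src U (\<tau> x1 \<gamma>1) \<otimes>\<^bsub>U\<^esub> \<gamma>2) p (tgt L (\<kappa> x3 m) \<otimes>\<^bsub>L\<^esub> x2))"
    for p m x1 x2 x3
  have b3: "L.bal3 (f p m)" if *: "p \<in> carrier U" "m \<in> carrier U" for p m
  proof (rule balanced3I)
    fix b x1 x2 x3 assume **: "b \<in> carrier B" "x1 \<in> carrier L" "x2 \<in> carrier L" "x3 \<in> carrier L"
    have "tgt L (\<kappa> x3 m) \<otimes>\<^bsub>L\<^esub> x2 \<in> carrier L" using * ** by simp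
    from U.csum_takeuchi[OF t.left_kernel[OF t.sbal_additive(1)[OF s[OF *(1)] this] **(2)] **(1) \<gamma>]
    show "f p m (tgt L b \<otimes>\<^bsub>L\<^esub> x1) x2 x3 = f p m x1 (src L b \<otimes>\<^bsub>L\<^esub> x2) x3"
      unfolding f_def using * ** by (simp add: t.pairing_B sbal_assoc[OF s] commutes)
  qed (use * in \<open>simp_all add: f_def additives t.pairing_adds k.pairing_adds balancedD[OF s] csum_plus
        k.pairing_B mults assocs\<close>)
  have "t.W x \<gamma> (\<lambda>\<gamma>' x'. k.V \<beta> x' (\<lambda>\<beta>' x''. J \<gamma>' \<beta>' x''))
      = csum L x (\<lambda>x1 x'. csum U \<gamma> (\<lambda>\<gamma>1 \<gamma>2. pmsum K B U \<beta> (\<lambda>p m. csum L x' (\<lambda>x2 x3.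
          J (src U (\<tau> x1 \<gamma>1) \<otimes>\<^bsub>U\<^esub> \<gamma>2) p (tgt L (\<kappa> x3 m) \<otimes>\<^bsub>L\<^esub> x2)))))"
    by (simp add: k.V_eq t.W_eq)
  also have "\<dots> = pmsum K B U \<beta> (\<lambda>p m. csum L x (\<lambda>x1 x'. csum L x' (\<lambda>x2 x3. f p m x1 x2 x3)))"
    unfolding f_def
    by (subst csum_pmsum_commute, subst csum_pmsum_commute, intro pmsum_cong[OF refl] csum_cong[OF refl] csum_commute)
  also have "\<dots> = pmsum K B U \<beta> (\<lambda>p m. csum L x (\<lambda>x' x3. csum L x' (\<lambda>x1 x2. f p m x1 x2 x3)))"
    by (simp add: L.csum_coassoc[OF b3])
  also have "\<dots> = k.V \<beta> x (\<lambda>\<beta>' x'. t.W x' \<gamma> (\<lambda>\<gamma>' x''. J \<gamma>' \<beta>' x''))"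
    unfolding k.V_eq t.W_eq f_def using \<gamma>
    by (simp add: L.csum_tgt[OF t.W_kernel[OF s]])
  finally show ?thesis .
qed

lemma mult_sbal:
  assumes "sbal F" "\<gamma> \<in> carrier U" "y \<in> carrier L"
  shows "sbal (\<lambda>\<alpha> x. F (\<gamma> \<otimes>\<^bsub>U\<^esub> \<alpha>) (x \<otimes>\<^bsub>L\<^esub> y))"
  by (rule balancedI) (use assms in \<open>simp_all add: additives assocs balancedD sbal_assoc\<close>)

lemma mult_tbal:
  assumes "tbal F" "\<gamma> \<in> carrier U" "y \<in> carrier L"
  shows "tbal (\<lambda>\<alpha> x. F (\<gamma> \<otimes>\<^bsub>U\<^esub> \<alpha>) (x \<otimes>\<^bsub>L\<^esub> y))"
  by (rule balancedI) (use assms in \<open>simp_all add: additives assocs balancedD tbal_assoc\<close>)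

lemma left_sbal:
  assumes "sbal F" "\<gamma> \<in> carrier U" shows "sbal (\<lambda>\<alpha> x. F (\<gamma> \<otimes>\<^bsub>U\<^esub> \<alpha>) x)"
  by (rule balancedI) (use assms in \<open>simp_all add: additives balancedD[OF assms(1)] sbal_assoc\<close>)

lemma left_tbal:
  assumes "tbal F" "\<gamma> \<in> carrier U" shows "tbal (\<lambda>\<alpha> x. F (\<gamma> \<otimes>\<^bsub>U\<^esub> \<alpha>) x)"
  by (rule balancedI) (use assms in \<open>simp_all add: additives balancedD[OF assms(1)] tbal_assoc\<close>)

text \<open>
  Each half satisfies such a rule for products, and the swap brings the halves belonging to the
  same factor together.
\<close>

lemma R_mult:
  assumes s: "sbal F" and t: "tbal F" and x: "x \<in> carrier L" and y: "y \<in> carrier L" and \<gamma>: "\<gamma> \<in> carrier U"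
  shows "R (x \<otimes>\<^bsub>L\<^esub> y) \<gamma> F = R y \<gamma> (\<lambda>\<gamma>' y'. R x \<gamma>' (\<lambda>\<alpha> x'. F \<alpha> (x' \<otimes>\<^bsub>L\<^esub> y')))"
proof -
  have "R (x \<otimes>\<^bsub>L\<^esub> y) \<gamma> F = t.W y \<gamma> (\<lambda>\<gamma>' y'. t.W x \<gamma>' (\<lambda>\<alpha> x'. k.V \<alpha> (x' \<otimes>\<^bsub>L\<^esub> y') F))"
    unfolding cross_def by (rule t.W_mult[OF k.V_sbal[OF s t] x y \<gamma>])
  also have "\<dots> = t.W y \<gamma> (\<lambda>\<gamma>' y'. t.W x \<gamma>' (\<lambda>\<alpha> x'. k.V \<alpha> y' (\<lambda>\<alpha>' y''. k.V \<alpha>' x' (\<lambda>\<alpha>'' x''. F \<alpha>'' (x'' \<otimes>\<^bsub>L\<^esub> y'')))))"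
    by (simp add: k.V_mult[OF t])
  also have "\<dots> = t.W y \<gamma> (\<lambda>\<gamma>' y'. k.V \<gamma>' y' (\<lambda>\<gamma>'' y''. t.W x \<gamma>'' (\<lambda>\<alpha>' x'. k.V \<alpha>' x' (\<lambda>\<alpha>'' x''. F \<alpha>'' (x'' \<otimes>\<^bsub>L\<^esub> y'')))))"
    by (simp add: V_W_swap[OF k.V_tbal[OF t]] x)
  finally show ?thesis by (simp add: cross_def)
qed

lemma R_mult_arg:
  assumes s: "sbal F" and t: "tbal F" and x: "x \<in> carrier L" and \<beta>: "\<beta> \<in> carrier U" and \<gamma>: "\<gamma> \<in> carrier U"
  shows "R x (\<beta> \<otimes>\<^bsub>U\<^esub> \<gamma>) F = R x \<beta> (\<lambda>\<beta>' x'. R x' \<gamma> (\<lambda>\<gamma>' x''. F (\<beta>' \<otimes>\<^bsub>U\<^esub> \<gamma>') x''))"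
proof -
  have "R x (\<beta> \<otimes>\<^bsub>U\<^esub> \<gamma>) F = t.W x \<beta> (\<lambda>\<beta>' x'. t.W x' \<gamma> (\<lambda>\<gamma>' x''. k.V (\<beta>' \<otimes>\<^bsub>U\<^esub> \<gamma>') x'' F))"
    unfolding cross_def by (rule t.W_mult_arg[OF k.V_sbal[OF s t] x \<beta> \<gamma>])
  also have "\<dots> = t.W x \<beta> (\<lambda>\<beta>' x'. t.W x' \<gamma> (\<lambda>\<gamma>' x''. k.V \<beta>' x'' (\<lambda>\<beta>'' z. k.V \<gamma>' z (\<lambda>\<gamma>'' w. F (\<beta>'' \<otimes>\<^bsub>U\<^esub> \<gamma>'') w))))"
    by (simp add: k.V_mult_arg[OF t])
  also have "\<dots> = t.W x \<beta> (\<lambda>\<beta>' x'. k.V \<beta>' x' (\<lambda>\<beta>'' x''. t.W x'' \<gamma> (\<lambda>\<gamma>' z. k.V \<gamma>' z (\<lambda>\<gamma>'' w. F (\<beta>'' \<otimes>\<^bsub>U\<^esub> \<gamma>'') w))))"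
    by (simp add: W_V_swap[OF k.V_sbal[OF left_sbal[OF s] left_tbal[OF t]]] \<gamma>)
  finally show ?thesis by (simp add: cross_def)
qed

lemma R_one_left: "sbal F \<Longrightarrow> tbal F \<Longrightarrow> \<beta> \<in> carrier U \<Longrightarrow> R \<one>\<^bsub>L\<^esub> \<beta> F = F \<beta> \<one>\<^bsub>L\<^esub>"
  unfolding cross_def by (simp add: t.W_one_left[OF k.V_sbal] k.V_one_right)

lemma R_one_right: "sbal F \<Longrightarrow> tbal F \<Longrightarrow> x \<in> carrier L \<Longrightarrow> R x \<one>\<^bsub>U\<^esub> F = F \<one>\<^bsub>U\<^esub> x"
  unfolding cross_def by (simp add: t.W_one_right[OF k.V_sbal] k.V_one_left)

lemma R_plus: "R x \<beta> (\<lambda>\<alpha> y. F \<alpha> y + F' \<alpha> y) = R x \<beta> F + R x \<beta> F'"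
  by (simp add: cross_def t.W_plus k.V_plus)

lemma R_csum: "R x \<beta> (\<lambda>\<alpha> y. csum M z (\<lambda>u v. H \<alpha> y u v)) = csum M z (\<lambda>u v. R x \<beta> (\<lambda>\<alpha> y. H \<alpha> y u v))"
  unfolding cross_def by (simp only: t.W_csum k.V_csum)

lemma R_pmsum: "R x \<beta> (\<lambda>\<alpha> y. pmsum K B M z (\<lambda>u v. H \<alpha> y u v)) = pmsum K B M z (\<lambda>u v. R x \<beta> (\<lambda>\<alpha> y. H \<alpha> y u v))"
  unfolding cross_def by (simp only: t.W_pmsum k.V_pmsum)

lemma R_add_left:
  "sbal F \<Longrightarrow> tbal F \<Longrightarrow> x \<in> carrier L \<Longrightarrow> y \<in> carrier L \<Longrightarrow> \<beta> \<in> carrier U \<Longrightarrow> R (x \<oplus>\<^bsub>L\<^esub> y) \<beta> F = R x \<beta> F + R y \<beta> F"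
  unfolding cross_def by (rule t.W_add_left[OF k.V_sbal])

lemma R_add_right:
  "sbal F \<Longrightarrow> tbal F \<Longrightarrow> x \<in> carrier L \<Longrightarrow> \<beta> \<in> carrier U \<Longrightarrow> \<gamma> \<in> carrier U \<Longrightarrow> R x (\<beta> \<oplus>\<^bsub>U\<^esub> \<gamma>) F = R x \<beta> F + R x \<gamma> F"
  unfolding cross_def by (rule t.W_add_right[OF k.V_sbal])

lemma R_src: "sbal F \<Longrightarrow> tbal F \<Longrightarrow> a \<in> carrier B \<Longrightarrow> x \<in> carrier L \<Longrightarrow> \<beta> \<in> carrier U
    \<Longrightarrow> R (src L a \<otimes>\<^bsub>L\<^esub> x) \<beta> F = R x \<beta> (\<lambda>\<alpha> y. F (src U a \<otimes>\<^bsub>U\<^esub> \<alpha>) y)"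
  unfolding cross_def by (simp add: t.W_src[OF k.V_sbal] k.V_src)

lemma R_tgt: "sbal F \<Longrightarrow> tbal F \<Longrightarrow> a \<in> carrier B \<Longrightarrow> x \<in> carrier L \<Longrightarrow> \<beta> \<in> carrier U
    \<Longrightarrow> R (tgt L a \<otimes>\<^bsub>L\<^esub> x) \<beta> F = R x \<beta> (\<lambda>\<alpha> y. F (tgt U a \<otimes>\<^bsub>U\<^esub> \<alpha>) y)"
  unfolding cross_def by (simp add: t.W_tgt[OF k.V_sbal] k.V_arg_tgt)

lemma R_tgt_right: "sbal F \<Longrightarrow> tbal F \<Longrightarrow> a \<in> carrier B \<Longrightarrow> x \<in> carrier L \<Longrightarrow> \<beta> \<in> carrier U
    \<Longrightarrow> R (x \<otimes>\<^bsub>L\<^esub> tgt L a) \<beta> F = R x (tgt U a \<otimes>\<^bsub>U\<^esub> \<beta>) F"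
  unfolding cross_def by (simp add: t.W_tgt_right[OF k.V_sbal] t.W_arg_tgt[OF k.V_sbal] k.V_tgt)

lemma R_arg_src_right: "sbal F \<Longrightarrow> tbal F \<Longrightarrow> a \<in> carrier B \<Longrightarrow> x \<in> carrier L \<Longrightarrow> \<beta> \<in> carrier U
    \<Longrightarrow> R x (\<beta> \<otimes>\<^bsub>U\<^esub> src U a) F = R x \<beta> (\<lambda>\<alpha> y. F \<alpha> (y \<otimes>\<^bsub>L\<^esub> src L a))"
  unfolding cross_def by (simp add: t.W_arg_src_right[OF k.V_sbal] k.V_arg_src_right)

lemma R_arg_tgt_right: "sbal F \<Longrightarrow> tbal F \<Longrightarrow> a \<in> carrier B \<Longrightarrow> x \<in> carrier L \<Longrightarrow> \<beta> \<in> carrier U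
    \<Longrightarrow> R x (\<beta> \<otimes>\<^bsub>U\<^esub> tgt U a) F = R x \<beta> (\<lambda>\<alpha> y. F \<alpha> (y \<otimes>\<^bsub>L\<^esub> tgt L a))"
  unfolding cross_def by (simp add: t.W_arg_tgt_right[OF k.V_sbal] k.V_tgt_right)

subsection \<open>The coaction on cross relations\<close>

text \<open>
  The right half takes \<open>tgt (\<kappa>[x\<^sub>2|\<alpha>\<^sub>-])\<close> to the left of \<open>x\<^sub>1\<close>, and the coproduct is
  \<open>tgt\<close>-linear in its second component.  So the right half, followed by the coproduct, touches the second
  component only.
\<close>

lemma cosum_V:
  assumes s: "\<And>\<beta> y. \<beta> \<in> carrier U \<Longrightarrow> y \<in> carrier L \<Longrightarrow> sbal (\<lambda>\<alpha> x. J \<alpha> x \<beta> y)"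
    and t: "\<And>\<beta> y. \<beta> \<in> carrier U \<Longrightarrow> y \<in> carrier L \<Longrightarrow> tbal (\<lambda>\<alpha> x. J \<alpha> x \<beta> y)"
    and s2: "\<And>\<alpha> x. \<alpha> \<in> carrier U \<Longrightarrow> x \<in> carrier L \<Longrightarrow> sbal (J \<alpha> x)"
    and t2: "\<And>\<alpha> x. \<alpha> \<in> carrier U \<Longrightarrow> x \<in> carrier L \<Longrightarrow> tbal (J \<alpha> x)"
    and j: "\<And>b \<alpha> x \<beta> y. b \<in> carrier B \<Longrightarrow> \<alpha> \<in> carrier U \<Longrightarrow> x \<in> carrier L \<Longrightarrow> \<beta> \<in> carrier U \<Longrightarrow> y \<in> carrier L
      \<Longrightarrow> J (tgt U b \<otimes>\<^bsub>U\<^esub> \<alpha>) x \<beta> y = J \<alpha> x (src U b \<otimes>\<^bsub>U\<^esub> \<beta>) y"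
    and \<alpha>: "\<alpha> \<in> carrier U" and x: "x \<in> carrier L"
  shows "k.V \<alpha> x (cosum U L J) = cosum U L (\<lambda>\<alpha> x \<beta> y. k.V \<beta> y (J \<alpha> x)) \<alpha> x"
proof -
  define f where "f p1 p2 m x1 x2 x3 = J p1 x1 p2 (tgt L (\<kappa> x3 m) \<otimes>\<^bsub>L\<^esub> x2)" for p1 p2 m x1 x2 x3
  have bU: "U.bal (\<lambda>p1 p2. J p1 u p2 v)" if "u \<in> carrier L" "v \<in> carrier L" for u v
    by (rule balancedI) (use that in \<open>simp_all add: balancedD(1)[OF s] balancedD(1)[OF s2] j\<close>)
  have bL: "L.bal (\<lambda>u v. csum U p (\<lambda>p1 p2. J p1 u p2 v))" if "p \<in> carrier U" for p
  proof (rule balancedI)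
    fix b u v assume *: "b \<in> carrier B" "u \<in> carrier L" "v \<in> carrier L"
    show "csum U p (\<lambda>p1 p2. J p1 (tgt L b \<otimes>\<^bsub>L\<^esub> u) p2 v) = csum U p (\<lambda>p1 p2. J p1 u p2 (src L b \<otimes>\<^bsub>L\<^esub> v))"
      using U.csum_takeuchi[OF bU[OF *(2,3)] *(1) that] * 
      by (simp add: balancedD(3)[OF t] balancedD(3)[OF s2])
  qed (use that in \<open>simp_all add: balancedD(2)[OF s] balancedD(2)[OF s2] csum_plus\<close>)
  have b3: "L.bal3 (\<lambda>x1 x2 x3. csum U p (\<lambda>p1 p2. f p1 p2 m x1 x2 x3))"
    if *: "p \<in> carrier U" "m \<in> carrier U" for p m
    unfolding f_def
  proof (rule balanced3I)
    fix b x1 x2 x3 assume **: "b \<in> carrier B" "x1 \<in> carrier L" "x2 \<in> carrier L" "x3 \<in> carrier L"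
    show "csum U p (\<lambda>p1 p2. J p1 (tgt L b \<otimes>\<^bsub>L\<^esub> x1) p2 (tgt L (\<kappa> x3 m) \<otimes>\<^bsub>L\<^esub> x2))
      = csum U p (\<lambda>p1 p2. J p1 x1 p2 (tgt L (\<kappa> x3 m) \<otimes>\<^bsub>L\<^esub> (src L b \<otimes>\<^bsub>L\<^esub> x2)))"
      using balancedD(3)[OF bL[OF *(1)] **(1,2), of "tgt L (\<kappa> x3 m) \<otimes>\<^bsub>L\<^esub> x2"] * ** by (simp add: commutes)
  qed (use * in \<open>simp_all add: additives k.pairing_adds balancedD[OF s] balancedD[OF s2] csum_plus k.pairing_B mults assocs\<close>)
  have swap: "pmsum K B U \<alpha> (\<lambda>p m. csum U p (\<lambda>p1 p2. csum L x' (\<lambda>x2 x3. f p1 p2 m x1 x2 x3)))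
      = csum U \<alpha> (\<lambda>\<alpha>1 \<alpha>2. pmsum K B U \<alpha>2 (\<lambda>p m. csum L x' (\<lambda>x2 x3. f \<alpha>1 p m x1 x2 x3)))"
    if *: "x1 \<in> carrier L" "x' \<in> carrier L" for x1 x'
  proof (rule U.csum_pm[symmetric, OF _ _ _ \<alpha>])
    show "U.lbal (\<lambda>p m. csum L x' (\<lambda>x2 x3. f \<alpha>1 p m x1 x2 x3))" if "\<alpha>1 \<in> carrier U" for \<alpha>1
      unfolding f_def
      by (rule balancedI)
         (use that * in \<open>simp_all add: additives k.pairing_adds balancedD[OF t2] csum_plus k.pairing_B mults assocs\<close>)
  qed (use * in \<open>simp_all add: f_def j balancedD[OF s] csum_plus\<close>)
  have "k.V \<alpha> x (cosum U L J) = pmsum K B U \<alpha> (\<lambda>p m. csum L x (\<lambda>x' x3. csum L (tgt L (\<kappa> x3 m) \<otimes>\<^bsub>L\<^esub> x')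
      (\<lambda>u v. csum U p (\<lambda>p1 p2. J p1 u p2 v))))"
    unfolding k.V_eq cosum_def by (intro pmsum_cong csum_cong refl csum_commute)
  also have "\<dots> = pmsum K B U \<alpha> (\<lambda>p m. csum L x (\<lambda>x' x3. csum L x' (\<lambda>x1 x2. csum U p (\<lambda>p1 p2. f p1 p2 m x1 x2 x3))))"
    by (simp add: L.csum_tgt[OF bL] f_def)
  also have "\<dots> = pmsum K B U \<alpha> (\<lambda>p m. csum L x (\<lambda>x1 x'. csum L x' (\<lambda>x2 x3. csum U p (\<lambda>p1 p2. f p1 p2 m x1 x2 x3))))"
    by (simp add: L.csum_coassoc[OF b3])
  also have "\<dots> = pmsum K B U \<alpha> (\<lambda>p m. csum L x (\<lambda>x1 x'. csum U p (\<lambda>p1 p2. csum L x' (\<lambda>x2 x3. f p1 p2 m x1 x2 x3))))"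
    by (intro pmsum_cong csum_cong refl csum_commute)
  also have "\<dots> = csum L x (\<lambda>x1 x'. pmsum K B U \<alpha> (\<lambda>p m. csum U p (\<lambda>p1 p2. csum L x' (\<lambda>x2 x3. f p1 p2 m x1 x2 x3))))"
    by (rule csum_pmsum_commute[symmetric])
  also have "\<dots> = csum L x (\<lambda>x1 x'. csum U \<alpha> (\<lambda>\<alpha>1 \<alpha>2. pmsum K B U \<alpha>2 (\<lambda>p m. csum L x' (\<lambda>x2 x3. f \<alpha>1 p m x1 x2 x3))))"
    by (simp add: swap)
  also have "\<dots> = csum U \<alpha> (\<lambda>\<alpha>1 \<alpha>2. csum L x (\<lambda>x1 x'. pmsum K B U \<alpha>2 (\<lambda>p m. csum L x' (\<lambda>x2 x3. f \<alpha>1 p m x1 x2 x3))))"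
    by (rule csum_commute)
  also have "\<dots> = cosum U L (\<lambda>\<alpha> x \<beta> y. k.V \<beta> y (J \<alpha> x)) \<alpha> x"
    by (simp add: cosum_def k.V_eq f_def)
  finally show ?thesis .
qed

text \<open>
  Similarly the left half touches only the first component, since the coproduct is \<open>src\<close>-linear there.
\<close>

lemma cosum_W:
  assumes s: "\<And>\<beta> y. \<beta> \<in> carrier U \<Longrightarrow> y \<in> carrier L \<Longrightarrow> sbal (\<lambda>\<alpha> x. J \<alpha> x \<beta> y)"
    and t: "\<And>\<beta> y. \<beta> \<in> carrier U \<Longrightarrow> y \<in> carrier L \<Longrightarrow> tbal (\<lambda>\<alpha> x. J \<alpha> x \<beta> y)"
    and s2: "\<And>\<alpha> x. \<alpha> \<in> carrier U \<Longrightarrow> x \<in> carrier L \<Longrightarrow> sbal (J \<alpha> x)"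
    and j: "\<And>b \<alpha> x \<beta> y. b \<in> carrier B \<Longrightarrow> \<alpha> \<in> carrier U \<Longrightarrow> x \<in> carrier L \<Longrightarrow> \<beta> \<in> carrier U \<Longrightarrow> y \<in> carrier L
      \<Longrightarrow> J (tgt U b \<otimes>\<^bsub>U\<^esub> \<alpha>) x \<beta> y = J \<alpha> x (src U b \<otimes>\<^bsub>U\<^esub> \<beta>) y"
    and \<beta>: "\<beta> \<in> carrier U" and x: "x \<in> carrier L"
  shows "t.W x \<beta> (cosum U L J) = cosum U L (\<lambda>\<beta>1 x1 \<beta>2 x2. t.W x1 \<beta>1 (\<lambda>\<alpha> y. J \<alpha> y \<beta>2 x2)) \<beta> x"
proof -
  define f where "f \<beta>1 \<beta>2 \<beta>3 x1 x2 x3 = J (src U (\<tau> x1 \<beta>1) \<otimes>\<^bsub>U\<^esub> \<beta>2) x2 \<beta>3 x3" for \<beta>1 \<beta>2 \<beta>3 x1 x2 x3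
  have bU: "U.bal (\<lambda>p1 p2. csum L x (\<lambda>u v. J p1 u p2 v))" for x
    by (rule balancedI) (simp_all add: balancedD(1)[OF s] balancedD(1)[OF s2] j csum_plus)
  have bU1: "U.bal (\<lambda>p1 p2. J (src U c \<otimes>\<^bsub>U\<^esub> p1) u p2 v)" if "u \<in> carrier L" "v \<in> carrier L" "c \<in> carrier B" for u v c
    by (rule balancedI) (use that in \<open>simp_all add: additives balancedD(1)[OF s] balancedD(1)[OF s2] j commutes\<close>)
  have bU3: "U.bal3 (\<lambda>\<beta>1 \<beta>2 \<beta>3. f \<beta>1 \<beta>2 \<beta>3 x1 x2 x3)" if "x1 \<in> carrier L" "x2 \<in> carrier L" "x3 \<in> carrier L" for x1 x2 x3
    unfolding f_def
    by (rule balanced3I)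
       (use that in \<open>simp_all add: additives t.pairing_adds t.pairing_B mults assocs commutes
          balancedD(1,2)[OF s] balancedD(1)[OF s2] j\<close>)
  have bL3: "L.bal3 (\<lambda>x1 x2 x3. csum U \<beta> (\<lambda>\<beta>1 \<beta>'. csum U \<beta>' (\<lambda>\<beta>2 \<beta>3. f \<beta>1 \<beta>2 \<beta>3 x1 x2 x3)))"
  proof (rule balanced3I)
    fix b x1 x2 x3 assume *: "b \<in> carrier B" "x1 \<in> carrier L" "x2 \<in> carrier L" "x3 \<in> carrier L"
    have g: "additive_on U (\<lambda>\<alpha>. J \<alpha> x2 \<beta>3 x3)" if "\<beta>3 \<in> carrier U" for \<beta>3
      by (rule additive_onI) (use that * in \<open>simp add: balancedD(1)[OF s]\<close>)
    have "csum U \<beta> (\<lambda>\<beta>' \<beta>3. csum U \<beta>' (\<lambda>\<beta>1 \<beta>2. f \<beta>1 \<beta>2 \<beta>3 (tgt L b \<otimes>\<^bsub>L\<^esub> x1) x2 x3))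
        = csum U \<beta> (\<lambda>\<beta>' \<beta>3. csum U \<beta>' (\<lambda>\<beta>1 \<beta>2. f \<beta>1 \<beta>2 \<beta>3 x1 (src L b \<otimes>\<^bsub>L\<^esub> x2) x3))"
    proof (rule csum_cong[OF refl])
      fix \<beta>' \<beta>3 assume **: "\<beta>' \<in> carrier U" "\<beta>3 \<in> carrier U"
      show "csum U \<beta>' (\<lambda>\<beta>1 \<beta>2. f \<beta>1 \<beta>2 \<beta>3 (tgt L b \<otimes>\<^bsub>L\<^esub> x1) x2 x3)
        = csum U \<beta>' (\<lambda>\<beta>1 \<beta>2. f \<beta>1 \<beta>2 \<beta>3 x1 (src L b \<otimes>\<^bsub>L\<^esub> x2) x3)"
        using U.csum_takeuchi[OF t.left_kernel[OF g[OF **(2)] *(2)] *(1) **(1)] * **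
        unfolding f_def by (simp add: t.pairing_B sbal_assoc[OF s])
    qed
    then show "csum U \<beta> (\<lambda>\<beta>1 \<beta>'. csum U \<beta>' (\<lambda>\<beta>2 \<beta>3. f \<beta>1 \<beta>2 \<beta>3 (tgt L b \<otimes>\<^bsub>L\<^esub> x1) x2 x3))
        = csum U \<beta> (\<lambda>\<beta>1 \<beta>'. csum U \<beta>' (\<lambda>\<beta>2 \<beta>3. f \<beta>1 \<beta>2 \<beta>3 x1 (src L b \<otimes>\<^bsub>L\<^esub> x2) x3))"
      using * by (simp add: U.csum_coassoc[OF bU3])
    have "csum U \<beta>' (\<lambda>\<beta>2 \<beta>3. f \<beta>1 \<beta>2 \<beta>3 x1 (tgt L b \<otimes>\<^bsub>L\<^esub> x2) x3) = csum U \<beta>' (\<lambda>\<beta>2 \<beta>3. f \<beta>1 \<beta>2 \<beta>3 x1 x2 (src L b \<otimes>\<^bsub>L\<^esub> x3))"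
      if "\<beta>' \<in> carrier U" "\<beta>1 \<in> carrier U" for \<beta>' \<beta>1
      using U.csum_takeuchi[OF bU1[OF *(3,4), of "\<tau> x1 \<beta>1"] *(1) that(1)] * that unfolding f_def
      by (simp add: tbal_assoc[OF t] balancedD(3)[OF s2])
    then show "csum U \<beta> (\<lambda>\<beta>1 \<beta>'. csum U \<beta>' (\<lambda>\<beta>2 \<beta>3. f \<beta>1 \<beta>2 \<beta>3 x1 (tgt L b \<otimes>\<^bsub>L\<^esub> x2) x3))
      = csum U \<beta> (\<lambda>\<beta>1 \<beta>'. csum U \<beta>' (\<lambda>\<beta>2 \<beta>3. f \<beta>1 \<beta>2 \<beta>3 x1 x2 (src L b \<otimes>\<^bsub>L\<^esub> x3)))" by simp
  qed (simp_all add: f_def additives t.pairing_adds balancedD[OF s] balancedD(1,2)[OF s2] csum_plus)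
  have "t.W x \<beta> (cosum U L J) = csum L x (\<lambda>x1 x'. csum U \<beta> (\<lambda>\<beta>1 \<beta>'. csum U \<beta>' (\<lambda>\<beta>2 \<beta>3. csum L x' (\<lambda>x2 x3. f \<beta>1 \<beta>2 \<beta>3 x1 x2 x3))))"
    unfolding t.W_eq cosum_def f_def by (simp add: U.csum_src[OF bU])
  also have "\<dots> = csum L x (\<lambda>x1 x'. csum L x' (\<lambda>x2 x3. csum U \<beta> (\<lambda>\<beta>1 \<beta>'. csum U \<beta>' (\<lambda>\<beta>2 \<beta>3. f \<beta>1 \<beta>2 \<beta>3 x1 x2 x3))))"
    by (rule csum_cong[OF refl], subst csum_commute[of L], rule csum_cong[OF refl], rule csum_commute)
  also have "\<dots> = csum L x (\<lambda>x' x3. csum L x' (\<lambda>x1 x2. csum U \<beta> (\<lambda>\<beta>1 \<beta>'. csum U \<beta>' (\<lambda>\<beta>2 \<beta>3. f \<beta>1 \<beta>2 \<beta>3 x1 x2 x3))))"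
    by (rule L.csum_coassoc[OF bL3, symmetric])
  also have "\<dots> = csum L x (\<lambda>x' x3. csum L x' (\<lambda>x1 x2. csum U \<beta> (\<lambda>\<beta>' \<beta>3. csum U \<beta>' (\<lambda>\<beta>1 \<beta>2. f \<beta>1 \<beta>2 \<beta>3 x1 x2 x3))))"
    by (simp add: U.csum_coassoc[OF bU3])
  also have "\<dots> = csum L x (\<lambda>x' x3. csum U \<beta> (\<lambda>\<beta>' \<beta>3. csum L x' (\<lambda>x1 x2. csum U \<beta>' (\<lambda>\<beta>1 \<beta>2. f \<beta>1 \<beta>2 \<beta>3 x1 x2 x3))))"
    by (intro csum_cong refl csum_commute)
  also have "\<dots> = csum U \<beta> (\<lambda>\<beta>' \<beta>3. csum L x (\<lambda>x' x3. csum L x' (\<lambda>x1 x2. csum U \<beta>' (\<lambda>\<beta>1 \<beta>2. f \<beta>1 \<beta>2 \<beta>3 x1 x2 x3))))"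
    by (rule csum_commute)
  also have "\<dots> = cosum U L (\<lambda>\<beta>1 x1 \<beta>2 x2. t.W x1 \<beta>1 (\<lambda>\<alpha> y. J \<alpha> y \<beta>2 x2)) \<beta> x"
    by (simp add: cosum_def t.W_eq f_def)
  finally show ?thesis .
qed

end

context hopf_pairing
begin

text \<open>
  The right half contributes \<open>\<tau>[x\<^sub>2|\<beta>\<^sub>2\<^sub>-]\<close> and the extra factor is \<open>\<tau>[x\<^sub>3|\<beta>\<^sub>3]\<close>.  The
  multiplicativity of the pairing collects both in \<open>\<tau>[x\<^sub>2|\<beta>\<^sub>2\<^sub>- \<beta>\<^sub>3]\<close>, and \<open>\<beta>\<^sub>2\<^sub>+ \<otimes> \<beta>\<^sub>2\<^sub>- \<beta>\<^sub>3 = \<beta>\<^sub>2 \<otimes> 1\<close>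
  leaves \<open>\<tau>[x\<^sub>2|1] = \<epsilon>(x\<^sub>2)\<close>.
\<close>

lemma W_V_cancel:
  assumes s: "sbal F" and t: "tbal F" and x: "x \<in> carrier L" and \<beta>: "\<beta> \<in> carrier U"
  shows "csum L x (\<lambda>xL xR. csum U \<beta> (\<lambda>\<beta>L \<beta>R. W (tgt L (\<tau> xR \<beta>R) \<otimes>\<^bsub>L\<^esub> xL) \<beta>L (\<lambda>\<alpha> y. V \<alpha> y F))) = W x \<beta> F"
proof -
  note VF = V_sbal[OF s t]
  define \<Phi> where "\<Phi> x1 x2 y = csum U \<beta> (\<lambda>\<beta>L \<beta>R. csum U \<beta>L (\<lambda>\<beta>1 \<beta>2.
    V (src U (\<tau> x1 \<beta>1) \<otimes>\<^bsub>U\<^esub> \<beta>2) (tgt L (\<tau> y \<beta>R) \<otimes>\<^bsub>L\<^esub> x2) F))" for x1 x2 y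
  define \<psi> where "\<psi> a x' p w = csum L x' (\<lambda>u z. F (src U a \<otimes>\<^bsub>U\<^esub> p) (tgt L (\<tau> z w) \<otimes>\<^bsub>L\<^esub> u))" for a x' p w
  \<comment> \<open>The indices of \<open>\<Phi>\<close> are the three components of \<open>x\<close> in the order of the iterated coproduct.\<close>
  have b3: "L.bal3 \<Phi>"
  proof (rule balanced3I)
    fix b x1 x2 y assume *: "b \<in> carrier B" "x1 \<in> carrier L" "x2 \<in> carrier L" "y \<in> carrier L"
    have "csum U \<beta>L (\<lambda>\<beta>1 \<beta>2. V (src U (\<tau> (tgt L b \<otimes>\<^bsub>L\<^esub> x1) \<beta>1) \<otimes>\<^bsub>U\<^esub> \<beta>2) (tgt L (\<tau> y \<beta>R) \<otimes>\<^bsub>L\<^esub> x2) F)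
      = csum U \<beta>L (\<lambda>\<beta>1 \<beta>2. V (src U (\<tau> x1 \<beta>1) \<otimes>\<^bsub>U\<^esub> \<beta>2) (tgt L (\<tau> y \<beta>R) \<otimes>\<^bsub>L\<^esub> (src L b \<otimes>\<^bsub>L\<^esub> x2)) F)"
      if **: "\<beta>L \<in> carrier U" "\<beta>R \<in> carrier U" for \<beta>L \<beta>R
    proof -
      have "tgt L (\<tau> y \<beta>R) \<otimes>\<^bsub>L\<^esub> x2 \<in> carrier L" using * ** by simp
      from U.csum_takeuchi[OF left_kernel[OF sbal_additive(1)[OF VF this] *(2)] *(1) **(1)]
      show ?thesis using * ** by (simp add: pairing_B sbal_assoc[OF VF] commutes)
    qed
    then show "\<Phi> (tgt L b \<otimes>\<^bsub>L\<^esub> x1) x2 y = \<Phi> x1 (src L b \<otimes>\<^bsub>L\<^esub> x2) y" unfolding \<Phi>_def by simp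
  qed (simp_all add: \<Phi>_def additives pairing_adds balancedD[OF VF] csum_plus pairing_B mults assocs)
  have Fl: "tbal (\<lambda>p. F (src U a \<otimes>\<^bsub>U\<^esub> p))" if "a \<in> carrier B" for a
    by (rule balancedI) (use that in \<open>simp_all add: additives balancedD[OF t] tbal_assoc[OF t]\<close>)
  have \<psi>_bal: "U.lbal (\<psi> a x')" if "a \<in> carrier B" "x' \<in> carrier L" for a x'
    unfolding \<psi>_def by (rule V_kernel[OF Fl[OF that(1)] that(2)])
  have \<psi>_bal': "U.lbal (\<lambda>p m. \<psi> a x' p (m \<otimes>\<^bsub>U\<^esub> \<delta>))" if "a \<in> carrier B" "x' \<in> carrier L" "\<delta> \<in> carrier U" for a x' \<delta>
    by (rule balancedI) (use that in \<open>simp_all add: additives assocs balancedD[OF \<psi>_bal]\<close>)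
  have \<psi>_add: "\<psi> (a \<oplus>\<^bsub>B\<^esub> a') x' p w = \<psi> a x' p w + \<psi> a' x' p w"
    if "a \<in> carrier B" "a' \<in> carrier B" "p \<in> carrier U" "w \<in> carrier U" for a a' x' p w
    unfolding \<psi>_def using that by (simp add: additives balancedD[OF t] csum_plus)
  have \<psi>_mult: "\<psi> (a \<otimes>\<^bsub>B\<^esub> b) x' p w = \<psi> a x' (src U b \<otimes>\<^bsub>U\<^esub> p) w"
    if "a \<in> carrier B" "b \<in> carrier B" "p \<in> carrier U" "w \<in> carrier U" for a b x' p w
    unfolding \<psi>_def using that by (simp add: mults assocs)
  have inner: "csum L x' (\<lambda>x2 y. V (src U a \<otimes>\<^bsub>U\<^esub> \<beta>2) (tgt L (\<tau> y \<beta>R) \<otimes>\<^bsub>L\<^esub> x2) F)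
      = pmsum K B U \<beta>2 (\<lambda>p m. \<psi> a x' p (m \<otimes>\<^bsub>U\<^esub> \<beta>R))"
    if *: "a \<in> carrier B" "x' \<in> carrier L" "\<beta>2 \<in> carrier U" "\<beta>R \<in> carrier U" for a x' \<beta>2 \<beta>R
  proof -
    have q3: "L.bal3 (\<lambda>u v y. F (src U a \<otimes>\<^bsub>U\<^esub> p) (tgt L (\<tau> (tgt L (\<tau> y \<beta>R) \<otimes>\<^bsub>L\<^esub> v) m) \<otimes>\<^bsub>L\<^esub> u))"
      if "p \<in> carrier U" "m \<in> carrier U" for p m
      by (rule balanced3I)
         (use that * in \<open>simp_all add: additives pairing_adds balancedD[OF t] pairing_B mults assocs commutes\<close>)
    have g: "additive_on B (\<lambda>b. F (src U a \<otimes>\<^bsub>U\<^esub> p) (tgt L b \<otimes>\<^bsub>L\<^esub> z))" if "p \<in> carrier U" "z \<in> carrier L" for p z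
      by (rule additive_onI) (use that * in \<open>simp add: additives balancedD[OF t]\<close>)
    have "csum L x' (\<lambda>x2 y. V (src U a \<otimes>\<^bsub>U\<^esub> \<beta>2) (tgt L (\<tau> y \<beta>R) \<otimes>\<^bsub>L\<^esub> x2) F)
      = csum L x' (\<lambda>x2 y. pmsum K B U \<beta>2 (\<lambda>p m. csum L x2 (\<lambda>u v.
          F (src U a \<otimes>\<^bsub>U\<^esub> p) (tgt L (\<tau> (tgt L (\<tau> y \<beta>R) \<otimes>\<^bsub>L\<^esub> v) m) \<otimes>\<^bsub>L\<^esub> u))))"
      using * by (simp add: V_src[OF t]) (simp add: V_eq L.csum_tgt[OF right_kernel[OF tbal_additive(2)[OF Fl]]])
    also have "\<dots> = pmsum K B U \<beta>2 (\<lambda>p m. csum L x' (\<lambda>x2 y. csum L x2 (\<lambda>u v.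
          F (src U a \<otimes>\<^bsub>U\<^esub> p) (tgt L (\<tau> (tgt L (\<tau> y \<beta>R) \<otimes>\<^bsub>L\<^esub> v) m) \<otimes>\<^bsub>L\<^esub> u))))"
      by (rule csum_pmsum_commute)
    also have "\<dots> = pmsum K B U \<beta>2 (\<lambda>p m. csum L x' (\<lambda>u x''. csum L x'' (\<lambda>v y.
          F (src U a \<otimes>\<^bsub>U\<^esub> p) (tgt L (\<tau> (tgt L (\<tau> y \<beta>R) \<otimes>\<^bsub>L\<^esub> v) m) \<otimes>\<^bsub>L\<^esub> u))))"
      by (simp add: L.csum_coassoc[OF q3])
    also have "\<dots> = pmsum K B U \<beta>2 (\<lambda>p m. \<psi> a x' p (m \<otimes>\<^bsub>U\<^esub> \<beta>R))"
      unfolding \<psi>_def using * by (simp add: pairing_mult_arg[OF g] pairing_B)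
    finally show ?thesis .
  qed
  have c3: "U.bal3 (\<lambda>\<beta>1 \<beta>2 \<beta>R. pmsum K B U \<beta>2 (\<lambda>p m. \<psi> (\<tau> x1 \<beta>1) x' p (m \<otimes>\<^bsub>U\<^esub> \<beta>R)))"
    if "x1 \<in> carrier L" "x' \<in> carrier L" for x1 x'
    by (rule balanced3I)
       (use that in \<open>simp_all add: pairing_adds additives \<psi>_add pmsum_plus U.pm_add[OF \<psi>_bal'] balancedD[OF \<psi>_bal]
         pairing_B \<psi>_mult U.pm_src[OF \<psi>_bal'] U.pm_tgt[OF \<psi>_bal'] assocs\<close>)
  have "csum L x (\<lambda>xL xR. csum U \<beta> (\<lambda>\<beta>L \<beta>R. W (tgt L (\<tau> xR \<beta>R) \<otimes>\<^bsub>L\<^esub> xL) \<beta>L (\<lambda>\<alpha> y. V \<alpha> y F)))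
    = csum L x (\<lambda>xL xR. csum U \<beta> (\<lambda>\<beta>L \<beta>R. csum L xL (\<lambda>x1 x2. csum U \<beta>L (\<lambda>\<beta>1 \<beta>2.
        V (src U (\<tau> x1 \<beta>1) \<otimes>\<^bsub>U\<^esub> \<beta>2) (tgt L (\<tau> xR \<beta>R) \<otimes>\<^bsub>L\<^esub> x2) F))))"
    by (simp add: W_tgt[OF VF]) (simp add: W_eq)
  also have "\<dots> = csum L x (\<lambda>xL xR. csum L xL (\<lambda>x1 x2. \<Phi> x1 x2 xR))"
    unfolding \<Phi>_def by (intro csum_cong refl csum_commute)
  also have "\<dots> = csum L x (\<lambda>x1 x'. csum L x' (\<lambda>x2 y. \<Phi> x1 x2 y))"
    by (rule L.csum_coassoc[OF b3])
  also have "\<dots> = csum L x (\<lambda>x1 x'. csum U \<beta> (\<lambda>\<beta>L \<beta>R. csum U \<beta>L (\<lambda>\<beta>1 \<beta>2.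
      csum L x' (\<lambda>x2 y. V (src U (\<tau> x1 \<beta>1) \<otimes>\<^bsub>U\<^esub> \<beta>2) (tgt L (\<tau> y \<beta>R) \<otimes>\<^bsub>L\<^esub> x2) F))))"
    unfolding \<Phi>_def
    by (rule csum_cong[OF refl], subst csum_commute[of L], rule csum_cong[OF refl], rule csum_commute)
  also have "\<dots> = csum L x (\<lambda>x1 x'. csum U \<beta> (\<lambda>\<beta>L \<beta>R. csum U \<beta>L (\<lambda>\<beta>1 \<beta>2. pmsum K B U \<beta>2 (\<lambda>p m. \<psi> (\<tau> x1 \<beta>1) x' p (m \<otimes>\<^bsub>U\<^esub> \<beta>R)))))"
    by (simp add: inner)
  also have "\<dots> = csum L x (\<lambda>x1 x'. csum U \<beta> (\<lambda>\<beta>1 \<beta>'. csum U \<beta>' (\<lambda>\<beta>2 \<beta>3. pmsum K B U \<beta>2 (\<lambda>p m. \<psi> (\<tau> x1 \<beta>1) x' p (m \<otimes>\<^bsub>U\<^esub> \<beta>3)))))"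
    by (simp add: U.csum_coassoc[OF c3])
  also have "\<dots> = csum L x (\<lambda>x1 x'. csum U \<beta> (\<lambda>\<beta>1 \<beta>'. \<psi> (\<tau> x1 \<beta>1) x' \<beta>' \<one>\<^bsub>U\<^esub>))"
    by (simp add: U.csum_pm_mult[OF \<psi>_bal])
  also have "\<dots> = W x \<beta> F"
    unfolding \<psi>_def W_eq by (simp add: L.csum_counit_right[OF tbal_additive(2)[OF t]])
  finally show ?thesis .
qed

text \<open>
  Under the counit the two values of the pairing combine to \<open>\<tau>[x|\<beta>\<^sub>+ \<beta>\<^sub>-]\<close>, where an
  element \<open>e\<close> of the base has been absorbed into \<open>\<beta>\<close>, and \<open>\<beta>\<^sub>+ \<beta>\<^sub>- = \<epsilon>(\<beta>)\<close>.
\<close>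

lemma W_V_counit:
  assumes h: "additive_on B h" and e: "e \<in> carrier B" and x: "x \<in> carrier L" and \<beta>: "\<beta> \<in> carrier U"
  shows "W x \<beta> (\<lambda>\<alpha> y. V \<alpha> y (\<lambda>\<gamma> z. h (counit U (\<gamma> \<otimes>\<^bsub>U\<^esub> src U (counit L (z \<otimes>\<^bsub>L\<^esub> src L e))))))
    = h (counit L (x \<otimes>\<^bsub>L\<^esub> src L (counit U (\<beta> \<otimes>\<^bsub>U\<^esub> src U e))))"
proof -
  note cu = U.counit_add L.counit_add U.counit_src U.counit_tgt L.counit_src L.counit_tgt
  have V_part: "V \<alpha> y (\<lambda>\<gamma> z. h (counit U (\<gamma> \<otimes>\<^bsub>U\<^esub> src U (counit L (z \<otimes>\<^bsub>L\<^esub> src L e)))))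
      = pmsum K B U \<alpha> (\<lambda>p m. h (counit U (p \<otimes>\<^bsub>U\<^esub> tgt U (\<tau> y (src U e \<otimes>\<^bsub>U\<^esub> m)))))"
    if \<alpha>: "\<alpha> \<in> carrier U" and y: "y \<in> carrier L" for \<alpha> y
  proof -
    have "csum L y (\<lambda>y1 y2. h (counit U (p \<otimes>\<^bsub>U\<^esub> src U (counit L (tgt L (\<tau> y2 m) \<otimes>\<^bsub>L\<^esub> y1 \<otimes>\<^bsub>L\<^esub> src L e)))))
      = h (counit U (p \<otimes>\<^bsub>U\<^esub> tgt U (\<tau> y (src U e \<otimes>\<^bsub>U\<^esub> m))))"
      if pm: "p \<in> carrier U" "m \<in> carrier U" for p m
    proof -
      define \<phi> where "\<phi> z = h (counit U (p \<otimes>\<^bsub>U\<^esub> tgt U (\<tau> z m)))" for z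
      have \<phi>: "additive_on L \<phi>"
        by (rule additive_onI) (use pm in \<open>simp add: \<phi>_def pairing_adds additives cu additive_onD[OF h]\<close>)
      have \<phi>b: "L.bal (\<lambda>x1 x2. \<phi> (src L (counit L x1) \<otimes>\<^bsub>L\<^esub> x2))"
        by (rule balancedI) (simp_all add: additives additive_onD[OF \<phi>] cu mults assocs)
      have "csum L y (\<lambda>y1 y2. h (counit U (p \<otimes>\<^bsub>U\<^esub> src U (counit L (tgt L (\<tau> y2 m) \<otimes>\<^bsub>L\<^esub> y1 \<otimes>\<^bsub>L\<^esub> src L e)))))
        = csum L y (\<lambda>y1 y2. \<phi> (src L (counit L (y1 \<otimes>\<^bsub>L\<^esub> src L e)) \<otimes>\<^bsub>L\<^esub> y2))"
        unfolding \<phi>_def using pm e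
        by (simp add: U.counit_mult_tgt_src cu assocs pairing_B)
      also have "\<dots> = csum L (y \<otimes>\<^bsub>L\<^esub> src L e) (\<lambda>y1 y2. \<phi> (src L (counit L y1) \<otimes>\<^bsub>L\<^esub> y2))"
        by (rule L.csum_src_right[OF \<phi>b e y, symmetric])
      also have "\<dots> = \<phi> (y \<otimes>\<^bsub>L\<^esub> src L e)"
        using L.csum_counit_left[OF \<phi>] y e by simp
      finally show ?thesis using pm y e by (simp add: \<phi>_def pairing_B)
    qed
    then show ?thesis by (simp add: V_eq)
  qed
  have lb: "U.lbal (\<lambda>p m. h (\<tau> x1 \<beta>1 \<otimes>\<^bsub>B\<^esub> counit U (p \<otimes>\<^bsub>U\<^esub> tgt U (\<tau> x2 (src U e \<otimes>\<^bsub>U\<^esub> m)))))"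
    if "x1 \<in> carrier L" "x2 \<in> carrier L" "\<beta>1 \<in> carrier U" for x1 x2 \<beta>1
    by (rule balancedI)
       (use that e in \<open>simp_all add: pairing_adds additives cu additive_onD[OF h] commutes pairing_B mults assocs\<close>)
  have lb': "U.lbal (\<lambda>p m. h (\<tau> x (p \<otimes>\<^bsub>U\<^esub> m)))"
    by (rule balancedI) (use x in \<open>simp_all add: pairing_adds additives additive_onD[OF h] assocs\<close>)
  have lb2: "U.lbal (\<lambda>p m. h (counit U (p \<otimes>\<^bsub>U\<^esub> tgt U (\<tau> x2 (src U e \<otimes>\<^bsub>U\<^esub> m)))))"
    if "x2 \<in> carrier L" for x2
    by (rule balancedI)
       (use that e in \<open>simp_all add: pairing_adds additives cu additive_onD[OF h] commutes pairing_B mults assocs\<close>)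
  have inner: "csum U p (\<lambda>p1 p2. h (\<tau> x1 p1 \<otimes>\<^bsub>B\<^esub> counit U (p2 \<otimes>\<^bsub>U\<^esub> tgt U c))) = h (\<tau> x1 (p \<otimes>\<^bsub>U\<^esub> tgt U c))"
    if *: "p \<in> carrier U" "x1 \<in> carrier L" "c \<in> carrier B" for p x1 c
  proof -
    have \<phi>: "additive_on U (\<lambda>z. h (\<tau> x1 z))"
      by (rule additive_onI) (use * in \<open>simp add: pairing_adds additive_onD[OF h]\<close>)
    have \<phi>b: "U.bal (\<lambda>p1 p2. h (\<tau> x1 (tgt U (counit U p2) \<otimes>\<^bsub>U\<^esub> p1)))"
      by (rule balancedI) (use * in \<open>simp_all add: additives pairing_adds additive_onD[OF h] cu mults assocs pairing_B\<close>)
    have "csum U p (\<lambda>p1 p2. h (\<tau> x1 p1 \<otimes>\<^bsub>B\<^esub> counit U (p2 \<otimes>\<^bsub>U\<^esub> tgt U c)))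
      = csum U p (\<lambda>p1 p2. h (\<tau> x1 (tgt U (counit U (p2 \<otimes>\<^bsub>U\<^esub> tgt U c)) \<otimes>\<^bsub>U\<^esub> p1)))"
      using * by (simp add: pairing_B)
    also have "\<dots> = csum U (p \<otimes>\<^bsub>U\<^esub> tgt U c) (\<lambda>p1 p2. h (\<tau> x1 (tgt U (counit U p2) \<otimes>\<^bsub>U\<^esub> p1)))"
      by (rule U.csum_tgt_right[OF \<phi>b *(3,1), symmetric])
    also have "\<dots> = h (\<tau> x1 (p \<otimes>\<^bsub>U\<^esub> tgt U c))"
      using U.csum_counit_right[OF \<phi>] * by simp
    finally show ?thesis .
  qed
  have swap: "csum U \<beta> (\<lambda>\<beta>1 \<beta>2. pmsum K B U \<beta>2 (\<lambda>p m. h (\<tau> x1 \<beta>1 \<otimes>\<^bsub>B\<^esub> counit U (p \<otimes>\<^bsub>U\<^esub> tgt U (\<tau> x2 (src U e \<otimes>\<^bsub>U\<^esub> m))))))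
      = pmsum K B U \<beta> (\<lambda>p m. h (\<tau> x1 (p \<otimes>\<^bsub>U\<^esub> tgt U (\<tau> x2 (src U e \<otimes>\<^bsub>U\<^esub> m)))))"
    if *: "x1 \<in> carrier L" "x2 \<in> carrier L" for x1 x2
  proof -
    have "csum U \<beta> (\<lambda>\<beta>1 \<beta>2. pmsum K B U \<beta>2 (\<lambda>p m. h (\<tau> x1 \<beta>1 \<otimes>\<^bsub>B\<^esub> counit U (p \<otimes>\<^bsub>U\<^esub> tgt U (\<tau> x2 (src U e \<otimes>\<^bsub>U\<^esub> m))))))
      = pmsum K B U \<beta> (\<lambda>p m. csum U p (\<lambda>p1 p2. h (\<tau> x1 p1 \<otimes>\<^bsub>B\<^esub> counit U (p2 \<otimes>\<^bsub>U\<^esub> tgt U (\<tau> x2 (src U e \<otimes>\<^bsub>U\<^esub> m))))))"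
      by (rule U.csum_pm[OF _ lb _ \<beta>])
         (use * e in \<open>simp_all add: pairing_adds additives additive_onD[OF h] cu pairing_B assocs\<close>)
    then show ?thesis using * e by (simp add: inner)
  qed
  have "W x \<beta> (\<lambda>\<alpha> y. V \<alpha> y (\<lambda>\<gamma> z. h (counit U (\<gamma> \<otimes>\<^bsub>U\<^esub> src U (counit L (z \<otimes>\<^bsub>L\<^esub> src L e))))))
    = csum L x (\<lambda>x1 x2. csum U \<beta> (\<lambda>\<beta>1 \<beta>2. pmsum K B U \<beta>2 (\<lambda>p m.
        h (\<tau> x1 \<beta>1 \<otimes>\<^bsub>B\<^esub> counit U (p \<otimes>\<^bsub>U\<^esub> tgt U (\<tau> x2 (src U e \<otimes>\<^bsub>U\<^esub> m)))))))"
    unfolding W_eq using e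
    by (simp add: V_part U.pm_src[OF lb2]) (simp add: cu assocs)
  also have "\<dots> = csum L x (\<lambda>x1 x2. pmsum K B U \<beta> (\<lambda>p m. h (\<tau> x1 (p \<otimes>\<^bsub>U\<^esub> tgt U (\<tau> x2 (src U e \<otimes>\<^bsub>U\<^esub> m))))))"
    by (simp add: swap)
  also have "\<dots> = pmsum K B U \<beta> (\<lambda>p m. csum L x (\<lambda>x1 x2. h (\<tau> x1 (p \<otimes>\<^bsub>U\<^esub> tgt U (\<tau> x2 (src U e \<otimes>\<^bsub>U\<^esub> m))))))"
    by (rule csum_pmsum_commute)
  also have "\<dots> = pmsum K B U \<beta> (\<lambda>p m. h (\<tau> x (p \<otimes>\<^bsub>U\<^esub> (src U e \<otimes>\<^bsub>U\<^esub> m))))"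
    using x e by (simp add: pairing_mult_arg[OF h])
  also have "\<dots> = pmsum K B U (\<beta> \<otimes>\<^bsub>U\<^esub> tgt U e) (\<lambda>p m. h (\<tau> x (p \<otimes>\<^bsub>U\<^esub> m)))"
    by (rule U.pm_tgt_right[OF lb' e \<beta>, symmetric])
  also have "\<dots> = h (\<tau> x (src U (counit U (\<beta> \<otimes>\<^bsub>U\<^esub> tgt U e))))"
  proof -
    have "additive_on U (\<lambda>z. h (\<tau> x z))"
      by (rule additive_onI) (use x in \<open>simp add: pairing_adds additive_onD[OF h]\<close>)
    from U.pm_mult_counit[OF this] show ?thesis using \<beta> e by simp
  qed
  also have "\<dots> = h (counit L (x \<otimes>\<^bsub>L\<^esub> src L (counit U (\<beta> \<otimes>\<^bsub>U\<^esub> src U e))))"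
    using pairing_src_right[of "counit U (\<beta> \<otimes>\<^bsub>U\<^esub> src U e)" x "\<one>\<^bsub>U\<^esub>"] x \<beta> e by (simp add: U.counit_mult_tgt_src)
  finally show ?thesis .
qed

end

context hopf_pairings
begin

text \<open>
  By \<open>cosum_V\<close> and \<open>cosum_W\<close> the coproduct turns the cross relation into the left half in the
  first component and the right half in the second.  Missing are the right half for \<open>\<tau>\<close> in the first component
  and the left half for \<open>\<tau>\<close> in the second.  Inserted together they cancel by \<open>W_V_cancel\<close>: the values
  of the left half in the second component are moved across the tensor product over the base and become the factor
  that undoes the right half in the first.
\<close>

lemma cosum_cross:
  assumes s: "\<And>\<beta> y. \<beta> \<in> carrier U \<Longrightarrow> y \<in> carrier L \<Longrightarrow> sbal (\<lambda>\<alpha> x. J \<alpha> x \<beta> y)"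
    and t: "\<And>\<beta> y. \<beta> \<in> carrier U \<Longrightarrow> y \<in> carrier L \<Longrightarrow> tbal (\<lambda>\<alpha> x. J \<alpha> x \<beta> y)"
    and s2: "\<And>\<alpha> x. \<alpha> \<in> carrier U \<Longrightarrow> x \<in> carrier L \<Longrightarrow> sbal (J \<alpha> x)"
    and t2: "\<And>\<alpha> x. \<alpha> \<in> carrier U \<Longrightarrow> x \<in> carrier L \<Longrightarrow> tbal (J \<alpha> x)"
    and j: "\<And>b \<alpha> x \<beta> y. b \<in> carrier B \<Longrightarrow> \<alpha> \<in> carrier U \<Longrightarrow> x \<in> carrier L \<Longrightarrow> \<beta> \<in> carrier U \<Longrightarrow> y \<in> carrier L
      \<Longrightarrow> J (tgt U b \<otimes>\<^bsub>U\<^esub> \<alpha>) x \<beta> y = J \<alpha> x (src U b \<otimes>\<^bsub>U\<^esub> \<beta>) y"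
    and x: "x \<in> carrier L" and \<beta>: "\<beta> \<in> carrier U"
  shows "R x \<beta> (cosum U L J)
    = cosum U L (\<lambda>\<beta>1 x1 \<beta>2 x2. cross K B U L \<tau> \<tau> x1 \<beta>1 (\<lambda>\<alpha> y. R x2 \<beta>2 (J \<alpha> y))) \<beta> x"
proof -
  interpret tt: hopf_pairings K B U L \<tau> \<tau> by unfold_locales
  define J' where "J' \<alpha> x \<beta> y = k.V \<beta> y (J \<alpha> x)" for \<alpha> x \<beta> y
  have J'_eq: "J' = (\<lambda>\<alpha> x \<beta> y. k.V \<beta> y (J \<alpha> x))" by (intro ext) (simp add: J'_def)
  have s': "sbal (\<lambda>\<alpha> x. J' \<alpha> x \<beta> y)" if "\<beta> \<in> carrier U" "y \<in> carrier L" for \<beta> y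
    unfolding J'_def by (rule balancedI) (use that in \<open>simp_all add: balancedD[OF s] k.V_plus\<close>)
  have t': "tbal (\<lambda>\<alpha> x. J' \<alpha> x \<beta> y)" if "\<beta> \<in> carrier U" "y \<in> carrier L" for \<beta> y
    unfolding J'_def by (rule balancedI) (use that in \<open>simp_all add: balancedD[OF t] k.V_plus\<close>)
  have s2': "sbal (J' \<alpha> x)" if "\<alpha> \<in> carrier U" "x \<in> carrier L" for \<alpha> x
    unfolding J'_def by (rule k.V_sbal[OF s2 t2]) (use that in auto)
  have j': "J' (tgt U b \<otimes>\<^bsub>U\<^esub> \<alpha>) x \<beta> y = J' \<alpha> x (src U b \<otimes>\<^bsub>U\<^esub> \<beta>) y"
    if "b \<in> carrier B" "\<alpha> \<in> carrier U" "x \<in> carrier L" "\<beta> \<in> carrier U" "y \<in> carrier L" for b \<alpha> x \<beta> y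
    unfolding J'_def using that by (simp add: k.V_src[OF t2] j)
  \<comment> \<open>The summand of \<open>W_V_cancel\<close> with \<open>J'\<close> in place of \<open>F\<close>; the indices \<open>2\<close> belong to the value of the pairing that crosses the tensor product.\<close>
  define r where "r x1 x2 x3 \<beta>1 \<beta>2 \<beta>3 = tt.R (tgt L (\<tau> x2 \<beta>2) \<otimes>\<^bsub>L\<^esub> x1) \<beta>1 (\<lambda>\<alpha> y. J' \<alpha> y \<beta>3 x3)"
    for x1 x2 x3 \<beta>1 \<beta>2 \<beta>3
  note Rs = tt.R_add_left[OF s' t'] tt.R_add_right[OF s' t'] tt.R_tgt[OF s' t'] tt.R_tgt_right[OF s' t']
  have W_expand: "tt.R x1 \<beta>1 (\<lambda>\<alpha> y. t.W x' \<beta>' (J' \<alpha> y))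
      = csum L x' (\<lambda>x2 x3. csum U \<beta>' (\<lambda>\<beta>2 \<beta>3. r x1 x2 x3 \<beta>1 \<beta>2 \<beta>3))"
    if *: "x1 \<in> carrier L" "\<beta>1 \<in> carrier U" "x' \<in> carrier L" "\<beta>' \<in> carrier U" for x1 \<beta>1 x' \<beta>'
  proof -
    have "tt.R x1 \<beta>1 (\<lambda>\<alpha> y. t.W x' \<beta>' (J' \<alpha> y))
      = tt.R x1 \<beta>1 (\<lambda>\<alpha> y. csum L x' (\<lambda>x2 x3. csum U \<beta>' (\<lambda>\<beta>2 \<beta>3. J' (tgt U (\<tau> x2 \<beta>2) \<otimes>\<^bsub>U\<^esub> \<alpha>) y \<beta>3 x3)))"
      by (simp add: t.W_eq j')
    also have "\<dots> = csum L x' (\<lambda>x2 x3. csum U \<beta>' (\<lambda>\<beta>2 \<beta>3. r x1 x2 x3 \<beta>1 \<beta>2 \<beta>3))"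
      using * by (simp add: tt.R_csum r_def Rs)
    finally show ?thesis .
  qed
  have r_bal: "U.bal (\<lambda>\<beta>2 \<beta>3. r x1 x2 x3 \<beta>1 \<beta>2 \<beta>3)"
    if "x1 \<in> carrier L" "x2 \<in> carrier L" "x3 \<in> carrier L" "\<beta>1 \<in> carrier U" for x1 x2 x3 \<beta>1
    by (rule balancedI)
       (use that in \<open>simp_all add: r_def t.pairing_adds additives Rs t.pairing_B mults assocs
         balancedD(1)[OF s2'] tt.R_plus j'\<close>)
  have L3: "L.bal3 (\<lambda>x1 x2 x3. csum U \<beta> (\<lambda>\<beta>1 \<beta>'. csum U \<beta>' (\<lambda>\<beta>2 \<beta>3. r x1 x2 x3 \<beta>1 \<beta>2 \<beta>3)))"
  proof (rule balanced3I)
    fix b x1 x2 x3 assume *: "b \<in> carrier B" "x1 \<in> carrier L" "x2 \<in> carrier L" "x3 \<in> carrier L"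
    have "csum U \<beta>' (\<lambda>\<beta>2 \<beta>3. r x1 (tgt L b \<otimes>\<^bsub>L\<^esub> x2) x3 \<beta>1 \<beta>2 \<beta>3) = csum U \<beta>' (\<lambda>\<beta>2 \<beta>3. r x1 x2 (src L b \<otimes>\<^bsub>L\<^esub> x3) \<beta>1 \<beta>2 \<beta>3)"
      if **: "\<beta>1 \<in> carrier U" "\<beta>' \<in> carrier U" for \<beta>1 \<beta>'
    proof -
      have "csum U \<beta>' (\<lambda>\<beta>2 \<beta>3. r x1 (tgt L b \<otimes>\<^bsub>L\<^esub> x2) x3 \<beta>1 \<beta>2 \<beta>3) = csum U \<beta>' (\<lambda>\<beta>2 \<beta>3. r x1 x2 x3 \<beta>1 (\<beta>2 \<otimes>\<^bsub>U\<^esub> tgt U b) \<beta>3)"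
        unfolding r_def using * by (simp add: t.pairing_B)
      also have "\<dots> = csum U \<beta>' (\<lambda>\<beta>2 \<beta>3. r x1 x2 x3 \<beta>1 \<beta>2 (\<beta>3 \<otimes>\<^bsub>U\<^esub> src U b))"
        by (rule U.csum_takeuchi[OF r_bal[OF *(2,3,4) **(1)] *(1) **(2)])
      also have "\<dots> = csum U \<beta>' (\<lambda>\<beta>2 \<beta>3. r x1 x2 (src L b \<otimes>\<^bsub>L\<^esub> x3) \<beta>1 \<beta>2 \<beta>3)"
        unfolding r_def using * by (simp add: balancedD(3)[OF s2'])
      finally show ?thesis .
    qed
    then show "csum U \<beta> (\<lambda>\<beta>1 \<beta>'. csum U \<beta>' (\<lambda>\<beta>2 \<beta>3. r x1 (tgt L b \<otimes>\<^bsub>L\<^esub> x2) x3 \<beta>1 \<beta>2 \<beta>3))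
        = csum U \<beta> (\<lambda>\<beta>1 \<beta>'. csum U \<beta>' (\<lambda>\<beta>2 \<beta>3. r x1 x2 (src L b \<otimes>\<^bsub>L\<^esub> x3) \<beta>1 \<beta>2 \<beta>3))" by simp
  qed (simp_all add: r_def t.pairing_adds additives Rs t.pairing_B mults assocs
         balancedD(2)[OF s2'] tt.R_plus csum_plus)
  have U3: "U.bal3 (\<lambda>\<beta>1 \<beta>2 \<beta>3. csum L x' (\<lambda>x1 x2. r x1 x2 x3 \<beta>1 \<beta>2 \<beta>3))"
    if *: "x' \<in> carrier L" "x3 \<in> carrier L" for x' x3
  proof (rule balanced3I)
    fix b \<beta>1 \<beta>2 \<beta>3 assume **: "b \<in> carrier B" "\<beta>1 \<in> carrier U" "\<beta>2 \<in> carrier U" "\<beta>3 \<in> carrier U"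
    have "additive_on L (\<lambda>z. tt.R z \<beta>1 (\<lambda>\<alpha> y. J' \<alpha> y \<beta>3 x3))"
      by (rule additive_onI) (use * ** in \<open>simp add: Rs\<close>)
    from L.csum_takeuchi[OF t.right_kernel[OF this **(3)] **(1) *(1)]
    show "csum L x' (\<lambda>x1 x2. r x1 x2 x3 (tgt U b \<otimes>\<^bsub>U\<^esub> \<beta>1) \<beta>2 \<beta>3) = csum L x' (\<lambda>x1 x2. r x1 x2 x3 \<beta>1 (src U b \<otimes>\<^bsub>U\<^esub> \<beta>2) \<beta>3)"
      unfolding r_def using * ** by (simp add: Rs[symmetric] t.pairing_B assocs)
  next
    fix b \<beta>1 \<beta>2 \<beta>3 assume **: "b \<in> carrier B" "\<beta>1 \<in> carrier U" "\<beta>2 \<in> carrier U" "\<beta>3 \<in> carrier U"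
    then show "csum L x' (\<lambda>x1 x2. r x1 x2 x3 \<beta>1 (tgt U b \<otimes>\<^bsub>U\<^esub> \<beta>2) \<beta>3) = csum L x' (\<lambda>x1 x2. r x1 x2 x3 \<beta>1 \<beta>2 (src U b \<otimes>\<^bsub>U\<^esub> \<beta>3))"
      using * by (simp add: balancedD(3)[OF r_bal])
  qed (use * in \<open>simp_all add: csum_plus balancedD(1,2)[OF r_bal], simp_all add: r_def Rs csum_plus\<close>)
  have "R x \<beta> (cosum U L J) = t.W x \<beta> (cosum U L J')"
    unfolding cross_def J'_eq by (simp add: cosum_V[OF s t s2 t2 j])
  also have "\<dots> = cosum U L (\<lambda>\<beta>1 x1 \<beta>2 x2. t.W x1 \<beta>1 (\<lambda>\<alpha> y. J' \<alpha> y \<beta>2 x2)) \<beta> x"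
    by (rule cosum_W[OF s' t' s2' j' \<beta> x])
  also have "\<dots> = csum L x (\<lambda>x' x3. csum U \<beta> (\<lambda>\<beta>' \<beta>3. csum L x' (\<lambda>x1 x2. csum U \<beta>' (\<lambda>\<beta>1 \<beta>2. r x1 x2 x3 \<beta>1 \<beta>2 \<beta>3))))"
    unfolding cosum_def r_def cross_def
    by (subst csum_commute) (simp add: t.W_V_cancel[OF s' t'])
  also have "\<dots> = csum L x (\<lambda>x' x3. csum U \<beta> (\<lambda>\<beta>' \<beta>3. csum U \<beta>' (\<lambda>\<beta>1 \<beta>2. csum L x' (\<lambda>x1 x2. r x1 x2 x3 \<beta>1 \<beta>2 \<beta>3))))"
    by (intro csum_cong refl csum_commute)
  also have "\<dots> = csum L x (\<lambda>x' x3. csum U \<beta> (\<lambda>\<beta>1 \<beta>'. csum U \<beta>' (\<lambda>\<beta>2 \<beta>3. csum L x' (\<lambda>x1 x2. r x1 x2 x3 \<beta>1 \<beta>2 \<beta>3))))"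
    by (simp add: U.csum_coassoc[OF U3])
  also have "\<dots> = csum L x (\<lambda>x' x3. csum L x' (\<lambda>x1 x2. csum U \<beta> (\<lambda>\<beta>1 \<beta>'. csum U \<beta>' (\<lambda>\<beta>2 \<beta>3. r x1 x2 x3 \<beta>1 \<beta>2 \<beta>3))))"
    by (rule csum_cong[OF refl], subst csum_commute[of L], rule csum_cong[OF refl], rule csum_commute)
  also have "\<dots> = csum L x (\<lambda>x1 x'. csum L x' (\<lambda>x2 x3. csum U \<beta> (\<lambda>\<beta>1 \<beta>'. csum U \<beta>' (\<lambda>\<beta>2 \<beta>3. r x1 x2 x3 \<beta>1 \<beta>2 \<beta>3))))"
    by (rule L.csum_coassoc[OF L3])
  also have "\<dots> = csum L x (\<lambda>x1 x'. csum U \<beta> (\<lambda>\<beta>1 \<beta>'. csum L x' (\<lambda>x2 x3. csum U \<beta>' (\<lambda>\<beta>2 \<beta>3. r x1 x2 x3 \<beta>1 \<beta>2 \<beta>3))))"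
    by (intro csum_cong refl csum_commute)
  also have "\<dots> = cosum U L (\<lambda>\<beta>1 x1 \<beta>2 x2. tt.R x1 \<beta>1 (\<lambda>\<alpha> y. t.W x2 \<beta>2 (J' \<alpha> y))) \<beta> x"
    unfolding cosum_def by (subst csum_commute) (simp add: W_expand)
  finally show ?thesis unfolding cross_def[of _ _ _ _ \<tau> \<kappa>] J'_def .
qed

end

section \<open>The algebra structure of the twisted double\<close>

text \<open>
  The carrier-guarded form of \<open>tsum\<close>, with a congruence rule for the simplifier.
\<close>

definition gsum ::
  "('m, 'u) ring_scheme \<Rightarrow> ('n, 'v) ring_scheme \<Rightarrow> (('m \<times> 'n) \<Rightarrow>\<^sub>0 int) set \<Rightarrow> ('m \<Rightarrow> 'n \<Rightarrow> circle) \<Rightarrow> circle"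
  where "gsum M N C \<phi> = tsum C (\<lambda>x y. if x \<in> carrier M \<and> y \<in> carrier N then \<phi> x y else 0)"

lemma gsum_cong [cong]:
  assumes "C = D" "\<And>x y. x \<in> carrier M \<Longrightarrow> y \<in> carrier N \<Longrightarrow> \<phi> x y = \<psi> x y"
  shows "gsum M N C \<phi> = gsum M N D \<psi>"
  unfolding gsum_def using assms by (simp cong: if_cong conj_cong)

lemma gsum_plus: "gsum M N C (\<lambda>x y. \<phi> x y + \<psi> x y) = gsum M N C \<phi> + gsum M N C \<psi>"
  unfolding gsum_def tsum_plus[symmetric] by (rule arg_cong[where f = "tsum _"]) (auto simp: fun_eq_iff)

lemma gsum_commute:
  "gsum M N C (\<lambda>x y. gsum M' N' D (\<lambda>u v. \<phi> x y u v)) = gsum M' N' D (\<lambda>u v. gsum M N C (\<lambda>x y. \<phi> x y u v))"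
  unfolding gsum_def tsum_if
  by (subst tsum_commute) (intro arg_cong[where f = "tsum _"] ext, simp)

lemma (in tensor_product) gsum_tsum: "C \<in> carrier TP \<Longrightarrow> tsum C \<phi> = gsum M N C \<phi>"
  unfolding gsum_def by (rule tsum_cong) auto

lemma keys_frag_extend_subset:
  assumes "\<And>z. z \<in> Poly_Mapping.keys c \<Longrightarrow> Poly_Mapping.keys (h z) \<subseteq> S"
  shows "Poly_Mapping.keys (frag_extend h c) \<subseteq> S"
  by (rule order_trans[OF keys_frag_extend]) (use assms in blast)

lemma keys_expand_subset:
  assumes "\<And>z. z \<in> Poly_Mapping.keys (repr C) \<Longrightarrow> Poly_Mapping.keys (h z) \<subseteq> S"
  shows "Poly_Mapping.keys (expand h C) \<subseteq> S"
  unfolding expand_def by (rule keys_frag_extend_subset) (rule assms)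

context left_bialgebroid
begin

lemma keys_comult: "x \<in> carrier L \<Longrightarrow> z \<in> Poly_Mapping.keys (repr (comult L x)) \<Longrightarrow> fst z \<in> carrier L \<and> snd z \<in> carrier L"
  using dia.keys_repr[OF comult_carrier[of x]] by auto

lemma keys_comult3: "x \<in> carrier L \<Longrightarrow> Poly_Mapping.keys (comult3 L x) \<subseteq> carrier L \<times> carrier L \<times> carrier L"
  unfolding comult3_def case_prod_beta'
proof (intro keys_expand_subset)
  fix z w assume "x \<in> carrier L" "z \<in> Poly_Mapping.keys (repr (comult L x))"
    "w \<in> Poly_Mapping.keys (repr (comult L (snd z)))"
  then show "Poly_Mapping.keys (frag_of (fst z, fst w, snd w)) \<subseteq> carrier L \<times> carrier L \<times> carrier L"
    using keys_comult[of x z] keys_comult[of "snd z" w] by (simp add: mem_Times_iff)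
qed

lemma lin_comult3:
  assumes "x \<in> carrier L"
  shows "lin (\<lambda>(x1, x2, x3). \<phi> x1 x2 x3) (comult3 L x) = csum L x (\<lambda>x1 x'. csum L x' (\<lambda>x2 x3. \<phi> x1 x2 x3))"
proof -
  have "lin (\<lambda>(x1, x2, x3). \<phi> x1 x2 x3) (comult3 L x)
    = tsum (comult L x) (\<lambda>x1 x'. tsum (comult L x') (\<lambda>x2 x3. \<phi> x1 x2 x3))"
    unfolding comult3_def lin_expand by simp
  then show ?thesis
    unfolding csum_if using assms by simp (rule dia.tsum_cong[OF comult_carrier], auto)
qed

end

context hopf_algebroid
begin

lemma keys_plus_minus_elem:
  "x \<in> carrier L \<Longrightarrow> z \<in> Poly_Mapping.keys (repr (plus_minus K B L x)) \<Longrightarrow> fst z \<in> carrier L \<and> snd z \<in> carrier L"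
  using keys_plus_minus[of x] by auto

lemma keys_comult_plus_minus:
  "x \<in> carrier L \<Longrightarrow> Poly_Mapping.keys (comult_plus_minus K B L x) \<subseteq> carrier L \<times> carrier L \<times> carrier L"
  unfolding comult_plus_minus_def case_prod_beta'
proof (intro keys_expand_subset)
  fix z w assume "x \<in> carrier L" "z \<in> Poly_Mapping.keys (repr (comult L x))"
    "w \<in> Poly_Mapping.keys (repr (plus_minus K B L (snd z)))"
  then show "Poly_Mapping.keys (frag_of (fst z, fst w, snd w)) \<subseteq> carrier L \<times> carrier L \<times> carrier L"
    using keys_comult[of x z] keys_plus_minus_elem[of "snd z" w] by (simp add: mem_Times_iff)
qed

lemma lin_comult_plus_minus:
  assumes "x \<in> carrier L"
  shows "lin (\<lambda>(x1, p, m). \<phi> x1 p m) (comult_plus_minus K B L x) = csum L x (\<lambda>x1 x2. pm x2 (\<lambda>p m. \<phi> x1 p m))"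
proof -
  have "lin (\<lambda>(x1, p, m). \<phi> x1 p m) (comult_plus_minus K B L x)
    = tsum (comult L x) (\<lambda>x1 x2. tsum (plus_minus K B L x2) (\<lambda>p m. \<phi> x1 p m))"
    unfolding comult_plus_minus_def lin_expand by simp
  then show ?thesis
    unfolding csum_if pm_if using assms by simp (rule dia.tsum_cong[OF comult_carrier], auto)
qed

end

context hopf_pair
begin

sublocale be: tensor_product K U L "carrier B \<times> carrier B"
  "\<lambda>(b, c) \<alpha>. \<alpha> \<otimes>\<^bsub>U\<^esub> (src U b \<otimes>\<^bsub>U\<^esub> tgt U c)" "\<lambda>(b, c) x. (src L b \<otimes>\<^bsub>L\<^esub> tgt L c) \<otimes>\<^bsub>L\<^esub> x"
proof
  fix \<phi> k x y
  assume b: "balanced U L (carrier B \<times> carrier B) (\<lambda>(b, c) \<alpha>. \<alpha> \<otimes>\<^bsub>U\<^esub> (src U b \<otimes>\<^bsub>U\<^esub> tgt U c))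
      (\<lambda>(b, c) x. (src L b \<otimes>\<^bsub>L\<^esub> tgt L c) \<otimes>\<^bsub>L\<^esub> x) \<phi>"
    and k: "k \<in> carrier K" "x \<in> carrier U" "y \<in> carrier L"
  show "\<phi> (k \<odot>\<^bsub>U\<^esub> x) y = \<phi> x (k \<odot>\<^bsub>L\<^esub> y)"
    using balancedD(3)[OF b, of "(k \<odot>\<^bsub>B\<^esub> \<one>\<^bsub>B\<^esub>, \<one>\<^bsub>B\<^esub>)" x y] k
    by (simp add: U.smult_src_right L.smult_src)
qed (auto simp: case_prod_beta)

text \<open>
  The tensor product over the enveloping algebra is balanced over both of its factors, and each is
  recovered by putting the unit into the other.
\<close>

lemma be_bal_iff: "be.bal F \<longleftrightarrow> sbal F \<and> tbal F"
proof (intro iffI conjI)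
  assume b: "be.bal F"
  show "sbal F"
  proof (rule balancedI)
    fix b \<alpha> x assume "b \<in> carrier B" "\<alpha> \<in> carrier U" "x \<in> carrier L"
    then show "F (\<alpha> \<otimes>\<^bsub>U\<^esub> src U b) x = F \<alpha> (src L b \<otimes>\<^bsub>L\<^esub> x)"
      using balancedD(3)[OF b, of "(b, \<one>\<^bsub>B\<^esub>)" \<alpha> x] by simp
  qed (simp_all add: balancedD(1,2)[OF b])
  show "tbal F"
  proof (rule balancedI)
    fix b \<alpha> x assume "b \<in> carrier B" "\<alpha> \<in> carrier U" "x \<in> carrier L"
    then show "F (\<alpha> \<otimes>\<^bsub>U\<^esub> tgt U b) x = F \<alpha> (tgt L b \<otimes>\<^bsub>L\<^esub> x)"
      using balancedD(3)[OF b, of "(\<one>\<^bsub>B\<^esub>, b)" \<alpha> x] by simp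
  qed (simp_all add: balancedD(1,2)[OF b])
next
  assume "sbal F \<and> tbal F"
  then have s: "sbal F" and t: "tbal F" by auto
  show "be.bal F"
    by (rule balancedI)
       (auto simp: balancedD(1,2)[OF s] tbal_assoc[OF t] balancedD(3)[OF s] assocs)
qed

abbreviation "T \<equiv> tensor_Be K B U L"
abbreviation pure (infixl "\<boxtimes>" 70) where "\<alpha> \<boxtimes> x \<equiv> cls T (frag_of (\<alpha>, x))"

lemma T_TP: "T = be.TP"
  by (simp add: tensor_Be_def)

lemmas pure_closed [simp] = be.pure_closed[folded T_TP]
lemmas T_pure_ext = be.pure_ext[folded T_TP]
lemmas T_abelian = be.abelian_group_TP[folded T_TP]
lemmas T_gsum = be.gsum_tsum[folded T_TP]

lemma T_bal: "additive_on T \<Phi> \<Longrightarrow> be.bal (\<lambda>\<alpha> x. \<Phi> (\<alpha> \<boxtimes> x))"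
  by (rule be.balanced_pure[folded T_TP])

lemma T_sbal: "additive_on T \<Phi> \<Longrightarrow> sbal (\<lambda>\<alpha> x. \<Phi> (\<alpha> \<boxtimes> x))"
  and T_tbal: "additive_on T \<Phi> \<Longrightarrow> tbal (\<lambda>\<alpha> x. \<Phi> (\<alpha> \<boxtimes> x))"
  using T_bal[of \<Phi>] by (auto simp: be_bal_iff)

lemma T_additive: "be.bal F \<Longrightarrow> additive_on T (\<lambda>C. gsum U L C F)"
  using be.additive_tsum[folded T_TP, of F] T_gsum
    abelian_monoid.a_closed[OF abelian_group.axioms(1)[OF T_abelian]]
  by (auto simp: additive_on_def)

lemma gsum_pure: "be.bal F \<Longrightarrow> \<alpha> \<in> carrier U \<Longrightarrow> x \<in> carrier L \<Longrightarrow> gsum U L (\<alpha> \<boxtimes> x) F = F \<alpha> x"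
  using T_gsum[of "\<alpha> \<boxtimes> x" F] be.tsum_pure[folded T_TP, of F \<alpha> x] by simp

lemma additive_on_gsum: "additive_on T \<Phi> \<Longrightarrow> C \<in> carrier T \<Longrightarrow> \<Phi> C = gsum U L C (\<lambda>\<alpha> x. \<Phi> (\<alpha> \<boxtimes> x))"
  using be.additive_on_tsum[folded T_TP, of \<Phi> C] T_gsum by simp

lemma pure_src: "b \<in> carrier B \<Longrightarrow> \<alpha> \<in> carrier U \<Longrightarrow> x \<in> carrier L \<Longrightarrow> (\<alpha> \<otimes>\<^bsub>U\<^esub> src U b) \<boxtimes> x = \<alpha> \<boxtimes> (src L b \<otimes>\<^bsub>L\<^esub> x)"
  using be.pure_balanced[folded T_TP, of "(b, \<one>\<^bsub>B\<^esub>)" \<alpha> x] by simp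

lemma pure_tgt: "b \<in> carrier B \<Longrightarrow> \<alpha> \<in> carrier U \<Longrightarrow> x \<in> carrier L \<Longrightarrow> (\<alpha> \<otimes>\<^bsub>U\<^esub> tgt U b) \<boxtimes> x = \<alpha> \<boxtimes> (tgt L b \<otimes>\<^bsub>L\<^esub> x)"
  using be.pure_balanced[folded T_TP, of "(\<one>\<^bsub>B\<^esub>, b)" \<alpha> x] by simp

lemma T_add_closed [simp]: "C \<in> carrier T \<Longrightarrow> D \<in> carrier T \<Longrightarrow> C \<oplus>\<^bsub>T\<^esub> D \<in> carrier T"
  by (rule abelian_monoid.a_closed[OF abelian_group.axioms(1)[OF T_abelian]])

lemma T_separate:
  assumes "C \<in> carrier T" "D \<in> carrier T" "\<And>\<Phi>. additive_on T \<Phi> \<Longrightarrow> \<Phi> C = \<Phi> D"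
  shows "C = D"
  by (rule abelian_group.characters_separate[OF T_abelian assms])

lemma T_smult_closed [simp]: "k \<in> carrier K \<Longrightarrow> C \<in> carrier T \<Longrightarrow> k \<odot>\<^bsub>T\<^esub> C \<in> carrier T"
  by (rule be.smult_closed[folded T_TP])

lemma smult_bal: "be.bal F \<Longrightarrow> k \<in> carrier K \<Longrightarrow> be.bal (\<lambda>\<alpha> x. F (k \<odot>\<^bsub>U\<^esub> \<alpha>) x)"
  unfolding be_bal_iff
proof (elim conjE, intro conjI)
  assume k: "k \<in> carrier K" and s: "sbal F" and t: "tbal F"
  show "sbal (\<lambda>\<alpha> x. F (k \<odot>\<^bsub>U\<^esub> \<alpha>) x)"
    by (rule balancedI) (use k in \<open>simp_all add: U.smult_src additives balancedD(1,2)[OF s] sbal_assoc[OF s]\<close>)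
  show "tbal (\<lambda>\<alpha> x. F (k \<odot>\<^bsub>U\<^esub> \<alpha>) x)"
    by (rule balancedI) (use k in \<open>simp_all add: U.smult_src additives balancedD(1,2)[OF s] tbal_assoc[OF t]\<close>)
qed

lemma gsum_smult:
  assumes F: "be.bal F" and k: "k \<in> carrier K" and C: "C \<in> carrier T"
  shows "gsum U L (k \<odot>\<^bsub>T\<^esub> C) F = gsum U L C (\<lambda>\<alpha> x. F (k \<odot>\<^bsub>U\<^esub> \<alpha>) x)"
  using be.tsum_smult[folded T_TP, OF F, of k C] T_gsum C k by simp

lemma additive_smult:
  assumes "additive_on T \<Phi>" "k \<in> carrier K" "C \<in> carrier T"
  shows "\<Phi> (k \<odot>\<^bsub>T\<^esub> C) = gsum U L C (\<lambda>\<alpha> x. \<Phi> ((k \<odot>\<^bsub>U\<^esub> \<alpha>) \<boxtimes> x))"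
  using additive_on_gsum[OF assms(1), of "k \<odot>\<^bsub>T\<^esub> C"] gsum_smult[OF T_bal[OF assms(1)] assms(2,3)] assms by simp

lemma smult_pure:
  assumes "k \<in> carrier K" "\<alpha> \<in> carrier U" "x \<in> carrier L"
  shows "k \<odot>\<^bsub>T\<^esub> (\<alpha> \<boxtimes> x) = (k \<odot>\<^bsub>U\<^esub> \<alpha>) \<boxtimes> x"
proof (rule T_separate)
  fix \<Phi> assume \<Phi>: "additive_on T \<Phi>"
  show "\<Phi> (k \<odot>\<^bsub>T\<^esub> (\<alpha> \<boxtimes> x)) = \<Phi> ((k \<odot>\<^bsub>U\<^esub> \<alpha>) \<boxtimes> x)"
    using additive_smult[OF \<Phi> assms(1), of "\<alpha> \<boxtimes> x"] gsum_pure[OF smult_bal[OF T_bal[OF \<Phi>] assms(1)]] assms by simp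
qed (use assms in simp_all)

end

context hopf_pairings
begin

abbreviation "A \<equiv> double_algebra K B U L \<tau> \<kappa>"

lemma A_carrier [simp]: "carrier A = carrier T" and A_add [simp]: "ring.add A = ring.add T"
  and A_zero [simp]: "ring.zero A = ring.zero T" and A_smult [simp]: "module.smult A = module.smult T"
  and A_one: "\<one>\<^bsub>A\<^esub> = \<one>\<^bsub>U\<^esub> \<boxtimes> \<one>\<^bsub>L\<^esub>" and A_mult: "C \<otimes>\<^bsub>A\<^esub> D = double_mult K B U L \<tau> \<kappa> C D"
  by (simp_all add: double_algebra_def)

lemma mult_closed [simp]:
  assumes "C \<in> carrier T" "D \<in> carrier T" shows "C \<otimes>\<^bsub>A\<^esub> D \<in> carrier T"
proof -
  have C: "fst z \<in> carrier U" "snd z \<in> carrier L" if "z \<in> Poly_Mapping.keys (repr C)" "C \<in> carrier T" for z C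
    using be.keys_repr[folded T_TP, of C] that by auto
  have c3: "fst z \<in> carrier L" "fst (snd z) \<in> carrier L" "snd (snd z) \<in> carrier L"
    if "z \<in> Poly_Mapping.keys (comult3 L x)" "x \<in> carrier L" for z x
    using L.keys_comult3[OF that(2)] that(1) by auto
  have p3: "fst z \<in> carrier U" "fst (snd z) \<in> carrier U" "snd (snd z) \<in> carrier U"
    if "z \<in> Poly_Mapping.keys (comult_plus_minus K B U x)" "x \<in> carrier U" for z x
    using U.keys_comult_plus_minus[OF that(2)] that(1) by auto
  show ?thesis
    unfolding A_mult double_mult_def
    by (rule be.induced_closed[folded T_TP], unfold case_prod_beta', rule keys_expand_subset,
        rule keys_frag_extend_subset, rule keys_frag_extend_subset)
       (simp add: C assms c3 p3)
qed

lemma R_bal_inner: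
  assumes s: "sbal F" and t: "tbal F" and \<alpha>: "\<alpha> \<in> carrier U" and x: "x \<in> carrier L"
  shows "be.bal (\<lambda>\<beta> y. R x \<beta> (\<lambda>p z. F (\<alpha> \<otimes>\<^bsub>U\<^esub> p) (z \<otimes>\<^bsub>L\<^esub> y)))"
proof -
  note st = mult_sbal[OF s \<alpha>] mult_tbal[OF t \<alpha>]
  have 1: "sbal (\<lambda>\<beta> y. R x \<beta> (\<lambda>p z. F (\<alpha> \<otimes>\<^bsub>U\<^esub> p) (z \<otimes>\<^bsub>L\<^esub> y)))"
    by (rule balancedI)
       (use \<alpha> x in \<open>simp_all add: R_add_right[OF st] R_arg_src_right[OF st] additives balancedD[OF s] R_plus assocs\<close>)
  have 2: "tbal (\<lambda>\<beta> y. R x \<beta> (\<lambda>p z. F (\<alpha> \<otimes>\<^bsub>U\<^esub> p) (z \<otimes>\<^bsub>L\<^esub> y)))"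
    by (rule balancedI)
       (use \<alpha> x in \<open>simp_all add: R_add_right[OF st] R_arg_tgt_right[OF st] additives balancedD[OF s] R_plus assocs\<close>)
  show ?thesis using 1 2 by (simp add: be_bal_iff)
qed

lemma R_bal_outer:
  assumes s: "sbal F" and t: "tbal F"
  shows "be.bal (\<lambda>\<alpha> x. gsum U L D (\<lambda>\<beta> y. R x \<beta> (\<lambda>p z. F (\<alpha> \<otimes>\<^bsub>U\<^esub> p) (z \<otimes>\<^bsub>L\<^esub> y))))"
proof -
  note st = mult_sbal[OF s] mult_tbal[OF t]
  have 1: "sbal (\<lambda>\<alpha> x. gsum U L D (\<lambda>\<beta> y. R x \<beta> (\<lambda>p z. F (\<alpha> \<otimes>\<^bsub>U\<^esub> p) (z \<otimes>\<^bsub>L\<^esub> y))))"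
    by (rule balancedI)
       (simp_all add: R_add_left[OF st] R_src[OF st] additives balancedD[OF s] R_plus gsum_plus assocs)
  have 2: "tbal (\<lambda>\<alpha> x. gsum U L D (\<lambda>\<beta> y. R x \<beta> (\<lambda>p z. F (\<alpha> \<otimes>\<^bsub>U\<^esub> p) (z \<otimes>\<^bsub>L\<^esub> y))))"
    by (rule balancedI)
       (simp_all add: R_add_left[OF st] R_tgt[OF st] additives balancedD[OF s] R_plus gsum_plus assocs)
  show ?thesis using 1 2 by (simp add: be_bal_iff)
qed

text \<open>
  The product of the double, seen through characters.  The sums over \<open>x\<^sub>2, x\<^sub>3\<close> and over the components of \<open>\<beta>\<close>
  commute, which exhibits the composite of the two halves of the cross relation.
\<close>

lemma gsum_mult:
  assumes F: "be.bal F" and C: "C \<in> carrier T" and D: "D \<in> carrier T"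
  shows "gsum U L (C \<otimes>\<^bsub>A\<^esub> D) F = gsum U L C (\<lambda>\<alpha> x. gsum U L D (\<lambda>\<beta> y. R x \<beta> (\<lambda>p z. F (\<alpha> \<otimes>\<^bsub>U\<^esub> p) (z \<otimes>\<^bsub>L\<^esub> y))))"
proof -
  from F have s: "sbal F" and t: "tbal F" by (auto simp: be_bal_iff)
  have R: "R x \<beta> (\<lambda>p z. F (\<alpha> \<otimes>\<^bsub>U\<^esub> p) (z \<otimes>\<^bsub>L\<^esub> y))
    = lin (\<lambda>(x, y). F x y) (frag_extend (\<lambda>(x1, x2, x3). frag_extend (\<lambda>(\<beta>1, \<beta>2p, \<beta>2m).
        frag_of (\<alpha> \<otimes>\<^bsub>U\<^esub> src U (\<tau> x1 \<beta>1) \<otimes>\<^bsub>U\<^esub> \<beta>2p, tgt L (\<kappa> x3 \<beta>2m) \<otimes>\<^bsub>L\<^esub> x2 \<otimes>\<^bsub>L\<^esub> y))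
        (comult_plus_minus K B U \<beta>)) (comult3 L x))"
    if *: "\<alpha> \<in> carrier U" "x \<in> carrier L" "\<beta> \<in> carrier U" "y \<in> carrier L" for \<alpha> x \<beta> y
  proof -
    have "lin (\<lambda>(x, y). F x y) (frag_extend (\<lambda>(x1, x2, x3). frag_extend (\<lambda>(\<beta>1, \<beta>2p, \<beta>2m).
        frag_of (\<alpha> \<otimes>\<^bsub>U\<^esub> src U (\<tau> x1 \<beta>1) \<otimes>\<^bsub>U\<^esub> \<beta>2p, tgt L (\<kappa> x3 \<beta>2m) \<otimes>\<^bsub>L\<^esub> x2 \<otimes>\<^bsub>L\<^esub> y))
        (comult_plus_minus K B U \<beta>)) (comult3 L x))
      = lin (\<lambda>(x1, x2, x3). lin (\<lambda>(\<beta>1, p, m). F (\<alpha> \<otimes>\<^bsub>U\<^esub> src U (\<tau> x1 \<beta>1) \<otimes>\<^bsub>U\<^esub> p) (tgt L (\<kappa> x3 m) \<otimes>\<^bsub>L\<^esub> x2 \<otimes>\<^bsub>L\<^esub> y))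
          (comult_plus_minus K B U \<beta>)) (comult3 L x)"
      unfolding lin_frag_extend by (simp add: case_prod_beta' lin_frag_extend)
    also have "\<dots> = csum L x (\<lambda>x1 x'. csum L x' (\<lambda>x2 x3. csum U \<beta> (\<lambda>\<beta>1 \<beta>2. pmsum K B U \<beta>2 (\<lambda>p m.
        F (\<alpha> \<otimes>\<^bsub>U\<^esub> src U (\<tau> x1 \<beta>1) \<otimes>\<^bsub>U\<^esub> p) (tgt L (\<kappa> x3 m) \<otimes>\<^bsub>L\<^esub> x2 \<otimes>\<^bsub>L\<^esub> y)))))"
      using * by (simp add: L.lin_comult3 U.lin_comult_plus_minus)
    also have "\<dots> = csum L x (\<lambda>x1 x'. csum U \<beta> (\<lambda>\<beta>1 \<beta>2. pmsum K B U \<beta>2 (\<lambda>p m. csum L x' (\<lambda>x2 x3.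
        F (\<alpha> \<otimes>\<^bsub>U\<^esub> src U (\<tau> x1 \<beta>1) \<otimes>\<^bsub>U\<^esub> p) (tgt L (\<kappa> x3 m) \<otimes>\<^bsub>L\<^esub> x2 \<otimes>\<^bsub>L\<^esub> y)))))"
      by (rule csum_cong[OF refl], subst csum_commute[of L], rule csum_cong[OF refl], rule csum_pmsum_commute)
    also have "\<dots> = R x \<beta> (\<lambda>p z. F (\<alpha> \<otimes>\<^bsub>U\<^esub> p) (z \<otimes>\<^bsub>L\<^esub> y))"
      unfolding cross_def t.W_eq using *
      by (simp add: k.V_src[OF mult_tbal[OF t]]) (simp add: k.V_eq assocs)
    finally show ?thesis by simp
  qed
  have "gsum U L (C \<otimes>\<^bsub>A\<^esub> D) F = tsum (C \<otimes>\<^bsub>A\<^esub> D) F" using C D by (simp add: T_gsum)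
  also have "\<dots> = tsum C (\<lambda>\<alpha> x. tsum D (\<lambda>\<beta> y. lin (\<lambda>(x, y). F x y) (frag_extend (\<lambda>(x1, x2, x3). frag_extend (\<lambda>(\<beta>1, \<beta>2p, \<beta>2m).
        frag_of (\<alpha> \<otimes>\<^bsub>U\<^esub> src U (\<tau> x1 \<beta>1) \<otimes>\<^bsub>U\<^esub> \<beta>2p, tgt L (\<kappa> x3 \<beta>2m) \<otimes>\<^bsub>L\<^esub> x2 \<otimes>\<^bsub>L\<^esub> y))
        (comult_plus_minus K B U \<beta>)) (comult3 L x))))"
    unfolding A_mult double_mult_def be.tsum_induced_pair[folded T_TP, OF F] lin_expand by simp
  also have "\<dots> = gsum U L C (\<lambda>\<alpha> x. gsum U L D (\<lambda>\<beta> y. R x \<beta> (\<lambda>p z. F (\<alpha> \<otimes>\<^bsub>U\<^esub> p) (z \<otimes>\<^bsub>L\<^esub> y))))"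
    unfolding T_gsum[OF C] T_gsum[OF D] by (intro gsum_cong refl) (simp add: R)
  finally show ?thesis .
qed

lemma mult_add_left:
  assumes "C \<in> carrier T" "C' \<in> carrier T" "D \<in> carrier T"
  shows "(C \<oplus>\<^bsub>T\<^esub> C') \<otimes>\<^bsub>A\<^esub> D = C \<otimes>\<^bsub>A\<^esub> D \<oplus>\<^bsub>T\<^esub> C' \<otimes>\<^bsub>A\<^esub> D"
proof (rule T_separate)
  fix \<Phi> assume \<Phi>: "additive_on T \<Phi>"
  note st = T_sbal[OF \<Phi>] T_tbal[OF \<Phi>]
  show "\<Phi> ((C \<oplus>\<^bsub>T\<^esub> C') \<otimes>\<^bsub>A\<^esub> D) = \<Phi> (C \<otimes>\<^bsub>A\<^esub> D \<oplus>\<^bsub>T\<^esub> C' \<otimes>\<^bsub>A\<^esub> D)"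
    using assms additive_onD[OF T_additive[OF R_bal_outer[OF st, of D]], of C C']
    by (simp add: additive_onD[OF \<Phi>] additive_on_gsum[OF \<Phi>, of "_ \<otimes>\<^bsub>A\<^esub> _"] gsum_mult[OF T_bal[OF \<Phi>]])
qed (use assms in simp_all)

lemma mult_add_right:
  assumes "C \<in> carrier T" "D \<in> carrier T" "D' \<in> carrier T"
  shows "C \<otimes>\<^bsub>A\<^esub> (D \<oplus>\<^bsub>T\<^esub> D') = C \<otimes>\<^bsub>A\<^esub> D \<oplus>\<^bsub>T\<^esub> C \<otimes>\<^bsub>A\<^esub> D'"
proof (rule T_separate)
  fix \<Phi> assume \<Phi>: "additive_on T \<Phi>"
  note st = T_sbal[OF \<Phi>] T_tbal[OF \<Phi>]
  show "\<Phi> (C \<otimes>\<^bsub>A\<^esub> (D \<oplus>\<^bsub>T\<^esub> D')) = \<Phi> (C \<otimes>\<^bsub>A\<^esub> D \<oplus>\<^bsub>T\<^esub> C \<otimes>\<^bsub>A\<^esub> D')"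
    using assms additive_onD[OF T_additive[OF R_bal_inner[OF st]], of _ _ D D']
    by (simp add: additive_onD[OF \<Phi>] additive_on_gsum[OF \<Phi>, of "_ \<otimes>\<^bsub>A\<^esub> _"] gsum_mult[OF T_bal[OF \<Phi>]] gsum_plus)
qed (use assms in simp_all)

lemma mult_additive_left: "additive_on T \<Phi> \<Longrightarrow> D \<in> carrier T \<Longrightarrow> additive_on T (\<lambda>C. \<Phi> (C \<otimes>\<^bsub>A\<^esub> D))"
  by (rule additive_onI) (simp add: mult_add_left additive_onD)

lemma mult_additive_right: "additive_on T \<Phi> \<Longrightarrow> C \<in> carrier T \<Longrightarrow> additive_on T (\<lambda>D. \<Phi> (C \<otimes>\<^bsub>A\<^esub> D))"
  by (rule additive_onI) (simp add: mult_add_right additive_onD)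

lemma mult_pure:
  assumes \<Phi>: "additive_on T \<Phi>" and "\<alpha> \<in> carrier U" "x \<in> carrier L" "\<beta> \<in> carrier U" "y \<in> carrier L"
  shows "\<Phi> ((\<alpha> \<boxtimes> x) \<otimes>\<^bsub>A\<^esub> (\<beta> \<boxtimes> y)) = R x \<beta> (\<lambda>p z. \<Phi> ((\<alpha> \<otimes>\<^bsub>U\<^esub> p) \<boxtimes> (z \<otimes>\<^bsub>L\<^esub> y)))"
proof -
  note st = T_sbal[OF \<Phi>] T_tbal[OF \<Phi>]
  have "\<Phi> ((\<alpha> \<boxtimes> x) \<otimes>\<^bsub>A\<^esub> (\<beta> \<boxtimes> y)) = gsum U L (\<alpha> \<boxtimes> x) (\<lambda>\<alpha> x. gsum U L (\<beta> \<boxtimes> y) (\<lambda>\<beta> y. R x \<beta> (\<lambda>p z. \<Phi> ((\<alpha> \<otimes>\<^bsub>U\<^esub> p) \<boxtimes> (z \<otimes>\<^bsub>L\<^esub> y)))))"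
    using assms(2-) by (subst additive_on_gsum[OF \<Phi>]) (simp_all only: mult_closed pure_closed gsum_mult[OF T_bal[OF \<Phi>]])
  also have "\<dots> = gsum U L (\<beta> \<boxtimes> y) (\<lambda>\<beta> y. R x \<beta> (\<lambda>p z. \<Phi> ((\<alpha> \<otimes>\<^bsub>U\<^esub> p) \<boxtimes> (z \<otimes>\<^bsub>L\<^esub> y))))"
    by (rule gsum_pure[OF R_bal_outer[OF st] assms(2,3)])
  also have "\<dots> = R x \<beta> (\<lambda>p z. \<Phi> ((\<alpha> \<otimes>\<^bsub>U\<^esub> p) \<boxtimes> (z \<otimes>\<^bsub>L\<^esub> y)))"
    by (rule gsum_pure[OF R_bal_inner[OF st assms(2,3)] assms(4,5)])
  finally show ?thesis .
qed

text \<open>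
  On pure tensors both sides move \<open>x\<close> past \<open>\<beta>\<close> and \<open>y\<close> past \<open>\<gamma>\<close>.  The left side then moves \<open>w y\<close> past
  \<open>\<gamma>\<close>, with \<open>w\<close> what became of \<open>x\<close>; \<open>R_mult\<close> splits this, the independent moves commute, and \<open>R_mult_arg\<close> collects the
  moves of \<open>x\<close> into one past \<open>\<beta> \<gamma>'\<close>.
\<close>

lemma mult_assoc:
  assumes "C \<in> carrier T" "D \<in> carrier T" "E \<in> carrier T"
  shows "C \<otimes>\<^bsub>A\<^esub> D \<otimes>\<^bsub>A\<^esub> E = C \<otimes>\<^bsub>A\<^esub> (D \<otimes>\<^bsub>A\<^esub> E)"
proof (rule T_separate)
  fix \<Phi> assume \<Phi>: "additive_on T \<Phi>"
  note st = T_sbal[OF \<Phi>] T_tbal[OF \<Phi>]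
  note al = mult_additive_left and ar = mult_additive_right
  have pure: "\<Phi> ((\<alpha> \<boxtimes> x) \<otimes>\<^bsub>A\<^esub> (\<beta> \<boxtimes> y) \<otimes>\<^bsub>A\<^esub> (\<gamma> \<boxtimes> z)) = \<Phi> ((\<alpha> \<boxtimes> x) \<otimes>\<^bsub>A\<^esub> ((\<beta> \<boxtimes> y) \<otimes>\<^bsub>A\<^esub> (\<gamma> \<boxtimes> z)))"
    if *: "\<alpha> \<in> carrier U" "x \<in> carrier L" "\<beta> \<in> carrier U" "y \<in> carrier L" "\<gamma> \<in> carrier U" "z \<in> carrier L"
    for \<alpha> x \<beta> y \<gamma> z
  proof -
    have "\<Phi> ((\<alpha> \<boxtimes> x) \<otimes>\<^bsub>A\<^esub> (\<beta> \<boxtimes> y) \<otimes>\<^bsub>A\<^esub> (\<gamma> \<boxtimes> z))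
      = R x \<beta> (\<lambda>p w. R (w \<otimes>\<^bsub>L\<^esub> y) \<gamma> (\<lambda>q v. \<Phi> (((\<alpha> \<otimes>\<^bsub>U\<^esub> p) \<otimes>\<^bsub>U\<^esub> q) \<boxtimes> (v \<otimes>\<^bsub>L\<^esub> z))))"
      using * by (simp add: mult_pure[OF al[OF \<Phi>]] mult_pure[OF \<Phi>])
    also have "\<dots> = R x \<beta> (\<lambda>p w. R y \<gamma> (\<lambda>\<gamma>' y'. R w \<gamma>' (\<lambda>q v. \<Phi> (((\<alpha> \<otimes>\<^bsub>U\<^esub> p) \<otimes>\<^bsub>U\<^esub> q) \<boxtimes> ((v \<otimes>\<^bsub>L\<^esub> y') \<otimes>\<^bsub>L\<^esub> z)))))"
      using * by (simp add: R_mult[OF mult_sbal[OF st(1)] mult_tbal[OF st(2)]])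
    also have "\<dots> = R y \<gamma> (\<lambda>\<gamma>' y'. R x \<beta> (\<lambda>p w. R w \<gamma>' (\<lambda>q v. \<Phi> (((\<alpha> \<otimes>\<^bsub>U\<^esub> p) \<otimes>\<^bsub>U\<^esub> q) \<boxtimes> ((v \<otimes>\<^bsub>L\<^esub> y') \<otimes>\<^bsub>L\<^esub> z)))))"
    proof -
      have RW: "R a b (\<lambda>p w. t.W c d (\<lambda>q v. H p w q v)) = t.W c d (\<lambda>q v. R a b (\<lambda>p w. H p w q v))" for a b c d H
        unfolding t.W_eq R_csum ..
      have RV: "R a b (\<lambda>p w. k.V d c (\<lambda>q v. H p w q v)) = k.V d c (\<lambda>q v. R a b (\<lambda>p w. H p w q v))" for a b c d H
        unfolding k.V_eq R_pmsum R_csum ..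
      show ?thesis unfolding cross_def[of _ _ _ _ _ _ y \<gamma>] RW RV ..
    qed
    also have "\<dots> = R y \<gamma> (\<lambda>\<gamma>' y'. R x (\<beta> \<otimes>\<^bsub>U\<^esub> \<gamma>') (\<lambda>p v. \<Phi> ((\<alpha> \<otimes>\<^bsub>U\<^esub> p) \<boxtimes> (v \<otimes>\<^bsub>L\<^esub> (y' \<otimes>\<^bsub>L\<^esub> z)))))"
      using * by (simp add: R_mult_arg[OF mult_sbal[OF st(1)] mult_tbal[OF st(2)]] assocs)
    also have "\<dots> = \<Phi> ((\<alpha> \<boxtimes> x) \<otimes>\<^bsub>A\<^esub> ((\<beta> \<boxtimes> y) \<otimes>\<^bsub>A\<^esub> (\<gamma> \<boxtimes> z)))"
      using * by (simp add: mult_pure[OF ar[OF \<Phi>]] mult_pure[OF \<Phi>])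
    finally show ?thesis .
  qed
  have 1: "\<Phi> ((\<alpha> \<boxtimes> x) \<otimes>\<^bsub>A\<^esub> (\<beta> \<boxtimes> y) \<otimes>\<^bsub>A\<^esub> E) = \<Phi> ((\<alpha> \<boxtimes> x) \<otimes>\<^bsub>A\<^esub> ((\<beta> \<boxtimes> y) \<otimes>\<^bsub>A\<^esub> E))"
    if "\<alpha> \<in> carrier U" "x \<in> carrier L" "\<beta> \<in> carrier U" "y \<in> carrier L" for \<alpha> x \<beta> y
    by (rule T_pure_ext[OF _ _ assms(3)])
       (use that in \<open>simp_all add: pure ar[OF \<Phi>] ar[OF ar[OF \<Phi>], of "\<alpha> \<boxtimes> x"]\<close>)
  have 2: "\<Phi> ((\<alpha> \<boxtimes> x) \<otimes>\<^bsub>A\<^esub> D \<otimes>\<^bsub>A\<^esub> E) = \<Phi> ((\<alpha> \<boxtimes> x) \<otimes>\<^bsub>A\<^esub> (D \<otimes>\<^bsub>A\<^esub> E))"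
    if "\<alpha> \<in> carrier U" "x \<in> carrier L" for \<alpha> x
    by (rule T_pure_ext[OF _ _ assms(2)])
       (use that assms in \<open>simp_all add: 1 ar[OF al[OF \<Phi>]] al[OF ar[OF \<Phi>]]\<close>)
  show "\<Phi> (C \<otimes>\<^bsub>A\<^esub> D \<otimes>\<^bsub>A\<^esub> E) = \<Phi> (C \<otimes>\<^bsub>A\<^esub> (D \<otimes>\<^bsub>A\<^esub> E))"
    by (rule T_pure_ext[OF _ _ assms(1)])
       (use assms in \<open>simp_all add: 2 al[OF al[OF \<Phi>]] al[OF \<Phi>]\<close>)
qed (use assms in simp_all)

lemma U_mult_pure:
  assumes "\<gamma> \<in> carrier U" "\<alpha> \<in> carrier U" "x \<in> carrier L"
  shows "(\<gamma> \<boxtimes> \<one>\<^bsub>L\<^esub>) \<otimes>\<^bsub>A\<^esub> (\<alpha> \<boxtimes> x) = (\<gamma> \<otimes>\<^bsub>U\<^esub> \<alpha>) \<boxtimes> x"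
proof (rule T_separate)
  fix \<Phi> assume \<Phi>: "additive_on T \<Phi>"
  show "\<Phi> ((\<gamma> \<boxtimes> \<one>\<^bsub>L\<^esub>) \<otimes>\<^bsub>A\<^esub> (\<alpha> \<boxtimes> x)) = \<Phi> ((\<gamma> \<otimes>\<^bsub>U\<^esub> \<alpha>) \<boxtimes> x)"
    using assms by (simp add: mult_pure[OF \<Phi>] R_one_left[OF mult_sbal[OF T_sbal[OF \<Phi>]] mult_tbal[OF T_tbal[OF \<Phi>]]])
qed (use assms in simp_all)

lemma pure_mult_L:
  assumes "y \<in> carrier L" "\<alpha> \<in> carrier U" "x \<in> carrier L"
  shows "(\<alpha> \<boxtimes> x) \<otimes>\<^bsub>A\<^esub> (\<one>\<^bsub>U\<^esub> \<boxtimes> y) = \<alpha> \<boxtimes> (x \<otimes>\<^bsub>L\<^esub> y)"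
proof (rule T_separate)
  fix \<Phi> assume \<Phi>: "additive_on T \<Phi>"
  show "\<Phi> ((\<alpha> \<boxtimes> x) \<otimes>\<^bsub>A\<^esub> (\<one>\<^bsub>U\<^esub> \<boxtimes> y)) = \<Phi> (\<alpha> \<boxtimes> (x \<otimes>\<^bsub>L\<^esub> y))"
    using assms by (simp add: mult_pure[OF \<Phi>] R_one_right[OF mult_sbal[OF T_sbal[OF \<Phi>]] mult_tbal[OF T_tbal[OF \<Phi>]]])
qed (use assms in simp_all)

lemma one_mult: "C \<in> carrier T \<Longrightarrow> \<one>\<^bsub>A\<^esub> \<otimes>\<^bsub>A\<^esub> C = C"
proof (rule T_separate)
  fix \<Phi> assume \<Phi>: "additive_on T \<Phi>" and C: "C \<in> carrier T"
  show "\<Phi> (\<one>\<^bsub>A\<^esub> \<otimes>\<^bsub>A\<^esub> C) = \<Phi> C"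
    by (rule T_pure_ext[OF mult_additive_right[OF \<Phi>] \<Phi> C]) (simp_all add: A_one U_mult_pure)
qed (simp_all add: A_one)

lemma mult_one: "C \<in> carrier T \<Longrightarrow> C \<otimes>\<^bsub>A\<^esub> \<one>\<^bsub>A\<^esub> = C"
proof (rule T_separate)
  fix \<Phi> assume \<Phi>: "additive_on T \<Phi>" and C: "C \<in> carrier T"
  show "\<Phi> (C \<otimes>\<^bsub>A\<^esub> \<one>\<^bsub>A\<^esub>) = \<Phi> C"
    by (rule T_pure_ext[OF mult_additive_left[OF \<Phi>] \<Phi> C]) (simp_all add: A_one pure_mult_L)
qed (simp_all add: A_one)

lemma smult_left:
  assumes k: "k \<in> carrier K" and C: "C \<in> carrier T"
  shows "k \<odot>\<^bsub>T\<^esub> C = ((k \<odot>\<^bsub>U\<^esub> \<one>\<^bsub>U\<^esub>) \<boxtimes> \<one>\<^bsub>L\<^esub>) \<otimes>\<^bsub>A\<^esub> C"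
proof (rule T_separate)
  fix \<Phi> assume \<Phi>: "additive_on T \<Phi>"
  show "\<Phi> (k \<odot>\<^bsub>T\<^esub> C) = \<Phi> (((k \<odot>\<^bsub>U\<^esub> \<one>\<^bsub>U\<^esub>) \<boxtimes> \<one>\<^bsub>L\<^esub>) \<otimes>\<^bsub>A\<^esub> C)"
    unfolding additive_smult[OF \<Phi> k C]
    using k C by (subst additive_on_gsum[OF mult_additive_right[OF \<Phi>]]) (simp_all add: U_mult_pure U.L.smult_mult_left)
qed (use assms in simp_all)

lemma smult_right:
  assumes k: "k \<in> carrier K" and C: "C \<in> carrier T"
  shows "k \<odot>\<^bsub>T\<^esub> C = C \<otimes>\<^bsub>A\<^esub> (\<one>\<^bsub>U\<^esub> \<boxtimes> (k \<odot>\<^bsub>L\<^esub> \<one>\<^bsub>L\<^esub>))"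
proof (rule T_separate)
  fix \<Phi> assume \<Phi>: "additive_on T \<Phi>"
  have "(k \<odot>\<^bsub>U\<^esub> \<alpha>) \<boxtimes> x = \<alpha> \<boxtimes> (x \<otimes>\<^bsub>L\<^esub> (k \<odot>\<^bsub>L\<^esub> \<one>\<^bsub>L\<^esub>))" if "\<alpha> \<in> carrier U" "x \<in> carrier L" for \<alpha> x
    using k that pure_src[of "k \<odot>\<^bsub>B\<^esub> \<one>\<^bsub>B\<^esub>" \<alpha> x]
    by (simp add: U.smult_src_right[symmetric] L.smult_src[symmetric] L.L.smult_mult_right)
  then show "\<Phi> (k \<odot>\<^bsub>T\<^esub> C) = \<Phi> (C \<otimes>\<^bsub>A\<^esub> (\<one>\<^bsub>U\<^esub> \<boxtimes> (k \<odot>\<^bsub>L\<^esub> \<one>\<^bsub>L\<^esub>)))"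
    unfolding additive_smult[OF \<Phi> k C]
    using k C by (subst additive_on_gsum[OF mult_additive_left[OF \<Phi>]]) (simp_all add: pure_mult_L)
qed (use assms in simp_all)

lemma A_ring: "ring A"
proof (rule ringI)
  show "abelian_group A"
    using T_abelian unfolding abelian_group_def abelian_group_axioms_def abelian_monoid_def by simp
  show "monoid A"
    by (rule monoidI) (simp_all add: A_one mult_assoc one_mult[unfolded A_one] mult_one[unfolded A_one])
qed (simp_all add: mult_add_left mult_add_right)

lemma A_k_algebra: "k_algebra K A"
proof -
  interpret A: ring A by (rule A_ring)
  have ka: "(a \<oplus>\<^bsub>K\<^esub> b) \<odot>\<^bsub>U\<^esub> \<one>\<^bsub>U\<^esub> = a \<odot>\<^bsub>U\<^esub> \<one>\<^bsub>U\<^esub> \<oplus>\<^bsub>U\<^esub> b \<odot>\<^bsub>U\<^esub> \<one>\<^bsub>U\<^esub>" "(a \<otimes>\<^bsub>K\<^esub> b) \<odot>\<^bsub>U\<^esub> \<one>\<^bsub>U\<^esub> = (a \<odot>\<^bsub>U\<^esub> \<one>\<^bsub>U\<^esub>) \<otimes>\<^bsub>U\<^esub> (b \<odot>\<^bsub>U\<^esub> \<one>\<^bsub>U\<^esub>)"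
    if "a \<in> carrier K" "b \<in> carrier K" for a b
    using that by (simp_all add: U.L.smult_l_distr U.L.smult_assoc1 U.L.smult_mult_left)
  have pl: "(\<alpha> \<oplus>\<^bsub>U\<^esub> \<beta>) \<boxtimes> x = (\<alpha> \<boxtimes> x) \<oplus>\<^bsub>T\<^esub> (\<beta> \<boxtimes> x)" if "\<alpha> \<in> carrier U" "\<beta> \<in> carrier U" "x \<in> carrier L" for \<alpha> \<beta> x
    using be.pure_add_left[folded T_TP] that .
  have "module K A"
  proof (rule moduleI)
    show "cring K" by (rule domain.axioms(1)[OF field.axioms(1)[OF U.B.scalars.field_axioms]])
    show "abelian_group A" by (rule A.is_abelian_group)
    fix a b C D assume [simp]: "a \<in> carrier K" "b \<in> carrier K" "C \<in> carrier A" "D \<in> carrier A"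
    have [simp]: "C \<in> carrier T" "D \<in> carrier T" using \<open>C \<in> carrier A\<close> \<open>D \<in> carrier A\<close> by simp_all
    show "a \<odot>\<^bsub>A\<^esub> C \<in> carrier A" by simp
    show "(a \<oplus>\<^bsub>K\<^esub> b) \<odot>\<^bsub>A\<^esub> C = a \<odot>\<^bsub>A\<^esub> C \<oplus>\<^bsub>A\<^esub> b \<odot>\<^bsub>A\<^esub> C"
      by (simp add: smult_left ka pl mult_add_left)
    show "a \<odot>\<^bsub>A\<^esub> (C \<oplus>\<^bsub>A\<^esub> D) = a \<odot>\<^bsub>A\<^esub> C \<oplus>\<^bsub>A\<^esub> a \<odot>\<^bsub>A\<^esub> D"
      by (simp add: smult_left mult_add_right)
    show "(a \<otimes>\<^bsub>K\<^esub> b) \<odot>\<^bsub>A\<^esub> C = a \<odot>\<^bsub>A\<^esub> (b \<odot>\<^bsub>A\<^esub> C)"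
      by (simp add: smult_left ka U_mult_pure mult_assoc[symmetric])
  next
    fix C assume "C \<in> carrier A"
    then show "\<one>\<^bsub>K\<^esub> \<odot>\<^bsub>A\<^esub> C = C"
      using one_mult[unfolded A_one, of C] by (simp add: smult_left)
  qed
  moreover have "k_algebra_axioms K A"
  proof
    fix k C D assume "k \<in> carrier K" "C \<in> carrier A" "D \<in> carrier A"
    then have [simp]: "k \<in> carrier K" "C \<in> carrier T" "D \<in> carrier T" by simp_all
    show "(k \<odot>\<^bsub>A\<^esub> C) \<otimes>\<^bsub>A\<^esub> D = k \<odot>\<^bsub>A\<^esub> (C \<otimes>\<^bsub>A\<^esub> D)" by (simp add: smult_left mult_assoc)
    show "C \<otimes>\<^bsub>A\<^esub> (k \<odot>\<^bsub>A\<^esub> D) = k \<odot>\<^bsub>A\<^esub> (C \<otimes>\<^bsub>A\<^esub> D)" by (simp add: smult_right mult_assoc)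
  qed
  ultimately show ?thesis
    using U.B.scalars.field_axioms A_ring by (simp add: k_algebra_def)
qed

end

section \<open>The coaction\<close>

context hopf_pair
begin

text \<open>
  The functions on four arguments that come from characters of the tensor product of the double with
  itself over the base, see \<open>coupled_pure\<close>.
\<close>

definition coupled :: "('p \<Rightarrow> 'l \<Rightarrow> 'p \<Rightarrow> 'l \<Rightarrow> circle) \<Rightarrow> bool"
  where "coupled J \<longleftrightarrow>
    (\<forall>\<beta>\<in>carrier U. \<forall>y\<in>carrier L. sbal (\<lambda>\<alpha> x. J \<alpha> x \<beta> y) \<and> tbal (\<lambda>\<alpha> x. J \<alpha> x \<beta> y))
    \<and> (\<forall>\<alpha>\<in>carrier U. \<forall>x\<in>carrier L. sbal (J \<alpha> x) \<and> tbal (J \<alpha> x))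
    \<and> (\<forall>b\<in>carrier B. \<forall>\<alpha>\<in>carrier U. \<forall>x\<in>carrier L. \<forall>\<beta>\<in>carrier U. \<forall>y\<in>carrier L.
        J (tgt U b \<otimes>\<^bsub>U\<^esub> \<alpha>) x \<beta> y = J \<alpha> x (src U b \<otimes>\<^bsub>U\<^esub> \<beta>) y)"

lemma coupledI:
  assumes "\<And>\<beta> y. \<beta> \<in> carrier U \<Longrightarrow> y \<in> carrier L \<Longrightarrow> sbal (\<lambda>\<alpha> x. J \<alpha> x \<beta> y)"
    and "\<And>\<beta> y. \<beta> \<in> carrier U \<Longrightarrow> y \<in> carrier L \<Longrightarrow> tbal (\<lambda>\<alpha> x. J \<alpha> x \<beta> y)"
    and "\<And>\<alpha> x. \<alpha> \<in> carrier U \<Longrightarrow> x \<in> carrier L \<Longrightarrow> sbal (J \<alpha> x)"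
    and "\<And>\<alpha> x. \<alpha> \<in> carrier U \<Longrightarrow> x \<in> carrier L \<Longrightarrow> tbal (J \<alpha> x)"
    and "\<And>b \<alpha> x \<beta> y. b \<in> carrier B \<Longrightarrow> \<alpha> \<in> carrier U \<Longrightarrow> x \<in> carrier L \<Longrightarrow> \<beta> \<in> carrier U \<Longrightarrow> y \<in> carrier L
      \<Longrightarrow> J (tgt U b \<otimes>\<^bsub>U\<^esub> \<alpha>) x \<beta> y = J \<alpha> x (src U b \<otimes>\<^bsub>U\<^esub> \<beta>) y"
  shows "coupled J"
  using assms by (simp add: coupled_def)

lemma coupledD:
  assumes "coupled J"
  shows "\<beta> \<in> carrier U \<Longrightarrow> y \<in> carrier L \<Longrightarrow> sbal (\<lambda>\<alpha> x. J \<alpha> x \<beta> y)"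
    and "\<beta> \<in> carrier U \<Longrightarrow> y \<in> carrier L \<Longrightarrow> tbal (\<lambda>\<alpha> x. J \<alpha> x \<beta> y)"
    and "\<alpha> \<in> carrier U \<Longrightarrow> x \<in> carrier L \<Longrightarrow> sbal (J \<alpha> x)"
    and "\<alpha> \<in> carrier U \<Longrightarrow> x \<in> carrier L \<Longrightarrow> tbal (J \<alpha> x)"
    and "b \<in> carrier B \<Longrightarrow> \<alpha> \<in> carrier U \<Longrightarrow> x \<in> carrier L \<Longrightarrow> \<beta> \<in> carrier U \<Longrightarrow> y \<in> carrier L
      \<Longrightarrow> J (tgt U b \<otimes>\<^bsub>U\<^esub> \<alpha>) x \<beta> y = J \<alpha> x (src U b \<otimes>\<^bsub>U\<^esub> \<beta>) y"
  using assms by (simp_all add: coupled_def)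

lemma coupled_additive:
  assumes "coupled J" "\<alpha> \<in> carrier U" "x \<in> carrier L" "\<beta> \<in> carrier U" "y \<in> carrier L"
  shows "\<alpha>' \<in> carrier U \<Longrightarrow> J (\<alpha> \<oplus>\<^bsub>U\<^esub> \<alpha>') x \<beta> y = J \<alpha> x \<beta> y + J \<alpha>' x \<beta> y"
    and "x' \<in> carrier L \<Longrightarrow> J \<alpha> (x \<oplus>\<^bsub>L\<^esub> x') \<beta> y = J \<alpha> x \<beta> y + J \<alpha> x' \<beta> y"
    and "\<beta>' \<in> carrier U \<Longrightarrow> J \<alpha> x (\<beta> \<oplus>\<^bsub>U\<^esub> \<beta>') y = J \<alpha> x \<beta> y + J \<alpha> x \<beta>' y"
    and "y' \<in> carrier L \<Longrightarrow> J \<alpha> x \<beta> (y \<oplus>\<^bsub>L\<^esub> y') = J \<alpha> x \<beta> y + J \<alpha> x \<beta> y'"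
  using balancedD(1,2)[OF coupledD(1)[OF assms(1)]] balancedD(1,2)[OF coupledD(3)[OF assms(1)]] assms
  by simp_all

lemma coupled_balanced:
  assumes "coupled J" "\<alpha> \<in> carrier U" "x \<in> carrier L" "\<beta> \<in> carrier U" "y \<in> carrier L" "b \<in> carrier B"
  shows "J (\<alpha> \<otimes>\<^bsub>U\<^esub> src U b) x \<beta> y = J \<alpha> (src L b \<otimes>\<^bsub>L\<^esub> x) \<beta> y"
    and "J (\<alpha> \<otimes>\<^bsub>U\<^esub> tgt U b) x \<beta> y = J \<alpha> (tgt L b \<otimes>\<^bsub>L\<^esub> x) \<beta> y"
    and "J \<alpha> x (\<beta> \<otimes>\<^bsub>U\<^esub> src U b) y = J \<alpha> x \<beta> (src L b \<otimes>\<^bsub>L\<^esub> y)"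
    and "J \<alpha> x (\<beta> \<otimes>\<^bsub>U\<^esub> tgt U b) y = J \<alpha> x \<beta> (tgt L b \<otimes>\<^bsub>L\<^esub> y)"
    and "J (tgt U b \<otimes>\<^bsub>U\<^esub> \<alpha>) x \<beta> y = J \<alpha> x (src U b \<otimes>\<^bsub>U\<^esub> \<beta>) y"
  using balancedD(3)[OF coupledD(1)[OF assms(1)]] balancedD(3)[OF coupledD(2)[OF assms(1)]]
    balancedD(3)[OF coupledD(3)[OF assms(1)]] balancedD(3)[OF coupledD(4)[OF assms(1)]]
    coupledD(5)[OF assms(1)] assms
  by simp_all

lemma cosum_bal_pointwise_U:
  assumes "coupled J" "u \<in> carrier L" "v \<in> carrier L"
  shows "U.bal (\<lambda>p1 p2. J p1 u p2 v)"
  by (rule balancedI) (use assms in \<open>simp_all add: coupled_additive coupled_balanced\<close>)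

lemma cosum_bal_U:
  assumes "coupled J"
  shows "U.bal (\<lambda>\<alpha>1 \<alpha>2. csum L x (\<lambda>x1 x2. J \<alpha>1 x1 \<alpha>2 x2))"
  by (rule balancedI) (use assms in \<open>simp_all add: coupled_additive coupled_balanced(5) csum_plus\<close>)

lemma cosum_bal_L:
  assumes J: "coupled J" and \<alpha>: "\<alpha> \<in> carrier U"
  shows "L.bal (\<lambda>x1 x2. csum U \<alpha> (\<lambda>\<alpha>1 \<alpha>2. J \<alpha>1 x1 \<alpha>2 x2))"
proof (rule balancedI)
  fix b u v assume *: "b \<in> carrier B" "u \<in> carrier L" "v \<in> carrier L"
  show "csum U \<alpha> (\<lambda>p1 p2. J p1 (tgt L b \<otimes>\<^bsub>L\<^esub> u) p2 v) = csum U \<alpha> (\<lambda>p1 p2. J p1 u p2 (src L b \<otimes>\<^bsub>L\<^esub> v))"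
    using U.csum_takeuchi[OF cosum_bal_pointwise_U[OF J *(2,3)] *(1) \<alpha>] * J
    by (simp add: coupled_balanced)
qed (use assms in \<open>simp_all add: coupled_additive csum_plus\<close>)

lemma cosum_alt: "cosum U L J \<alpha> x = csum L x (\<lambda>x1 x2. csum U \<alpha> (\<lambda>\<alpha>1 \<alpha>2. J \<alpha>1 x1 \<alpha>2 x2))"
  unfolding cosum_def by (rule csum_commute)

lemma cosum_cong [cong]:
  assumes "\<alpha> = \<beta>" "x = y"
    "\<And>\<alpha> x \<beta> y. \<alpha> \<in> carrier U \<Longrightarrow> x \<in> carrier L \<Longrightarrow> \<beta> \<in> carrier U \<Longrightarrow> y \<in> carrier L \<Longrightarrow> J \<alpha> x \<beta> y = J' \<alpha> x \<beta> y"
  shows "cosum U L J \<alpha> x = cosum U L J' \<beta> y"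
  unfolding cosum_def using assms by simp

lemma cosum_src:
  "coupled J \<Longrightarrow> b \<in> carrier B \<Longrightarrow> \<alpha> \<in> carrier U \<Longrightarrow> x \<in> carrier L
    \<Longrightarrow> cosum U L J (src U b \<otimes>\<^bsub>U\<^esub> \<alpha>) x = cosum U L (\<lambda>\<alpha> x \<beta> y. J (src U b \<otimes>\<^bsub>U\<^esub> \<alpha>) x \<beta> y) \<alpha> x"
  unfolding cosum_def by (rule U.csum_src[OF cosum_bal_U])

lemma cosum_tgt:
  "coupled J \<Longrightarrow> b \<in> carrier B \<Longrightarrow> \<alpha> \<in> carrier U \<Longrightarrow> x \<in> carrier L
    \<Longrightarrow> cosum U L J (tgt U b \<otimes>\<^bsub>U\<^esub> \<alpha>) x = cosum U L (\<lambda>\<alpha> x \<beta> y. J \<alpha> x (tgt U b \<otimes>\<^bsub>U\<^esub> \<beta>) y) \<alpha> x"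
  unfolding cosum_def by (rule U.csum_tgt[OF cosum_bal_U])

lemma cosum_src_right:
  "coupled J \<Longrightarrow> b \<in> carrier B \<Longrightarrow> \<alpha> \<in> carrier U \<Longrightarrow> x \<in> carrier L
    \<Longrightarrow> cosum U L J \<alpha> (x \<otimes>\<^bsub>L\<^esub> src L b) = cosum U L (\<lambda>\<alpha> x \<beta> y. J \<alpha> (x \<otimes>\<^bsub>L\<^esub> src L b) \<beta> y) \<alpha> x"
  unfolding cosum_alt by (rule L.csum_src_right[OF cosum_bal_L])

lemma cosum_takeuchi:
  "coupled J \<Longrightarrow> b \<in> carrier B \<Longrightarrow> \<alpha> \<in> carrier U \<Longrightarrow> x \<in> carrier L
    \<Longrightarrow> cosum U L (\<lambda>\<alpha> x \<beta> y. J \<alpha> (x \<otimes>\<^bsub>L\<^esub> tgt L b) \<beta> y) \<alpha> x = cosum U L (\<lambda>\<alpha> x \<beta> y. J \<alpha> x \<beta> (y \<otimes>\<^bsub>L\<^esub> src L b)) \<alpha> x"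
  unfolding cosum_alt by (rule L.csum_takeuchi[OF cosum_bal_L])

lemma cosum_one:
  assumes J: "coupled J" shows "cosum U L J \<one>\<^bsub>U\<^esub> \<one>\<^bsub>L\<^esub> = J \<one>\<^bsub>U\<^esub> \<one>\<^bsub>L\<^esub> \<one>\<^bsub>U\<^esub> \<one>\<^bsub>L\<^esub>"
proof -
  have "L.bal (\<lambda>x1 x2. J \<one>\<^bsub>U\<^esub> x1 \<one>\<^bsub>U\<^esub> x2)"
  proof (rule balancedI)
    fix b x1 x2 assume *: "b \<in> carrier B" "x1 \<in> carrier L" "x2 \<in> carrier L"
    show "J \<one>\<^bsub>U\<^esub> (tgt L b \<otimes>\<^bsub>L\<^esub> x1) \<one>\<^bsub>U\<^esub> x2 = J \<one>\<^bsub>U\<^esub> x1 \<one>\<^bsub>U\<^esub> (src L b \<otimes>\<^bsub>L\<^esub> x2)"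
      using coupled_balanced(2,3,5)[OF J, of "\<one>\<^bsub>U\<^esub>" x1 "\<one>\<^bsub>U\<^esub>" x2 b] * by simp
  qed (simp_all add: coupled_additive[OF J])
  then show ?thesis
    unfolding cosum_def by (simp add: U.csum_one[OF cosum_bal_U[OF J]] L.csum_one)
qed

lemma cosum_bal:
  assumes J: "coupled J" shows "be.bal (cosum U L J)"
proof -
  have s: "sbal (cosum U L J)"
  proof (rule balancedI)
    fix b \<alpha> x assume *: "b \<in> carrier B" "\<alpha> \<in> carrier U" "x \<in> carrier L"
    have "cosum U L J (\<alpha> \<otimes>\<^bsub>U\<^esub> src U b) x = csum U \<alpha> (\<lambda>\<alpha>1 \<alpha>2. csum L x (\<lambda>x1 x2. J \<alpha>1 (src L b \<otimes>\<^bsub>L\<^esub> x1) \<alpha>2 x2))"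
      unfolding cosum_def using * J by (simp add: U.csum_src_right[OF cosum_bal_U[OF J]] coupled_balanced)
    also have "\<dots> = csum L x (\<lambda>x1 x2. csum U \<alpha> (\<lambda>\<alpha>1 \<alpha>2. J \<alpha>1 (src L b \<otimes>\<^bsub>L\<^esub> x1) \<alpha>2 x2))"
      by (rule csum_commute)
    also have "\<dots> = cosum U L J \<alpha> (src L b \<otimes>\<^bsub>L\<^esub> x)"
      unfolding cosum_alt using * by (simp add: L.csum_src[OF cosum_bal_L[OF J]])
    finally show "cosum U L J (\<alpha> \<otimes>\<^bsub>U\<^esub> src U b) x = cosum U L J \<alpha> (src L b \<otimes>\<^bsub>L\<^esub> x)" .
  next
    fix \<alpha> x x' assume *: "\<alpha> \<in> carrier U" "x \<in> carrier L" "x' \<in> carrier L"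
    then show "cosum U L J \<alpha> (x \<oplus>\<^bsub>L\<^esub> x') = cosum U L J \<alpha> x + cosum U L J \<alpha> x'"
      unfolding cosum_alt by (simp add: L.csum_add[OF cosum_bal_L[OF J]])
  qed (simp add: cosum_def U.csum_add[OF cosum_bal_U[OF J]])
  have t: "tbal (cosum U L J)"
  proof (rule balancedI)
    fix b \<alpha> x assume *: "b \<in> carrier B" "\<alpha> \<in> carrier U" "x \<in> carrier L"
    have "cosum U L J (\<alpha> \<otimes>\<^bsub>U\<^esub> tgt U b) x = csum U \<alpha> (\<lambda>\<alpha>1 \<alpha>2. csum L x (\<lambda>x1 x2. J \<alpha>1 x1 \<alpha>2 (tgt L b \<otimes>\<^bsub>L\<^esub> x2)))"
      unfolding cosum_def using * J by (simp add: U.csum_tgt_right[OF cosum_bal_U[OF J]] coupled_balanced)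
    also have "\<dots> = csum L x (\<lambda>x1 x2. csum U \<alpha> (\<lambda>\<alpha>1 \<alpha>2. J \<alpha>1 x1 \<alpha>2 (tgt L b \<otimes>\<^bsub>L\<^esub> x2)))"
      by (rule csum_commute)
    also have "\<dots> = cosum U L J \<alpha> (tgt L b \<otimes>\<^bsub>L\<^esub> x)"
      unfolding cosum_alt using * by (simp add: L.csum_tgt[OF cosum_bal_L[OF J]])
    finally show "cosum U L J (\<alpha> \<otimes>\<^bsub>U\<^esub> tgt U b) x = cosum U L J \<alpha> (tgt L b \<otimes>\<^bsub>L\<^esub> x)" .
  qed (simp_all add: balancedD(1,2)[OF s])
  show ?thesis using s t by (simp add: be_bal_iff)
qed

text \<open>
  Coassociativity in \<open>U\<close> and in \<open>L\<close>, applied one after the other.  That the inner sum over \<open>\<alpha>\<close> is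
  balanced in the components of \<open>x\<close> rests on the Takeuchi condition for \<open>U\<close>.
\<close>

lemma cosum_coassoc:
  assumes 12: "\<And>\<alpha>3 x3. \<alpha>3 \<in> carrier U \<Longrightarrow> x3 \<in> carrier L \<Longrightarrow> coupled (\<lambda>\<alpha>1 x1 \<alpha>2 x2. \<phi> \<alpha>1 x1 \<alpha>2 x2 \<alpha>3 x3)"
    and 23: "\<And>\<alpha>1 x1. \<alpha>1 \<in> carrier U \<Longrightarrow> x1 \<in> carrier L \<Longrightarrow> coupled (\<phi> \<alpha>1 x1)"
    and \<alpha>: "\<alpha> \<in> carrier U" and x: "x \<in> carrier L"
  shows "cosum U L (\<lambda>\<alpha>' x' \<alpha>3 x3. cosum U L (\<lambda>\<alpha>1 x1 \<alpha>2 x2. \<phi> \<alpha>1 x1 \<alpha>2 x2 \<alpha>3 x3) \<alpha>' x') \<alpha> x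
    = cosum U L (\<lambda>\<alpha>1 x1 \<alpha>' x'. cosum U L (\<phi> \<alpha>1 x1) \<alpha>' x') \<alpha> x"
proof -
  have u3: "U.bal3 (\<lambda>\<alpha>1 \<alpha>2 \<alpha>3. \<phi> \<alpha>1 x1 \<alpha>2 x2 \<alpha>3 x3)"
    if "x1 \<in> carrier L" "x2 \<in> carrier L" "x3 \<in> carrier L" for x1 x2 x3
    by (rule balanced3I)
       (use that in \<open>simp_all add: coupled_additive[OF 12] coupled_additive[OF 23]
         coupled_balanced(5)[OF 12] coupled_balanced(5)[OF 23]\<close>)
  have l3: "L.bal3 (\<lambda>x1 x2 x3. csum U \<alpha> (\<lambda>\<alpha>1 \<alpha>'. csum U \<alpha>' (\<lambda>\<alpha>2 \<alpha>3. \<phi> \<alpha>1 x1 \<alpha>2 x2 \<alpha>3 x3)))"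
  proof (rule balanced3I)
    fix b x1 x2 x3 assume *: "b \<in> carrier B" "x1 \<in> carrier L" "x2 \<in> carrier L" "x3 \<in> carrier L"
    have "csum U \<alpha> (\<lambda>\<alpha>' \<alpha>3. csum U \<alpha>' (\<lambda>\<alpha>1 \<alpha>2. \<phi> \<alpha>1 (tgt L b \<otimes>\<^bsub>L\<^esub> x1) \<alpha>2 x2 \<alpha>3 x3))
      = csum U \<alpha> (\<lambda>\<alpha>' \<alpha>3. csum U \<alpha>' (\<lambda>\<alpha>1 \<alpha>2. \<phi> \<alpha>1 x1 \<alpha>2 (src L b \<otimes>\<^bsub>L\<^esub> x2) \<alpha>3 x3))"
      using * by (simp add: balancedD(3)[OF cosum_bal_L[OF 12]])
    then show "csum U \<alpha> (\<lambda>\<alpha>1 \<alpha>'. csum U \<alpha>' (\<lambda>\<alpha>2 \<alpha>3. \<phi> \<alpha>1 (tgt L b \<otimes>\<^bsub>L\<^esub> x1) \<alpha>2 x2 \<alpha>3 x3))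
      = csum U \<alpha> (\<lambda>\<alpha>1 \<alpha>'. csum U \<alpha>' (\<lambda>\<alpha>2 \<alpha>3. \<phi> \<alpha>1 x1 \<alpha>2 (src L b \<otimes>\<^bsub>L\<^esub> x2) \<alpha>3 x3))"
      using * by (simp add: U.csum_coassoc[OF u3])
  next
    fix b x1 x2 x3 assume *: "b \<in> carrier B" "x1 \<in> carrier L" "x2 \<in> carrier L" "x3 \<in> carrier L"
    then show "csum U \<alpha> (\<lambda>\<alpha>1 \<alpha>'. csum U \<alpha>' (\<lambda>\<alpha>2 \<alpha>3. \<phi> \<alpha>1 x1 \<alpha>2 (tgt L b \<otimes>\<^bsub>L\<^esub> x2) \<alpha>3 x3))
      = csum U \<alpha> (\<lambda>\<alpha>1 \<alpha>'. csum U \<alpha>' (\<lambda>\<alpha>2 \<alpha>3. \<phi> \<alpha>1 x1 \<alpha>2 x2 \<alpha>3 (src L b \<otimes>\<^bsub>L\<^esub> x3)))"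
      by (simp add: balancedD(3)[OF cosum_bal_L[OF 23]])
  qed (simp_all add: coupled_additive[OF 12] coupled_additive[OF 23] csum_plus)
  have "cosum U L (\<lambda>\<alpha>' x' \<alpha>3 x3. cosum U L (\<lambda>\<alpha>1 x1 \<alpha>2 x2. \<phi> \<alpha>1 x1 \<alpha>2 x2 \<alpha>3 x3) \<alpha>' x') \<alpha> x
    = csum L x (\<lambda>x' x3. csum U \<alpha> (\<lambda>\<alpha>' \<alpha>3. csum L x' (\<lambda>x1 x2. csum U \<alpha>' (\<lambda>\<alpha>1 \<alpha>2. \<phi> \<alpha>1 x1 \<alpha>2 x2 \<alpha>3 x3))))"
    unfolding cosum_alt ..
  also have "\<dots> = csum L x (\<lambda>x' x3. csum L x' (\<lambda>x1 x2. csum U \<alpha> (\<lambda>\<alpha>' \<alpha>3. csum U \<alpha>' (\<lambda>\<alpha>1 \<alpha>2. \<phi> \<alpha>1 x1 \<alpha>2 x2 \<alpha>3 x3))))"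
    by (intro csum_cong refl csum_commute)
  also have "\<dots> = csum L x (\<lambda>x' x3. csum L x' (\<lambda>x1 x2. csum U \<alpha> (\<lambda>\<alpha>1 \<alpha>'. csum U \<alpha>' (\<lambda>\<alpha>2 \<alpha>3. \<phi> \<alpha>1 x1 \<alpha>2 x2 \<alpha>3 x3))))"
    by (simp add: U.csum_coassoc[OF u3])
  also have "\<dots> = csum L x (\<lambda>x1 x'. csum L x' (\<lambda>x2 x3. csum U \<alpha> (\<lambda>\<alpha>1 \<alpha>'. csum U \<alpha>' (\<lambda>\<alpha>2 \<alpha>3. \<phi> \<alpha>1 x1 \<alpha>2 x2 \<alpha>3 x3))))"
    by (rule L.csum_coassoc[OF l3])
  also have "\<dots> = csum L x (\<lambda>x1 x'. csum U \<alpha> (\<lambda>\<alpha>1 \<alpha>'. csum L x' (\<lambda>x2 x3. csum U \<alpha>' (\<lambda>\<alpha>2 \<alpha>3. \<phi> \<alpha>1 x1 \<alpha>2 x2 \<alpha>3 x3))))"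
    by (intro csum_cong refl csum_commute)
  also have "\<dots> = cosum U L (\<lambda>\<alpha>1 x1 \<alpha>' x'. cosum U L (\<phi> \<alpha>1 x1) \<alpha>' x') \<alpha> x"
    unfolding cosum_alt ..
  finally show ?thesis .
qed

abbreviation "ds \<equiv> double_src K B U L"
abbreviation "dt \<equiv> double_tgt K B U L"

lemma ds_closed [simp]: "b \<in> carrier B \<Longrightarrow> ds b \<in> carrier T"
  and dt_closed [simp]: "b \<in> carrier B \<Longrightarrow> dt b \<in> carrier T"
  by (simp_all add: double_src_def double_tgt_def)

lemma ds_alt: "b \<in> carrier B \<Longrightarrow> ds b = \<one>\<^bsub>U\<^esub> \<boxtimes> src L b"
  using pure_src[of b "\<one>\<^bsub>U\<^esub>" "\<one>\<^bsub>L\<^esub>"] by (simp add: double_src_def)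

lemma dt_alt: "b \<in> carrier B \<Longrightarrow> dt b = \<one>\<^bsub>U\<^esub> \<boxtimes> tgt L b"
  using pure_tgt[of b "\<one>\<^bsub>U\<^esub>" "\<one>\<^bsub>L\<^esub>"] by (simp add: double_tgt_def)

lemma ds_add: "a \<in> carrier B \<Longrightarrow> b \<in> carrier B \<Longrightarrow> ds (a \<oplus>\<^bsub>B\<^esub> b) = ds a \<oplus>\<^bsub>T\<^esub> ds b"
  using be.pure_add_left[folded T_TP, of "src U a" "src U b" "\<one>\<^bsub>L\<^esub>"] by (simp add: double_src_def U.src_add)

lemma dt_add: "a \<in> carrier B \<Longrightarrow> b \<in> carrier B \<Longrightarrow> dt (a \<oplus>\<^bsub>B\<^esub> b) = dt a \<oplus>\<^bsub>T\<^esub> dt b"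
  using be.pure_add_left[folded T_TP, of "tgt U a" "tgt U b" "\<one>\<^bsub>L\<^esub>"] by (simp add: double_tgt_def U.tgt_add)

lemma ds_one: "ds \<one>\<^bsub>B\<^esub> = \<one>\<^bsub>U\<^esub> \<boxtimes> \<one>\<^bsub>L\<^esub>" and dt_one: "dt \<one>\<^bsub>B\<^esub> = \<one>\<^bsub>U\<^esub> \<boxtimes> \<one>\<^bsub>L\<^esub>"
  by (simp_all add: double_src_def double_tgt_def)

text \<open>
  On pure tensors \<open>\<epsilon>(\<alpha> \<otimes> x) = \<epsilon>(\<alpha> \<epsilon>(x))\<close>.
\<close>

definition eps where "eps = evaluate B (\<lambda>(\<alpha>, x). counit U (\<alpha> \<otimes>\<^bsub>U\<^esub> src U (counit L x)))"

lemma eps_bal: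
  assumes h: "additive_on B h"
  shows "be.bal (\<lambda>\<alpha> x. h (counit U (\<alpha> \<otimes>\<^bsub>U\<^esub> src U (counit L x))))"
proof -
  note cu = U.counit_add L.counit_add U.counit_src U.counit_tgt L.counit_src L.counit_tgt
  have "sbal (\<lambda>\<alpha> x. h (counit U (\<alpha> \<otimes>\<^bsub>U\<^esub> src U (counit L x))))"
    by (rule balancedI) (simp_all add: additives cu additive_onD[OF h] mults assocs)
  moreover have "tbal (\<lambda>\<alpha> x. h (counit U (\<alpha> \<otimes>\<^bsub>U\<^esub> src U (counit L x))))"
  proof (rule balancedI)
    fix b \<alpha> x assume *: "b \<in> carrier B" "\<alpha> \<in> carrier U" "x \<in> carrier L"
    have "\<alpha> \<otimes>\<^bsub>U\<^esub> tgt U b \<otimes>\<^bsub>U\<^esub> src U (counit L x) = \<alpha> \<otimes>\<^bsub>U\<^esub> src U (counit L x) \<otimes>\<^bsub>U\<^esub> tgt U b"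
      using * by (simp add: assocs U.src_tgt_commute)
    then have "counit U (\<alpha> \<otimes>\<^bsub>U\<^esub> tgt U b \<otimes>\<^bsub>U\<^esub> src U (counit L x)) = counit U (\<alpha> \<otimes>\<^bsub>U\<^esub> src U (counit L x) \<otimes>\<^bsub>U\<^esub> src U b)"
      using * by (simp add: U.counit_mult_tgt_src)
    then show "h (counit U (\<alpha> \<otimes>\<^bsub>U\<^esub> tgt U b \<otimes>\<^bsub>U\<^esub> src U (counit L x))) = h (counit U (\<alpha> \<otimes>\<^bsub>U\<^esub> src U (counit L (tgt L b \<otimes>\<^bsub>L\<^esub> x))))"
      using * by (simp add: cu mults assocs)
  qed (simp_all add: additives cu additive_onD[OF h])
  ultimately show ?thesis by (simp add: be_bal_iff)
qed

lemma eps_closed [simp]: assumes "C \<in> carrier T" shows "eps C \<in> carrier B"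
  unfolding eps_def
  using be.keys_repr[folded T_TP, OF assms]
  by (intro abelian_group.evaluate_closed[OF U.B.total.is_abelian_group]) auto

lemma additive_eps_gsum:
  assumes h: "additive_on B h" and C: "C \<in> carrier T"
  shows "h (eps C) = gsum U L C (\<lambda>\<alpha> x. h (counit U (\<alpha> \<otimes>\<^bsub>U\<^esub> src U (counit L x))))"
proof -
  have "h (eps C) = lin (\<lambda>z. h ((\<lambda>(\<alpha>, x). counit U (\<alpha> \<otimes>\<^bsub>U\<^esub> src U (counit L x))) z)) (repr C)"
    unfolding eps_def using be.keys_repr[folded T_TP, OF C]
    by (intro abelian_group.additive_on_evaluate[OF U.B.total.is_abelian_group] h) auto
  then show ?thesis using C by (simp add: T_gsum[symmetric] tsum_def case_prod_beta')
qed

lemma eps_additive: "additive_on B h \<Longrightarrow> additive_on T (\<lambda>C. h (eps C))"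
  using T_additive[OF eps_bal, of h] by (simp add: additive_on_def additive_eps_gsum)

lemma B_separate:
  assumes "a \<in> carrier B" "b \<in> carrier B" "\<And>h. additive_on B h \<Longrightarrow> h a = h b"
  shows "a = b"
  by (rule abelian_group.characters_separate[OF U.B.total.is_abelian_group assms])

lemma eps_pure: "\<alpha> \<in> carrier U \<Longrightarrow> x \<in> carrier L \<Longrightarrow> eps (\<alpha> \<boxtimes> x) = counit U (\<alpha> \<otimes>\<^bsub>U\<^esub> src U (counit L x))"
  by (rule B_separate) (simp_all add: additive_eps_gsum gsum_pure[OF eps_bal])

lemma eps_add: "C \<in> carrier T \<Longrightarrow> D \<in> carrier T \<Longrightarrow> eps (C \<oplus>\<^bsub>T\<^esub> D) = eps C \<oplus>\<^bsub>B\<^esub> eps D"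
  by (rule B_separate) (simp_all add: additive_onD[OF eps_additive] additive_onD)

end

text \<open>
  The two products on the same tensor product: \<open>H\<close> below is the bialgebroid, with \<open>\<tau>\<close> in both places, and
  the comodule algebra is \<open>A\<close>, with \<open>\<tau>\<close> and \<open>\<kappa>\<close>.
\<close>

locale double = hopf_pairings K B U L \<tau> \<kappa> + h: hopf_pairings K B U L \<tau> \<tau>
  for K :: "('k, 'i) ring_scheme" and B :: "('k, 'b, 'w) module_scheme"
    and U :: "('k, 'b, 'p, 'n) bialgebroid_scheme" and L :: "('k, 'b, 'l, 'm) bialgebroid_scheme"
    and \<tau> \<kappa> :: "'l \<Rightarrow> 'p \<Rightarrow> 'b"

context hopf_pairings
begin

lemma ds_mult_pure: "b \<in> carrier B \<Longrightarrow> \<alpha> \<in> carrier U \<Longrightarrow> x \<in> carrier L \<Longrightarrow> ds b \<otimes>\<^bsub>A\<^esub> (\<alpha> \<boxtimes> x) = (src U b \<otimes>\<^bsub>U\<^esub> \<alpha>) \<boxtimes> x"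
  by (simp add: double_src_def U_mult_pure)

lemma dt_mult_pure: "b \<in> carrier B \<Longrightarrow> \<alpha> \<in> carrier U \<Longrightarrow> x \<in> carrier L \<Longrightarrow> dt b \<otimes>\<^bsub>A\<^esub> (\<alpha> \<boxtimes> x) = (tgt U b \<otimes>\<^bsub>U\<^esub> \<alpha>) \<boxtimes> x"
  by (simp add: double_tgt_def U_mult_pure)

lemma pure_mult_ds: "b \<in> carrier B \<Longrightarrow> \<alpha> \<in> carrier U \<Longrightarrow> x \<in> carrier L \<Longrightarrow> (\<alpha> \<boxtimes> x) \<otimes>\<^bsub>A\<^esub> ds b = \<alpha> \<boxtimes> (x \<otimes>\<^bsub>L\<^esub> src L b)"
  by (simp add: ds_alt pure_mult_L)

lemma pure_mult_dt: "b \<in> carrier B \<Longrightarrow> \<alpha> \<in> carrier U \<Longrightarrow> x \<in> carrier L \<Longrightarrow> (\<alpha> \<boxtimes> x) \<otimes>\<^bsub>A\<^esub> dt b = \<alpha> \<boxtimes> (x \<otimes>\<^bsub>L\<^esub> tgt L b)"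
  by (simp add: dt_alt pure_mult_L)

lemma ds_mult: "a \<in> carrier B \<Longrightarrow> b \<in> carrier B \<Longrightarrow> ds (a \<otimes>\<^bsub>B\<^esub> b) = ds a \<otimes>\<^bsub>A\<^esub> ds b"
  by (simp add: double_src_def U_mult_pure U.src_mult)

lemma dt_mult: "a \<in> carrier B \<Longrightarrow> b \<in> carrier B \<Longrightarrow> dt (a \<otimes>\<^bsub>B\<^esub> b) = dt b \<otimes>\<^bsub>A\<^esub> dt a"
  by (simp add: double_tgt_def U_mult_pure U.tgt_mult)

lemma smult_ds: "k \<in> carrier K \<Longrightarrow> C \<in> carrier T \<Longrightarrow> k \<odot>\<^bsub>T\<^esub> C = ds (k \<odot>\<^bsub>B\<^esub> \<one>\<^bsub>B\<^esub>) \<otimes>\<^bsub>A\<^esub> C"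
  by (simp add: smult_left double_src_def U.src_smult)

lemma smult_dt: "k \<in> carrier K \<Longrightarrow> C \<in> carrier T \<Longrightarrow> k \<odot>\<^bsub>T\<^esub> C = dt (k \<odot>\<^bsub>B\<^esub> \<one>\<^bsub>B\<^esub>) \<otimes>\<^bsub>A\<^esub> C"
  by (simp add: smult_left double_tgt_def U.tgt_smult)

lemma smult_dt_right: "k \<in> carrier K \<Longrightarrow> C \<in> carrier T \<Longrightarrow> k \<odot>\<^bsub>T\<^esub> C = C \<otimes>\<^bsub>A\<^esub> dt (k \<odot>\<^bsub>B\<^esub> \<one>\<^bsub>B\<^esub>)"
  by (simp add: smult_right dt_alt L.tgt_smult)

end

context double
begin

abbreviation "H \<equiv> double_algebra K B U L \<tau> \<tau>"

sublocale hp: tensor_product K H A "carrier B" "\<lambda>b C. dt b \<otimes>\<^bsub>H\<^esub> C" "\<lambda>b D. ds b \<otimes>\<^bsub>A\<^esub> D"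
proof
  fix \<phi> k x y
  assume b: "balanced H A (carrier B) (\<lambda>b C. dt b \<otimes>\<^bsub>H\<^esub> C) (\<lambda>b D. ds b \<otimes>\<^bsub>A\<^esub> D) \<phi>"
    and k: "k \<in> carrier K" "x \<in> carrier H" "y \<in> carrier A"
  show "\<phi> (k \<odot>\<^bsub>H\<^esub> x) y = \<phi> x (k \<odot>\<^bsub>A\<^esub> y)"
    using balancedD(3)[OF b, of "k \<odot>\<^bsub>B\<^esub> \<one>\<^bsub>B\<^esub>" x y] k
    by (simp add: h.smult_dt[symmetric] smult_ds[symmetric])
qed auto

lemma hp_diamond: "diamond K B H dt A ds = hp.TP"
  by (simp add: diamond_def)

lemma hp_gsum: "C \<in> carrier hp.TP \<Longrightarrow> tsum C \<phi> = gsum T T C \<phi>"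
  using hp.gsum_tsum[of C \<phi>] by (simp add: gsum_def)

abbreviation "coa \<equiv> double_coact K B U L \<tau> \<kappa>"

lemma coupled_pure:
  assumes J: "hp.bal J" shows "coupled (\<lambda>\<alpha> x \<beta> y. J (\<alpha> \<boxtimes> x) (\<beta> \<boxtimes> y))"
proof -
  have l: "additive_on T (\<lambda>C. J C D)" if "D \<in> carrier T" for D
    by (rule additive_onI) (use balancedD(1)[OF J] that in simp)
  have r: "additive_on T (J C)" if "C \<in> carrier T" for C
    by (rule additive_onI) (use balancedD(2)[OF J] that in simp)
  show ?thesis
  proof (rule coupledI)
    fix b \<alpha> x \<beta> y
    assume "b \<in> carrier B" "\<alpha> \<in> carrier U" "x \<in> carrier L" "\<beta> \<in> carrier U" "y \<in> carrier L"
    then show "J ((tgt U b \<otimes>\<^bsub>U\<^esub> \<alpha>) \<boxtimes> x) (\<beta> \<boxtimes> y) = J (\<alpha> \<boxtimes> x) ((src U b \<otimes>\<^bsub>U\<^esub> \<beta>) \<boxtimes> y)"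
      using balancedD(3)[OF J, of b "\<alpha> \<boxtimes> x" "\<beta> \<boxtimes> y"] by (simp add: h.dt_mult_pure ds_mult_pure)
  qed (simp_all add: T_sbal[OF l] T_tbal[OF l] T_sbal[OF r] T_tbal[OF r])
qed

lemma coa_closed:
  assumes "C \<in> carrier T" shows "coa C \<in> carrier hp.TP"
  unfolding double_coact_def hp_diamond case_prod_beta'
proof (rule hp.induced_closed, rule keys_expand_subset, rule keys_expand_subset)
  fix z a x assume "z \<in> Poly_Mapping.keys (repr C)" "a \<in> Poly_Mapping.keys (repr (comult U (fst z)))"
    "x \<in> Poly_Mapping.keys (repr (comult L (snd z)))"
  moreover from this have "fst z \<in> carrier U" "snd z \<in> carrier L"
    using be.keys_repr[folded T_TP, OF assms] by auto
  ultimately show "Poly_Mapping.keys (frag_of (fst a \<boxtimes> fst x, snd a \<boxtimes> snd x)) \<subseteq> carrier H \<times> carrier A"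
    using U.keys_comult[of "fst z" a] L.keys_comult[of "snd z" x] by simp
qed

lemma gsum_coa:
  assumes J: "hp.bal J" and C: "C \<in> carrier T"
  shows "gsum T T (coa C) J = gsum U L C (cosum U L (\<lambda>\<alpha> x \<beta> y. J (\<alpha> \<boxtimes> x) (\<beta> \<boxtimes> y)))"
proof -
  have "gsum T T (coa C) J = tsum (coa C) J"
    using hp_gsum coa_closed[OF C] by simp
  also have "\<dots> = tsum C (\<lambda>\<alpha> x. tsum (comult U \<alpha>) (\<lambda>\<alpha>1 \<alpha>2. tsum (comult L x) (\<lambda>x1 x2. J (\<alpha>1 \<boxtimes> x1) (\<alpha>2 \<boxtimes> x2))))"
    unfolding double_coact_def hp_diamond hp.tsum_induced_pair[OF J] lin_expand by simp
  also have "\<dots> = gsum U L C (cosum U L (\<lambda>\<alpha> x \<beta> y. J (\<alpha> \<boxtimes> x) (\<beta> \<boxtimes> y)))"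
    unfolding T_gsum[OF C] cosum_def by (intro gsum_cong refl) (simp add: U.csum_if L.csum_if)
  finally show ?thesis .
qed

lemma coa_additive: "hp.bal J \<Longrightarrow> additive_on T (\<lambda>C. gsum T T (coa C) J)"
  using T_additive[OF cosum_bal[OF coupled_pure], of J] by (simp add: additive_on_def gsum_coa)

lemma gsum_coa_pure:
  "hp.bal J \<Longrightarrow> \<alpha> \<in> carrier U \<Longrightarrow> x \<in> carrier L
    \<Longrightarrow> gsum T T (coa (\<alpha> \<boxtimes> x)) J = cosum U L (\<lambda>\<alpha> x \<beta> y. J (\<alpha> \<boxtimes> x) (\<beta> \<boxtimes> y)) \<alpha> x"
  by (simp add: gsum_coa gsum_pure[OF cosum_bal[OF coupled_pure]])

lemma hp_bal_right:
  assumes J: "hp.bal J" and C: "C \<in> carrier T" and D: "D \<in> carrier T"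
  shows "hp.bal (\<lambda>x y. J (x \<otimes>\<^bsub>H\<^esub> C) (y \<otimes>\<^bsub>A\<^esub> D))"
  by (rule balancedI)
     (use C D in \<open>simp_all add: h.mult_add_left mult_add_left h.mult_assoc mult_assoc
       balancedD(1,2)[OF J, simplified] balancedD(3)[OF J, simplified]\<close>)

lemma gsum_coa_takeuchi:
  assumes J: "hp.bal J" and C: "C \<in> carrier T" and a: "a \<in> carrier B"
  shows "gsum T T (coa C) (\<lambda>x y. J (x \<otimes>\<^bsub>H\<^esub> dt a) y) = gsum T T (coa C) (\<lambda>x y. J x (y \<otimes>\<^bsub>A\<^esub> ds a))"
proof -
  have J1: "hp.bal (\<lambda>x y. J (x \<otimes>\<^bsub>H\<^esub> dt a) y)"
    by (rule balancedI)
       (use a in \<open>simp_all add: h.mult_add_left h.mult_assoc balancedD(1,2)[OF J, simplified] balancedD(3)[OF J, simplified]\<close>)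
  have J2: "hp.bal (\<lambda>x y. J x (y \<otimes>\<^bsub>A\<^esub> ds a))"
    by (rule balancedI)
       (use a in \<open>simp_all add: mult_add_left mult_assoc balancedD(1,2)[OF J, simplified] balancedD(3)[OF J, simplified]\<close>)
  show ?thesis
  proof (rule T_pure_ext[OF coa_additive[OF J1] coa_additive[OF J2] C])
    fix \<alpha> x assume *: "\<alpha> \<in> carrier U" "x \<in> carrier L"
    then show "gsum T T (coa (\<alpha> \<boxtimes> x)) (\<lambda>x y. J (x \<otimes>\<^bsub>H\<^esub> dt a) y) = gsum T T (coa (\<alpha> \<boxtimes> x)) (\<lambda>x y. J x (y \<otimes>\<^bsub>A\<^esub> ds a))"
      using a cosum_takeuchi[OF coupled_pure[OF J] a *]
      by (simp add: gsum_coa_pure[OF J1] gsum_coa_pure[OF J2] h.pure_mult_dt pure_mult_ds)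
  qed
qed

lemma coa_takeuchi:
  assumes "C \<in> carrier T" shows "coa C \<in> takeuchi K B H dt A ds"
  unfolding takeuchi_def hp_diamond mem_Collect_eq
proof (intro conjI ballI coa_closed assms)
  fix a assume a: "a \<in> carrier B"
  have k: "fst z \<in> carrier T" "snd z \<in> carrier T" if "z \<in> Poly_Mapping.keys (repr (coa C))" for z
    using hp.keys_repr[OF coa_closed[OF assms]] that by auto
  show "induced hp.TP (\<lambda>(x, y). frag_of (x \<otimes>\<^bsub>H\<^esub> dt a, y)) (coa C) = induced hp.TP (\<lambda>(x, y). frag_of (x, y \<otimes>\<^bsub>A\<^esub> ds a)) (coa C)"
  proof (rule hp.tensor_eqI)
    fix J assume J: "hp.bal J"
    show "tsum (induced hp.TP (\<lambda>(x, y). frag_of (x \<otimes>\<^bsub>H\<^esub> dt a, y)) (coa C)) J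
      = tsum (induced hp.TP (\<lambda>(x, y). frag_of (x, y \<otimes>\<^bsub>A\<^esub> ds a)) (coa C)) J"
      using gsum_coa_takeuchi[OF J assms a]
      by (simp add: hp.tsum_induced_pair[OF J] hp_gsum[OF coa_closed[OF assms]])
  qed (use a k in \<open>auto intro!: hp.induced_closed simp: case_prod_beta'\<close>)
qed

lemma hp_bal_convolution:
  assumes J: "hp.bal J" and C: "C \<in> carrier T"
  shows "hp.bal (\<lambda>c' d'. gsum T T (coa C) (\<lambda>c d. J (c \<otimes>\<^bsub>H\<^esub> c') (d \<otimes>\<^bsub>A\<^esub> d')))"
proof (rule balancedI)
  fix b c' d' assume "b \<in> carrier B" "c' \<in> carrier H" "d' \<in> carrier A"
  then have *: "b \<in> carrier B" "c' \<in> carrier T" "d' \<in> carrier T" by simp_all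
  show "gsum T T (coa C) (\<lambda>c d. J (c \<otimes>\<^bsub>H\<^esub> (dt b \<otimes>\<^bsub>H\<^esub> c')) (d \<otimes>\<^bsub>A\<^esub> d')) = gsum T T (coa C) (\<lambda>c d. J (c \<otimes>\<^bsub>H\<^esub> c') (d \<otimes>\<^bsub>A\<^esub> (ds b \<otimes>\<^bsub>A\<^esub> d')))"
  proof -
    have "gsum T T (coa C) (\<lambda>c d. J (c \<otimes>\<^bsub>H\<^esub> (dt b \<otimes>\<^bsub>H\<^esub> c')) (d \<otimes>\<^bsub>A\<^esub> d')) = gsum T T (coa C) (\<lambda>c d. J (c \<otimes>\<^bsub>H\<^esub> dt b \<otimes>\<^bsub>H\<^esub> c') (d \<otimes>\<^bsub>A\<^esub> d'))"
      by (rule gsum_cong[OF refl]) (use * in \<open>simp add: h.mult_assoc\<close>)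
    also have "\<dots> = gsum T T (coa C) (\<lambda>c d. J (c \<otimes>\<^bsub>H\<^esub> c') (d \<otimes>\<^bsub>A\<^esub> ds b \<otimes>\<^bsub>A\<^esub> d'))"
      by (rule gsum_coa_takeuchi[OF hp_bal_right[OF J *(2,3)] C *(1)])
    also have "\<dots> = gsum T T (coa C) (\<lambda>c d. J (c \<otimes>\<^bsub>H\<^esub> c') (d \<otimes>\<^bsub>A\<^esub> (ds b \<otimes>\<^bsub>A\<^esub> d')))"
      by (rule gsum_cong[OF refl]) (use * in \<open>simp add: mult_assoc\<close>)
    finally show ?thesis .
  qed
qed (simp_all add: C h.mult_add_right mult_add_right balancedD(1,2)[OF J, simplified] gsum_plus)

text \<open>
  Expand the coproduct of \<open>(\<alpha> p) \<otimes> (z y)\<close>, where \<open>p \<otimes> z\<close> is the result of moving \<open>x\<close> past \<open>\<beta>\<close>.  What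
  remains is the coproduct of \<open>p \<otimes> z\<close> evaluated in the function \<open>j'\<close>, and \<open>cosum_cross\<close> turns it into the
  product in \<open>H\<close> in the first component and the product in \<open>A\<close> in the second.
\<close>

lemma coa_mult_pure:
  assumes J: "hp.bal J" and *: "\<alpha> \<in> carrier U" "x \<in> carrier L" "\<beta> \<in> carrier U" "y \<in> carrier L"
  shows "gsum T T (coa ((\<alpha> \<boxtimes> x) \<otimes>\<^bsub>A\<^esub> (\<beta> \<boxtimes> y))) J
    = gsum T T (coa (\<beta> \<boxtimes> y)) (\<lambda>c' d'. gsum T T (coa (\<alpha> \<boxtimes> x)) (\<lambda>c d. J (c \<otimes>\<^bsub>H\<^esub> c') (d \<otimes>\<^bsub>A\<^esub> d')))"
proof -
  define j where "j = (\<lambda>\<alpha> x \<beta> y. J (\<alpha> \<boxtimes> x) (\<beta> \<boxtimes> y))"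
  have j: "coupled j" unfolding j_def by (rule coupled_pure[OF J])
  have jU: "U.bal (\<lambda>\<alpha>1 \<alpha>2. j (\<alpha>1 \<otimes>\<^bsub>U\<^esub> p1) u (\<alpha>2 \<otimes>\<^bsub>U\<^esub> p2) v)"
    if "p1 \<in> carrier U" "p2 \<in> carrier U" "u \<in> carrier L" "v \<in> carrier L" for p1 p2 u v
    by (rule balancedI) (use that in \<open>simp_all add: additives assocs coupled_additive[OF j] coupled_balanced(5)[OF j]\<close>)
  define j' where "j' p1 z1 p2 z2 = csum U \<alpha> (\<lambda>\<alpha>1 \<alpha>2. csum L y (\<lambda>y1 y2. j (\<alpha>1 \<otimes>\<^bsub>U\<^esub> p1) (z1 \<otimes>\<^bsub>L\<^esub> y1) (\<alpha>2 \<otimes>\<^bsub>U\<^esub> p2) (z2 \<otimes>\<^bsub>L\<^esub> y2)))"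
    for p1 z1 p2 z2
  have j'_coupled: "coupled j'"
  proof (rule coupledI)
    fix b p z q w
    assume **: "b \<in> carrier B" "p \<in> carrier U" "z \<in> carrier L" "q \<in> carrier U" "w \<in> carrier L"
    have "csum U \<alpha> (\<lambda>\<alpha>1 \<alpha>2. j (\<alpha>1 \<otimes>\<^bsub>U\<^esub> (tgt U b \<otimes>\<^bsub>U\<^esub> p)) u (\<alpha>2 \<otimes>\<^bsub>U\<^esub> q) v) = csum U \<alpha> (\<lambda>\<alpha>1 \<alpha>2. j (\<alpha>1 \<otimes>\<^bsub>U\<^esub> p) u (\<alpha>2 \<otimes>\<^bsub>U\<^esub> (src U b \<otimes>\<^bsub>U\<^esub> q)) v)"
      if "u \<in> carrier L" "v \<in> carrier L" for u v
      using U.csum_takeuchi[OF jU[OF **(2,4) that] **(1) *(1)] ** by (simp add: assocs)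
    then have "csum L y (\<lambda>y1 y2. csum U \<alpha> (\<lambda>\<alpha>1 \<alpha>2. j (\<alpha>1 \<otimes>\<^bsub>U\<^esub> (tgt U b \<otimes>\<^bsub>U\<^esub> p)) (z \<otimes>\<^bsub>L\<^esub> y1) (\<alpha>2 \<otimes>\<^bsub>U\<^esub> q) (w \<otimes>\<^bsub>L\<^esub> y2)))
      = csum L y (\<lambda>y1 y2. csum U \<alpha> (\<lambda>\<alpha>1 \<alpha>2. j (\<alpha>1 \<otimes>\<^bsub>U\<^esub> p) (z \<otimes>\<^bsub>L\<^esub> y1) (\<alpha>2 \<otimes>\<^bsub>U\<^esub> (src U b \<otimes>\<^bsub>U\<^esub> q)) (w \<otimes>\<^bsub>L\<^esub> y2)))"
      using ** by simp
    then show "j' (tgt U b \<otimes>\<^bsub>U\<^esub> p) z q w = j' p z (src U b \<otimes>\<^bsub>U\<^esub> q) w"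
      unfolding j'_def by (simp only: csum_commute[of L y])
  qed (rule balancedI; simp add: j'_def additives coupled_additive[OF j] csum_plus assocs
        sbal_assoc[OF coupledD(1)[OF j]] tbal_assoc[OF coupledD(2)[OF j]]
        sbal_assoc[OF coupledD(3)[OF j]] tbal_assoc[OF coupledD(4)[OF j]])+
  have "gsum T T (coa ((\<alpha> \<boxtimes> x) \<otimes>\<^bsub>A\<^esub> (\<beta> \<boxtimes> y))) J = R x \<beta> (\<lambda>p z. cosum U L j (\<alpha> \<otimes>\<^bsub>U\<^esub> p) (z \<otimes>\<^bsub>L\<^esub> y))"
    using * by (simp add: mult_pure[OF coa_additive[OF J]] gsum_coa_pure[OF J] j_def)
  also have "\<dots> = R x \<beta> (cosum U L j')"
  proof (rule cross_cong[OF refl refl])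
    fix p z assume pz: "p \<in> carrier U" "z \<in> carrier L"
    have "cosum U L j (\<alpha> \<otimes>\<^bsub>U\<^esub> p) (z \<otimes>\<^bsub>L\<^esub> y)
      = csum U \<alpha> (\<lambda>\<alpha>1 \<alpha>2. csum U p (\<lambda>p1 p2. csum L z (\<lambda>z1 z2. csum L y (\<lambda>y1 y2.
          j (\<alpha>1 \<otimes>\<^bsub>U\<^esub> p1) (z1 \<otimes>\<^bsub>L\<^esub> y1) (\<alpha>2 \<otimes>\<^bsub>U\<^esub> p2) (z2 \<otimes>\<^bsub>L\<^esub> y2)))))"
    proof -
      have "cosum U L j (\<alpha> \<otimes>\<^bsub>U\<^esub> p) (z \<otimes>\<^bsub>L\<^esub> y) = csum U \<alpha> (\<lambda>\<alpha>1 \<alpha>2. csum U p (\<lambda>p1 p2. csum L (z \<otimes>\<^bsub>L\<^esub> y) (\<lambda>w1 w2.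
          j (\<alpha>1 \<otimes>\<^bsub>U\<^esub> p1) w1 (\<alpha>2 \<otimes>\<^bsub>U\<^esub> p2) w2)))"
        unfolding cosum_def using * pz by (simp add: U.csum_mult[OF cosum_bal_U[OF j]])
      also have "\<dots> = csum L (z \<otimes>\<^bsub>L\<^esub> y) (\<lambda>w1 w2. csum U (\<alpha> \<otimes>\<^bsub>U\<^esub> p) (\<lambda>\<gamma>1 \<gamma>2. j \<gamma>1 w1 \<gamma>2 w2))"
        using * pz by (simp add: U.csum_mult[OF cosum_bal_pointwise_U[OF j]])
          (subst csum_commute[of U p], subst csum_commute[of U \<alpha>], rule refl)
      also have "\<dots> = csum L z (\<lambda>z1 z2. csum L y (\<lambda>y1 y2. csum U (\<alpha> \<otimes>\<^bsub>U\<^esub> p) (\<lambda>\<gamma>1 \<gamma>2. j \<gamma>1 (z1 \<otimes>\<^bsub>L\<^esub> y1) \<gamma>2 (z2 \<otimes>\<^bsub>L\<^esub> y2))))"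
        using * pz by (simp add: L.csum_mult[OF cosum_bal_L[OF j]])
      also have "\<dots> = csum L z (\<lambda>z1 z2. csum L y (\<lambda>y1 y2. csum U \<alpha> (\<lambda>\<alpha>1 \<alpha>2. csum U p (\<lambda>p1 p2.
          j (\<alpha>1 \<otimes>\<^bsub>U\<^esub> p1) (z1 \<otimes>\<^bsub>L\<^esub> y1) (\<alpha>2 \<otimes>\<^bsub>U\<^esub> p2) (z2 \<otimes>\<^bsub>L\<^esub> y2)))))"
        using * pz by (simp add: U.csum_mult[OF cosum_bal_pointwise_U[OF j]])
      also have "\<dots> = csum L z (\<lambda>z1 z2. csum U \<alpha> (\<lambda>\<alpha>1 \<alpha>2. csum U p (\<lambda>p1 p2. csum L y (\<lambda>y1 y2.
          j (\<alpha>1 \<otimes>\<^bsub>U\<^esub> p1) (z1 \<otimes>\<^bsub>L\<^esub> y1) (\<alpha>2 \<otimes>\<^bsub>U\<^esub> p2) (z2 \<otimes>\<^bsub>L\<^esub> y2)))))"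
        by (rule csum_cong[OF refl], subst csum_commute[of L y], rule csum_cong[OF refl], rule csum_commute)
      also have "\<dots> = csum U \<alpha> (\<lambda>\<alpha>1 \<alpha>2. csum U p (\<lambda>p1 p2. csum L z (\<lambda>z1 z2. csum L y (\<lambda>y1 y2.
          j (\<alpha>1 \<otimes>\<^bsub>U\<^esub> p1) (z1 \<otimes>\<^bsub>L\<^esub> y1) (\<alpha>2 \<otimes>\<^bsub>U\<^esub> p2) (z2 \<otimes>\<^bsub>L\<^esub> y2)))))"
        by (subst csum_commute[of L z], rule csum_cong[OF refl], rule csum_commute)
      finally show ?thesis .
    qed
    also have "\<dots> = csum U p (\<lambda>p1 p2. csum L z (\<lambda>z1 z2. csum U \<alpha> (\<lambda>\<alpha>1 \<alpha>2. csum L y (\<lambda>y1 y2.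
          j (\<alpha>1 \<otimes>\<^bsub>U\<^esub> p1) (z1 \<otimes>\<^bsub>L\<^esub> y1) (\<alpha>2 \<otimes>\<^bsub>U\<^esub> p2) (z2 \<otimes>\<^bsub>L\<^esub> y2)))))"
      by (subst csum_commute[of U \<alpha>], rule csum_cong[OF refl], rule csum_commute)
    also have "\<dots> = cosum U L j' p z"
      by (simp add: cosum_def j'_def)
    finally show "cosum U L j (\<alpha> \<otimes>\<^bsub>U\<^esub> p) (z \<otimes>\<^bsub>L\<^esub> y) = cosum U L j' p z" .
  qed
  also have "\<dots> = cosum U L (\<lambda>\<beta>1 x1 \<beta>2 x2. h.R x1 \<beta>1 (\<lambda>p z. R x2 \<beta>2 (j' p z))) \<beta> x"
    using * by (intro cosum_cross) (simp_all add: coupledD[OF j'_coupled])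
  also have "\<dots> = csum U \<beta> (\<lambda>\<beta>1 \<beta>2. csum L x (\<lambda>x1 x2. csum U \<alpha> (\<lambda>\<alpha>1 \<alpha>2. csum L y (\<lambda>y1 y2.
      h.R x1 \<beta>1 (\<lambda>p z. R x2 \<beta>2 (\<lambda>q w. j (\<alpha>1 \<otimes>\<^bsub>U\<^esub> p) (z \<otimes>\<^bsub>L\<^esub> y1) (\<alpha>2 \<otimes>\<^bsub>U\<^esub> q) (w \<otimes>\<^bsub>L\<^esub> y2)))))))"
    by (simp add: cosum_def j'_def R_csum h.R_csum)
  also have "\<dots> = csum U \<beta> (\<lambda>\<beta>1 \<beta>2. csum L y (\<lambda>y1 y2. csum U \<alpha> (\<lambda>\<alpha>1 \<alpha>2. csum L x (\<lambda>x1 x2. 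
      h.R x1 \<beta>1 (\<lambda>p z. R x2 \<beta>2 (\<lambda>q w. j (\<alpha>1 \<otimes>\<^bsub>U\<^esub> p) (z \<otimes>\<^bsub>L\<^esub> y1) (\<alpha>2 \<otimes>\<^bsub>U\<^esub> q) (w \<otimes>\<^bsub>L\<^esub> y2)))))))"
  proof (rule csum_cong[OF refl])
    fix \<beta>1 \<beta>2
    let ?f = "\<lambda>x1 x2 \<alpha>1 \<alpha>2 y1 y2. h.R x1 \<beta>1 (\<lambda>p z. R x2 \<beta>2 (\<lambda>q w. j (\<alpha>1 \<otimes>\<^bsub>U\<^esub> p) (z \<otimes>\<^bsub>L\<^esub> y1) (\<alpha>2 \<otimes>\<^bsub>U\<^esub> q) (w \<otimes>\<^bsub>L\<^esub> y2)))"
    have "csum L x (\<lambda>x1 x2. csum U \<alpha> (\<lambda>\<alpha>1 \<alpha>2. csum L y (\<lambda>y1 y2. ?f x1 x2 \<alpha>1 \<alpha>2 y1 y2)))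
      = csum L x (\<lambda>x1 x2. csum L y (\<lambda>y1 y2. csum U \<alpha> (\<lambda>\<alpha>1 \<alpha>2. ?f x1 x2 \<alpha>1 \<alpha>2 y1 y2)))"
      by (intro csum_cong refl csum_commute)
    also have "\<dots> = csum L y (\<lambda>y1 y2. csum L x (\<lambda>x1 x2. csum U \<alpha> (\<lambda>\<alpha>1 \<alpha>2. ?f x1 x2 \<alpha>1 \<alpha>2 y1 y2)))"
      by (rule csum_commute)
    also have "\<dots> = csum L y (\<lambda>y1 y2. csum U \<alpha> (\<lambda>\<alpha>1 \<alpha>2. csum L x (\<lambda>x1 x2. ?f x1 x2 \<alpha>1 \<alpha>2 y1 y2)))"
      by (intro csum_cong refl csum_commute)
    finally show "csum L x (\<lambda>x1 x2. csum U \<alpha> (\<lambda>\<alpha>1 \<alpha>2. csum L y (\<lambda>y1 y2. ?f x1 x2 \<alpha>1 \<alpha>2 y1 y2)))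
      = csum L y (\<lambda>y1 y2. csum U \<alpha> (\<lambda>\<alpha>1 \<alpha>2. csum L x (\<lambda>x1 x2. ?f x1 x2 \<alpha>1 \<alpha>2 y1 y2)))" .
  qed
  also have "\<dots> = cosum U L (\<lambda>\<beta>1 y1 \<beta>2 y2. gsum T T (coa (\<alpha> \<boxtimes> x)) (\<lambda>c d. J (c \<otimes>\<^bsub>H\<^esub> (\<beta>1 \<boxtimes> y1)) (d \<otimes>\<^bsub>A\<^esub> (\<beta>2 \<boxtimes> y2)))) \<beta> y"
  proof -
    have "gsum T T (coa (\<alpha> \<boxtimes> x)) (\<lambda>c d. J (c \<otimes>\<^bsub>H\<^esub> (\<beta>1 \<boxtimes> y1)) (d \<otimes>\<^bsub>A\<^esub> (\<beta>2 \<boxtimes> y2)))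
      = csum U \<alpha> (\<lambda>\<alpha>1 \<alpha>2. csum L x (\<lambda>x1 x2.
      h.R x1 \<beta>1 (\<lambda>p z. R x2 \<beta>2 (\<lambda>q w. j (\<alpha>1 \<otimes>\<^bsub>U\<^esub> p) (z \<otimes>\<^bsub>L\<^esub> y1) (\<alpha>2 \<otimes>\<^bsub>U\<^esub> q) (w \<otimes>\<^bsub>L\<^esub> y2)))))"
      if **: "\<beta>1 \<in> carrier U" "y1 \<in> carrier L" "\<beta>2 \<in> carrier U" "y2 \<in> carrier L" for \<beta>1 y1 \<beta>2 y2
    proof -
      have l: "additive_on T (\<lambda>C. J C D)" if "D \<in> carrier T" for D
        by (rule additive_onI) (use balancedD(1)[OF J] that in simp)
      have r: "additive_on T (J C)" if "C \<in> carrier T" for C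
        by (rule additive_onI) (use balancedD(2)[OF J] that in simp)
      show ?thesis
        using * ** by (simp add: gsum_coa_pure[OF hp_bal_right[OF J]] cosum_def h.mult_pure[OF l])
          (simp add: mult_pure[OF r] j_def)
    qed
    then show ?thesis by (simp add: cosum_def)
  qed
  also have "\<dots> = gsum T T (coa (\<beta> \<boxtimes> y)) (\<lambda>c' d'. gsum T T (coa (\<alpha> \<boxtimes> x)) (\<lambda>c d. J (c \<otimes>\<^bsub>H\<^esub> c') (d \<otimes>\<^bsub>A\<^esub> d')))"
    using * by (simp add: gsum_coa_pure[OF hp_bal_convolution[OF J]])
  finally show ?thesis .
qed

end

context double
begin

lemma keys_coa: "C \<in> carrier T \<Longrightarrow> z \<in> Poly_Mapping.keys (repr (coa C)) \<Longrightarrow> fst z \<in> carrier T \<and> snd z \<in> carrier T"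
  using hp.keys_repr[OF coa_closed, of C] by auto

lemma coa_eqI:
  assumes "C \<in> carrier T" "E \<in> carrier hp.TP" "\<And>J. hp.bal J \<Longrightarrow> gsum T T (coa C) J = tsum E J"
  shows "coa C = E"
  by (rule hp.tensor_eqI[OF coa_closed[OF assms(1)] assms(2)])
     (simp add: hp_gsum coa_closed assms(1) assms(3)[symmetric])

lemma coa_add:
  assumes "C \<in> carrier T" "D \<in> carrier T"
  shows "coa (C \<oplus>\<^bsub>T\<^esub> D) = coa C \<oplus>\<^bsub>hp.TP\<^esub> coa D"
proof (rule coa_eqI)
  show "coa C \<oplus>\<^bsub>hp.TP\<^esub> coa D \<in> carrier hp.TP"
    using assms coa_closed abelian_monoid.a_closed[OF abelian_group.axioms(1)[OF hp.abelian_group_TP]] by simp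
  fix J assume J: "hp.bal J"
  show "gsum T T (coa (C \<oplus>\<^bsub>T\<^esub> D)) J = tsum (coa C \<oplus>\<^bsub>hp.TP\<^esub> coa D) J"
    using assms by (simp add: hp.tsum_add[OF J] coa_closed hp_gsum additive_onD[OF coa_additive[OF J]])
qed (use assms in simp)

lemma hp_bal_mult_H:
  assumes J: "hp.bal J" and C: "C \<in> carrier T"
  shows "hp.bal (\<lambda>x y. J (x \<otimes>\<^bsub>H\<^esub> C) y)"
  by (rule balancedI)
     (use C in \<open>simp_all add: h.mult_add_left h.mult_assoc balancedD(1,2)[OF J, simplified] balancedD(3)[OF J, simplified]\<close>)

lemma coa_smult:
  assumes k: "k \<in> carrier K" and C: "C \<in> carrier T"
  shows "coa (k \<odot>\<^bsub>T\<^esub> C) = k \<odot>\<^bsub>hp.TP\<^esub> coa C"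
proof (rule coa_eqI)
  show "k \<odot>\<^bsub>hp.TP\<^esub> coa C \<in> carrier hp.TP" by (rule hp.smult_closed[OF k coa_closed[OF C]])
  fix J assume J: "hp.bal J"
  note J' = hp_bal_mult_H[OF J, of "\<one>\<^bsub>U\<^esub> \<boxtimes> (k \<odot>\<^bsub>L\<^esub> \<one>\<^bsub>L\<^esub>)"]
  have "gsum T T (coa (k \<odot>\<^bsub>T\<^esub> C)) J = gsum T T (coa C) (\<lambda>x y. J (x \<otimes>\<^bsub>H\<^esub> (\<one>\<^bsub>U\<^esub> \<boxtimes> (k \<odot>\<^bsub>L\<^esub> \<one>\<^bsub>L\<^esub>))) y)"
  proof (rule T_pure_ext[OF _ coa_additive[OF J'] C])
    show "additive_on T (\<lambda>C. gsum T T (coa (k \<odot>\<^bsub>T\<^esub> C)) J)"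
      unfolding additive_on_def using mult_additive_right[OF coa_additive[OF J], of "ds (k \<odot>\<^bsub>B\<^esub> \<one>\<^bsub>B\<^esub>)"] k
      by (simp add: smult_ds additive_on_def)
    fix \<alpha> x assume *: "\<alpha> \<in> carrier U" "x \<in> carrier L"
    then show "gsum T T (coa (k \<odot>\<^bsub>T\<^esub> (\<alpha> \<boxtimes> x))) J = gsum T T (coa (\<alpha> \<boxtimes> x)) (\<lambda>x y. J (x \<otimes>\<^bsub>H\<^esub> (\<one>\<^bsub>U\<^esub> \<boxtimes> (k \<odot>\<^bsub>L\<^esub> \<one>\<^bsub>L\<^esub>))) y)"
      using k cosum_src[OF coupled_pure[OF J], of "k \<odot>\<^bsub>B\<^esub> \<one>\<^bsub>B\<^esub>" \<alpha> x]
      by (simp add: gsum_coa_pure[OF J] gsum_coa_pure[OF J']) (simp add: smult_pure h.smult_right[symmetric] gsum_coa_pure[OF J] U.smult_src)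
  qed (use k in simp)
  also have "\<dots> = tsum (k \<odot>\<^bsub>hp.TP\<^esub> coa C) J"
    using k by (simp add: hp.tsum_smult[OF J] hp_gsum[OF coa_closed[OF C]] h.smult_right)
  finally show "gsum T T (coa (k \<odot>\<^bsub>T\<^esub> C)) J = tsum (k \<odot>\<^bsub>hp.TP\<^esub> coa C) J" .
qed (use assms in simp)

lemma gsum_coa_mult:
  assumes J: "hp.bal J" and C: "C \<in> carrier T" and D: "D \<in> carrier T"
  shows "gsum T T (coa (C \<otimes>\<^bsub>A\<^esub> D)) J = gsum T T (coa C) (\<lambda>c d. gsum T T (coa D) (\<lambda>c' d'. J (c \<otimes>\<^bsub>H\<^esub> c') (d \<otimes>\<^bsub>A\<^esub> d')))"
proof -
  have b1: "hp.bal (\<lambda>c d. gsum T T (coa D) (\<lambda>c' d'. J (c \<otimes>\<^bsub>H\<^esub> c') (d \<otimes>\<^bsub>A\<^esub> d')))" if "D \<in> carrier T" for D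
    by (rule balancedI)
       (simp_all add: h.mult_add_left mult_add_left h.mult_assoc mult_assoc gsum_plus
         balancedD(1,2)[OF J, simplified] balancedD(3)[OF J, simplified])
  note b2 = hp_bal_convolution[OF J]
  have 1: "gsum T T (coa ((\<alpha> \<boxtimes> x) \<otimes>\<^bsub>A\<^esub> D)) J = gsum T T (coa (\<alpha> \<boxtimes> x)) (\<lambda>c d. gsum T T (coa D) (\<lambda>c' d'. J (c \<otimes>\<^bsub>H\<^esub> c') (d \<otimes>\<^bsub>A\<^esub> d')))"
    if "\<alpha> \<in> carrier U" "x \<in> carrier L" for \<alpha> x
    unfolding gsum_commute[of T T "coa (\<alpha> \<boxtimes> x)"]
    by (rule T_pure_ext[OF mult_additive_right[OF coa_additive[OF J]] coa_additive[OF b2] D])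
       (use that coa_mult_pure[OF J] in simp_all)
  show ?thesis
    by (rule T_pure_ext[OF mult_additive_left[OF coa_additive[OF J] D] coa_additive[OF b1[OF D]] C]) (rule 1)
qed

lemma coa_mult:
  assumes C: "C \<in> carrier T" and D: "D \<in> carrier T"
  shows "coa (C \<otimes>\<^bsub>A\<^esub> D) = component_mult H A hp.TP (coa C) (coa D)"
proof (rule coa_eqI)
  show "component_mult H A hp.TP (coa C) (coa D) \<in> carrier hp.TP"
    unfolding component_mult_def case_prod_beta'
  proof (rule hp.induced_closed, rule keys_expand_subset)
    fix z w assume "z \<in> Poly_Mapping.keys (repr (coa C))" "w \<in> Poly_Mapping.keys (repr (coa D))"
    then show "Poly_Mapping.keys (frag_of (fst z \<otimes>\<^bsub>H\<^esub> fst w, snd z \<otimes>\<^bsub>A\<^esub> snd w)) \<subseteq> carrier H \<times> carrier A"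
      using keys_coa[OF C] keys_coa[OF D] by simp
  qed
  fix J assume J: "hp.bal J"
  show "gsum T T (coa (C \<otimes>\<^bsub>A\<^esub> D)) J = tsum (component_mult H A hp.TP (coa C) (coa D)) J"
    unfolding gsum_coa_mult[OF J C D] component_mult_def hp.tsum_induced_pair[OF J] lin_expand
    by (simp add: hp_gsum coa_closed C D)
qed (use assms in simp)

lemma coa_one: "coa \<one>\<^bsub>A\<^esub> = cls hp.TP (frag_of (\<one>\<^bsub>H\<^esub>, \<one>\<^bsub>A\<^esub>))"
proof (rule coa_eqI)
  show "cls hp.TP (frag_of (\<one>\<^bsub>H\<^esub>, \<one>\<^bsub>A\<^esub>)) \<in> carrier hp.TP"
    by (rule hp.pure_closed) (simp_all add: A_one h.A_one)
  fix J assume J: "hp.bal J"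
  show "gsum T T (coa \<one>\<^bsub>A\<^esub>) J = tsum (cls hp.TP (frag_of (\<one>\<^bsub>H\<^esub>, \<one>\<^bsub>A\<^esub>))) J"
    by (simp add: hp.tsum_pure[OF J]) (simp add: A_one h.A_one gsum_coa_pure[OF J] cosum_one[OF coupled_pure[OF J]])
qed (simp add: A_one)

lemma ds_dt_commute: "b \<in> carrier B \<Longrightarrow> c \<in> carrier B \<Longrightarrow> ds b \<otimes>\<^bsub>A\<^esub> dt c = dt c \<otimes>\<^bsub>A\<^esub> ds b"
  by (simp add: double_src_def double_tgt_def U_mult_pure U.src_tgt_commute)

lemma ds_dt_H: "b \<in> carrier B \<Longrightarrow> c \<in> carrier B \<Longrightarrow> C \<in> carrier T \<Longrightarrow> dt c \<otimes>\<^bsub>H\<^esub> (ds b \<otimes>\<^bsub>H\<^esub> C) = ds b \<otimes>\<^bsub>H\<^esub> (dt c \<otimes>\<^bsub>H\<^esub> C)"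
  by (simp add: h.mult_assoc[symmetric] double_src_def double_tgt_def h.U_mult_pure U.src_tgt_commute)

lemma ds_dt_A: "b \<in> carrier B \<Longrightarrow> c \<in> carrier B \<Longrightarrow> C \<in> carrier T \<Longrightarrow> dt c \<otimes>\<^bsub>A\<^esub> (ds b \<otimes>\<^bsub>A\<^esub> C) = ds b \<otimes>\<^bsub>A\<^esub> (dt c \<otimes>\<^bsub>A\<^esub> C)"
  by (simp add: mult_assoc[symmetric] double_src_def double_tgt_def U_mult_pure U.src_tgt_commute)

lemma hp_bal_ds:
  assumes J: "hp.bal J" and b: "b \<in> carrier B" shows "hp.bal (\<lambda>x y. J (ds b \<otimes>\<^bsub>H\<^esub> x) y)"
  by (rule balancedI)
     (use b in \<open>simp_all add: h.mult_add_right ds_dt_H[symmetric] balancedD(1,2)[OF J, simplified] balancedD(3)[OF J, simplified]\<close>)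

lemma hp_bal_dt:
  assumes J: "hp.bal J" and b: "b \<in> carrier B" shows "hp.bal (\<lambda>x y. J x (dt b \<otimes>\<^bsub>A\<^esub> y))"
  by (rule balancedI)
     (use b in \<open>simp_all add: mult_add_right ds_dt_A balancedD(1,2)[OF J, simplified] balancedD(3)[OF J, simplified]\<close>)

lemma gsum_coa_src:
  assumes J: "hp.bal J" and b: "b \<in> carrier B" and C: "C \<in> carrier T"
  shows "gsum T T (coa (ds b \<otimes>\<^bsub>A\<^esub> C)) J = gsum T T (coa C) (\<lambda>x y. J (ds b \<otimes>\<^bsub>H\<^esub> x) y)"
proof (rule T_pure_ext[OF mult_additive_right[OF coa_additive[OF J]] coa_additive[OF hp_bal_ds[OF J b]] C])
  fix \<alpha> x assume "\<alpha> \<in> carrier U" "x \<in> carrier L"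
  then show "gsum T T (coa (ds b \<otimes>\<^bsub>A\<^esub> (\<alpha> \<boxtimes> x))) J = gsum T T (coa (\<alpha> \<boxtimes> x)) (\<lambda>x y. J (ds b \<otimes>\<^bsub>H\<^esub> x) y)"
    using b by (simp add: gsum_coa_pure[OF hp_bal_ds[OF J b]] ds_mult_pure h.ds_mult_pure gsum_coa_pure[OF J]
      cosum_src[OF coupled_pure[OF J]])
qed (use b in simp)

lemma gsum_coa_tgt:
  assumes J: "hp.bal J" and b: "b \<in> carrier B" and C: "C \<in> carrier T"
  shows "gsum T T (coa (dt b \<otimes>\<^bsub>A\<^esub> C)) J = gsum T T (coa C) (\<lambda>x y. J x (dt b \<otimes>\<^bsub>A\<^esub> y))"
proof (rule T_pure_ext[OF mult_additive_right[OF coa_additive[OF J]] coa_additive[OF hp_bal_dt[OF J b]] C])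
  fix \<alpha> x assume "\<alpha> \<in> carrier U" "x \<in> carrier L"
  then show "gsum T T (coa (dt b \<otimes>\<^bsub>A\<^esub> (\<alpha> \<boxtimes> x))) J = gsum T T (coa (\<alpha> \<boxtimes> x)) (\<lambda>x y. J x (dt b \<otimes>\<^bsub>A\<^esub> y))"
    using b by (simp add: gsum_coa_pure[OF hp_bal_dt[OF J b]] dt_mult_pure gsum_coa_pure[OF J]
      cosum_tgt[OF coupled_pure[OF J]])
qed (use b in simp)

lemma gsum_coa_src_right:
  assumes J: "hp.bal J" and b: "b \<in> carrier B" and C: "C \<in> carrier T"
  shows "gsum T T (coa (C \<otimes>\<^bsub>A\<^esub> ds b)) J = gsum T T (coa C) (\<lambda>x y. J (x \<otimes>\<^bsub>H\<^esub> ds b) y)"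
proof (rule T_pure_ext[OF mult_additive_left[OF coa_additive[OF J]] coa_additive[OF hp_bal_mult_H[OF J]] C])
  fix \<alpha> x assume "\<alpha> \<in> carrier U" "x \<in> carrier L"
  then show "gsum T T (coa ((\<alpha> \<boxtimes> x) \<otimes>\<^bsub>A\<^esub> ds b)) J = gsum T T (coa (\<alpha> \<boxtimes> x)) (\<lambda>x y. J (x \<otimes>\<^bsub>H\<^esub> ds b) y)"
    using b by (simp add: gsum_coa_pure[OF hp_bal_mult_H[OF J]] pure_mult_ds h.pure_mult_ds gsum_coa_pure[OF J]
      cosum_src_right[OF coupled_pure[OF J]])
qed (use b in simp_all)

lemma coa_B_bilinear:
  assumes b: "b \<in> carrier B" and b': "b' \<in> carrier B" and C: "C \<in> carrier T"
  shows "coa (ds b \<otimes>\<^bsub>A\<^esub> C \<otimes>\<^bsub>A\<^esub> ds b') = induced hp.TP (\<lambda>(h, q). frag_of (ds b \<otimes>\<^bsub>H\<^esub> h \<otimes>\<^bsub>H\<^esub> ds b', q)) (coa C)"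
proof (rule coa_eqI)
  show "induced hp.TP (\<lambda>(h, q). frag_of (ds b \<otimes>\<^bsub>H\<^esub> h \<otimes>\<^bsub>H\<^esub> ds b', q)) (coa C) \<in> carrier hp.TP"
    unfolding case_prod_beta' by (rule hp.induced_closed) (use b b' keys_coa[OF C] in simp)
  fix J assume J: "hp.bal J"
  show "gsum T T (coa (ds b \<otimes>\<^bsub>A\<^esub> C \<otimes>\<^bsub>A\<^esub> ds b')) J = tsum (induced hp.TP (\<lambda>(h, q). frag_of (ds b \<otimes>\<^bsub>H\<^esub> h \<otimes>\<^bsub>H\<^esub> ds b', q)) (coa C)) J"
    using b b' C
    by (simp add: gsum_coa_src_right[OF J] gsum_coa_src[OF hp_bal_mult_H[OF J]] hp.tsum_induced_pair[OF J]
      hp_gsum coa_closed)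
qed (use assms in simp)

lemma coa_Be:
  assumes b: "b \<in> carrier B" and c: "c \<in> carrier B" and C: "C \<in> carrier T"
  shows "coa (ds b \<otimes>\<^bsub>A\<^esub> dt c \<otimes>\<^bsub>A\<^esub> C) = induced hp.TP (\<lambda>(x1, x2). frag_of (ds b \<otimes>\<^bsub>H\<^esub> x1, dt c \<otimes>\<^bsub>A\<^esub> x2)) (coa C)"
proof (rule coa_eqI)
  show "induced hp.TP (\<lambda>(x1, x2). frag_of (ds b \<otimes>\<^bsub>H\<^esub> x1, dt c \<otimes>\<^bsub>A\<^esub> x2)) (coa C) \<in> carrier hp.TP"
    unfolding case_prod_beta' by (rule hp.induced_closed) (use b c keys_coa[OF C] in simp)
  fix J assume J: "hp.bal J"
  show "gsum T T (coa (ds b \<otimes>\<^bsub>A\<^esub> dt c \<otimes>\<^bsub>A\<^esub> C)) J = tsum (induced hp.TP (\<lambda>(x1, x2). frag_of (ds b \<otimes>\<^bsub>H\<^esub> x1, dt c \<otimes>\<^bsub>A\<^esub> x2)) (coa C)) J"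
    using b c C
    by (simp add: mult_assoc gsum_coa_src[OF J] gsum_coa_tgt[OF hp_bal_ds[OF J]] hp.tsum_induced_pair[OF J]
      hp_gsum coa_closed)
qed (use assms in simp)

text \<open>
  The counit laws of \<open>U\<close> and \<open>L\<close>, the first one after absorbing the counit of \<open>x1\<close> into \<open>\<alpha>1\<close>.
\<close>

lemma gsum_coa_counit_left:
  assumes \<Phi>: "additive_on T \<Phi>" and C: "C \<in> carrier T"
  shows "gsum T T (coa C) (\<lambda>h q. \<Phi> (ds (eps h) \<otimes>\<^bsub>A\<^esub> q)) = \<Phi> C"
proof -
  have eps_dt: "eps (dt b \<otimes>\<^bsub>H\<^esub> D) = eps D \<otimes>\<^bsub>B\<^esub> b" if "b \<in> carrier B" "D \<in> carrier T" for b D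
  proof (rule B_separate)
    fix g assume g: "additive_on B g"
    have g': "additive_on B (\<lambda>a. g (a \<otimes>\<^bsub>B\<^esub> b))"
      by (rule additive_onI) (use that in \<open>simp add: additives additive_onD[OF g]\<close>)
    show "g (eps (dt b \<otimes>\<^bsub>H\<^esub> D)) = g (eps D \<otimes>\<^bsub>B\<^esub> b)"
      by (rule T_pure_ext[OF h.mult_additive_right[OF eps_additive[OF g]] eps_additive[OF g'] that(2)])
         (use that in \<open>simp_all add: h.dt_mult_pure eps_pure assocs U.counit_tgt\<close>)
  qed (use that in simp_all)
  have b: "hp.bal (\<lambda>h q. \<Phi> (ds (eps h) \<otimes>\<^bsub>A\<^esub> q))"
    by (rule balancedI)
       (simp_all add: eps_add ds_add mult_add_left mult_add_right additive_onD[OF \<Phi>] eps_dt ds_mult mult_assoc)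
  show ?thesis
  proof (rule T_pure_ext[OF coa_additive[OF b] \<Phi> C])
    fix \<alpha> x assume *: "\<alpha> \<in> carrier U" "x \<in> carrier L"
    have g: "additive_on U (\<lambda>\<gamma>. \<Phi> (\<gamma> \<boxtimes> y))" if "y \<in> carrier L" for y
      by (rule additive_onI) (use that in \<open>simp add: balancedD(1)[OF T_sbal[OF \<Phi>]]\<close>)
    have gb: "U.bal (\<lambda>\<alpha>1 \<alpha>2. \<Phi> ((src U (counit U \<alpha>1) \<otimes>\<^bsub>U\<^esub> \<alpha>2) \<boxtimes> y))" if "y \<in> carrier L" for y
      by (rule balancedI)
         (use that in \<open>simp_all add: additives additive_onD[OF g] U.counit_tgt mults assocs\<close>)
    have "csum U \<alpha> (\<lambda>\<alpha>1 \<alpha>2. \<Phi> ((src U (counit U (\<alpha>1 \<otimes>\<^bsub>U\<^esub> src U c)) \<otimes>\<^bsub>U\<^esub> \<alpha>2) \<boxtimes> y)) = \<Phi> ((\<alpha> \<otimes>\<^bsub>U\<^esub> src U c) \<boxtimes> y)"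
      if "c \<in> carrier B" "y \<in> carrier L" for c y
      using U.csum_src_right[OF gb[OF that(2)] that(1) *(1)] U.csum_counit_left[OF g[OF that(2)], of "\<alpha> \<otimes>\<^bsub>U\<^esub> src U c"] * that
      by simp
    then have "gsum T T (coa (\<alpha> \<boxtimes> x)) (\<lambda>h q. \<Phi> (ds (eps h) \<otimes>\<^bsub>A\<^esub> q)) = csum L x (\<lambda>x1 x2. \<Phi> (\<alpha> \<boxtimes> (src L (counit L x1) \<otimes>\<^bsub>L\<^esub> x2)))"
      using * by (simp add: gsum_coa_pure[OF b] cosum_alt eps_pure ds_mult_pure pure_src)
    also have "\<dots> = \<Phi> (\<alpha> \<boxtimes> x)"
      by (rule L.csum_counit_left[OF _ *(2)]) (rule additive_onI, use * in \<open>simp add: balancedD(2)[OF T_sbal[OF \<Phi>]]\<close>)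
    finally show "gsum T T (coa (\<alpha> \<boxtimes> x)) (\<lambda>h q. \<Phi> (ds (eps h) \<otimes>\<^bsub>A\<^esub> q)) = \<Phi> (\<alpha> \<boxtimes> x)" .
  qed
qed

lemma eps_ds:
  assumes "b \<in> carrier B" "D \<in> carrier T" shows "eps (ds b \<otimes>\<^bsub>A\<^esub> D) = b \<otimes>\<^bsub>B\<^esub> eps D"
proof (rule B_separate)
  fix g assume g: "additive_on B g"
  have g': "additive_on B (\<lambda>a. g (b \<otimes>\<^bsub>B\<^esub> a))"
    by (rule additive_onI) (use assms in \<open>simp add: additives additive_onD[OF g]\<close>)
  show "g (eps (ds b \<otimes>\<^bsub>A\<^esub> D)) = g (b \<otimes>\<^bsub>B\<^esub> eps D)"
    by (rule T_pure_ext[OF mult_additive_right[OF eps_additive[OF g]] eps_additive[OF g'] assms(2)])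
       (use assms in \<open>simp_all add: ds_mult_pure eps_pure assocs U.counit_src\<close>)
qed (use assms in simp_all)

lemma eps_dt:
  assumes "b \<in> carrier B" "D \<in> carrier T" shows "eps (dt b \<otimes>\<^bsub>A\<^esub> D) = eps D \<otimes>\<^bsub>B\<^esub> b"
proof (rule B_separate)
  fix g assume g: "additive_on B g"
  have g': "additive_on B (\<lambda>a. g (a \<otimes>\<^bsub>B\<^esub> b))"
    by (rule additive_onI) (use assms in \<open>simp add: additives additive_onD[OF g]\<close>)
  show "g (eps (dt b \<otimes>\<^bsub>A\<^esub> D)) = g (eps D \<otimes>\<^bsub>B\<^esub> b)"
    by (rule T_pure_ext[OF mult_additive_right[OF eps_additive[OF g]] eps_additive[OF g'] assms(2)])
       (use assms in \<open>simp_all add: dt_mult_pure eps_pure assocs U.counit_tgt\<close>)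
qed (use assms in simp_all)

lemma hp_bal_counit_right:
  assumes \<Phi>: "additive_on T \<Phi>" shows "hp.bal (\<lambda>h q. \<Phi> (dt (eps q) \<otimes>\<^bsub>H\<^esub> h))"
  by (rule balancedI)
     (simp_all add: eps_add dt_add h.mult_add_left h.mult_add_right additive_onD[OF \<Phi>] eps_ds h.dt_mult h.mult_assoc)

lemma gsum_coa_counit_right:
  assumes \<Phi>: "additive_on T \<Phi>" and C: "C \<in> carrier T"
  shows "gsum T T (coa C) (\<lambda>h q. \<Phi> (dt (eps q) \<otimes>\<^bsub>H\<^esub> h)) = \<Phi> C"
proof -
  note b = hp_bal_counit_right[OF \<Phi>]
  show ?thesis
  proof (rule T_pure_ext[OF coa_additive[OF b] \<Phi> C])
    fix \<alpha> x assume *: "\<alpha> \<in> carrier U" "x \<in> carrier L"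
    have g: "additive_on U (\<lambda>\<gamma>. \<Phi> (\<gamma> \<boxtimes> y))" if "y \<in> carrier L" for y
      by (rule additive_onI) (use that in \<open>simp add: balancedD(1)[OF T_sbal[OF \<Phi>]]\<close>)
    have gb: "U.bal (\<lambda>\<alpha>1 \<alpha>2. \<Phi> ((tgt U (counit U \<alpha>2) \<otimes>\<^bsub>U\<^esub> \<alpha>1) \<boxtimes> y))" if "y \<in> carrier L" for y
      by (rule balancedI)
         (use that in \<open>simp_all add: additives additive_onD[OF g] U.counit_src mults assocs\<close>)
    have "csum U \<alpha> (\<lambda>\<alpha>1 \<alpha>2. \<Phi> ((tgt U (counit U (\<alpha>2 \<otimes>\<^bsub>U\<^esub> src U c)) \<otimes>\<^bsub>U\<^esub> \<alpha>1) \<boxtimes> y)) = \<Phi> ((\<alpha> \<otimes>\<^bsub>U\<^esub> tgt U c) \<boxtimes> y)"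
      if "c \<in> carrier B" "y \<in> carrier L" for c y
      using U.csum_tgt_right[OF gb[OF that(2)] that(1) *(1)] U.csum_counit_right[OF g[OF that(2)], of "\<alpha> \<otimes>\<^bsub>U\<^esub> tgt U c"] * that
      by (simp add: U.counit_mult_tgt_src)
    then have "gsum T T (coa (\<alpha> \<boxtimes> x)) (\<lambda>h q. \<Phi> (dt (eps q) \<otimes>\<^bsub>H\<^esub> h)) = csum L x (\<lambda>x1 x2. \<Phi> (\<alpha> \<boxtimes> (tgt L (counit L x2) \<otimes>\<^bsub>L\<^esub> x1)))"
      using * by (simp add: gsum_coa_pure[OF b] cosum_alt eps_pure h.dt_mult_pure pure_tgt)
    also have "\<dots> = \<Phi> (\<alpha> \<boxtimes> x)"
      by (rule L.csum_counit_right[OF _ *(2)]) (rule additive_onI, use * in \<open>simp add: balancedD(2)[OF T_sbal[OF \<Phi>]]\<close>)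
    finally show "gsum T T (coa (\<alpha> \<boxtimes> x)) (\<lambda>h q. \<Phi> (dt (eps q) \<otimes>\<^bsub>H\<^esub> h)) = \<Phi> (\<alpha> \<boxtimes> x)" .
  qed
qed

sublocale tp: triple_product K B H dt H ds dt A ds
  by standard (simp_all add: smult_ds[symmetric] h.smult_dt[symmetric] h.smult_ds[symmetric])

text \<open>
  Characters of the threefold tensor product restrict to coupled functions in each pair of neighbouring
  arguments, so on pure tensors this is \<open>cosum_coassoc\<close>.
\<close>

lemma coa_coassoc:
  assumes C: "C \<in> carrier T"
  shows "induced tp.T3 (\<lambda>(h, q). expand (\<lambda>(h1, h2). frag_of (h1, h2, q)) (double_coact K B U L \<tau> \<tau> h)) (coa C)
    = induced tp.T3 (\<lambda>(h, q). expand (\<lambda>(h', q'). frag_of (h, h', q')) (coa q)) (coa C)"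
proof -
  interpret hh: double K B U L \<tau> \<tau> by unfold_locales
  show ?thesis
  proof (rule tp.diamond3_eqI)
    show "induced tp.T3 (\<lambda>(h, q). expand (\<lambda>(h1, h2). frag_of (h1, h2, q)) (hh.coa h)) (coa C) \<in> carrier tp.T3"
      unfolding case_prod_beta'
    proof (rule tp.induced3_closed, rule keys_expand_subset)
      fix z w assume "z \<in> Poly_Mapping.keys (repr (coa C))" "w \<in> Poly_Mapping.keys (repr (hh.coa (fst z)))"
      then show "Poly_Mapping.keys (frag_of (fst w, snd w, snd z)) \<subseteq> carrier H \<times> carrier H \<times> carrier A"
        using keys_coa[OF C, of z] hh.keys_coa[of "fst z" w] by (simp add: mem_Times_iff)
    qed
    show "induced tp.T3 (\<lambda>(h, q). expand (\<lambda>(h', q'). frag_of (h, h', q')) (coa q)) (coa C) \<in> carrier tp.T3"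
      unfolding case_prod_beta'
    proof (rule tp.induced3_closed, rule keys_expand_subset)
      fix z w assume "z \<in> Poly_Mapping.keys (repr (coa C))" "w \<in> Poly_Mapping.keys (repr (coa (snd z)))"
      then show "Poly_Mapping.keys (frag_of (fst z, fst w, snd w)) \<subseteq> carrier H \<times> carrier H \<times> carrier A"
        using keys_coa[OF C, of z] keys_coa[of "snd z" w] by (simp add: mem_Times_iff)
    qed
    fix \<phi> assume b3: "tp.bal3 \<phi>"
    have b12: "hh.hp.bal (\<lambda>x y. \<phi> x y q)" if "q \<in> carrier T" for q
      by (rule balancedI) (use b3 that in \<open>simp_all add: balanced3_def\<close>)
    have b23: "hp.bal (\<phi> x)" if "x \<in> carrier T" for x
      by (rule balancedI) (use b3 that in \<open>simp_all add: balanced3_def\<close>)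
    have add3: "\<phi> x y (q \<oplus>\<^bsub>T\<^esub> q') = \<phi> x y q + \<phi> x y q'"
      if "x \<in> carrier T" "y \<in> carrier T" "q \<in> carrier T" "q' \<in> carrier T" for x y q q'
      using b3 that by (simp add: balanced3_def)
    have add1: "\<phi> (x \<oplus>\<^bsub>T\<^esub> x') y q = \<phi> x y q + \<phi> x' y q" "b \<in> carrier B \<Longrightarrow> \<phi> (dt b \<otimes>\<^bsub>H\<^esub> x) y q = \<phi> x (ds b \<otimes>\<^bsub>H\<^esub> y) q"
      if "x \<in> carrier T" "y \<in> carrier T" "q \<in> carrier T" "x' \<in> carrier T" for x y q x' b
      using b3 that by (simp_all add: balanced3_def)
    have \<Omega>1: "hp.bal (\<lambda>h q. gsum T T (hh.coa h) (\<lambda>h1 h2. \<phi> h1 h2 q))"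
      by (rule balancedI)
         (simp_all add: additive_onD[OF hh.coa_additive[OF b12]] add3 gsum_plus hh.gsum_coa_tgt[OF b12]
           balancedD(3)[OF b23, simplified])
    have \<Omega>2: "hp.bal (\<lambda>h q. gsum T T (coa q) (\<lambda>h' q'. \<phi> h h' q'))"
      by (rule balancedI)
         (simp_all add: additive_onD[OF coa_additive[OF b23]] add1 gsum_plus gsum_coa_src[OF b23])
    have main: "gsum T T (coa C) (\<lambda>h q. gsum T T (hh.coa h) (\<lambda>h1 h2. \<phi> h1 h2 q))
      = gsum T T (coa C) (\<lambda>h q. gsum T T (coa q) (\<lambda>h' q'. \<phi> h h' q'))"
    proof (rule T_pure_ext[OF coa_additive[OF \<Omega>1] coa_additive[OF \<Omega>2] C])
      fix \<alpha> x assume *: "\<alpha> \<in> carrier U" "x \<in> carrier L"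
      have "cosum U L (\<lambda>\<alpha>' x' \<alpha>3 x3. cosum U L (\<lambda>\<alpha>1 x1 \<alpha>2 x2. \<phi> (\<alpha>1 \<boxtimes> x1) (\<alpha>2 \<boxtimes> x2) (\<alpha>3 \<boxtimes> x3)) \<alpha>' x') \<alpha> x
        = cosum U L (\<lambda>\<alpha>1 x1 \<alpha>' x'. cosum U L (\<lambda>\<alpha>2 x2 \<alpha>3 x3. \<phi> (\<alpha>1 \<boxtimes> x1) (\<alpha>2 \<boxtimes> x2) (\<alpha>3 \<boxtimes> x3)) \<alpha>' x') \<alpha> x"
        by (rule cosum_coassoc[OF _ _ *]) (simp_all add: hh.coupled_pure[OF b12] coupled_pure[OF b23])
      then show "gsum T T (coa (\<alpha> \<boxtimes> x)) (\<lambda>h q. gsum T T (hh.coa h) (\<lambda>h1 h2. \<phi> h1 h2 q))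
        = gsum T T (coa (\<alpha> \<boxtimes> x)) (\<lambda>h q. gsum T T (coa q) (\<lambda>h' q'. \<phi> h h' q'))"
        using * by (simp add: gsum_coa_pure[OF \<Omega>1] gsum_coa_pure[OF \<Omega>2] hh.gsum_coa_pure[OF b12] gsum_coa_pure[OF b23])
    qed
    have "lin (\<lambda>(x, y, z). \<phi> x y z) (repr (induced tp.T3 (\<lambda>(h, q). expand (\<lambda>(h1, h2). frag_of (h1, h2, q)) (hh.coa h)) (coa C)))
      = tsum (coa C) (\<lambda>h q. tsum (hh.coa h) (\<lambda>h1 h2. \<phi> h1 h2 q))"
      unfolding tp.lin_repr_induced3[OF b3] tsum_def[of "coa C"] by (rule lin_cong) (auto simp: lin_expand)
    also have "\<dots> = gsum T T (coa C) (\<lambda>h q. gsum T T (hh.coa h) (\<lambda>h1 h2. \<phi> h1 h2 q))"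
      unfolding hp_gsum[OF coa_closed[OF C]] by (rule gsum_cong[OF refl]) (simp add: hh.hp_gsum hh.coa_closed)
    also have "\<dots> = gsum T T (coa C) (\<lambda>h q. gsum T T (coa q) (\<lambda>h' q'. \<phi> h h' q'))" by (rule main)
    also have "\<dots> = tsum (coa C) (\<lambda>h q. tsum (coa q) (\<lambda>h' q'. \<phi> h h' q'))"
      unfolding hp_gsum[OF coa_closed[OF C]] by (rule gsum_cong[OF refl]) (simp add: hp_gsum coa_closed)
    also have "\<dots> = lin (\<lambda>(x, y, z). \<phi> x y z) (repr (induced tp.T3 (\<lambda>(h, q). expand (\<lambda>(h', q'). frag_of (h, h', q')) (coa q)) (coa C)))"
      unfolding tp.lin_repr_induced3[OF b3] tsum_def[of "coa C"] by (rule lin_cong) (auto simp: lin_expand)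
    finally show "lin (\<lambda>(x, y, z). \<phi> x y z) (repr (induced tp.T3 (\<lambda>(h, q). expand (\<lambda>(h1, h2). frag_of (h1, h2, q)) (hh.coa h)) (coa C)))
      = lin (\<lambda>(x, y, z). \<phi> x y z) (repr (induced tp.T3 (\<lambda>(h, q). expand (\<lambda>(h', q'). frag_of (h, h', q')) (coa q)) (coa C)))" .
  qed
qed

text \<open>
  On pure tensors \<open>\<alpha> \<otimes> x\<close> and \<open>\<beta> \<otimes> y\<close> the counit of the product becomes the left-hand side of \<open>W_V_counit\<close>
  with \<open>e = \<epsilon>(y)\<close>, once \<open>\<epsilon>(\<gamma> \<gamma>') = \<epsilon>(\<gamma> \<epsilon>(\<gamma>'))\<close> has been applied in \<open>U\<close> and in \<open>L\<close>.
\<close>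

lemma eps_mult_src:
  assumes C: "C \<in> carrier T" and D: "D \<in> carrier T"
  shows "eps (C \<otimes>\<^bsub>H\<^esub> ds (eps D)) = eps (C \<otimes>\<^bsub>H\<^esub> D)"
proof (rule B_separate)
  fix g assume g: "additive_on B g"
  have pure: "g (eps ((\<alpha> \<boxtimes> x) \<otimes>\<^bsub>H\<^esub> ds (eps (\<beta> \<boxtimes> y)))) = g (eps ((\<alpha> \<boxtimes> x) \<otimes>\<^bsub>H\<^esub> (\<beta> \<boxtimes> y)))"
    if *: "\<alpha> \<in> carrier U" "x \<in> carrier L" "\<beta> \<in> carrier U" "y \<in> carrier L" for \<alpha> x \<beta> y
  proof -
    have g': "additive_on B (\<lambda>b. g (counit U (\<alpha> \<otimes>\<^bsub>U\<^esub> src U b)))"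
      by (rule additive_onI) (use * in \<open>simp add: additives additive_onD[OF g]\<close>)
    have cm: "counit U (\<alpha> \<otimes>\<^bsub>U\<^esub> \<gamma>) = counit U (\<alpha> \<otimes>\<^bsub>U\<^esub> src U (counit U \<gamma>))" if "\<gamma> \<in> carrier U" for \<gamma>
      using U.counit_mult_src[of \<alpha> \<gamma>] * that by simp
    have cl: "counit L (z \<otimes>\<^bsub>L\<^esub> y) = counit L (z \<otimes>\<^bsub>L\<^esub> src L (counit L y))" if "z \<in> carrier L" for z
      using L.counit_mult_src[of z y] * that by simp
    have "g (eps ((\<alpha> \<boxtimes> x) \<otimes>\<^bsub>H\<^esub> (\<beta> \<boxtimes> y))) = h.R x \<beta> (\<lambda>p z. g (counit U (\<alpha> \<otimes>\<^bsub>U\<^esub> src U (counit U (p \<otimes>\<^bsub>U\<^esub> src U (counit L (z \<otimes>\<^bsub>L\<^esub> src L (counit L y))))))))"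
    proof -
      have "g (eps ((\<alpha> \<boxtimes> x) \<otimes>\<^bsub>H\<^esub> (\<beta> \<boxtimes> y))) = h.R x \<beta> (\<lambda>p z. g (eps ((\<alpha> \<otimes>\<^bsub>U\<^esub> p) \<boxtimes> (z \<otimes>\<^bsub>L\<^esub> y))))"
        using * by (rule h.mult_pure[OF eps_additive[OF g]])
      also have "\<dots> = h.R x \<beta> (\<lambda>p z. g (counit U (\<alpha> \<otimes>\<^bsub>U\<^esub> src U (counit U (p \<otimes>\<^bsub>U\<^esub> src U (counit L (z \<otimes>\<^bsub>L\<^esub> src L (counit L y))))))))"
      proof (rule cross_cong[OF refl refl])
        fix p z assume pz: "p \<in> carrier U" "z \<in> carrier L"
        have "eps ((\<alpha> \<otimes>\<^bsub>U\<^esub> p) \<boxtimes> (z \<otimes>\<^bsub>L\<^esub> y)) = counit U (\<alpha> \<otimes>\<^bsub>U\<^esub> (p \<otimes>\<^bsub>U\<^esub> src U (counit L (z \<otimes>\<^bsub>L\<^esub> src L (counit L y)))))"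
          using * pz cl by (simp add: eps_pure U.assoc)
        also have "\<dots> = counit U (\<alpha> \<otimes>\<^bsub>U\<^esub> src U (counit U (p \<otimes>\<^bsub>U\<^esub> src U (counit L (z \<otimes>\<^bsub>L\<^esub> src L (counit L y))))))"
          by (rule cm) (use * pz in simp)
        finally show "g (eps ((\<alpha> \<otimes>\<^bsub>U\<^esub> p) \<boxtimes> (z \<otimes>\<^bsub>L\<^esub> y))) = g (counit U (\<alpha> \<otimes>\<^bsub>U\<^esub> src U (counit U (p \<otimes>\<^bsub>U\<^esub> src U (counit L (z \<otimes>\<^bsub>L\<^esub> src L (counit L y)))))))"
          by simp
      qed
      finally show ?thesis .
    qed
    also have "\<dots> = g (counit U (\<alpha> \<otimes>\<^bsub>U\<^esub> src U (counit L (x \<otimes>\<^bsub>L\<^esub> src L (counit U (\<beta> \<otimes>\<^bsub>U\<^esub> src U (counit L y)))))))"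
      unfolding cross_def using t.W_V_counit[OF g', of "counit L y" x \<beta>] * by simp
    also have "\<dots> = g (eps ((\<alpha> \<boxtimes> x) \<otimes>\<^bsub>H\<^esub> ds (eps (\<beta> \<boxtimes> y))))"
      using * by (simp add: h.pure_mult_ds eps_pure)
    finally show ?thesis by simp
  qed
  have 1: "g (eps ((\<alpha> \<boxtimes> x) \<otimes>\<^bsub>H\<^esub> ds (eps D))) = g (eps ((\<alpha> \<boxtimes> x) \<otimes>\<^bsub>H\<^esub> D))"
    if "\<alpha> \<in> carrier U" "x \<in> carrier L" for \<alpha> x
  proof (rule T_pure_ext[OF _ h.mult_additive_right[OF eps_additive[OF g]] D])
    show "additive_on T (\<lambda>D. g (eps ((\<alpha> \<boxtimes> x) \<otimes>\<^bsub>H\<^esub> ds (eps D))))"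
      by (rule additive_onI) (use that in \<open>simp add: eps_add ds_add h.mult_add_right additive_onD[OF g]\<close>)
  qed (use that pure in simp_all)
  show "g (eps (C \<otimes>\<^bsub>H\<^esub> ds (eps D))) = g (eps (C \<otimes>\<^bsub>H\<^esub> D))"
    by (rule T_pure_ext[OF h.mult_additive_left[OF eps_additive[OF g]] h.mult_additive_left[OF eps_additive[OF g]] C])
       (use D 1 in simp_all)
qed (use assms in simp_all)

lemma eps_mult_tgt_src:
  assumes b: "b \<in> carrier B" and C: "C \<in> carrier T"
  shows "eps (C \<otimes>\<^bsub>H\<^esub> dt b) = eps (C \<otimes>\<^bsub>H\<^esub> ds b)"
proof (rule B_separate)
  fix g assume g: "additive_on B g"
  show "g (eps (C \<otimes>\<^bsub>H\<^esub> dt b)) = g (eps (C \<otimes>\<^bsub>H\<^esub> ds b))"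
    by (rule T_pure_ext[OF h.mult_additive_left[OF eps_additive[OF g]] h.mult_additive_left[OF eps_additive[OF g]] C])
       (use b in \<open>simp_all add: h.pure_mult_dt h.pure_mult_ds eps_pure L.counit_mult_tgt_src\<close>)
qed (use assms in simp_all)

lemma eps_mult_tgt:
  "C \<in> carrier T \<Longrightarrow> D \<in> carrier T \<Longrightarrow> eps (C \<otimes>\<^bsub>H\<^esub> dt (eps D)) = eps (C \<otimes>\<^bsub>H\<^esub> D)"
  by (simp add: eps_mult_tgt_src eps_mult_src)

end

section \<open>The Galois map\<close>

context hopf_pair
begin

lemma cosum_tgt_right:
  "coupled J \<Longrightarrow> b \<in> carrier B \<Longrightarrow> \<alpha> \<in> carrier U \<Longrightarrow> x \<in> carrier L
    \<Longrightarrow> cosum U L J \<alpha> (x \<otimes>\<^bsub>L\<^esub> tgt L b) = cosum U L (\<lambda>\<alpha> x \<beta> y. J \<alpha> x \<beta> (y \<otimes>\<^bsub>L\<^esub> tgt L b)) \<alpha> x"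
  unfolding cosum_alt by (rule L.csum_tgt_right[OF cosum_bal_L])

end

context double
begin

text \<open>
  Apply the right counit law to a coinvariant \<open>C\<close>: the coaction \<open>1 \<otimes> C\<close> goes to \<open>dt (eps C)\<close>, so \<open>C\<close>
  is in the image of the target map.
\<close>

lemma coinvariant_iff:
  assumes C: "C \<in> carrier T"
  shows "coa C = cls hp.TP (frag_of (\<one>\<^bsub>H\<^esub>, C)) \<longleftrightarrow> C \<in> dt ` carrier B"
proof
  assume eq: "coa C = cls hp.TP (frag_of (\<one>\<^bsub>H\<^esub>, C))"
  have "C = dt (eps C)"
  proof (rule T_separate)
    fix \<Phi> assume \<Phi>: "additive_on T \<Phi>"
    have "\<Phi> C = tsum (cls hp.TP (frag_of (\<one>\<^bsub>H\<^esub>, C))) (\<lambda>h q. \<Phi> (dt (eps q) \<otimes>\<^bsub>H\<^esub> h))"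
      unfolding eq[symmetric] hp_gsum[OF coa_closed[OF C]] by (rule gsum_coa_counit_right[OF \<Phi> C, symmetric])
    also have "\<dots> = \<Phi> (dt (eps C))"
      using C by (simp add: hp.tsum_pure[OF hp_bal_counit_right[OF \<Phi>]] h.mult_one)
    finally show "\<Phi> C = \<Phi> (dt (eps C))" .
  qed (use C in simp_all)
  moreover have "eps C \<in> carrier B" using C by simp
  ultimately show "C \<in> dt ` carrier B" by (rule image_eqI)
next
  assume "C \<in> dt ` carrier B"
  then obtain b where b: "b \<in> carrier B" "C = dt b" by blast
  have one: "\<one>\<^bsub>H\<^esub> \<in> carrier T" "\<one>\<^bsub>A\<^esub> \<in> carrier T" by (simp_all add: A_one h.A_one)
  show "coa C = cls hp.TP (frag_of (\<one>\<^bsub>H\<^esub>, C))"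
  proof (rule coa_eqI[OF C])
    show "cls hp.TP (frag_of (\<one>\<^bsub>H\<^esub>, C)) \<in> carrier hp.TP"
      by (rule hp.pure_closed) (use one C in simp_all)
    fix J assume J: "hp.bal J"
    have "gsum T T (coa C) J = gsum T T (coa \<one>\<^bsub>A\<^esub>) (\<lambda>x y. J x (dt b \<otimes>\<^bsub>A\<^esub> y))"
      using gsum_coa_tgt[OF J b(1) one(2)] b by (simp add: mult_one)
    also have "\<dots> = tsum (coa \<one>\<^bsub>A\<^esub>) (\<lambda>x y. J x (dt b \<otimes>\<^bsub>A\<^esub> y))"
      by (rule hp_gsum[OF coa_closed[OF one(2)], symmetric])
    also have "\<dots> = J \<one>\<^bsub>H\<^esub> C"
      using b by (simp add: coa_one hp.tsum_pure[OF hp_bal_dt[OF J b(1)]] mult_one)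
    finally show "gsum T T (coa C) J = tsum (cls hp.TP (frag_of (\<one>\<^bsub>H\<^esub>, C))) J"
      by (simp add: hp.tsum_pure[OF J])
  qed
qed

lemma gsum_coa_tgt_right:
  assumes J: "hp.bal J" and b: "b \<in> carrier B" and C: "C \<in> carrier T"
  shows "gsum T T (coa (C \<otimes>\<^bsub>A\<^esub> dt b)) J = gsum T T (coa C) (\<lambda>x y. J x (y \<otimes>\<^bsub>A\<^esub> dt b))"
proof -
  have J': "hp.bal (\<lambda>x y. J x (y \<otimes>\<^bsub>A\<^esub> dt b))"
    by (rule balancedI)
       (use b in \<open>simp_all add: mult_add_left mult_assoc balancedD(1,2)[OF J, simplified] balancedD(3)[OF J, simplified]\<close>)
  show ?thesis
  proof (rule T_pure_ext[OF mult_additive_left[OF coa_additive[OF J]] coa_additive[OF J'] C])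
    fix \<alpha> x assume "\<alpha> \<in> carrier U" "x \<in> carrier L"
    then show "gsum T T (coa ((\<alpha> \<boxtimes> x) \<otimes>\<^bsub>A\<^esub> dt b)) J = gsum T T (coa (\<alpha> \<boxtimes> x)) (\<lambda>x y. J x (y \<otimes>\<^bsub>A\<^esub> dt b))"
      using b by (simp add: gsum_coa_pure[OF J'] pure_mult_dt gsum_coa_pure[OF J] cosum_tgt_right[OF coupled_pure[OF J]])
  qed (use b in simp)
qed

sublocale gt: tensor_product K A A "dt ` carrier B" "\<lambda>n p. p \<otimes>\<^bsub>A\<^esub> n" "\<lambda>n q. n \<otimes>\<^bsub>A\<^esub> q"
proof
  fix \<phi> k x y
  assume b: "balanced A A (dt ` carrier B) (\<lambda>n p. p \<otimes>\<^bsub>A\<^esub> n) (\<lambda>n q. n \<otimes>\<^bsub>A\<^esub> q) \<phi>"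
    and k: "k \<in> carrier K" "x \<in> carrier A" "y \<in> carrier A"
  have "dt (k \<odot>\<^bsub>B\<^esub> \<one>\<^bsub>B\<^esub>) \<in> dt ` carrier B" using k by simp
  from balancedD(3)[OF b this, of x y] k
  show "\<phi> (k \<odot>\<^bsub>A\<^esub> x) y = \<phi> x (k \<odot>\<^bsub>A\<^esub> y)"
    by (simp add: smult_dt_right[symmetric] smult_dt[symmetric])
qed auto

lemma gt_gsum: "E \<in> carrier gt.TP \<Longrightarrow> tsum E \<phi> = gsum T T E \<phi>"
  using gt.gsum_tsum[of E \<phi>] by (simp add: gsum_def)

lemma gt_balD: "gt.bal g \<Longrightarrow> b \<in> carrier B \<Longrightarrow> p \<in> carrier T \<Longrightarrow> q \<in> carrier T \<Longrightarrow> g (p \<otimes>\<^bsub>A\<^esub> dt b) q = g p (dt b \<otimes>\<^bsub>A\<^esub> q)"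
  using balancedD(3)[of A A "dt ` carrier B" _ _ g "dt b" p q] by simp

text \<open>
  This is \<open>galois_map\<close> for the two structures of the double, with the records removed.
\<close>

definition gal where
  "gal = induced hp.TP (\<lambda>(p, q). expand (\<lambda>(h, p'). frag_of (h, p' \<otimes>\<^bsub>A\<^esub> q)) (coa p))"

text \<open>
  The pullback of a character along the Galois map.
\<close>

definition pull where
  "pull J p q = gsum T T (coa p) (\<lambda>h p'. J h (p' \<otimes>\<^bsub>A\<^esub> q))"

lemma hp_bal_mult_A:
  assumes J: "hp.bal J" and q: "q \<in> carrier T"
  shows "hp.bal (\<lambda>h p. J h (p \<otimes>\<^bsub>A\<^esub> q))"
  by (rule balancedI)
     (use q in \<open>simp_all add: mult_add_left mult_assoc balancedD(1,2)[OF J, simplified] balancedD(3)[OF J, simplified]\<close>)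

lemma pull_bal:
  assumes J: "hp.bal J" shows "gt.bal (pull J)"
proof (rule balancedI)
  fix n p q assume "n \<in> dt ` carrier B" "p \<in> carrier A" "q \<in> carrier A"
  then obtain b where b: "n = dt b" "b \<in> carrier B" "p \<in> carrier T" "q \<in> carrier T" by auto
  show "pull J (p \<otimes>\<^bsub>A\<^esub> n) q = pull J p (n \<otimes>\<^bsub>A\<^esub> q)"
    unfolding pull_def b(1) using b
    by (simp add: gsum_coa_tgt_right[OF hp_bal_mult_A[OF J]] mult_assoc)
qed (simp_all add: pull_def additive_onD[OF coa_additive[OF hp_bal_mult_A[OF J]]] mult_add_right
      balancedD(2)[OF J, simplified] gsum_plus)

lemma gal_closed:
  assumes "E \<in> carrier gt.TP" shows "gal E \<in> carrier hp.TP"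
  unfolding gal_def case_prod_beta'
proof (rule hp.induced_closed, rule keys_expand_subset)
  fix z w assume "z \<in> Poly_Mapping.keys (repr E)" "w \<in> Poly_Mapping.keys (repr (coa (fst z)))"
  moreover from this have "fst z \<in> carrier T" "snd z \<in> carrier T" using gt.keys_repr[OF assms] by auto
  ultimately show "Poly_Mapping.keys (frag_of (fst w, snd w \<otimes>\<^bsub>A\<^esub> snd z)) \<subseteq> carrier H \<times> carrier A"
    using keys_coa[of "fst z" w] by simp
qed

lemma tsum_gal:
  assumes J: "hp.bal J" and E: "E \<in> carrier gt.TP"
  shows "tsum (gal E) J = gsum T T E (pull J)"
proof -
  have "tsum (gal E) J = tsum E (\<lambda>p q. tsum (coa p) (\<lambda>h p'. J h (p' \<otimes>\<^bsub>A\<^esub> q)))"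
    unfolding gal_def hp.tsum_induced_pair[OF J] lin_expand by simp
  also have "\<dots> = gsum T T E (pull J)"
    unfolding gt_gsum[OF E] pull_def by (rule gsum_cong[OF refl]) (simp add: hp_gsum coa_closed)
  finally show ?thesis .
qed

text \<open>
  The pullback along the inverse \<open>(\<alpha> \<otimes> x) \<otimes> q \<mapsto> (\<alpha>\<^sub>+ \<otimes> x\<^sub>+) \<otimes> x\<^sub>- \<alpha>\<^sub>- q\<close> of the Galois map.  The product \<open>x\<^sub>- \<alpha>\<^sub>- q\<close>
  is formed in \<open>A\<close>, where it involves the pairings, but its terms cancel by associativity alone.
\<close>

definition pull_inv where
  "pull_inv g h q = gsum U L h (\<lambda>\<alpha> x. U.pm \<alpha> (\<lambda>a a'. L.pm x (\<lambda>y y'.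
    g (a \<boxtimes> y) ((\<one>\<^bsub>U\<^esub> \<boxtimes> y') \<otimes>\<^bsub>A\<^esub> ((a' \<boxtimes> \<one>\<^bsub>L\<^esub>) \<otimes>\<^bsub>A\<^esub> q)))))"

lemma U_assoc:
  "a \<in> carrier U \<Longrightarrow> c \<in> carrier U \<Longrightarrow> Z \<in> carrier T
    \<Longrightarrow> ((a \<otimes>\<^bsub>U\<^esub> c) \<boxtimes> \<one>\<^bsub>L\<^esub>) \<otimes>\<^bsub>A\<^esub> Z = (a \<boxtimes> \<one>\<^bsub>L\<^esub>) \<otimes>\<^bsub>A\<^esub> ((c \<boxtimes> \<one>\<^bsub>L\<^esub>) \<otimes>\<^bsub>A\<^esub> Z)"
  by (simp add: mult_assoc[symmetric] U_mult_pure)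

lemma L_assoc:
  "y \<in> carrier L \<Longrightarrow> z \<in> carrier L \<Longrightarrow> Z \<in> carrier T
    \<Longrightarrow> (\<one>\<^bsub>U\<^esub> \<boxtimes> (y \<otimes>\<^bsub>L\<^esub> z)) \<otimes>\<^bsub>A\<^esub> Z = (\<one>\<^bsub>U\<^esub> \<boxtimes> y) \<otimes>\<^bsub>A\<^esub> ((\<one>\<^bsub>U\<^esub> \<boxtimes> z) \<otimes>\<^bsub>A\<^esub> Z)"
  by (simp add: mult_assoc[symmetric] pure_mult_L)

lemma pure_add:
  "a \<in> carrier U \<Longrightarrow> c \<in> carrier U \<Longrightarrow> y \<in> carrier L \<Longrightarrow> (a \<oplus>\<^bsub>U\<^esub> c) \<boxtimes> y = (a \<boxtimes> y) \<oplus>\<^bsub>T\<^esub> (c \<boxtimes> y)"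
  "a \<in> carrier U \<Longrightarrow> y \<in> carrier L \<Longrightarrow> z \<in> carrier L \<Longrightarrow> a \<boxtimes> (y \<oplus>\<^bsub>L\<^esub> z) = (a \<boxtimes> y) \<oplus>\<^bsub>T\<^esub> (a \<boxtimes> z)"
  using be.pure_add_left[folded T_TP, of a c y] be.pure_add_right[folded T_TP, of a z y] by simp_all

lemma unit_src: "b \<in> carrier B \<Longrightarrow> \<one>\<^bsub>U\<^esub> \<boxtimes> src L b = src U b \<boxtimes> \<one>\<^bsub>L\<^esub>"
  using ds_alt[of b] by (simp add: double_src_def)

lemma unit_tgt: "b \<in> carrier B \<Longrightarrow> \<one>\<^bsub>U\<^esub> \<boxtimes> tgt L b = tgt U b \<boxtimes> \<one>\<^bsub>L\<^esub>"
  using dt_alt[of b] by (simp add: double_tgt_def)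

lemma gt_additive:
  assumes "gt.bal g" "p \<in> carrier T" "q \<in> carrier T"
  shows "p' \<in> carrier T \<Longrightarrow> g (p \<oplus>\<^bsub>T\<^esub> p') q = g p q + g p' q" "q' \<in> carrier T \<Longrightarrow> g p (q \<oplus>\<^bsub>T\<^esub> q') = g p q + g p q'"
  using balancedD(1,2)[OF assms(1)] assms by simp_all

lemma back_L:
  assumes g: "gt.bal g" and a: "a \<in> carrier U" and Q: "Q \<in> carrier T"
  shows "L.lbal (\<lambda>y y'. g (a \<boxtimes> y) ((\<one>\<^bsub>U\<^esub> \<boxtimes> y') \<otimes>\<^bsub>A\<^esub> Q))"
proof (rule balancedI)
  fix b y y' assume "b \<in> carrier B" "y \<in> carrier L" "y' \<in> carrier L"
  then show "g (a \<boxtimes> (y \<otimes>\<^bsub>L\<^esub> tgt L b)) ((\<one>\<^bsub>U\<^esub> \<boxtimes> y') \<otimes>\<^bsub>A\<^esub> Q) = g (a \<boxtimes> y) ((\<one>\<^bsub>U\<^esub> \<boxtimes> (tgt L b \<otimes>\<^bsub>L\<^esub> y')) \<otimes>\<^bsub>A\<^esub> Q)"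
    using a Q gt_balD[OF g, of b "a \<boxtimes> y" "(\<one>\<^bsub>U\<^esub> \<boxtimes> y') \<otimes>\<^bsub>A\<^esub> Q"]
    by (simp add: pure_mult_dt L_assoc dt_alt[symmetric])
qed (use a Q in \<open>simp_all add: pure_add mult_add_left gt_additive[OF g]\<close>)

lemma back_U:
  assumes g: "gt.bal g" and x: "x \<in> carrier L" and z: "z \<in> carrier L" and q: "q \<in> carrier T"
  shows "U.lbal (\<lambda>a a'. L.pm x (\<lambda>y y'. g (a \<boxtimes> y) ((\<one>\<^bsub>U\<^esub> \<boxtimes> y') \<otimes>\<^bsub>A\<^esub> ((a' \<boxtimes> z) \<otimes>\<^bsub>A\<^esub> q))))"
proof (rule balancedI)
  fix b a a' assume *: "b \<in> carrier B" "a \<in> carrier U" "a' \<in> carrier U"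
  have "(a' \<boxtimes> z) \<otimes>\<^bsub>A\<^esub> q \<in> carrier T" using * z q by simp
  from L.pm_takeuchi[OF back_L[OF g *(2) this] *(1) x]
  have "L.pm x (\<lambda>y y'. g (a \<boxtimes> (tgt L b \<otimes>\<^bsub>L\<^esub> y)) ((\<one>\<^bsub>U\<^esub> \<boxtimes> y') \<otimes>\<^bsub>A\<^esub> ((a' \<boxtimes> z) \<otimes>\<^bsub>A\<^esub> q)))
    = L.pm x (\<lambda>y y'. g (a \<boxtimes> y) ((\<one>\<^bsub>U\<^esub> \<boxtimes> (y' \<otimes>\<^bsub>L\<^esub> tgt L b)) \<otimes>\<^bsub>A\<^esub> ((a' \<boxtimes> z) \<otimes>\<^bsub>A\<^esub> q)))" .
  also have "\<dots> = L.pm x (\<lambda>y y'. g (a \<boxtimes> y) ((\<one>\<^bsub>U\<^esub> \<boxtimes> y') \<otimes>\<^bsub>A\<^esub> (((tgt U b \<otimes>\<^bsub>U\<^esub> a') \<boxtimes> z) \<otimes>\<^bsub>A\<^esub> q)))"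
  proof -
    have "(tgt U b \<boxtimes> \<one>\<^bsub>L\<^esub>) \<otimes>\<^bsub>A\<^esub> ((a' \<boxtimes> z) \<otimes>\<^bsub>A\<^esub> q) = ((tgt U b \<otimes>\<^bsub>U\<^esub> a') \<boxtimes> z) \<otimes>\<^bsub>A\<^esub> q"
      using * z q by (simp add: mult_assoc[symmetric] U_mult_pure)
    then show ?thesis using * z q by (simp add: L_assoc unit_tgt)
  qed
  finally show "L.pm x (\<lambda>y y'. g ((a \<otimes>\<^bsub>U\<^esub> tgt U b) \<boxtimes> y) ((\<one>\<^bsub>U\<^esub> \<boxtimes> y') \<otimes>\<^bsub>A\<^esub> ((a' \<boxtimes> z) \<otimes>\<^bsub>A\<^esub> q)))
    = L.pm x (\<lambda>y y'. g (a \<boxtimes> y) ((\<one>\<^bsub>U\<^esub> \<boxtimes> y') \<otimes>\<^bsub>A\<^esub> (((tgt U b \<otimes>\<^bsub>U\<^esub> a') \<boxtimes> z) \<otimes>\<^bsub>A\<^esub> q)))"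
    using * by (simp add: pure_tgt)
qed (use x z q in \<open>simp_all add: pure_add mult_add_left mult_add_right gt_additive[OF g] pmsum_plus\<close>)

text \<open>
  A source element on the right of \<open>\<alpha>\<close> passes through \<open>\<alpha>\<^sub>+\<close> to the left of \<open>x\<^sub>+\<close>.  A target element
  on the right of \<open>\<alpha>\<close> comes out as a source element on the left of \<open>\<alpha>\<^sub>-\<close>, and one on the left of \<open>x\<close> as a source element on the
  right of \<open>x\<^sub>-\<close>.
\<close>

lemma back_bal:
  assumes g: "gt.bal g" and q: "q \<in> carrier T"
  shows "be.bal (\<lambda>\<alpha> x. U.pm \<alpha> (\<lambda>a a'. L.pm x (\<lambda>y y'. g (a \<boxtimes> y) ((\<one>\<^bsub>U\<^esub> \<boxtimes> y') \<otimes>\<^bsub>A\<^esub> ((a' \<boxtimes> \<one>\<^bsub>L\<^esub>) \<otimes>\<^bsub>A\<^esub> q)))))"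
proof -
  note bL = back_L[OF g] and bU = back_U[OF g _ L.L.total.one_closed q]
  have s: "sbal (\<lambda>\<alpha> x. U.pm \<alpha> (\<lambda>a a'. L.pm x (\<lambda>y y'. g (a \<boxtimes> y) ((\<one>\<^bsub>U\<^esub> \<boxtimes> y') \<otimes>\<^bsub>A\<^esub> ((a' \<boxtimes> \<one>\<^bsub>L\<^esub>) \<otimes>\<^bsub>A\<^esub> q)))))"
    by (rule balancedI)
       (use q in \<open>simp_all add: U.pm_add[OF bU] L.pm_add[OF bL] pmsum_plus U.pm_src_right[OF bU] L.pm_src[OF bL] pure_src\<close>)
  have t: "tbal (\<lambda>\<alpha> x. U.pm \<alpha> (\<lambda>a a'. L.pm x (\<lambda>y y'. g (a \<boxtimes> y) ((\<one>\<^bsub>U\<^esub> \<boxtimes> y') \<otimes>\<^bsub>A\<^esub> ((a' \<boxtimes> \<one>\<^bsub>L\<^esub>) \<otimes>\<^bsub>A\<^esub> q)))))"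
    by (rule balancedI)
       (use q in \<open>simp_all add: U.pm_add[OF bU] L.pm_add[OF bL] pmsum_plus U.pm_tgt_right[OF bU] L.pm_tgt[OF bL]
         L_assoc U_assoc unit_src\<close>)
  show ?thesis using s t by (simp add: be_bal_iff)
qed

lemma back_pure:
  "gt.bal g \<Longrightarrow> q \<in> carrier T \<Longrightarrow> \<alpha> \<in> carrier U \<Longrightarrow> x \<in> carrier L
    \<Longrightarrow> pull_inv g (\<alpha> \<boxtimes> x) q = U.pm \<alpha> (\<lambda>a a'. L.pm x (\<lambda>y y'. g (a \<boxtimes> y) ((\<one>\<^bsub>U\<^esub> \<boxtimes> y') \<otimes>\<^bsub>A\<^esub> ((a' \<boxtimes> \<one>\<^bsub>L\<^esub>) \<otimes>\<^bsub>A\<^esub> q))))"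
  unfolding pull_inv_def by (rule gsum_pure[OF back_bal])

lemma back_additive: "gt.bal g \<Longrightarrow> q \<in> carrier T \<Longrightarrow> additive_on T (\<lambda>h. pull_inv g h q)"
  unfolding pull_inv_def by (rule T_additive[OF back_bal])

lemma back_hp_bal:
  assumes g: "gt.bal g" shows "hp.bal (pull_inv g)"
proof (rule balancedI)
  fix b C q assume "b \<in> carrier B" "C \<in> carrier H" "q \<in> carrier A"
  then have *: "b \<in> carrier B" "C \<in> carrier T" "q \<in> carrier T" by simp_all
  show "pull_inv g (dt b \<otimes>\<^bsub>H\<^esub> C) q = pull_inv g C (ds b \<otimes>\<^bsub>A\<^esub> q)"
  proof (rule T_pure_ext[OF h.mult_additive_right[OF back_additive[OF g *(3)]] back_additive[OF g] *(2)])
    fix \<alpha> x assume "\<alpha> \<in> carrier U" "x \<in> carrier L"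
    then show "pull_inv g (dt b \<otimes>\<^bsub>H\<^esub> (\<alpha> \<boxtimes> x)) q = pull_inv g (\<alpha> \<boxtimes> x) (ds b \<otimes>\<^bsub>A\<^esub> q)"
      using * by (simp add: h.dt_mult_pure back_pure[OF g]
        U.pm_tgt[OF back_U[OF g _ L.L.total.one_closed]] U_assoc double_src_def)
  qed (use * in simp_all)
qed (simp_all add: additive_onD[OF back_additive[OF g]],
     simp add: pull_inv_def mult_add_right gt_additive[OF g] pmsum_plus gsum_plus)

text \<open>
  The identity \<open>x\<^sub>1\<^sub>+ \<otimes> x\<^sub>1\<^sub>- x\<^sub>2 = x \<otimes> 1\<close>, first for \<open>U\<close> and then for \<open>L\<close>.
\<close>

lemma back_coa:
  assumes g: "gt.bal g" and p: "p \<in> carrier T" and q: "q \<in> carrier T"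
  shows "gsum T T (coa p) (\<lambda>h p'. pull_inv g h (p' \<otimes>\<^bsub>A\<^esub> q)) = g p q"
proof -
  note b = hp_bal_mult_A[OF back_hp_bal[OF g] q]
  have g1: "additive_on T (\<lambda>p. g p q)" by (rule additive_onI) (use q in \<open>simp add: gt_additive[OF g]\<close>)
  show ?thesis
  proof (rule T_pure_ext[OF coa_additive[OF b] g1 p])
    fix \<alpha> x assume *: "\<alpha> \<in> carrier U" "x \<in> carrier L"
    define G where "G a a' = csum L x (\<lambda>x1 x2. L.pm x1 (\<lambda>y y'. g (a \<boxtimes> y) ((\<one>\<^bsub>U\<^esub> \<boxtimes> y') \<otimes>\<^bsub>A\<^esub> ((a' \<boxtimes> x2) \<otimes>\<^bsub>A\<^esub> q))))" for a a'
    have G: "U.lbal G"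
      unfolding G_def
      by (rule balancedI) (use q in \<open>simp_all add: balancedD[OF back_U[OF g]] csum_plus\<close>)
    have mult: "(a' \<boxtimes> \<one>\<^bsub>L\<^esub>) \<otimes>\<^bsub>A\<^esub> ((\<beta> \<boxtimes> y) \<otimes>\<^bsub>A\<^esub> q) = ((a' \<otimes>\<^bsub>U\<^esub> \<beta>) \<boxtimes> y) \<otimes>\<^bsub>A\<^esub> q"
      if "a' \<in> carrier U" "\<beta> \<in> carrier U" "y \<in> carrier L" for a' \<beta> y
      using that q by (simp add: mult_assoc[symmetric] U_mult_pure)
    have "gsum T T (coa (\<alpha> \<boxtimes> x)) (\<lambda>h p'. pull_inv g h (p' \<otimes>\<^bsub>A\<^esub> q))
      = csum U \<alpha> (\<lambda>\<alpha>1 \<alpha>2. csum L x (\<lambda>x1 x2. U.pm \<alpha>1 (\<lambda>a a'. L.pm x1 (\<lambda>y y'.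
          g (a \<boxtimes> y) ((\<one>\<^bsub>U\<^esub> \<boxtimes> y') \<otimes>\<^bsub>A\<^esub> (((a' \<otimes>\<^bsub>U\<^esub> \<alpha>2) \<boxtimes> x2) \<otimes>\<^bsub>A\<^esub> q))))))"
      using * q by (simp add: gsum_coa_pure[OF b] cosum_def back_pure[OF g] mult)
    also have "\<dots> = csum U \<alpha> (\<lambda>\<alpha>1 \<alpha>2. U.pm \<alpha>1 (\<lambda>a a'. G a (a' \<otimes>\<^bsub>U\<^esub> \<alpha>2)))"
      unfolding G_def by (intro csum_cong refl csum_pmsum_commute)
    also have "\<dots> = G \<alpha> \<one>\<^bsub>U\<^esub>" by (rule U.csum_pm_mult[OF G *(1)])
    also have "\<dots> = csum L x (\<lambda>x1 x2. L.pm x1 (\<lambda>y y'. g (\<alpha> \<boxtimes> y) ((\<one>\<^bsub>U\<^esub> \<boxtimes> (y' \<otimes>\<^bsub>L\<^esub> x2)) \<otimes>\<^bsub>A\<^esub> q)))"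
      unfolding G_def using * q by (simp add: L_assoc)
    also have "\<dots> = g (\<alpha> \<boxtimes> x) ((\<one>\<^bsub>U\<^esub> \<boxtimes> \<one>\<^bsub>L\<^esub>) \<otimes>\<^bsub>A\<^esub> q)"
      by (rule L.csum_pm_mult[OF back_L[OF g *(1) q] *(2)])
    also have "\<dots> = g (\<alpha> \<boxtimes> x) q" using one_mult[OF q] by (simp add: A_one)
    finally show "gsum T T (coa (\<alpha> \<boxtimes> x)) (\<lambda>h p'. pull_inv g h (p' \<otimes>\<^bsub>A\<^esub> q)) = g (\<alpha> \<boxtimes> x) q" .
  qed
qed

text \<open>
  The identity \<open>x\<^sub>+\<^sub>1 \<otimes> x\<^sub>+\<^sub>2 x\<^sub>- = x \<otimes> 1\<close>, first for \<open>L\<close> and then for \<open>U\<close>.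
\<close>

lemma back_pull:
  assumes J: "hp.bal J" and p: "p \<in> carrier T" and q: "q \<in> carrier T"
  shows "pull_inv (pull J) p q = J p q"
proof -
  have J1: "additive_on T (\<lambda>p. J p q)" by (rule additive_onI) (use q balancedD(1)[OF J] in simp)
  note g = pull_bal[OF J]
  show ?thesis
  proof (rule T_pure_ext[OF back_additive[OF g q] J1 p])
    fix \<alpha> x assume *: "\<alpha> \<in> carrier U" "x \<in> carrier L"
    have inner: "L.pm x (\<lambda>y y'. pull J (a \<boxtimes> y) ((\<one>\<^bsub>U\<^esub> \<boxtimes> y') \<otimes>\<^bsub>A\<^esub> ((a' \<boxtimes> \<one>\<^bsub>L\<^esub>) \<otimes>\<^bsub>A\<^esub> q)))
      = csum U a (\<lambda>\<alpha>1 \<alpha>2. J (\<alpha>1 \<boxtimes> x) (((\<alpha>2 \<otimes>\<^bsub>U\<^esub> a') \<boxtimes> \<one>\<^bsub>L\<^esub>) \<otimes>\<^bsub>A\<^esub> q))"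
      if a: "a \<in> carrier U" "a' \<in> carrier U" for a a'
    proof -
      define Q where "Q = (a' \<boxtimes> \<one>\<^bsub>L\<^esub>) \<otimes>\<^bsub>A\<^esub> q"
      have Q: "Q \<in> carrier T" using a q by (simp add: Q_def)
      have J': "hp.bal (\<lambda>h p. J h (p \<otimes>\<^bsub>A\<^esub> Q))" by (rule hp_bal_mult_A[OF J Q])
      have mult: "(\<beta> \<boxtimes> y) \<otimes>\<^bsub>A\<^esub> ((\<one>\<^bsub>U\<^esub> \<boxtimes> y') \<otimes>\<^bsub>A\<^esub> Q) = (\<beta> \<boxtimes> (y \<otimes>\<^bsub>L\<^esub> y')) \<otimes>\<^bsub>A\<^esub> Q"
        if "\<beta> \<in> carrier U" "y \<in> carrier L" "y' \<in> carrier L" for \<beta> y y'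
        using that Q by (simp add: mult_assoc[symmetric] pure_mult_L)
      have "L.pm x (\<lambda>y y'. pull J (a \<boxtimes> y) ((\<one>\<^bsub>U\<^esub> \<boxtimes> y') \<otimes>\<^bsub>A\<^esub> Q))
        = L.pm x (\<lambda>y y'. csum L y (\<lambda>y1 y2. csum U a (\<lambda>\<alpha>1 \<alpha>2. J (\<alpha>1 \<boxtimes> y1) ((\<alpha>2 \<boxtimes> (y2 \<otimes>\<^bsub>L\<^esub> y')) \<otimes>\<^bsub>A\<^esub> Q))))"
        unfolding pull_def using a Q by (simp add: gsum_coa_pure[OF hp_bal_mult_A[OF J]] cosum_alt mult)
      also have "\<dots> = csum U a (\<lambda>\<alpha>1 \<alpha>2. J (\<alpha>1 \<boxtimes> x) ((\<alpha>2 \<boxtimes> \<one>\<^bsub>L\<^esub>) \<otimes>\<^bsub>A\<^esub> Q))"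
        by (rule L.pm_csum_mult[OF cosum_bal_L[OF coupled_pure[OF J'] a(1)] *(2)])
      finally show ?thesis using a q by (simp add: Q_def U_assoc)
    qed
    have bU: "U.bal (\<lambda>u v. J (u \<boxtimes> x) ((v \<boxtimes> \<one>\<^bsub>L\<^esub>) \<otimes>\<^bsub>A\<^esub> q))"
    proof (rule balancedI)
      fix b u v assume **: "b \<in> carrier B" "u \<in> carrier U" "v \<in> carrier U"
      have "ds b \<otimes>\<^bsub>A\<^esub> ((v \<boxtimes> \<one>\<^bsub>L\<^esub>) \<otimes>\<^bsub>A\<^esub> q) = ((src U b \<otimes>\<^bsub>U\<^esub> v) \<boxtimes> \<one>\<^bsub>L\<^esub>) \<otimes>\<^bsub>A\<^esub> q"
        using ** q by (simp add: double_src_def U_assoc)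
      then show "J ((tgt U b \<otimes>\<^bsub>U\<^esub> u) \<boxtimes> x) ((v \<boxtimes> \<one>\<^bsub>L\<^esub>) \<otimes>\<^bsub>A\<^esub> q) = J (u \<boxtimes> x) (((src U b \<otimes>\<^bsub>U\<^esub> v) \<boxtimes> \<one>\<^bsub>L\<^esub>) \<otimes>\<^bsub>A\<^esub> q)"
        using balancedD(3)[OF J, of b "u \<boxtimes> x" "(v \<boxtimes> \<one>\<^bsub>L\<^esub>) \<otimes>\<^bsub>A\<^esub> q"] ** * q by (simp add: h.dt_mult_pure)
    qed (use * q in \<open>simp_all add: pure_add mult_add_left balancedD(1,2)[OF J, simplified]\<close>)
    have "pull_inv (pull J) (\<alpha> \<boxtimes> x) q = U.pm \<alpha> (\<lambda>a a'. csum U a (\<lambda>\<alpha>1 \<alpha>2. J (\<alpha>1 \<boxtimes> x) (((\<alpha>2 \<otimes>\<^bsub>U\<^esub> a') \<boxtimes> \<one>\<^bsub>L\<^esub>) \<otimes>\<^bsub>A\<^esub> q)))"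
      using * q by (simp add: back_pure[OF g] inner)
    also have "\<dots> = J (\<alpha> \<boxtimes> x) ((\<one>\<^bsub>U\<^esub> \<boxtimes> \<one>\<^bsub>L\<^esub>) \<otimes>\<^bsub>A\<^esub> q)" by (rule U.pm_csum_mult[OF bU *(1)])
    also have "\<dots> = J (\<alpha> \<boxtimes> x) q" using one_mult[OF q] by (simp add: A_one)
    finally show "pull_inv (pull J) (\<alpha> \<boxtimes> x) q = J (\<alpha> \<boxtimes> x) q" .
  qed
qed

definition back_elem where
  "back_elem = induced gt.TP (\<lambda>(h, q). expand (\<lambda>(\<alpha>, x). frag_extend (\<lambda>(a, a'). frag_extend (\<lambda>(y, y').
    frag_of (a \<boxtimes> y, (\<one>\<^bsub>U\<^esub> \<boxtimes> y') \<otimes>\<^bsub>A\<^esub> ((a' \<boxtimes> \<one>\<^bsub>L\<^esub>) \<otimes>\<^bsub>A\<^esub> q))) (repr (plus_minus K B L x))) (repr (plus_minus K B U \<alpha>))) h)"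

lemma back_elem_closed:
  assumes "E \<in> carrier hp.TP" shows "back_elem E \<in> carrier gt.TP"
  unfolding back_elem_def case_prod_beta'
proof (rule gt.induced_closed, rule keys_expand_subset, rule keys_frag_extend_subset, rule keys_frag_extend_subset)
  fix z w u v assume *: "z \<in> Poly_Mapping.keys (repr E)" "w \<in> Poly_Mapping.keys (repr (fst z))"
    "u \<in> Poly_Mapping.keys (repr (plus_minus K B U (fst w)))" "v \<in> Poly_Mapping.keys (repr (plus_minus K B L (snd w)))"
  then have z: "fst z \<in> carrier T" "snd z \<in> carrier T" using hp.keys_repr[OF assms] by auto
  then have w: "fst w \<in> carrier U" "snd w \<in> carrier L"
    using be.keys_repr[folded T_TP, of "fst z"] * by auto
  show "Poly_Mapping.keys (frag_of (fst u \<boxtimes> fst v, (\<one>\<^bsub>U\<^esub> \<boxtimes> snd v) \<otimes>\<^bsub>A\<^esub> ((snd u \<boxtimes> \<one>\<^bsub>L\<^esub>) \<otimes>\<^bsub>A\<^esub> snd z))) \<subseteq> carrier A \<times> carrier A"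
    using U.keys_plus_minus_elem[OF w(1) *(3)] L.keys_plus_minus_elem[OF w(2) *(4)] z by simp
qed

lemma tsum_back_elem:
  assumes g: "gt.bal g" and E: "E \<in> carrier hp.TP"
  shows "tsum (back_elem E) g = gsum T T E (pull_inv g)"
proof -
  have "tsum (back_elem E) g = tsum E (\<lambda>h q. tsum h (\<lambda>\<alpha> x. tsum (plus_minus K B U \<alpha>) (\<lambda>a a'.
      tsum (plus_minus K B L x) (\<lambda>y y'. g (a \<boxtimes> y) ((\<one>\<^bsub>U\<^esub> \<boxtimes> y') \<otimes>\<^bsub>A\<^esub> ((a' \<boxtimes> \<one>\<^bsub>L\<^esub>) \<otimes>\<^bsub>A\<^esub> q))))))"
    unfolding back_elem_def gt.tsum_induced_pair[OF g] lin_expand lin_frag_extend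
    by (simp add: tsum_def case_prod_beta' lin_frag_extend)
  also have "\<dots> = gsum T T E (pull_inv g)"
    unfolding hp_gsum[OF E]
  proof (rule gsum_cong[OF refl])
    fix h q assume h: "h \<in> carrier T" and "q \<in> carrier T"
    show "tsum h (\<lambda>\<alpha> x. tsum (plus_minus K B U \<alpha>) (\<lambda>a a'.
      tsum (plus_minus K B L x) (\<lambda>y y'. g (a \<boxtimes> y) ((\<one>\<^bsub>U\<^esub> \<boxtimes> y') \<otimes>\<^bsub>A\<^esub> ((a' \<boxtimes> \<one>\<^bsub>L\<^esub>) \<otimes>\<^bsub>A\<^esub> q))))) = pull_inv g h q"
      unfolding T_gsum[OF h] pull_inv_def by (rule gsum_cong[OF refl]) (simp add: U.pm_if L.pm_if)
  qed
  finally show ?thesis .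
qed

text \<open>
  Characters of the source of the Galois map are pullbacks of characters of its target, which gives
  injectivity.  For surjectivity, \<open>back_elem\<close> lifts the inverse to elements.
\<close>

lemma gal_bij: "bij_betw gal (carrier gt.TP) (carrier hp.TP)"
proof (rule bij_betwI')
  fix E E' assume E: "E \<in> carrier gt.TP" "E' \<in> carrier gt.TP"
  show "gal E = gal E' \<longleftrightarrow> E = E'"
  proof
    assume eq: "gal E = gal E'"
    show "E = E'"
    proof (rule gt.tensor_eqI[OF E])
      fix g assume g: "gt.bal g"
      have "tsum D g = tsum (gal D) (pull_inv g)" if "D \<in> carrier gt.TP" for D
        unfolding tsum_gal[OF back_hp_bal[OF g] that] gt_gsum[OF that] pull_def
        by (rule gsum_cong[OF refl]) (simp add: back_coa[OF g])
      then show "tsum E g = tsum E' g" using E eq by simp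
    qed
  qed simp
next
  show "gal E \<in> carrier hp.TP" if "E \<in> carrier gt.TP" for E using gal_closed[OF that] .
next
  fix D assume D: "D \<in> carrier hp.TP"
  have "gal (back_elem D) = D"
  proof (rule hp.tensor_eqI[OF gal_closed[OF back_elem_closed[OF D]] D])
    fix J assume J: "hp.bal J"
    have "tsum (gal (back_elem D)) J = gsum T T D (pull_inv (pull J))"
      unfolding tsum_gal[OF J back_elem_closed[OF D]] gt_gsum[OF back_elem_closed[OF D], symmetric]
      by (rule tsum_back_elem[OF pull_bal[OF J] D])
    also have "\<dots> = tsum D J" unfolding hp_gsum[OF D] by (rule gsum_cong[OF refl]) (rule back_pull[OF J])
    finally show "tsum (gal (back_elem D)) J = tsum D J" .
  qed
  then show "\<exists>E\<in>carrier gt.TP. D = gal E" using back_elem_closed[OF D] by metis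
qed

end

section \<open>The Galois extension\<close>

text \<open>
  The records of the double carry further fields, which do not enter the axioms of an algebra.
\<close>

lemma k_algebra_cong:
  assumes "k_algebra K A" "carrier A' = carrier A" "monoid.mult A' = monoid.mult A" "monoid.one A' = monoid.one A"
    "ring.zero A' = ring.zero A" "ring.add A' = ring.add A" "module.smult A' = module.smult A"
  shows "k_algebra K A'"
  using assms(1)
  unfolding k_algebra_def module_def module_axioms_def k_algebra_axioms_def ring_def ring_axioms_def
    abelian_group_def abelian_monoid_def abelian_group_axioms_def monoid_def
    Group.comm_monoid_def comm_monoid_axioms_def comm_group_def group_def group_axioms_def Units_def
  by (simp (no_asm_use) only: assms(2-) monoid.simps partial_object.simps)

context double
begin

abbreviation "Hb \<equiv> double_bialgebroid K B U L \<tau>"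
abbreviation "Pc \<equiv> double_comodule_algebra K B U L \<tau> \<kappa>"

lemma Hb_simps: "carrier Hb = carrier T" "monoid.mult Hb = monoid.mult H" "monoid.one Hb = monoid.one H"
  "ring.zero Hb = ring.zero T" "ring.add Hb = ring.add T" "module.smult Hb = module.smult T"
  "src Hb = ds" "tgt Hb = dt" "comult Hb = double_coact K B U L \<tau> \<tau>" "counit Hb = eps"
  by (simp_all add: double_bialgebroid_def module.defs bialgebroid.defs double_algebra_def eps_def)

lemma Pc_simps: "carrier Pc = carrier T" "monoid.mult Pc = monoid.mult A" "monoid.one Pc = monoid.one A"
  "ring.zero Pc = ring.zero T" "ring.add Pc = ring.add T" "module.smult Pc = module.smult T"
  "base_map Pc = ds" "coact Pc = coa"
  by (simp_all add: double_comodule_algebra_def module.defs comodule_algebra.defs double_algebra_def)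

lemma diamond_double: "diamond K B Hb dt Pc ds = hp.TP"
  unfolding hp_diamond[symmetric] diamond_def tensor_def bilinear_relators_def by (simp add: Hb_simps Pc_simps)

lemma diamond3_double: "diamond3 K B Hb dt Hb ds dt Pc ds = tp.T3"
  unfolding diamond3_def by (simp add: Hb_simps Pc_simps)

lemma takeuchi_double: "takeuchi K B Hb dt Pc ds = takeuchi K B H dt A ds"
  unfolding takeuchi_def diamond_double hp_diamond by (simp add: Hb_simps Pc_simps)

lemma component_mult_double: "component_mult Hb Pc = component_mult H A"
  by (intro ext) (simp add: component_mult_def Hb_simps Pc_simps)

lemma ds_alg_hom: "ds \<in> alg_hom K B Pc"
  unfolding alg_hom_def ring_hom_def mem_Collect_eq
  by (simp add: Pi_iff Pc_simps ds_add ds_mult ds_one A_one) (simp add: double_src_def smult_pure U.src_smult)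

lemma coa_counital:
  assumes P: "abelian_group P" "carrier P = carrier T" "ring.add P = ring.add T" and C: "C \<in> carrier T"
  shows "evaluate P (\<lambda>(h, q). ds (eps h) \<otimes>\<^bsub>A\<^esub> q) (coa C) = C"
proof -
  have k: "(case z of (h, q) \<Rightarrow> ds (eps h) \<otimes>\<^bsub>A\<^esub> q) \<in> carrier P" if "z \<in> Poly_Mapping.keys (repr (coa C))" for z
    using keys_coa[OF C that] by (simp add: case_prod_beta P)
  have cl: "evaluate P (\<lambda>(h, q). ds (eps h) \<otimes>\<^bsub>A\<^esub> q) (coa C) \<in> carrier T"
    using abelian_group.evaluate_closed[OF P(1) k] by (simp add: P)
  show ?thesis
  proof (rule T_separate[OF cl C])
    fix \<Phi> assume \<Phi>: "additive_on T \<Phi>"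
    then have "additive_on P \<Phi>" by (simp add: additive_on_def P)
    from abelian_group.additive_on_evaluate[OF P(1) this k]
    have "\<Phi> (evaluate P (\<lambda>(h, q). ds (eps h) \<otimes>\<^bsub>A\<^esub> q) (coa C)) = tsum (coa C) (\<lambda>h q. \<Phi> (ds (eps h) \<otimes>\<^bsub>A\<^esub> q))"
      by (simp add: tsum_def case_prod_beta')
    then show "\<Phi> (evaluate P (\<lambda>(h, q). ds (eps h) \<otimes>\<^bsub>A\<^esub> q) (coa C)) = \<Phi> C"
      unfolding hp_gsum[OF coa_closed[OF C]] gsum_coa_counit_left[OF \<Phi> C] .
  qed
qed

lemma coa_counital_right:
  assumes P: "abelian_group P" "carrier P = carrier T" "ring.add P = ring.add T" and C: "C \<in> carrier T"
  shows "evaluate P (\<lambda>(h, q). dt (eps q) \<otimes>\<^bsub>H\<^esub> h) (coa C) = C"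
proof -
  have k: "(case z of (h, q) \<Rightarrow> dt (eps q) \<otimes>\<^bsub>H\<^esub> h) \<in> carrier P" if "z \<in> Poly_Mapping.keys (repr (coa C))" for z
    using keys_coa[OF C that] by (simp add: case_prod_beta P)
  have cl: "evaluate P (\<lambda>(h, q). dt (eps q) \<otimes>\<^bsub>H\<^esub> h) (coa C) \<in> carrier T"
    using abelian_group.evaluate_closed[OF P(1) k] by (simp add: P)
  show ?thesis
  proof (rule T_separate[OF cl C])
    fix \<Phi> assume \<Phi>: "additive_on T \<Phi>"
    then have "additive_on P \<Phi>" by (simp add: additive_on_def P)
    from abelian_group.additive_on_evaluate[OF P(1) this k]
    have "\<Phi> (evaluate P (\<lambda>(h, q). dt (eps q) \<otimes>\<^bsub>H\<^esub> h) (coa C)) = tsum (coa C) (\<lambda>h q. \<Phi> (dt (eps q) \<otimes>\<^bsub>H\<^esub> h))"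
      by (simp add: tsum_def case_prod_beta')
    then show "\<Phi> (evaluate P (\<lambda>(h, q). dt (eps q) \<otimes>\<^bsub>H\<^esub> h) (coa C)) = \<Phi> C"
      unfolding hp_gsum[OF coa_closed[OF C]] gsum_coa_counit_right[OF \<Phi> C] .
  qed
qed

lemma Hb_k_algebra: "k_algebra K Hb"
  by (rule k_algebra_cong[OF h.A_k_algebra]) (simp_all add: Hb_simps)

lemma Pc_k_algebra: "k_algebra K Pc"
  by (rule k_algebra_cong[OF A_k_algebra]) (simp_all add: Pc_simps)

lemma k_algebra_abelian_group: "k_algebra K M \<Longrightarrow> abelian_group M"
  unfolding k_algebra_def using ring.is_abelian_group by blast

lemma comodule_algebra: "left_comodule_algebra K B Hb Pc"
proof (rule left_comodule_algebra.intro)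
  show "k_algebra K Pc" by (rule Pc_k_algebra)
  show "base_map Pc \<in> alg_hom K B Pc" by (simp add: Pc_simps(7) ds_alg_hom)
  fix p assume p: "p \<in> carrier Pc"
  show "evaluate Pc (\<lambda>(h, q). base_map Pc (counit Hb h) \<otimes>\<^bsub>Pc\<^esub> q) (coact Pc p) = p"
    using coa_counital[OF k_algebra_abelian_group[OF Pc_k_algebra]] p by (simp add: Pc_simps Hb_simps)
  fix b b' assume "b \<in> carrier B" "b' \<in> carrier B"
  then show "coact Pc (base_map Pc b \<otimes>\<^bsub>Pc\<^esub> p \<otimes>\<^bsub>Pc\<^esub> base_map Pc b')
      = induced (diamond K B Hb (tgt Hb) Pc (base_map Pc))
          (\<lambda>(h, q). frag_of (src Hb b \<otimes>\<^bsub>Hb\<^esub> h \<otimes>\<^bsub>Hb\<^esub> src Hb b', q)) (coact Pc p)"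
    using coa_B_bilinear p by (simp only: Pc_simps Hb_simps diamond_double)
qed (simp_all add: Pc_simps Hb_simps diamond_double diamond3_double takeuchi_double component_mult_double
      coa_takeuchi coa_add coa_smult coa_mult coa_one coa_coassoc)

lemma dt_alg_hom: "dt \<in> alg_hom K (opposite B) Hb"
  unfolding alg_hom_def ring_hom_def mem_Collect_eq
  by (simp add: Pi_iff Hb_simps opposite_def dt_add h.dt_mult dt_one h.A_one) (simp add: double_tgt_def smult_pure U.tgt_smult)

lemma bialgebroid: "left_bialgebroid K B Hb"
proof -
  interpret hh: double K B U L \<tau> \<tau> by unfold_locales
  have diamond_self: "diamond K B Hb dt Hb ds = hh.hp.TP"
    unfolding hh.hp_diamond[symmetric] diamond_def tensor_def bilinear_relators_def by (simp add: Hb_simps)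
  have diamond3_self: "diamond3 K B Hb dt Hb ds dt Hb ds = hh.tp.T3"
    unfolding diamond3_def by (simp add: Hb_simps)
  have takeuchi_self: "takeuchi K B Hb dt Hb ds = takeuchi K B H dt H ds"
    unfolding takeuchi_def diamond_self hh.hp_diamond by (simp add: Hb_simps)
  have component_mult_self: "component_mult Hb Hb = component_mult H H"
    by (intro ext) (simp add: component_mult_def Hb_simps)
  have src_hom: "ds \<in> alg_hom K B Hb"
    unfolding alg_hom_def ring_hom_def mem_Collect_eq
    by (simp add: Pi_iff Hb_simps ds_add h.ds_mult ds_one h.A_one) (simp add: double_src_def smult_pure U.src_smult)
  have eps_one: "eps \<one>\<^bsub>H\<^esub> = \<one>\<^bsub>B\<^esub>" by (simp add: h.A_one eps_pure U.counit_one L.counit_one)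
  have eps_Be: "eps (ds b \<otimes>\<^bsub>H\<^esub> dt c \<otimes>\<^bsub>H\<^esub> C) = b \<otimes>\<^bsub>B\<^esub> eps C \<otimes>\<^bsub>B\<^esub> c" if "b \<in> carrier B" "c \<in> carrier B" "C \<in> carrier T" for b c C
    using that by (simp add: h.mult_assoc hh.eps_ds hh.eps_dt assocs)
  show ?thesis
  proof (rule left_bialgebroid.intro)
    show "k_algebra K B" by (rule U.base_algebra)
    show "k_algebra K Hb" by (rule Hb_k_algebra)
    show "src Hb \<in> alg_hom K B Hb" by (simp add: Hb_simps(7) src_hom)
    show "tgt Hb \<in> alg_hom K (opposite B) Hb" by (simp add: Hb_simps(8) dt_alg_hom)
    note ag = k_algebra_abelian_group[OF Hb_k_algebra]
    fix x assume x: "x \<in> carrier Hb"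
    show "evaluate Hb (\<lambda>(x1, x2). src Hb (counit Hb x1) \<otimes>\<^bsub>Hb\<^esub> x2) (comult Hb x) = x"
      using hh.coa_counital[OF ag] x by (simp add: Hb_simps)
    show "evaluate Hb (\<lambda>(x1, x2). tgt Hb (counit Hb x2) \<otimes>\<^bsub>Hb\<^esub> x1) (comult Hb x) = x"
      using hh.coa_counital_right[OF ag] x by (simp add: Hb_simps)
    fix b c assume bc: "b \<in> carrier B" "c \<in> carrier B"
    show "comult Hb (src Hb b \<otimes>\<^bsub>Hb\<^esub> tgt Hb c \<otimes>\<^bsub>Hb\<^esub> x)
        = induced (diamond K B Hb (tgt Hb) Hb (src Hb))
            (\<lambda>(x1, x2). frag_of (src Hb b \<otimes>\<^bsub>Hb\<^esub> x1, tgt Hb c \<otimes>\<^bsub>Hb\<^esub> x2)) (comult Hb x)"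
      using hh.coa_Be bc x by (simp only: Hb_simps diamond_self)
    show "counit Hb (src Hb b \<otimes>\<^bsub>Hb\<^esub> tgt Hb c \<otimes>\<^bsub>Hb\<^esub> x) = b \<otimes>\<^bsub>B\<^esub> counit Hb x \<otimes>\<^bsub>B\<^esub> c"
      using eps_Be bc x by (simp only: Hb_simps)
  qed (simp_all add: Hb_simps diamond_self diamond3_self takeuchi_self component_mult_self
      hh.coa_takeuchi hh.coa_add hh.coa_mult hh.coa_one hh.coa_coassoc
      hh.ds_dt_commute eps_add eps_one eps_mult_src eps_mult_tgt)
qed

lemma galois: "left_galois_extension K B Hb Pc (dt ` carrier B)"
  unfolding left_galois_extension_def
proof (intro conjI bialgebroid comodule_algebra)
  show "dt ` carrier B = coinvariants K B Hb Pc"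
  proof (rule Set.set_eqI)
    fix C
    show "C \<in> dt ` carrier B \<longleftrightarrow> C \<in> coinvariants K B Hb Pc"
      unfolding coinvariants_def mem_Collect_eq
      using coinvariant_iff[of C] by (auto simp: Hb_simps Pc_simps diamond_double)
  qed
  have "galois_map K B Hb Pc = gal"
    unfolding galois_map_def gal_def by (simp add: Hb_simps Pc_simps diamond_double)
  moreover have "tensor K Pc Pc (dt ` carrier B) (\<lambda>n p. p \<otimes>\<^bsub>Pc\<^esub> n) (\<lambda>n q. n \<otimes>\<^bsub>Pc\<^esub> q) = gt.TP"
    unfolding tensor_def bilinear_relators_def by (simp add: Pc_simps)
  ultimately show "bij_betw (galois_map K B Hb Pc)
      (carrier (tensor K Pc Pc (dt ` carrier B) (\<lambda>n p. p \<otimes>\<^bsub>Pc\<^esub> n) (\<lambda>n q. n \<otimes>\<^bsub>Pc\<^esub> q)))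
      (carrier (diamond K B Hb (tgt Hb) Pc (base_map Pc)))"
    using gal_bij by (simp add: Hb_simps(8) Pc_simps(7) diamond_double)
qed

end

theorem corollary5p5:
  fixes K :: "'k ring"
    and B :: "('k, 'b) module"
    and U :: "('k, 'b, 'p) bialgebroid"
    and L :: "('k, 'b, 'l) bialgebroid"
    and \<tau> \<kappa> :: "'l \<Rightarrow> 'p \<Rightarrow> 'b"
  assumes "field K"
    and "k_algebra K B"
    and "hopf_algebroid K B U"
    and "hopf_algebroid K B L"
    and "all_faithfully_flat K B U"
    and "all_faithfully_flat K B L"
    and "skew_pairing K B L U \<tau>"
    and "skew_pairing K B L U \<kappa>"
  shows "left_galois_extension K B
    (double_bialgebroid K B U L \<tau>)
    (double_comodule_algebra K B U L \<tau> \<kappa>)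
    (double_tgt K B U L ` carrier B)"
proof -
  interpret double K B U L \<tau> \<kappa>
    by (intro double.intro hopf_pairings.intro hopf_pairing.intro hopf_pair.intro assms)
  show ?thesis by (rule galois)
qed

end
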